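(* Assume that the following six conditions hold. (1) There is a fixed $\Delta>0$ such that $\inf_{i,j\in\mathbb{N},\, i\neq j}\|s_i-s_j\|\ge\Delta$. (2) For all $x\in\mathbb{R}^d$, $\sup_{\theta\in\Theta}|k_\theta(x)|\le \frac{C_{\sup}}{1+\|x\|^{d+C_{\inf}}}$. (3) For all $x\in\mathbb{R}^d$, $$\max_{s=1,2,3}\ \max_{i_1,\ldots,i_s\in\{1,\ldots,p\}}\ \sup_{\theta\in\Theta}\left|\frac{\partial^s}{\partial\theta_{i_1}\cdots\partial\theta_{i_s}}k_\theta(x)\right|\le\frac{C_{\sup}}{1+\|x\|^{d+C_{\inf}}}.$$ In (2) and (3), $C_{\inf}>0$ and $C_{\sup}<\infty$ are fixed constants. (4) The map $(\theta,\omega)\in\Theta\times\mathbb{R}^d\mapsto\hat{k}_\theta(\omega)$ is continuous and strictly positive. (5) For all $\epsilon>0$, $$\liminf_{n\to\infty}\ \inf_{\theta\in\Theta,\ \|\theta-\theta_0\|\ge\epsilon}\ \frac1n\sum_{i,j=1}^n\left(k_\theta(s_i-s_j)-k_{\theta_0}(s_i-s_j)\right)^2>0.$$ (6) For all $(\lambda_1,\ldots,\lambda_p)\in\mathbb{R}^p\setminus\{0\}$, $$\liminf_{n\to\infty}\ \frac1n\sum_{i,j=1}^n\left(\sum_{m=1}^p\lambda_m\frac{\partial k_{\theta_0}(s_i-s_j)}{\partial\theta_m}\right)^2>0.$$ Let $\Sigma_{\theta_0}$ (depending on $n$) be the $p\times p$ matrix with element $i,j$ equal to $$\frac12\,\frac1n\,\mathrm{tr}\left(R_{\theta_0}^{-1}\frac{\partial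 R_{\theta_0}}{\partial\theta_i}R_{\theta_0}^{-1}\frac{\partial R_{\theta_0}}{\partial\theta_j}\right).$$ Then $$0<\liminf_{n\to\infty}\lambda_{\inf}(\Sigma_{\theta_0})\le\limsup_{n\to\infty}\lambda_{\sup}(\Sigma_{\theta_0})<\infty.$$ Furthermore, $$\sqrt{n}\,\left(\Sigma_{\theta_0}^{-1}\right)^{-1/2}(\hat{\theta}_{\mathrm{ML}}-\theta_0)\ \to\ \mathcal{N}(0,I_p)\quad\text{in distribution as } n\to\infty.$$
   Context: Let $d,p\in\mathbb{N}$ (positive integers) and let $\|\cdot\|$ be the Euclidean norm. $\Theta\subset\mathbb{R}^p$ is compact, and $\{k_\theta;\theta\in\Theta\}$ is a family of functions $k_\theta:\mathbb{R}^d\to\mathbb{R}$ that are symmetric ($k_\theta(u)=k_\theta(-u)$) and positive definite, meaning that for all $m\in\mathbb{N}$ and $u_1,\ldots,u_m\in\mathbb{R}^d$ the matrix $[k_\theta(u_i-u_j)]_{i,j=1,\ldots,m}$ is positive semi-definite. The partial derivatives of $\theta\mapsto k_\theta(x)$ appearing in the statement are understood to exist. The spectral density of $k_\theta$ is the function $\hat{k}_\theta:\mathbb{R}^d\to\mathbb{R}$ such that $k_\theta(u)=\int_{\mathbb{R}^d}\hat{k}_\theta(\omega)e^{\mathrm{i}\omega^\top u}\,d\omega$ for $u\in\mathbb{R}^d$ (the Fourier transform of $k_\theta$). $\xi:\mathbb{R}^d\to\mathbb{R}$ is a Gaussian process with mean function zero and with $\mathrm{cov}(\xi(u),\xi(v))=k_{\theta_0}(u-v)$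 for all $u,v\in\mathbb{R}^d$, for some (true) $\theta_0\in\Theta$. $(s_i)_{i\in\mathbb{N}}$ is a sequence of pairwise distinct points in $\mathbb{R}^d$, and the observation vector is $y=(\xi(s_1),\ldots,\xi(s_n))^\top$. For $\theta\in\Theta$, $R_\theta=[k_\theta(s_i-s_j)]_{i,j=1,\ldots,n}$, assumed invertible for every $n$; $\partial R_{\theta_0}/\partial\theta_i$ is the entrywise partial derivative of $R_\theta$ at $\theta=\theta_0$. Let $L_n(\theta)=\frac1n\log(|R_\theta|)+\frac1n y^\top R_\theta^{-1}y$, where $|R_\theta|$ is the determinant. A maximum likelihood estimator $\hat{\theta}_{\mathrm{ML}}$ (depending on $n$) is a measurable function of the observations satisfying $\hat{\theta}_{\mathrm{ML}}\in\mathrm{argmin}_{\theta\in\Theta}L_n(\theta)$ (equivalently maximizing the Gaussian density of $y$ over $\theta\in\Theta$). At least one such measurable estimator is assumed to exist, and the result holds for any choice of it. $\lambda_{\inf}(M)$ and $\lambda_{\sup}(M)$ denote the smallest and largest eigenvalues of a symmetric matrix $M$. For a symmetric strictly positive definite matrix $M$, $M^{-1/2}$ denotes the unique symmetric (positive definite) matrix square root of $M^{-1}$. $I_p$ is the $p\times p$ identity matrix.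
   Formalization: It is assumed in addition that θ_0 lies in the interior of Θ (for θ_0 on the boundary, e.g. Θ=[θ_0,b] with p=1, asymptotic normality fails) and that θ ↦ k_θ(x) is continuous on Θ for every x. *)

theory Defs
  imports
    "HOL-Probability.Probability"
    "Jordan_Normal_Form.Determinant"
    "Jordan_Normal_Form.Gauss_Jordan_Elimination"
begin

text \<open>
  Conventions: the Euclidean spaces of fixed dimension are \<open>real ^ 'd\<close> and \<open>real ^ 'p\<close>; the
  matrices whose size \<open>n\<close> grows are of type \<open>real mat\<close>. The observation points
  \<open>s 0, s 1, \<dots>\<close> are indexed from 0, so that the first \<open>n\<close> of them have indices \<open>i < n\<close>.
  A covariance family is a function \<open>k\<close>, where \<open>k \<theta> u\<close> is only relevant for \<open>\<theta> \<in> \<Theta>\<close>.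
\<close>

subsection \<open>Covariance functions and their parameter derivatives\<close>

definition symmetric_function :: "(real ^ 'd \<Rightarrow> real) \<Rightarrow> bool" where
  "symmetric_function f \<longleftrightarrow> (\<forall>u. f (- u) = f u)"

definition positive_definite_function :: "(real ^ 'd \<Rightarrow> real) \<Rightarrow> bool" where
  "positive_definite_function f \<longleftrightarrow>
     (\<forall>m (u :: nat \<Rightarrow> real ^ 'd) (c :: nat \<Rightarrow> real).
        0 \<le> (\<Sum>i<m. \<Sum>j<m. c i * c j * f (u i - u j)))"

definition has_spectral_density :: "(real ^ 'd \<Rightarrow> real) \<Rightarrow> (real ^ 'd \<Rightarrow> real) \<Rightarrow> bool" where
  "has_spectral_density f fhat \<longleftrightarrow>
     integrable lborel fhat \<and>
     (\<forall>u. complex_of_real (f u) =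
        (\<integral>\<omega>. complex_of_real (fhat \<omega>) * exp (\<i> * complex_of_real (inner \<omega> u)) \<partial>lborel))"

text \<open>
  Partial derivative in direction \<open>i\<close> of a function on \<open>\<Theta>\<close>. At interior points of \<open>\<Theta>\<close> this is
  the usual two-sided partial derivative. At boundary points only increments that stay in \<open>\<Theta>\<close>
  are used (one-sided derivatives); if there are no such increments, every value qualifies.
\<close>

definition has_partial_derivative ::
  "(real ^ 'p) set \<Rightarrow> 'p::finite \<Rightarrow> (real ^ 'p \<Rightarrow> real) \<Rightarrow> real \<Rightarrow> real ^ 'p \<Rightarrow> bool" where
  "has_partial_derivative \<Theta> i f D \<theta> \<longleftrightarrow>
     ((\<lambda>t. f (\<theta> + t *\<^sub>R axis i 1)) has_real_derivative D)
       (at 0 within {t. \<theta> + t *\<^sub>R axis i 1 \<in> \<Theta>})"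

text \<open>
  \<open>Dk [i\<^sub>1, \<dots>, i\<^sub>s] \<theta> x\<close> is the iterated partial derivative of \<open>\<theta> \<mapsto> k \<theta> x\<close> with respect to the
  coordinates \<open>i\<^sub>1, \<dots>, i\<^sub>s\<close> (that with respect to \<open>i\<^sub>s\<close> being taken first), for all orders \<open>s \<le> r\<close>.
\<close>

definition iterated_partial_derivatives ::
  "(real ^ 'p) set \<Rightarrow> nat \<Rightarrow> (real ^ 'p::finite \<Rightarrow> real ^ 'd \<Rightarrow> real) \<Rightarrow>
     ('p list \<Rightarrow> real ^ 'p \<Rightarrow> real ^ 'd \<Rightarrow> real) \<Rightarrow> bool" where
  "iterated_partial_derivatives \<Theta> r k Dk \<longleftrightarrow>
     (\<forall>\<theta>\<in>\<Theta>. \<forall>x. Dk [] \<theta> x = k \<theta> x) \<and>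
     (\<forall>is i. length is < r \<longrightarrow>
        (\<forall>\<theta>\<in>\<Theta>. \<forall>x. has_partial_derivative \<Theta> i (\<lambda>\<theta>'. Dk is \<theta>' x) (Dk (i # is) \<theta> x) \<theta>))"

subsection \<open>Gaussian processes and convergence in distribution\<close>

definition gaussian_rv :: "'a measure \<Rightarrow> ('a \<Rightarrow> real) \<Rightarrow> bool" where
  "gaussian_rv M X \<longleftrightarrow>
     X \<in> borel_measurable M \<and>
     ((\<exists>c. AE \<omega> in M. X \<omega> = c) \<or>
      (\<exists>\<mu> \<sigma>. 0 < \<sigma> \<and> distributed M lborel X (normal_density \<mu> \<sigma>)))"

definition gaussian_process :: "'a measure \<Rightarrow> ('i \<Rightarrow> 'a \<Rightarrow> real) \<Rightarrow> bool" where
  "gaussian_process M \<xi> \<longleftrightarrow>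
     (\<forall>J c. finite J \<longrightarrow> gaussian_rv M (\<lambda>\<omega>. \<Sum>u\<in>J. c u * \<xi> u \<omega>))"

definition covariance :: "'a measure \<Rightarrow> ('a \<Rightarrow> real) \<Rightarrow> ('a \<Rightarrow> real) \<Rightarrow> real" where
  "covariance M X Y =
     (\<integral>\<omega>. (X \<omega> - (\<integral>\<omega>'. X \<omega>' \<partial>M)) * (Y \<omega> - (\<integral>\<omega>'. Y \<omega>' \<partial>M)) \<partial>M)"

definition std_normal_vec :: "(real ^ 'p::finite) measure" where
  "std_normal_vec = density lborel (\<lambda>x. ennreal (\<Prod>i\<in>UNIV. std_normal_density (vec_nth x i)))"

definition converges_in_distribution ::
  "'a measure \<Rightarrow> (nat \<Rightarrow> 'a \<Rightarrow> real ^ 'p) \<Rightarrow> (real ^ 'p::finite) measure \<Rightarrow> bool" where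
  "converges_in_distribution M X N \<longleftrightarrow>
     (\<forall>n. X n \<in> borel_measurable M) \<and>
     (\<forall>f :: real ^ 'p \<Rightarrow> real. continuous_on UNIV f \<longrightarrow> bounded (range f) \<longrightarrow>
        (\<lambda>n. \<integral>\<omega>. f (X n \<omega>) \<partial>M) \<longlonglongrightarrow> (\<integral>x. f x \<partial>N))"

subsection \<open>Matrices\<close>

definition mat_trace :: "real mat \<Rightarrow> real" where
  "mat_trace A = (\<Sum>i<dim_row A. A $$ (i, i))"

text \<open>Only used for invertible matrices, for which \<^const>\<open>mat_inverse\<close> is not \<^const>\<open>None\<close>.\<close>

abbreviation mat_inv :: "real mat \<Rightarrow> real mat" where
  "mat_inv A \<equiv> the (mat_inverse A)"

definition eigenvalues :: "real ^ 'p ^ 'p::finite \<Rightarrow> real set" where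
  "eigenvalues A = {\<mu>. \<exists>v. v \<noteq> 0 \<and> A *v v = \<mu> *\<^sub>R v}"

text \<open>For symmetric matrices the set of eigenvalues is finite and nonempty.\<close>

definition lambda_inf :: "real ^ 'p ^ 'p::finite \<Rightarrow> real" where
  "lambda_inf A = Min (eigenvalues A)"

definition lambda_sup :: "real ^ 'p ^ 'p::finite \<Rightarrow> real" where
  "lambda_sup A = Max (eigenvalues A)"

definition inv_sqrt_matrix :: "real ^ 'p ^ 'p::finite \<Rightarrow> real ^ 'p ^ 'p" where
  "inv_sqrt_matrix A =
     (THE B. Finite_Cartesian_Product.transpose B = B \<and>
        (\<forall>x. x \<noteq> 0 \<longrightarrow> 0 < inner x (B *v x)) \<and>
        B ** B = matrix_inv A)"

subsection \<open>Likelihood and Fisher information\<close>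

definition cov_matrix ::
  "(real ^ 'p \<Rightarrow> real ^ 'd \<Rightarrow> real) \<Rightarrow> (nat \<Rightarrow> real ^ 'd) \<Rightarrow> nat \<Rightarrow> real ^ 'p \<Rightarrow> real mat" where
  "cov_matrix k s n \<theta> = Matrix.mat n n (\<lambda>(i, j). k \<theta> (s i - s j))"

definition likelihood_criterion ::
  "(real ^ 'p \<Rightarrow> real ^ 'd \<Rightarrow> real) \<Rightarrow> (nat \<Rightarrow> real ^ 'd) \<Rightarrow> nat \<Rightarrow> (nat \<Rightarrow> real) \<Rightarrow> real ^ 'p \<Rightarrow> real"
where
  "likelihood_criterion k s n y \<theta> =
     1 / real n * ln (Determinant.det (cov_matrix k s n \<theta>)) +
     1 / real n * scalar_prod (Matrix.vec n y)
       (mult_mat_vec (mat_inv (cov_matrix k s n \<theta>)) (Matrix.vec n y))"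

definition observations ::
  "(real ^ 'd \<Rightarrow> 'a \<Rightarrow> real) \<Rightarrow> (nat \<Rightarrow> real ^ 'd) \<Rightarrow> nat \<Rightarrow> 'a \<Rightarrow> nat \<Rightarrow> real" where
  "observations \<xi> s n \<omega> = (\<lambda>i\<in>{..<n}. \<xi> (s i) \<omega>)"

text \<open>\<open>est n\<close> maps an observation vector of length \<open>n\<close> to a parameter.\<close>

definition max_likelihood_estimator ::
  "'a measure \<Rightarrow> (real ^ 'd \<Rightarrow> 'a \<Rightarrow> real) \<Rightarrow> (nat \<Rightarrow> real ^ 'd) \<Rightarrow>
     (real ^ 'p::finite) set \<Rightarrow> (real ^ 'p \<Rightarrow> real ^ 'd \<Rightarrow> real) \<Rightarrow>
     (nat \<Rightarrow> (nat \<Rightarrow> real) \<Rightarrow> real ^ 'p) \<Rightarrow> bool" where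
  "max_likelihood_estimator M \<xi> s \<Theta> k est \<longleftrightarrow>
     (\<forall>n\<ge>1. est n \<in> borel_measurable (PiM {..<n} (\<lambda>_. borel)) \<and>
        (\<forall>\<omega>\<in>space M.
           is_arg_min (likelihood_criterion k s n (observations \<xi> s n \<omega>)) (\<lambda>\<theta>. \<theta> \<in> \<Theta>)
             (est n (observations \<xi> s n \<omega>))))"

text \<open>
  The matrix \<open>\<Sigma>\<^bsub>\<theta>\<^sub>0\<^esub>\<close> for \<open>n\<close> observations, where \<open>Dk\<close> contains the iterated partial
  derivatives of \<open>k\<close>.
\<close>

definition fisher_matrix ::
  "(real ^ 'p \<Rightarrow> real ^ 'd \<Rightarrow> real) \<Rightarrow> ('p list \<Rightarrow> real ^ 'p \<Rightarrow> real ^ 'd \<Rightarrow> real) \<Rightarrow>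
     (nat \<Rightarrow> real ^ 'd) \<Rightarrow> real ^ 'p::finite \<Rightarrow> nat \<Rightarrow> real ^ 'p ^ 'p" where
  "fisher_matrix k Dk s \<theta>0 n =
     (let Rinv = mat_inv (cov_matrix k s n \<theta>0);
          dR = (\<lambda>i. cov_matrix (Dk [i]) s n \<theta>0)
      in \<chi> i j. 1 / 2 * (1 / real n) * mat_trace (Rinv * dR i * Rinv * dR j))"

end

theory Submission
  imports Defs "HOL-Real_Asymp.Real_Asymp"
begin

text \<open>
  Separation of the points, polynomial decay of \<open>k\<^sub>\<theta>\<close> and positivity of the spectral density bound the
  eigenvalues of all \<open>R\<^sub>\<theta>\<close> from above and away from 0, uniformly in \<open>n\<close> and \<open>\<theta>\<close>. Diagonalising
  \<open>R\<^sub>\<theta>\<^sub>0\<close> and a symmetric perturbation \<open>E\<close> simultaneously turns the criterion difference into a sum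
  \<open>1/n \<Sum>\<^sub>i ln (1 + e\<^sub>i) + w\<^sub>i\<^sup>2 (1 / (1 + e\<^sub>i) - 1)\<close> with independent standard normal \<open>w\<^sub>i\<close>, so that every
  random quantity is a bounded deterministic term plus a centred quadratic form in white noise.

  Consistency: the difference is at least a constant times \<open>1/n \<Sum>\<^sub>i e\<^sub>i\<^sup>2\<close>, which condition (5) keeps away from 0,
  up to a quadratic form of variance \<open>O(1/n)\<close>; a finite net of \<open>\<Theta>\<close> makes this uniform. Normality:
  near \<open>\<theta>\<^sub>0\<close> the criterion is a quadratic polynomial with Hessian \<open>2 \<Sigma>\<close> and linear
  coefficient \<open>g\<close>, up to an error that is negligible in probability, so the estimator is close to the
  minimiser \<open>-1/2 \<Sigma>\<^sup>-\<^sup>1 g\<close> of that polynomial. Its characteristic function is a product of those of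
  \<open>w\<^sub>i\<^sup>2 - 1\<close>, and Levy's continuity theorem concludes.
\<close>

subsection \<open>Separated points\<close>

text \<open>The data are known only through Gaussian linear combinations, so independence of the
  whitened coordinates is itself a result, obtained by factorising characteristic functions one
  coordinate at a time. All matrices grow with \<open>n\<close>, hence every estimate goes through
  two constants fixed once: an upper operator bound \<open>Cop\<close> and a lower eigenvalue bound
  \<open>cR\<close>. The parameter set need not contain segments, so away from \<theta>0 closeness
  of covariances comes from convergence of spectral densities, and Taylor expansion is confined to a
  box around \<theta>0. The rate of the estimator is found by comparing values instead of solving a
  score equation: the expansion error is small relative to the squared increment, so mere
  consistency places the estimator where its value can be compared with that of the explicit
  minimiser, and strong convexity turns this into a bound of order n^(-1/2). The normalisation fits
  because the linear coefficient g has covariance 4 \<Sigma> / n, so that -1/2 \<Sigma>^-1 g has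
  covariance \<Sigma>^-1 / n.\<close>

lemma separated_card_le:
  fixes s :: "nat \<Rightarrow> 'a::euclidean_space"
  assumes fin: "finite J" and \<Delta>: "\<Delta> > 0" and r: "r \<ge> 0"
    and sep: "\<And>i j. i \<in> J \<Longrightarrow> j \<in> J \<Longrightarrow> i \<noteq> j \<Longrightarrow> \<Delta> \<le> norm (s i - s j)"
    and near: "\<And>j. j \<in> J \<Longrightarrow> norm (s j - x) \<le> r"
  shows "real (card J) \<le> (1 + 2 * r / \<Delta>) ^ DIM('a)"
proof -
  let ?V = "unit_ball_vol (real DIM('a))"
  have V: "?V > 0" by simp
  \<comment> \<open>Packing by volume: the balls of radius \<Delta>/2 around the points are disjoint
    and all lie in one ball of radius r + \<Delta>/2, so the ratio of the two volumes bounds the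
    count.\<close>
  have disj: "disjoint_family_on (\<lambda>j. ball (s j) (\<Delta> / 2)) J"
  proof -
    have False if "i \<in> J" "j \<in> J" "i \<noteq> j" "dist (s i) z < \<Delta> / 2" "dist (s j) z < \<Delta> / 2" for i j z
      using dist_triangle2[of "s i" "s j" z] sep[OF that(1-3)] that(4,5) by (simp add: dist_norm)
    thus ?thesis unfolding disjoint_family_on_def by (auto simp: disjoint_iff)
  qed
  have sub: "(\<Union>j\<in>J. ball (s j) (\<Delta> / 2)) \<subseteq> ball x (r + \<Delta> / 2)"
  proof
    fix z assume "z \<in> (\<Union>j\<in>J. ball (s j) (\<Delta> / 2))"
    then obtain j where "j \<in> J" "dist (s j) z < \<Delta> / 2" by auto
    thus "z \<in> ball x (r + \<Delta> / 2)"
      using near[of j] dist_triangle[of x z "s j"] by (simp add: dist_norm norm_minus_commute)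
  qed
  have fm: "c \<in> fmeasurable lborel" if "c = ball y t" for c and y :: 'a and t
    unfolding that fmeasurable_def by (auto intro: emeasure_bounded_finite simp flip: infinity_ennreal_def)
  have "real (card J) * (?V * (\<Delta> / 2) ^ DIM('a)) = (\<Sum>j\<in>J. measure lborel (ball (s j) (\<Delta> / 2)))"
    using \<Delta> by (simp add: content_ball)
  also have "\<dots> = measure lborel (\<Union>j\<in>J. ball (s j) (\<Delta> / 2))"
    by (rule measure_UNION'[symmetric, OF fin]) (use fm disj in \<open>auto simp: disjoint_family_on_def pairwise_def disjnt_def\<close>)
  also have "\<dots> \<le> measure lborel (ball x (r + \<Delta> / 2))"
    by (rule measure_mono_fmeasurable[OF sub]) (use fm in auto)
  also have "\<dots> = ?V * (r + \<Delta> / 2) ^ DIM('a)"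
    using \<Delta> r by (simp add: content_ball)
  finally have "real (card J) * (\<Delta> / 2) ^ DIM('a) \<le> (r + \<Delta> / 2) ^ DIM('a)"
    using V by (simp add: mult.left_commute)
  hence "real (card J) \<le> (r + \<Delta> / 2) ^ DIM('a) / (\<Delta> / 2) ^ DIM('a)"
    using \<Delta> by (simp add: field_simps)
  also have "\<dots> = (1 + 2 * r / \<Delta>) ^ DIM('a)"
  proof -
    have "(r + \<Delta> / 2) / (\<Delta> / 2) = 1 + 2 * r / \<Delta>" using \<Delta> by (simp add: field_simps)
    thus ?thesis by (simp only: power_divide[symmetric])
  qed
  finally show ?thesis .
qed

text \<open>Dyadic shells around \<open>x\<close>: the shell of radius about 2^m holds O(2^(m d))
  points, each of weight about 2^(-m \<beta>), which leaves a geometric series of ratio 2^(d -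
  \<beta>) < 1. The bound depends on \<Delta>, \<beta> and the dimension alone, and this is what
  makes all later matrix bounds uniform in the number of points.\<close>

lemma separated_sum_bounded:
  assumes \<Delta>: "\<Delta> > 0" and \<beta>: "\<beta> > real DIM('a::euclidean_space)"
  shows "\<exists>S>0. \<forall>(s :: nat \<Rightarrow> 'a) J x. finite J \<longrightarrow> (\<forall>i j. i \<noteq> j \<longrightarrow> \<Delta> \<le> norm (s i - s j)) \<longrightarrow>
       (\<Sum>j\<in>J. 1 / (1 + norm (s j - x) powr \<beta>)) \<le> S"
proof -
  define d where "d = DIM('a)"
  define q where "q = 2 powr (real d - \<beta>)"
  have q: "0 < q" "q < 1" using \<beta> unfolding q_def d_def by (auto intro: powr_less_one)
  define K where "K = 2 powr \<beta> * (1 + 2 / \<Delta>) ^ d"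
  have K: "K > 0" unfolding K_def using \<Delta> by (intro mult_pos_pos zero_less_power) (auto intro: add_pos_pos)
  have main: "(\<Sum>j\<in>J. 1 / (1 + norm (s j - x) powr \<beta>)) \<le> K / (1 - q)"
    if fin: "finite J" and sep: "\<And>i j. i \<noteq> j \<Longrightarrow> \<Delta> \<le> norm (s i - s j)" for s :: "nat \<Rightarrow> 'a" and J x
  proof -
    define lev where "lev = (\<lambda>j. LEAST m. norm (s j - x) < 2 ^ m)"
    have lev1: "norm (s j - x) < 2 ^ lev j" for j
    proof -
      obtain m :: nat where "norm (s j - x) < 2 ^ m" using real_arch_pow[of 2 "norm (s j - x)"] by auto
      thus ?thesis unfolding lev_def by (rule LeastI)
    qed
    \<comment> \<open>A point of level m + 1 is only known to have distance at least 2^m; the factor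
      \<open>2 powr \<beta>\<close> pays for that one level, and at level 0 it dominates the trivial
      bound 1.\<close>
    have lev2: "1 / (1 + norm (s j - x) powr \<beta>) \<le> 2 powr \<beta> * 2 powr (- real (lev j) * \<beta>)" for j
    proof (cases "lev j")
      case 0
      have "1 / (1 + norm (s j - x) powr \<beta>) \<le> 1" by (simp add: divide_le_eq_1 add_pos_nonneg)
      also have "1 \<le> 2 powr \<beta>" using \<beta> by (intro ge_one_powr_ge_zero) auto
      finally show ?thesis using 0 by simp
    next
      case (Suc m)
      have "\<not> norm (s j - x) < 2 ^ m"
        using not_less_Least[of m "\<lambda>m. norm (s j - x) < 2 ^ m"] Suc unfolding lev_def by simp
      hence "(2 ^ m) powr \<beta> \<le> norm (s j - x) powr \<beta>" using \<beta> by (intro powr_mono2) auto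
      hence le: "(2 ^ m) powr \<beta> \<le> 1 + norm (s j - x) powr \<beta>" by simp
      have "1 / (1 + norm (s j - x) powr \<beta>) \<le> 1 / (2 ^ m) powr \<beta>"
        by (intro divide_left_mono le) (auto intro!: mult_pos_pos add_pos_nonneg)
      also have "\<dots> = 2 powr (- real m * \<beta>)"
        by (simp add: powr_powr powr_minus_divide flip: powr_realpow)
      also have "\<dots> = 2 powr \<beta> * 2 powr (- real (lev j) * \<beta>)"
        unfolding Suc by (simp add: powr_add[symmetric] algebra_simps)
      finally show ?thesis .
    qed
    \<comment> \<open>Strict upper bound for the levels that occur, so that grouping by level is a
      finite sum; inserting 0 covers the empty index set.\<close>
    define N where "N = Suc (Max (insert 0 (lev ` J)))"
    have N: "lev j < N" if "j \<in> J" for j unfolding N_def using fin that by (simp add: le_imp_less_Suc)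
    have "(\<Sum>j\<in>J. 1 / (1 + norm (s j - x) powr \<beta>)) \<le> (\<Sum>j\<in>J. 2 powr \<beta> * 2 powr (- real (lev j) * \<beta>))"
      by (intro sum_mono lev2)
    also have "\<dots> = (\<Sum>m<N. \<Sum>j\<in>{j\<in>J. lev j = m}. 2 powr \<beta> * 2 powr (- real (lev j) * \<beta>))"
      by (rule sum.group[symmetric]) (use fin N in auto)
    also have "\<dots> \<le> (\<Sum>m<N. K * q ^ m)"
    proof (rule sum_mono)
      fix m
      have "real (card {j\<in>J. lev j = m}) \<le> (1 + 2 * 2 ^ m / \<Delta>) ^ d"
        unfolding d_def by (rule separated_card_le[where s = s and x = x])
          (use fin \<Delta> sep lev1 in \<open>auto intro: less_imp_le\<close>)
      also have "\<dots> \<le> (2 ^ m * (1 + 2 / \<Delta>)) ^ d"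
        using \<Delta> by (intro power_mono) (auto simp: field_simps intro!: mult_right_mono)
      finally have "(\<Sum>j\<in>{j\<in>J. lev j = m}. 2 powr \<beta> * 2 powr (- real (lev j) * \<beta>))
          \<le> (2 ^ m * (1 + 2 / \<Delta>)) ^ d * (2 powr \<beta> * 2 powr (- real m * \<beta>))"
        by (simp add: mult_right_mono)
      also have "\<dots> = K * ((2 ^ m) ^ d * 2 powr (- real m * \<beta>))"
        unfolding K_def power_mult_distrib by (simp add: algebra_simps)
      also have "(2 ^ m) ^ d * 2 powr (- real m * \<beta>) = q ^ m"
        unfolding q_def by (simp add: powr_powr powr_add[symmetric] power_mult[symmetric] algebra_simps flip: powr_realpow)
      finally show "(\<Sum>j\<in>{j\<in>J. lev j = m}. 2 powr \<beta> * 2 powr (- real (lev j) * \<beta>)) \<le> K * q ^ m" .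
    qed
    also have "\<dots> = K * ((1 - q ^ N) / (1 - q))"
      using q by (simp add: sum_distrib_left[symmetric] sum_gp_strict)
    also have "\<dots> \<le> K * (1 / (1 - q))"
      using q K by (intro mult_left_mono divide_right_mono) auto
    finally show ?thesis by simp
  qed
  show ?thesis by (rule exI[of _ "K / (1 - q)"]) (use K q main in auto)
qed

subsection \<open>Gaussian integrals\<close>

text \<open>Lebesgue measure on \<open>real ^ 'n\<close> is the image of a product measure indexed
  by \<open>Basis\<close>; as the basis consists of the vectors \<open>axis i 1\<close>, Fubini for
  finite products can be reindexed by coordinates.\<close>

lemma
  fixes f :: "'n::finite \<Rightarrow> real \<Rightarrow> 'b::{real_normed_field, banach, second_countable_topology}"
  assumes f: "\<And>i. integrable lborel (f i)"
  shows integral_lborel_prod: "(\<integral>x. (\<Prod>i\<in>UNIV. f i (vec_nth x i)) \<partial>(lborel :: (real ^ 'n) measure)) = (\<Prod>i\<in>UNIV. \<integral>y. f i y \<partial>lborel)"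
    and integrable_lborel_prod: "integrable (lborel :: (real ^ 'n) measure) (\<lambda>x. \<Prod>i\<in>UNIV. f i (vec_nth x i))"
proof -
  let ?e = "\<lambda>i::'n. axis i (1::real)"
  have inj: "inj ?e" by (auto simp: inj_on_def axis_eq_axis)
  have Basis: "(Basis :: (real ^ 'n) set) = range ?e" by (auto simp: Basis_vec_def)
  define g where "g = (\<lambda>b. f (inv_into UNIV ?e b))"
  have g: "g (?e i) = f i" for i unfolding g_def by (simp add: inv_f_f[OF inj])
  have gint: "integrable lborel (g b)" for b unfolding g_def by (rule f)
  have reindex: "(\<Prod>b\<in>Basis. h b) = (\<Prod>i\<in>UNIV. h (?e i))" for h :: "real ^ 'n \<Rightarrow> 'b"
    unfolding Basis by (simp add: prod.reindex[OF inj])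
  have meas: "(\<lambda>f. \<Sum>b\<in>Basis. f b *\<^sub>R b) \<in> (\<Pi>\<^sub>M b\<in>(Basis :: (real ^ 'n) set). lborel) \<rightarrow>\<^sub>M borel" by measurable
  have fm [measurable]: "f i \<in> borel_measurable borel" for i using f[of i] by simp
  have pm: "(\<lambda>x. \<Prod>i\<in>UNIV. f i (vec_nth x i)) \<in> borel_measurable (borel :: (real ^ 'n) measure)"
    by (intro borel_measurable_prod measurable_compose[OF _ fm] borel_measurable_continuous_onI) (auto intro: continuous_intros)
  have coord: "vec_nth (\<Sum>b\<in>Basis. x b *\<^sub>R b) i = x (?e i)" for x i
  proof -
    have "vec_nth (\<Sum>b\<in>Basis. x b *\<^sub>R b) i = (\<Sum>b\<in>Basis. x b *\<^sub>R b) \<bullet> ?e i" by (simp add: inner_axis)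
    also have "\<dots> = x (?e i)" by (rule inner_sum_left_Basis) (auto simp: Basis)
    finally show ?thesis .
  qed
  have eq: "(\<Prod>i\<in>UNIV. f i (vec_nth (\<Sum>b\<in>Basis. x b *\<^sub>R b) i)) = (\<Prod>b\<in>Basis. g b (x b))" for x
    unfolding reindex g coord ..
  interpret product_sigma_finite "\<lambda>_::real ^ 'n. lborel :: real measure" ..
  have "(\<integral>x. (\<Prod>i\<in>UNIV. f i (vec_nth x i)) \<partial>(lborel :: (real ^ 'n) measure))
     = (\<integral>x. (\<Prod>b\<in>Basis. g b (x b)) \<partial>(\<Pi>\<^sub>M b\<in>(Basis :: (real ^ 'n) set). lborel))"
    unfolding lborel_eq[where 'a = "real ^ 'n"] by (subst integral_distr[OF meas pm]) (simp only: eq)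
  also have "\<dots> = (\<Prod>b\<in>Basis. \<integral>y. g b y \<partial>lborel)" by (rule product_integral_prod) (auto simp: gint)
  finally show "(\<integral>x. (\<Prod>i\<in>UNIV. f i (vec_nth x i)) \<partial>(lborel :: (real ^ 'n) measure)) = (\<Prod>i\<in>UNIV. \<integral>y. f i y \<partial>lborel)"
    unfolding reindex g .
  show "integrable (lborel :: (real ^ 'n) measure) (\<lambda>x. \<Prod>i\<in>UNIV. f i (vec_nth x i))"
    unfolding lborel_eq[where 'a = "real ^ 'n"] integrable_distr_eq[OF meas pm] eq
    by (rule product_integrable_prod) (auto simp: gint)
qed

text \<open>The substitution x -> c x with c = sqrt (2 a) reduces to the characteristic function of
  the standard normal law, evaluated at u / c.\<close>

lemma
  fixes a u :: real assumes a: "a > 0"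
  shows gaussian_fourier_real: "(\<integral>x. exp (- a * x\<^sup>2) * iexp (u * x) \<partial>lborel) = sqrt (pi / a) * exp (- u\<^sup>2 / (4 * a))"
    and gaussian_fourier_real_integrable: "integrable lborel (\<lambda>x. exp (- a * x\<^sup>2) * iexp (u * x))"
proof -
  define c where "c = sqrt (2 * a)"
  have c: "c > 0" "c\<^sup>2 = 2 * a" using a unfolding c_def by auto
  define t where "t = u / c"
  let ?F = "\<lambda>x::real. std_normal_density x * iexp (t * x)"
  have int: "integrable lborel ?F"
  proof (rule Bochner_Integration.integrable_bound)
    show "integrable lborel std_normal_density" by simp
  qed (auto simp: norm_mult simp del: of_real_mult)
  have F: "(\<integral>x. ?F x \<partial>lborel) = exp (- t\<^sup>2 / 2)"
  proof -
    have "char std_normal_distribution t = (\<integral>x. ?F x \<partial>lborel)"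
      unfolding char_def by (subst integral_density) (auto simp: scaleR_conv_of_real)
    thus ?thesis by (simp add: char_std_normal_distribution)
  qed
  have eq: "?F (0 + c * x) = (1 / sqrt (2 * pi)) * (exp (- a * x\<^sup>2) * iexp (u * x))" for x
  proof -
    have e1: "- (c * x)\<^sup>2 / 2 = - a * x\<^sup>2" by (simp add: power_mult_distrib c)
    have e2: "t * (c * x) = u * x" unfolding t_def using c by simp
    show ?thesis unfolding std_normal_density_def add_0 e1 e2 by simp
  qed
  have k: "complex_of_real (sqrt (2 * pi)) * (complex_of_real (1 / sqrt (2 * pi)) * z) = z" for z by simp
  have "integrable lborel (\<lambda>x. ?F (0 + c * x))"
    using lborel_integrable_real_affine[OF int, of c 0] c by simp
  from integrable_mult_right[OF this, of "complex_of_real (sqrt (2 * pi))"]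
  show "integrable lborel (\<lambda>x. exp (- a * x\<^sup>2) * iexp (u * x))" unfolding eq k .
  have "complex_of_real (exp (- t\<^sup>2 / 2)) = c *\<^sub>R (\<integral>x. ?F (0 + c * x) \<partial>lborel)"
    unfolding F[symmetric] using lborel_integral_real_affine[of c ?F 0] c by simp
  also have "\<dots> = complex_of_real c * (complex_of_real (1 / sqrt (2 * pi)) * (\<integral>x. exp (- a * x\<^sup>2) * iexp (u * x) \<partial>lborel))"
    unfolding eq integral_mult_right_zero scaleR_conv_of_real ..
  finally have A: "complex_of_real (exp (- t\<^sup>2 / 2)) = \<dots>" .
  have "complex_of_real (sqrt (2 * pi) / c) * (complex_of_real c * (complex_of_real (1 / sqrt (2 * pi)) * z)) = z" for z
    using c(1) by simp
  hence "complex_of_real (sqrt (2 * pi) / c) * complex_of_real (exp (- t\<^sup>2 / 2)) = (\<integral>x. exp (- a * x\<^sup>2) * iexp (u * x) \<partial>lborel)"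
    unfolding A .
  moreover have "sqrt (2 * pi) / c = sqrt (pi / a)" unfolding c_def real_sqrt_divide[symmetric] by simp
  moreover have "- t\<^sup>2 / 2 = - u\<^sup>2 / (4 * a)" unfolding t_def power_divide c by simp
  ultimately show "(\<integral>x. exp (- a * x\<^sup>2) * iexp (u * x) \<partial>lborel) = sqrt (pi / a) * exp (- u\<^sup>2 / (4 * a))"
    by (metis of_real_mult)
qed

text \<open>Both factors of the integrand split over the coordinates.\<close>

lemma
  fixes u :: "real ^ 'n" and a :: real assumes a: "a > 0"
  shows gaussian_fourier: "(\<integral>x. exp (- a * (norm x)\<^sup>2) * iexp (u \<bullet> x) \<partial>lborel) = sqrt (pi / a) ^ CARD('n) * exp (- (norm u)\<^sup>2 / (4 * a))"
    and gaussian_fourier_integrable: "integrable lborel (\<lambda>x. exp (- a * (norm x)\<^sup>2) * iexp (u \<bullet> x))"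
proof -
  have eq: "exp (- a * (norm x)\<^sup>2) * iexp (u \<bullet> x) = (\<Prod>i\<in>UNIV. complex_of_real (exp (- a * (vec_nth x i)\<^sup>2)) * iexp (vec_nth u i * vec_nth x i))" for x :: "real ^ 'n"
  proof -
    have "exp (- a * (norm x)\<^sup>2) = (\<Prod>i\<in>UNIV. exp (- a * (vec_nth x i)\<^sup>2))"
      unfolding norm_vec_def L2_set_def by (simp add: sum_nonneg sum_distrib_left flip: exp_sum)
    moreover have "iexp (u \<bullet> x) = (\<Prod>i\<in>UNIV. iexp (vec_nth u i * vec_nth x i))"
      unfolding inner_vec_def by (simp add: sum_distrib_left flip: exp_sum)
    ultimately show ?thesis by (simp only: of_real_prod prod.distrib)
  qed
  note int = gaussian_fourier_real_integrable[OF a]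
  show "integrable lborel (\<lambda>x. exp (- a * (norm x)\<^sup>2) * iexp (u \<bullet> x))"
    unfolding eq using int by (rule integrable_lborel_prod)
  have "(\<integral>x. exp (- a * (norm x)\<^sup>2) * iexp (u \<bullet> x) \<partial>lborel)
      = (\<Prod>i\<in>UNIV. complex_of_real (sqrt (pi / a) * exp (- (vec_nth u i)\<^sup>2 / (4 * a))))"
    unfolding eq by (subst integral_lborel_prod[OF int], intro prod.cong refl, rule gaussian_fourier_real[OF a])
  also have "\<dots> = complex_of_real (\<Prod>i\<in>UNIV. (sqrt (pi / a) * exp (- (vec_nth u i)\<^sup>2 / (4 * a))))"
    by (simp only: of_real_prod)
  also have "(\<Prod>i\<in>UNIV. (sqrt (pi / a) * exp (- (vec_nth u i)\<^sup>2 / (4 * a)))) = sqrt (pi / a) ^ CARD('n) * exp (- (norm u)\<^sup>2 / (4 * a))"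
    unfolding norm_vec_def L2_set_def prod.distrib by (simp add: sum_nonneg sum_negf sum_divide_distrib flip: exp_sum)
  finally show "(\<integral>x. exp (- a * (norm x)\<^sup>2) * iexp (u \<bullet> x) \<partial>lborel) = sqrt (pi / a) ^ CARD('n) * exp (- (norm u)\<^sup>2 / (4 * a))"
    by (simp only: of_real_mult)
qed

lemma
  fixes a :: real assumes a: "a > 0"
  shows gaussian_integral: "(\<integral>x. exp (- a * (norm (x :: real ^ 'n))\<^sup>2) \<partial>lborel) = sqrt (pi / a) ^ CARD('n)"
    and gaussian_integrable: "integrable lborel (\<lambda>x :: real ^ 'n. exp (- a * (norm x)\<^sup>2))"
    and gaussian_cos_integral: "(\<integral>x. exp (- a * (norm x)\<^sup>2) * cos (u \<bullet> x) \<partial>lborel) = sqrt (pi / a) ^ CARD('n) * exp (- (norm (u :: real ^ 'n))\<^sup>2 / (4 * a))"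
    and gaussian_cos_integrable: "integrable lborel (\<lambda>x :: real ^ 'n. exp (- a * (norm x)\<^sup>2) * cos (u \<bullet> x))"
proof -
  have R: "Re (exp (- a * (norm x)\<^sup>2) * iexp (u \<bullet> x)) = exp (- a * (norm x)\<^sup>2) * cos (u \<bullet> x)" for u x :: "real ^ 'n"
    by (simp add: Re_exp)
  show c: "integrable lborel (\<lambda>x :: real ^ 'n. exp (- a * (norm x)\<^sup>2) * cos (u \<bullet> x))" for u
    using integrable_Re[OF gaussian_fourier_integrable[OF a, of u]] by (simp only: R)
  show cI: "(\<integral>x. exp (- a * (norm x)\<^sup>2) * cos (u \<bullet> x) \<partial>lborel) = sqrt (pi / a) ^ CARD('n) * exp (- (norm (u :: real ^ 'n))\<^sup>2 / (4 * a))" for u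
    using integral_Re[OF gaussian_fourier_integrable[OF a, of u]] unfolding R gaussian_fourier[OF a]
    by (simp flip: of_real_mult of_real_power)
  show "integrable lborel (\<lambda>x :: real ^ 'n. exp (- a * (norm x)\<^sup>2))" using c[of 0] by simp
  show "(\<integral>x. exp (- a * (norm (x :: real ^ 'n))\<^sup>2) \<partial>lborel) = sqrt (pi / a) ^ CARD('n)" using cI[of 0] by simp
qed

subsection \<open>Levy's continuity theorem in Euclidean space\<close>

text \<open>A Gaussian is its own Fourier transform up to scaling, so Fubini writes the mean of a
  Gaussian bump of \<open>X\<close> around \<open>y\<close> as a Gaussian average of the
  characteristic function of \<open>X\<close>. This is the bridge from characteristic functions to
  test functions.\<close>

lemma gaussian_kernel_expectation:
  fixes X :: "'a \<Rightarrow> real ^ 'p" and y :: "real ^ 'p"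
  assumes "prob_space M" and [measurable]: "X \<in> borel_measurable M" and a: "a > 0"
  shows "complex_of_real (sqrt (pi / a) ^ CARD('p)) * (\<integral>\<omega>. exp (- (norm (X \<omega> - y))\<^sup>2 / (4 * a)) \<partial>M)
    = (\<integral>t. exp (- a * (norm t)\<^sup>2) * iexp (- (y \<bullet> t)) * (\<integral>\<omega>. iexp (t \<bullet> X \<omega>) \<partial>M) \<partial>lborel)"
proof -
  interpret prob_space M by fact
  interpret P: pair_sigma_finite M "lborel :: (real ^ 'p) measure" ..
  let ?F = "\<lambda>(\<omega>, t). complex_of_real (exp (- a * (norm t)\<^sup>2)) * iexp ((X \<omega> - y) \<bullet> t)"
  have m: "?F \<in> borel_measurable (M \<Otimes>\<^sub>M lborel)" by measurable
  have int: "integrable (M \<Otimes>\<^sub>M lborel) ?F"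
  proof (rule P.Fubini_integrable[OF m])
    show "AE \<omega> in M. integrable lborel (\<lambda>t. ?F (\<omega>, t))"
      using gaussian_fourier_integrable[OF a] by auto
    have "norm (?F (\<omega>, t)) = exp (- a * (norm t)\<^sup>2)" for \<omega> t by (simp only: split_conv norm_mult norm_exp_i_times) simp
    thus "integrable M (\<lambda>\<omega>. \<integral>t. norm (?F (\<omega>, t)) \<partial>lborel)" by simp
  qed
  have "(\<integral>\<omega>. (\<integral>t. ?F (\<omega>, t) \<partial>lborel) \<partial>M) = (\<integral>\<omega>. complex_of_real (sqrt (pi / a) ^ CARD('p) * exp (- (norm (X \<omega> - y))\<^sup>2 / (4 * a))) \<partial>M)"
    unfolding split_conv gaussian_fourier[OF a] by (simp only: of_real_mult)
  also have "\<dots> = complex_of_real (sqrt (pi / a) ^ CARD('p)) * (\<integral>\<omega>. exp (- (norm (X \<omega> - y))\<^sup>2 / (4 * a)) \<partial>M)"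
    by (simp only: integral_complex_of_real integral_mult_right_zero of_real_mult)
  finally have "complex_of_real (sqrt (pi / a) ^ CARD('p)) * (\<integral>\<omega>. exp (- (norm (X \<omega> - y))\<^sup>2 / (4 * a)) \<partial>M) = (\<integral>\<omega>. (\<integral>t. ?F (\<omega>, t) \<partial>lborel) \<partial>M)" ..
  also have "\<dots> = (\<integral>t. (\<integral>\<omega>. ?F (\<omega>, t) \<partial>M) \<partial>lborel)"
    using P.Fubini_integral[of "\<lambda>\<omega> t. ?F (\<omega>, t)"] int by simp
  also have "\<dots> = (\<integral>t. exp (- a * (norm t)\<^sup>2) * iexp (- (y \<bullet> t)) * (\<integral>\<omega>. iexp (t \<bullet> X \<omega>) \<partial>M) \<partial>lborel)"
  proof (intro Bochner_Integration.integral_cong refl)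
    fix t
    have e: "iexp ((X \<omega> - y) \<bullet> t) = iexp (- (y \<bullet> t)) * iexp (t \<bullet> X \<omega>)" for \<omega>
    proof -
      have "(X \<omega> - y) \<bullet> t = - (y \<bullet> t) + t \<bullet> X \<omega>" by (simp add: inner_diff_left inner_diff_right inner_commute)
      thus ?thesis by (simp only: of_real_add distrib_left exp_add)
    qed
    have "(\<integral>\<omega>. ?F (\<omega>, t) \<partial>M) = (\<integral>\<omega>. (complex_of_real (exp (- a * (norm t)\<^sup>2)) * iexp (- (y \<bullet> t))) * iexp (t \<bullet> X \<omega>) \<partial>M)"
      unfolding split_conv e by (simp only: mult.assoc)
    thus "(\<integral>\<omega>. ?F (\<omega>, t) \<partial>M) = exp (- a * (norm t)\<^sup>2) * iexp (- (y \<bullet> t)) * (\<integral>\<omega>. iexp (t \<bullet> X \<omega>) \<partial>M)"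
      by (simp only: integral_mult_right_zero)
  qed
  finally show ?thesis .
qed

text \<open>Characteristic functions are bounded by 1, so the Gaussian weight dominates and their
  pointwise convergence suffices.\<close>

lemma gaussian_kernel_convergence:
  fixes X :: "nat \<Rightarrow> 'a \<Rightarrow> real ^ 'p" and N :: "(real ^ 'p) measure"
  assumes M: "prob_space M" and X: "\<And>n. X n \<in> borel_measurable M"
    and N: "prob_space N" and sN: "sets N = sets borel"
    and char: "\<And>t. (\<lambda>n. \<integral>\<omega>. iexp (t \<bullet> X n \<omega>) \<partial>M) \<longlonglongrightarrow> (\<integral>x. iexp (t \<bullet> x) \<partial>N)" and b: "b > 0"
  shows "(\<lambda>n. \<integral>\<omega>. exp (- b * (norm (X n \<omega> - y))\<^sup>2) \<partial>M) \<longlonglongrightarrow> (\<integral>x. exp (- b * (norm (x - y))\<^sup>2) \<partial>N)"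
proof -
  interpret M: prob_space M by fact
  interpret N: prob_space N by fact
  \<comment> \<open>Dual width: the Fourier transform of the weight exp (-a |t|^2) is a bump with
    exponent b.\<close>
  define a where "a = 1 / (4 * b)"
  have a: "a > 0" "1 / (4 * a) = b" using b unfolding a_def by auto
  have ab: "- (norm z)\<^sup>2 / (4 * a) = - b * (norm z)\<^sup>2" for z :: "real ^ 'p"
    using b unfolding a_def by simp
  let ?c = "complex_of_real (sqrt (pi / a) ^ CARD('p))"
  have c: "?c \<noteq> 0" using a by simp
  have idN: "(\<lambda>x. x) \<in> borel_measurable N" using measurable_ident_sets[OF sN] by simp
  have "(\<lambda>n. \<integral>t. exp (- a * (norm t)\<^sup>2) * iexp (- (y \<bullet> t)) * (\<integral>\<omega>. iexp (t \<bullet> X n \<omega>) \<partial>M) \<partial>lborel)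
     \<longlonglongrightarrow> (\<integral>t. exp (- a * (norm t)\<^sup>2) * iexp (- (y \<bullet> t)) * (\<integral>x. iexp (t \<bullet> x) \<partial>N) \<partial>lborel)"
  proof (rule integral_dominated_convergence[where w = "\<lambda>t. exp (- a * (norm t)\<^sup>2)"])
    have [measurable]: "X n \<in> borel_measurable M" for n by (rule X)
    show "(\<lambda>t. exp (- a * (norm t)\<^sup>2) * iexp (- (y \<bullet> t)) * (\<integral>\<omega>. iexp (t \<bullet> X n \<omega>) \<partial>M)) \<in> borel_measurable lborel" for n
      by measurable
    note sN[measurable_cong]
    show "(\<lambda>t. exp (- a * (norm t)\<^sup>2) * iexp (- (y \<bullet> t)) * (\<integral>x. iexp (t \<bullet> x) \<partial>N)) \<in> borel_measurable lborel"
      by measurable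
    show "AE t in lborel. (\<lambda>n. exp (- a * (norm t)\<^sup>2) * iexp (- (y \<bullet> t)) * (\<integral>\<omega>. iexp (t \<bullet> X n \<omega>) \<partial>M))
       \<longlonglongrightarrow> exp (- a * (norm t)\<^sup>2) * iexp (- (y \<bullet> t)) * (\<integral>x. iexp (t \<bullet> x) \<partial>N)"
      by (intro AE_I2 tendsto_mult_left char)
    show "integrable lborel (\<lambda>t :: real ^ 'p. exp (- a * (norm t)\<^sup>2))" by (rule gaussian_integrable[OF a(1)])
    have "norm (\<integral>\<omega>. iexp (t \<bullet> X n \<omega>) \<partial>M) \<le> 1" for n t
    proof -
      have "norm (\<integral>\<omega>. iexp (t \<bullet> X n \<omega>) \<partial>M) \<le> (\<integral>\<omega>. norm (iexp (t \<bullet> X n \<omega>)) \<partial>M)" by (rule integral_norm_bound)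
      thus ?thesis unfolding norm_exp_i_times using M.prob_space by simp
    qed
    thus "AE t in lborel. norm (exp (- a * (norm t)\<^sup>2) * iexp (- (y \<bullet> t)) * (\<integral>\<omega>. iexp (t \<bullet> X n \<omega>) \<partial>M)) \<le> exp (- a * (norm t)\<^sup>2)" for n
      unfolding norm_mult norm_exp_i_times by (auto intro!: AE_I2 mult_left_le)
  qed
  hence "(\<lambda>n. ?c * (\<integral>\<omega>. exp (- (norm (X n \<omega> - y))\<^sup>2 / (4 * a)) \<partial>M)) \<longlonglongrightarrow> ?c * (\<integral>x. exp (- (norm (x - y))\<^sup>2 / (4 * a)) \<partial>N)"
    unfolding gaussian_kernel_expectation[OF M X a(1)] gaussian_kernel_expectation[OF N idN a(1)] .
  hence "(\<lambda>n. complex_of_real (\<integral>\<omega>. exp (- (norm (X n \<omega> - y))\<^sup>2 / (4 * a)) \<partial>M)) \<longlonglongrightarrow> complex_of_real (\<integral>x. exp (- (norm (x - y))\<^sup>2 / (4 * a)) \<partial>N)"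
    using c by (rule tendsto_mult_left_iff[THEN iffD1, rotated])
  thus ?thesis unfolding tendsto_of_real_iff ab .
qed

text \<open>Fubini moves the smoothing integral outside; the inner means converge by the previous
  result, and |f| dominates.\<close>

lemma smoothing_convergence:
  fixes X :: "nat \<Rightarrow> 'a \<Rightarrow> real ^ 'p" and N :: "(real ^ 'p) measure" and f :: "real ^ 'p \<Rightarrow> real"
  assumes M: "prob_space M" and X: "\<And>n. X n \<in> borel_measurable M"
    and N: "prob_space N" and sN: "sets N = sets borel"
    and char: "\<And>t. (\<lambda>n. \<integral>\<omega>. iexp (t \<bullet> X n \<omega>) \<partial>M) \<longlonglongrightarrow> (\<integral>x. iexp (t \<bullet> x) \<partial>N)" and b: "b > 0"
    and f: "integrable lborel f"
  shows "(\<lambda>n. \<integral>\<omega>. (\<integral>y. f y * exp (- b * (norm (X n \<omega> - y))\<^sup>2) \<partial>lborel) \<partial>M)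
     \<longlonglongrightarrow> (\<integral>x. (\<integral>y. f y * exp (- b * (norm (x - y))\<^sup>2) \<partial>lborel) \<partial>N)"
proof -
  have [measurable]: "f \<in> borel_measurable borel" using f by simp
  have e1: "\<bar>f y * exp (- b * (norm (z - y))\<^sup>2)\<bar> \<le> \<bar>f y\<bar>" for y z
    using b by (auto simp: abs_mult intro!: mult_left_le)
  have fub: "(\<integral>\<omega>. (\<integral>y. f y * exp (- b * (norm (Z \<omega> - y))\<^sup>2) \<partial>lborel) \<partial>P) = (\<integral>y. f y * (\<integral>\<omega>. exp (- b * (norm (Z \<omega> - y))\<^sup>2) \<partial>P) \<partial>lborel)"
    if "prob_space P" and [measurable]: "Z \<in> borel_measurable P" for P :: "'c measure" and Z :: "'c \<Rightarrow> real ^ 'p"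
  proof -
    interpret prob_space P by fact
    interpret P: pair_sigma_finite P "lborel :: (real ^ 'p) measure" ..
    let ?F = "\<lambda>\<omega> y. f y * exp (- b * (norm (Z \<omega> - y))\<^sup>2)"
    have m: "case_prod ?F \<in> borel_measurable (P \<Otimes>\<^sub>M lborel)" by measurable
    have i: "integrable lborel (\<lambda>y. ?F \<omega> y)" for \<omega>
      by (rule Bochner_Integration.integrable_bound[OF f]) (use e1 in auto)
    have "integrable (P \<Otimes>\<^sub>M lborel) (case_prod ?F)"
    proof (rule P.Fubini_integrable[OF m])
      show "AE \<omega> in P. integrable lborel (\<lambda>y. case_prod ?F (\<omega>, y))" using i by auto
      show "integrable P (\<lambda>\<omega>. \<integral>y. norm (case_prod ?F (\<omega>, y)) \<partial>lborel)"
      proof (rule integrable_const_bound[where B = "\<integral>y. \<bar>f y\<bar> \<partial>lborel"])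
        have "(\<integral>y. \<bar>?F \<omega> y\<bar> \<partial>lborel) \<le> (\<integral>y. \<bar>f y\<bar> \<partial>lborel)" for \<omega>
          by (intro integral_mono integrable_abs i f e1)
        thus "AE \<omega> in P. norm (\<integral>y. norm (case_prod ?F (\<omega>, y)) \<partial>lborel) \<le> (\<integral>y. \<bar>f y\<bar> \<partial>lborel)"
          by (auto simp: integral_nonneg)
      qed measurable
    qed
    from P.Fubini_integral[OF this] show ?thesis by simp
  qed
  have idN: "(\<lambda>x. x) \<in> borel_measurable N" using measurable_ident_sets[OF sN] by simp
  have 1: "\<bar>\<integral>\<omega>. exp (- b * (norm (X n \<omega> - y))\<^sup>2) \<partial>M\<bar> \<le> 1" for n y
  proof -
    interpret prob_space M by fact
    have [measurable]: "X n \<in> borel_measurable M" by (rule X)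
    have "(\<integral>\<omega>. exp (- b * (norm (X n \<omega> - y))\<^sup>2) \<partial>M) \<le> 1"
      using b by (intro integral_le_const integrable_const_bound[where B = 1]) auto
    thus ?thesis by (simp add: integral_nonneg)
  qed
  have "(\<lambda>n. \<integral>y. f y * (\<integral>\<omega>. exp (- b * (norm (X n \<omega> - y))\<^sup>2) \<partial>M) \<partial>lborel)
      \<longlonglongrightarrow> (\<integral>y. f y * (\<integral>x. exp (- b * (norm (x - y))\<^sup>2) \<partial>N) \<partial>lborel)"
  proof (rule integral_dominated_convergence[where w = "\<lambda>y. \<bar>f y\<bar>"])
    interpret M: prob_space M by fact
    interpret N: prob_space N by fact
    have [measurable]: "X n \<in> borel_measurable M" for n by (rule X)
    show "(\<lambda>y. f y * (\<integral>\<omega>. exp (- b * (norm (X n \<omega> - y))\<^sup>2) \<partial>M)) \<in> borel_measurable lborel" for n by measurable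
    note sN[measurable_cong]
    show "(\<lambda>y. f y * (\<integral>x. exp (- b * (norm (x - y))\<^sup>2) \<partial>N)) \<in> borel_measurable lborel" by measurable
    show "AE y in lborel. (\<lambda>n. f y * (\<integral>\<omega>. exp (- b * (norm (X n \<omega> - y))\<^sup>2) \<partial>M)) \<longlonglongrightarrow> f y * (\<integral>x. exp (- b * (norm (x - y))\<^sup>2) \<partial>N)"
      by (intro AE_I2 tendsto_mult_left gaussian_kernel_convergence[OF M X N sN char b])
    show "integrable lborel (\<lambda>y. \<bar>f y\<bar>)" using f by simp
    show "AE y in lborel. norm (f y * (\<integral>\<omega>. exp (- b * (norm (X n \<omega> - y))\<^sup>2) \<partial>M)) \<le> \<bar>f y\<bar>" for n
      using 1 by (auto simp: abs_mult intro!: AE_I2 mult_left_le)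
  qed
  thus ?thesis unfolding fub[OF M X] fub[OF N idN] .
qed

text \<open>Small increments contribute at most \<open>e\<close> by uniform continuity. For the
  others one half of the exponent gives the factor exp (-b \<delta>^2 / 2) and the other half stays
  integrable; widening the Gaussian to parameter b/2 multiplies its mass by
  \<open>sqrt 2 ^ CARD('p)\<close>.\<close>

lemma gaussian_smoothing_error:
  fixes f :: "real ^ 'p \<Rightarrow> real"
  assumes [measurable]: "f \<in> borel_measurable borel" and B: "\<And>x. \<bar>f x\<bar> \<le> B"
    and \<delta>: "\<delta> > 0" "\<And>x y. norm (x - y) < \<delta> \<Longrightarrow> \<bar>f x - f y\<bar> \<le> e" and b: "b > 0"
  shows "\<bar>(\<integral>y. f y * exp (- b * (norm (x - y))\<^sup>2) \<partial>lborel) / sqrt (pi / b) ^ CARD('p) - f x\<bar>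
    \<le> e + 2 * B * sqrt 2 ^ CARD('p) * exp (- (b / 2) * \<delta>\<^sup>2)"
proof -
  let ?g = "\<lambda>b z. exp (- b * (norm (z :: real ^ 'p))\<^sup>2)"
  define G where "G = sqrt (pi / b) ^ CARD('p)"
  have G: "G > 0" unfolding G_def using b by simp
  have B0: "B \<ge> 0" using B[of 0] by linarith
  have e0: "e \<ge> 0" using \<delta>(2)[of 0 0] \<delta>(1) by auto
  have ig: "integrable lborel (?g b)" "integrable lborel (?g (b / 2))" 
    using gaussian_integrable[OF b, where 'n = 'p] gaussian_integrable[of "b / 2", where 'n = 'p] b by auto
  have gG: "(\<integral>z. ?g b z \<partial>lborel) = G" unfolding G_def by (rule gaussian_integral[OF b])
  have g2: "(\<integral>z. ?g (b / 2) z \<partial>lborel) = sqrt 2 ^ CARD('p) * G"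
  proof -
    have "sqrt (pi / (b / 2)) = sqrt 2 * sqrt (pi / b)" unfolding real_sqrt_mult[symmetric] by simp
    thus ?thesis unfolding G_def using gaussian_integral[of "b / 2", where 'n = 'p] b by (simp add: power_mult_distrib)
  qed
  have if': "integrable lborel (\<lambda>z. f (x + z) * ?g b z)"
  proof (rule Bochner_Integration.integrable_bound)
    show "integrable lborel (\<lambda>z. B * ?g b z)" using ig by simp
    show "AE z in lborel. norm (f (x + z) * ?g b z) \<le> norm (B * ?g b z)"
      using B B0 by (auto simp: abs_mult intro!: mult_right_mono)
  qed measurable
  have "(\<integral>y. f y * ?g b (x - y) \<partial>lborel) = (\<integral>z. f (x + z) * ?g b z \<partial>lborel)"
  proof -
    have "(\<integral>y. f y * ?g b (x - y) \<partial>lborel) = (\<integral>y. f y * ?g b (x - y) \<partial>distr lborel borel ((+) x))"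
      by (simp only: lborel_distr_plus)
    also have "\<dots> = (\<integral>z. f (x + z) * ?g b (x - (x + z)) \<partial>lborel)" by (subst integral_distr) auto
    finally show ?thesis by simp
  qed
  moreover have "f x * G = (\<integral>z. f x * ?g b z \<partial>lborel)" unfolding integral_mult_right_zero gG ..
  ultimately have E: "(\<integral>y. f y * ?g b (x - y) \<partial>lborel) - f x * G = (\<integral>z. f (x + z) * ?g b z - f x * ?g b z \<partial>lborel)"
    by (simp only: Bochner_Integration.integral_diff[OF if' integrable_mult_right[OF ig(1)]])
  have "\<bar>(\<integral>y. f y * ?g b (x - y) \<partial>lborel) - f x * G\<bar> \<le> (\<integral>z. \<bar>f (x + z) * ?g b z - f x * ?g b z\<bar> \<partial>lborel)"
    unfolding E by (rule integral_abs_bound)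
  also have "\<dots> \<le> (\<integral>z. e * ?g b z + 2 * B * exp (- (b / 2) * \<delta>\<^sup>2) * ?g (b / 2) z \<partial>lborel)"
  proof (rule integral_mono)
    show "integrable lborel (\<lambda>z. \<bar>f (x + z) * ?g b z - f x * ?g b z\<bar>)"
      using if' ig by (intro integrable_abs Bochner_Integration.integrable_diff) auto
    show "integrable lborel (\<lambda>z. e * ?g b z + 2 * B * exp (- (b / 2) * \<delta>\<^sup>2) * ?g (b / 2) z)"
      using ig by simp
    fix z :: "real ^ 'p"
    have eq: "\<bar>f (x + z) * ?g b z - f x * ?g b z\<bar> = \<bar>f (x + z) - f x\<bar> * ?g b z"
      unfolding left_diff_distrib[symmetric] abs_mult by simp
    show "\<bar>f (x + z) * ?g b z - f x * ?g b z\<bar> \<le> e * ?g b z + 2 * B * exp (- (b / 2) * \<delta>\<^sup>2) * ?g (b / 2) z"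
    proof (cases "norm z < \<delta>")
      case True
      hence "\<bar>f (x + z) - f x\<bar> * ?g b z \<le> e * ?g b z" using \<delta>(2)[of "x + z" x] by (intro mult_right_mono) auto
      moreover have "0 \<le> 2 * B * exp (- (b / 2) * \<delta>\<^sup>2) * ?g (b / 2) z" using B0 by simp
      ultimately show ?thesis unfolding eq by linarith
    next
      case False
      hence "\<delta>\<^sup>2 \<le> (norm z)\<^sup>2" using \<delta>(1) by (intro power_mono) auto
      hence "- b * (norm z)\<^sup>2 \<le> - (b / 2) * \<delta>\<^sup>2 + - (b / 2) * (norm z)\<^sup>2"
        using mult_left_mono[of "\<delta>\<^sup>2" "(norm z)\<^sup>2" "b / 2"] b by (simp add: algebra_simps)
      hence "?g b z \<le> exp (- (b / 2) * \<delta>\<^sup>2) * ?g (b / 2) z" unfolding exp_add[symmetric] by simp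
      hence "\<bar>f (x + z) - f x\<bar> * ?g b z \<le> (2 * B) * (exp (- (b / 2) * \<delta>\<^sup>2) * ?g (b / 2) z)"
        using B[of "x + z"] B[of x] B0 by (intro mult_mono) auto
      moreover have "0 \<le> e * ?g b z" using e0 by simp
      ultimately show ?thesis unfolding eq by (simp add: mult.assoc)
    qed
  qed
  also have "\<dots> = e * G + 2 * B * exp (- (b / 2) * \<delta>\<^sup>2) * (sqrt 2 ^ CARD('p) * G)"
    unfolding Bochner_Integration.integral_add[OF integrable_mult_right[OF ig(1)] integrable_mult_right[OF ig(2)]]
      integral_mult_right_zero gG g2 ..
  also have "\<dots> = (e + 2 * B * sqrt 2 ^ CARD('p) * exp (- (b / 2) * \<delta>\<^sup>2)) * G"
    by (simp add: algebra_simps)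
  finally have "\<bar>(\<integral>y. f y * ?g b (x - y) \<partial>lborel) - f x * G\<bar> / G \<le> e + 2 * B * sqrt 2 ^ CARD('p) * exp (- (b / 2) * \<delta>\<^sup>2)"
    using G by (simp add: pos_divide_le_eq)
  also have "\<bar>(\<integral>y. f y * ?g b (x - y) \<partial>lborel) - f x * G\<bar> / G = \<bar>(\<integral>y. f y * ?g b (x - y) \<partial>lborel) / G - f x\<bar>"
  proof -
    have "((\<integral>y. f y * ?g b (x - y) \<partial>lborel) - f x * G) / G = (\<integral>y. f y * ?g b (x - y) \<partial>lborel) / G - f x"
      using G by (simp add: diff_divide_distrib)
    moreover have "\<bar>A\<bar> / G = \<bar>A / G\<bar>" for A using G by simp
    ultimately show ?thesis by (simp only:)
  qed
  finally show ?thesis unfolding G_def .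
qed

text \<open>A continuous function of compact support is integrable and uniformly continuous:
  smoothing changes it uniformly by at most \<epsilon>/4, and means of smoothed functions already
  converge.\<close>

lemma levy_continuity_compact_support:
  fixes X :: "nat \<Rightarrow> 'a \<Rightarrow> real ^ 'p" and N :: "(real ^ 'p) measure" and f :: "real ^ 'p \<Rightarrow> real"
  assumes M: "prob_space M" and X: "\<And>n. X n \<in> borel_measurable M"
    and N: "prob_space N" and sN: "sets N = sets borel"
    and char: "\<And>t. (\<lambda>n. \<integral>\<omega>. iexp (t \<bullet> X n \<omega>) \<partial>M) \<longlonglongrightarrow> (\<integral>x. iexp (t \<bullet> x) \<partial>N)"
    and f: "continuous_on UNIV f" and supp: "\<And>x. R < norm x \<Longrightarrow> f x = 0"
  shows "(\<lambda>n. \<integral>\<omega>. f (X n \<omega>) \<partial>M) \<longlonglongrightarrow> (\<integral>x. f x \<partial>N)"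
proof (rule LIMSEQ_I)
  fix \<epsilon> :: real assume \<epsilon>: "\<epsilon> > 0"
  interpret M: prob_space M by fact
  interpret N: prob_space N by fact
  note sN[measurable_cong]
  have [measurable]: "X n \<in> borel_measurable M" for n by (rule X)
  have fm [measurable]: "f \<in> borel_measurable borel" using f by (rule borel_measurable_continuous_onI)
  \<comment> \<open>The extra 1 in the radius: two points at distance below 1 that are not both in
    \<open>?S\<close> are both outside the support, so uniform continuity on \<open>?S\<close>
    extends to the whole space.\<close>
  let ?S = "cball 0 (\<bar>R\<bar> + 1) :: (real ^ 'p) set"
  have fS: "continuous_on ?S f" using f continuous_on_subset by blast
  have "bounded (f ` ?S)" by (intro compact_imp_bounded compact_continuous_image fS) simp
  then obtain B where B0: "B > 0" and "\<And>x. x \<in> ?S \<Longrightarrow> \<bar>f x\<bar> \<le> B" unfolding bounded_pos by auto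
  hence B: "\<bar>f x\<bar> \<le> B" for x using supp[of x] B0 by (cases "x \<in> ?S") auto
  have "integrable lborel (\<lambda>x. indicator ?S x *\<^sub>R f x)" by (rule borel_integrable_compact[OF _ fS]) simp
  moreover have "(\<lambda>x. indicator ?S x *\<^sub>R f x) = f" using supp by (auto simp: indicator_def fun_eq_iff)
  ultimately have fint: "integrable lborel f" by simp
  have "uniformly_continuous_on ?S f" by (rule compact_uniformly_continuous[OF fS]) simp
  then obtain d where d: "d > 0" "\<And>x y. x \<in> ?S \<Longrightarrow> y \<in> ?S \<Longrightarrow> dist y x < d \<Longrightarrow> dist (f y) (f x) < \<epsilon> / 8"
    unfolding uniformly_continuous_on_def using \<epsilon> by (metis zero_less_divide_iff zero_less_numeral)
  define \<delta> where "\<delta> = min d 1"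
  have \<delta>: "\<delta> > 0" unfolding \<delta>_def using d by simp
  have uc: "\<bar>f x - f y\<bar> \<le> \<epsilon> / 8" if "norm (x - y) < \<delta>" for x y
  proof (cases "x \<in> ?S \<and> y \<in> ?S")
    case True thus ?thesis using d(2)[of y x] that unfolding \<delta>_def by (auto simp: dist_norm)
  next
    case False
    have "norm (x - y) < 1" using that unfolding \<delta>_def by simp
    hence "\<bar>R\<bar> < norm x" "\<bar>R\<bar> < norm y"
      using False norm_triangle_ineq2[of x y] norm_triangle_ineq2[of y x] by (auto simp: norm_minus_commute)
    thus ?thesis using supp[of x] supp[of y] \<epsilon> by auto
  qed
  have "((\<lambda>b. 2 * B * sqrt 2 ^ CARD('p) * exp (- (b / 2) * \<delta>\<^sup>2)) \<longlongrightarrow> 0) at_top"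
    using \<delta> by real_asymp
  hence "\<forall>\<^sub>F b in at_top. 2 * B * sqrt 2 ^ CARD('p) * exp (- (b / 2) * \<delta>\<^sup>2) < \<epsilon> / 8"
    by (rule order_tendstoD) (use \<epsilon> in auto)
  then obtain b where b: "b > 0" "2 * B * sqrt 2 ^ CARD('p) * exp (- (b / 2) * \<delta>\<^sup>2) < \<epsilon> / 8"
    using eventually_gt_at_top[of 0] by (metis (mono_tags, lifting) eventually_happens' eventually_conj trivial_limit_at_top_linorder)
  define h where "h = (\<lambda>x. (\<integral>y. f y * exp (- b * (norm (x - y))\<^sup>2) \<partial>lborel) / sqrt (pi / b) ^ CARD('p))"
  have hm [measurable]: "h \<in> borel_measurable borel" unfolding h_def by measurable
  have hf: "\<bar>h x - f x\<bar> \<le> \<epsilon> / 4" for x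
    using gaussian_smoothing_error[OF fm B \<delta> uc b(1), of x] b(2) unfolding h_def by linarith
  have hB: "\<bar>h x\<bar> \<le> B + \<epsilon> / 4" for x using hf[of x] B[of x] by linarith
  have close: "\<bar>(\<integral>\<omega>. h (Z \<omega>) \<partial>P) - (\<integral>\<omega>. f (Z \<omega>) \<partial>P)\<bar> \<le> \<epsilon> / 4"
    if "prob_space P" and [measurable]: "Z \<in> borel_measurable P" for P :: "'c measure" and Z
  proof -
    interpret prob_space P by fact
    have i: "integrable P (\<lambda>\<omega>. h (Z \<omega>))" "integrable P (\<lambda>\<omega>. f (Z \<omega>))"
      using integrable_const_bound[of "\<lambda>\<omega>. h (Z \<omega>)" "B + \<epsilon> / 4"] hB integrable_const_bound[of "\<lambda>\<omega>. f (Z \<omega>)" B] B by auto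
    have "\<bar>(\<integral>\<omega>. h (Z \<omega>) \<partial>P) - (\<integral>\<omega>. f (Z \<omega>) \<partial>P)\<bar> = \<bar>\<integral>\<omega>. h (Z \<omega>) - f (Z \<omega>) \<partial>P\<bar>" using i by simp
    also have "\<dots> \<le> (\<integral>\<omega>. \<bar>h (Z \<omega>) - f (Z \<omega>)\<bar> \<partial>P)" by (rule integral_abs_bound)
    also have "\<dots> \<le> \<epsilon> / 4" using i hf by (intro integral_le_const integrable_abs Bochner_Integration.integrable_diff) auto
    finally show ?thesis .
  qed
  have "(\<lambda>n. \<integral>\<omega>. h (X n \<omega>) \<partial>M) \<longlonglongrightarrow> (\<integral>x. h x \<partial>N)"
    unfolding h_def integral_divide_zero
    by (intro tendsto_divide tendsto_const smoothing_convergence[OF M X N sN char b(1) fint]) (use b in auto)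
  from LIMSEQ_D[OF this, of "\<epsilon> / 4"] obtain n0 where n0: "\<And>n. n \<ge> n0 \<Longrightarrow> \<bar>(\<integral>\<omega>. h (X n \<omega>) \<partial>M) - (\<integral>x. h x \<partial>N)\<bar> < \<epsilon> / 4"
    using \<epsilon> by auto
  have idN: "(\<lambda>x. x) \<in> borel_measurable N" by measurable
  have "norm ((\<integral>\<omega>. f (X n \<omega>) \<partial>M) - (\<integral>x. f x \<partial>N)) < \<epsilon>" if "n \<ge> n0" for n
    using n0[OF that] close[OF M X, of n] close[OF N idN] \<epsilon> unfolding real_norm_def by linarith
  thus "\<exists>no. \<forall>n\<ge>no. norm ((\<integral>\<omega>. f (X n \<omega>) \<partial>M) - (\<integral>x. f x \<partial>N)) < \<epsilon>" by blast
qed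

text \<open>Tightness comes from the convergence itself: a compactly supported cut-off has mean
  close to 1 under the limit law, hence by the compactly supported case also along the sequence, so
  the mass cut away is eventually small.\<close>

theorem levy_continuity_vec:
  fixes X :: "nat \<Rightarrow> 'a \<Rightarrow> real ^ 'p" and N :: "(real ^ 'p) measure" and f :: "real ^ 'p \<Rightarrow> real"
  assumes M: "prob_space M" and X: "\<And>n. X n \<in> borel_measurable M"
    and N: "prob_space N" and sN: "sets N = sets borel"
    and char: "\<And>t. (\<lambda>n. \<integral>\<omega>. iexp (t \<bullet> X n \<omega>) \<partial>M) \<longlonglongrightarrow> (\<integral>x. iexp (t \<bullet> x) \<partial>N)"
    and f: "continuous_on UNIV f" and bdd: "bounded (range f)"
  shows "(\<lambda>n. \<integral>\<omega>. f (X n \<omega>) \<partial>M) \<longlonglongrightarrow> (\<integral>x. f x \<partial>N)"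
proof (rule LIMSEQ_I)
  fix \<epsilon> :: real assume \<epsilon>: "\<epsilon> > 0"
  interpret M: prob_space M by fact
  interpret N: prob_space N by fact
  note sN[measurable_cong]
  have [measurable]: "X n \<in> borel_measurable M" for n by (rule X)
  have fm [measurable]: "f \<in> borel_measurable borel" using f by (rule borel_measurable_continuous_onI)
  obtain B where B0: "B > 0" and B: "\<And>x. \<bar>f x\<bar> \<le> B" using bdd unfolding bounded_pos by auto
  \<comment> \<open>Equal to 1 on the ball of radius r, equal to 0 outside radius r + 1, and linear
    in the norm between.\<close>
  define \<psi> where "\<psi> = (\<lambda>r (x :: real ^ 'p). max 0 (min 1 (r + 1 - norm x)))"
  have \<psi>c: "continuous_on UNIV (\<psi> r)" for r unfolding \<psi>_def by (intro continuous_intros)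
  have \<psi>m [measurable]: "\<psi> r \<in> borel_measurable borel" for r using \<psi>c by (rule borel_measurable_continuous_onI)
  have \<psi>01: "0 \<le> \<psi> r x" "\<psi> r x \<le> 1" for r x unfolding \<psi>_def by auto
  have \<psi>0: "\<psi> r x = 0" if "r + 1 < norm x" for r x using that unfolding \<psi>_def by auto
  define e where "e = \<epsilon> / (5 * B)"
  have e: "e > 0" "B * e = \<epsilon> / 5" unfolding e_def using \<epsilon> B0 by auto
  have "(\<lambda>m. \<integral>x. \<psi> (real m) x \<partial>N) \<longlonglongrightarrow> (\<integral>x. 1 \<partial>N)"
  proof (rule integral_dominated_convergence[where w = "\<lambda>_. 1"])
    show "AE x in N. (\<lambda>m. \<psi> (real m) x) \<longlonglongrightarrow> 1"
    proof (rule AE_I2)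
      fix x :: "real ^ 'p"
      obtain m0 where "norm x < real m0" using reals_Archimedean2 by blast
      hence "\<forall>\<^sub>F m in sequentially. \<psi> (real m) x = 1"
        unfolding \<psi>_def by (intro eventually_sequentiallyI[of m0]) auto
      thus "(\<lambda>m. \<psi> (real m) x) \<longlonglongrightarrow> 1" by (rule tendsto_eventually)
    qed
  qed (use \<psi>01 in auto)
  hence "\<forall>\<^sub>F m in sequentially. 1 - e < (\<integral>x. \<psi> (real m) x \<partial>N)"
    by (rule order_tendstoD(1)) (use e N.prob_space in simp)
  then obtain m where m: "1 - e < (\<integral>x. \<psi> (real m) x \<partial>N)" by (auto simp: eventually_sequentially)
  let ?\<psi> = "\<psi> (real m)"
  have c1: "(\<lambda>n. \<integral>\<omega>. ?\<psi> (X n \<omega>) \<partial>M) \<longlonglongrightarrow> (\<integral>x. ?\<psi> x \<partial>N)"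
    by (rule levy_continuity_compact_support[OF M X N sN char \<psi>c \<psi>0])
  have "(\<lambda>n. \<integral>\<omega>. f (X n \<omega>) * ?\<psi> (X n \<omega>) \<partial>M) \<longlonglongrightarrow> (\<integral>x. f x * ?\<psi> x \<partial>N)"
    by (rule levy_continuity_compact_support[OF M X N sN char, where R = "real m + 1"])
      (auto intro!: continuous_intros f \<psi>c simp: \<psi>0)
  from LIMSEQ_D[OF this, of "\<epsilon> / 5"] obtain n0 where n0: "\<And>n. n \<ge> n0 \<Longrightarrow>
      \<bar>(\<integral>\<omega>. f (X n \<omega>) * ?\<psi> (X n \<omega>) \<partial>M) - (\<integral>x. f x * ?\<psi> x \<partial>N)\<bar> < \<epsilon> / 5" using \<epsilon> by auto
  from order_tendstoD(1)[OF c1 m] obtain n1 where n1: "\<And>n. n \<ge> n1 \<Longrightarrow> 1 - e < (\<integral>\<omega>. ?\<psi> (X n \<omega>) \<partial>M)"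
    by (auto simp: eventually_sequentially)
  have close: "\<bar>(\<integral>\<omega>. f (Z \<omega>) \<partial>P) - (\<integral>\<omega>. f (Z \<omega>) * ?\<psi> (Z \<omega>) \<partial>P)\<bar> \<le> \<epsilon> / 5"
    if "prob_space P" and [measurable]: "Z \<in> borel_measurable P" and big: "1 - e < (\<integral>\<omega>. ?\<psi> (Z \<omega>) \<partial>P)" for P :: "'c measure" and Z
  proof -
    interpret prob_space P by fact
    have i\<psi>: "integrable P (\<lambda>\<omega>. ?\<psi> (Z \<omega>))"
      using \<psi>01 by (intro integrable_const_bound[where B = 1]) auto
    have if': "integrable P (\<lambda>\<omega>. f (Z \<omega>))"
      using B by (intro integrable_const_bound[where B = B]) auto
    have if2: "integrable P (\<lambda>\<omega>. f (Z \<omega>) * ?\<psi> (Z \<omega>))"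
    proof (intro integrable_const_bound[where B = "B * 1"] AE_I2)
      show "norm (f (Z \<omega>) * ?\<psi> (Z \<omega>)) \<le> B * 1" for \<omega>
        unfolding norm_mult using B[of "Z \<omega>"] \<psi>01[of "real m" "Z \<omega>"] B0 by (intro mult_mono) auto
    qed measurable
    have "\<bar>(\<integral>\<omega>. f (Z \<omega>) \<partial>P) - (\<integral>\<omega>. f (Z \<omega>) * ?\<psi> (Z \<omega>) \<partial>P)\<bar> = \<bar>\<integral>\<omega>. f (Z \<omega>) - f (Z \<omega>) * ?\<psi> (Z \<omega>) \<partial>P\<bar>"
      using if' if2 by simp
    also have "\<dots> \<le> (\<integral>\<omega>. \<bar>f (Z \<omega>) - f (Z \<omega>) * ?\<psi> (Z \<omega>)\<bar> \<partial>P)" by (rule integral_abs_bound)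
    also have "\<dots> \<le> (\<integral>\<omega>. B * (1 - ?\<psi> (Z \<omega>)) \<partial>P)"
    proof (rule integral_mono)
      show "integrable P (\<lambda>\<omega>. \<bar>f (Z \<omega>) - f (Z \<omega>) * ?\<psi> (Z \<omega>)\<bar>)"
        using if' if2 by (intro integrable_abs Bochner_Integration.integrable_diff)
      show "integrable P (\<lambda>\<omega>. B * (1 - ?\<psi> (Z \<omega>)))" using i\<psi> by simp
      fix \<omega>
      have "f (Z \<omega>) - f (Z \<omega>) * ?\<psi> (Z \<omega>) = f (Z \<omega>) * (1 - ?\<psi> (Z \<omega>))" by (simp add: algebra_simps)
      thus "\<bar>f (Z \<omega>) - f (Z \<omega>) * ?\<psi> (Z \<omega>)\<bar> \<le> B * (1 - ?\<psi> (Z \<omega>))"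
        using B[of "Z \<omega>"] \<psi>01[of "real m" "Z \<omega>"] by (simp add: abs_mult mult_right_mono)
    qed
    also have "\<dots> = B * (1 - (\<integral>\<omega>. ?\<psi> (Z \<omega>) \<partial>P))" using i\<psi> prob_space by simp
    also have "\<dots> \<le> B * e" using big B0 by (intro mult_left_mono) auto
    finally show ?thesis unfolding e .
  qed
  have idN: "(\<lambda>x. x) \<in> borel_measurable N" by measurable
  have "norm ((\<integral>\<omega>. f (X n \<omega>) \<partial>M) - (\<integral>x. f x \<partial>N)) < \<epsilon>" if "n \<ge> max n0 n1" for n
    using n0[of n] close[OF M X n1[of n]] close[OF N idN m] \<epsilon> that unfolding real_norm_def by linarith
  thus "\<exists>no. \<forall>n\<ge>no. norm ((\<integral>\<omega>. f (X n \<omega>) \<partial>M) - (\<integral>x. f x \<partial>N)) < \<epsilon>" by blast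
qed

text \<open>The density is a constant times exp (-|x|^2 / 2), so total mass and characteristic
  function are the Gaussian integrals with a = 1/2.\<close>

lemma std_normal_vec:
  shows sets_std_normal_vec: "sets (std_normal_vec :: (real ^ 'p) measure) = sets borel"
    and prob_space_std_normal_vec: "prob_space (std_normal_vec :: (real ^ 'p) measure)"
    and char_std_normal_vec: "(\<integral>x. iexp (t \<bullet> x) \<partial>std_normal_vec) = complex_of_real (exp (- (norm (t :: real ^ 'p))\<^sup>2 / 2))"
proof -
  show "sets (std_normal_vec :: (real ^ 'p) measure) = sets borel" unfolding std_normal_vec_def by simp
  define D where "D = (\<lambda>x :: real ^ 'p. \<Prod>i\<in>UNIV. std_normal_density (vec_nth x i))"
  have D0: "D x \<ge> 0" for x unfolding D_def by (intro prod_nonneg) auto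
  have D: "D x = (1 / sqrt (2 * pi)) ^ CARD('p) * exp (- (1 / 2) * (norm x)\<^sup>2)" for x
    unfolding D_def std_normal_density_def norm_vec_def L2_set_def prod.distrib
    by (simp add: sum_nonneg sum_negf sum_divide_distrib flip: exp_sum)
  have k: "(1 / sqrt (2 * pi)) ^ CARD('p) * sqrt (pi / (1 / 2)) ^ CARD('p) = 1"
    unfolding power_mult_distrib[symmetric] by (simp add: mult.commute)
  note i = gaussian_integrable[of "1 / 2", where 'n = 'p]
  have Dint: "integrable lborel D" unfolding D using i by simp
  have [measurable]: "D \<in> borel_measurable borel" using Dint by simp
  have "(\<integral>x. D x \<partial>lborel) = 1" unfolding D integral_mult_right_zero using gaussian_integral[of "1 / 2", where 'n = 'p] k by simp
  hence e1: "emeasure (density lborel D) (space (density lborel D)) = 1"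
    using Dint D0
    by (subst emeasure_density) (auto simp: nn_integral_eq_integral cong: nn_integral_cong)
  have SD: "std_normal_vec = density lborel D" unfolding std_normal_vec_def D_def ..
  show "prob_space (std_normal_vec :: (real ^ 'p) measure)" unfolding SD using e1 by (rule prob_spaceI)
  have "(\<integral>x. iexp (t \<bullet> x) \<partial>std_normal_vec) = (\<integral>x. D x *\<^sub>R iexp (t \<bullet> x) \<partial>lborel)"
    unfolding SD using D0 by (subst integral_density) auto
  also have "\<dots> = (\<integral>x. complex_of_real ((1 / sqrt (2 * pi)) ^ CARD('p)) * (exp (- (1 / 2) * (norm x)\<^sup>2) * iexp (t \<bullet> x)) \<partial>lborel)"
    unfolding D scaleR_conv_of_real of_real_mult by (simp only: mult.assoc)
  also have "\<dots> = complex_of_real ((1 / sqrt (2 * pi)) ^ CARD('p)) * complex_of_real (sqrt (pi / (1 / 2)) ^ CARD('p) * exp (- (norm t)\<^sup>2 / (4 * (1 / 2))))"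
    by (subst integral_mult_right_zero, subst gaussian_fourier) (simp, simp only: of_real_mult)
  also have "\<dots> = complex_of_real (((1 / sqrt (2 * pi)) ^ CARD('p) * sqrt (pi / (1 / 2)) ^ CARD('p)) * exp (- (norm t)\<^sup>2 / 2))"
    by (simp only: of_real_mult[symmetric] mult.assoc) simp
  finally show "(\<integral>x. iexp (t \<bullet> x) \<partial>std_normal_vec) = complex_of_real (exp (- (norm (t :: real ^ 'p))\<^sup>2 / 2))"
    unfolding k by simp
qed

subsection \<open>Quadratic forms of stationary covariance functions\<close>

text \<open>Cauchy-Schwarz over index pairs after splitting the dominating kernel as sqrt W times
  sqrt W; one factor then sees only row sums, the other only column sums.\<close>

lemma schur_test:
  fixes u v :: "nat \<Rightarrow> real" and E W :: "nat \<Rightarrow> nat \<Rightarrow> real"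
  assumes EW: "\<And>i j. i < n \<Longrightarrow> j < n \<Longrightarrow> \<bar>E i j\<bar> \<le> W i j"
    and row: "\<And>i. i < n \<Longrightarrow> (\<Sum>j<n. W i j) \<le> \<rho>" and col: "\<And>j. j < n \<Longrightarrow> (\<Sum>i<n. W i j) \<le> \<rho>"
  shows "\<bar>\<Sum>i<n. \<Sum>j<n. u i * v j * E i j\<bar> \<le> \<rho> * (sqrt (\<Sum>i<n. (u i)\<^sup>2) * sqrt (\<Sum>i<n. (v i)\<^sup>2))"
proof (cases "n = 0")
  case False
  have W0: "W i j \<ge> 0" if "i < n" "j < n" for i j using EW[OF that] by linarith
  have "0 \<le> (\<Sum>j<n. W 0 j)" using W0 False by (intro sum_nonneg) auto
  also have "\<dots> \<le> \<rho>" using row False by simp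
  finally have \<rho>: "\<rho> \<ge> 0" .
  let ?P = "{..<n} \<times> {..<n}"
  have "\<bar>\<Sum>i<n. \<Sum>j<n. u i * v j * E i j\<bar> \<le> (\<Sum>i<n. \<Sum>j<n. \<bar>u i * v j * E i j\<bar>)"
    by (intro order_trans[OF sum_abs] sum_mono sum_abs)
  also have "\<dots> \<le> (\<Sum>i<n. \<Sum>j<n. (\<bar>u i\<bar> * sqrt (W i j)) * (\<bar>v j\<bar> * sqrt (W i j)))"
  proof (intro sum_mono)
    fix i j assume "i \<in> {..<n}" "j \<in> {..<n}"
    hence ij: "i < n" "j < n" by auto
    have "\<bar>u i * v j * E i j\<bar> = \<bar>u i\<bar> * \<bar>v j\<bar> * \<bar>E i j\<bar>" by (simp add: abs_mult)
    also have "\<dots> \<le> \<bar>u i\<bar> * \<bar>v j\<bar> * W i j" using EW[OF ij] by (intro mult_left_mono) auto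
    also have "\<dots> = \<bar>u i\<bar> * \<bar>v j\<bar> * (sqrt (W i j) * sqrt (W i j))" using W0[OF ij] by simp
    finally show "\<bar>u i * v j * E i j\<bar> \<le> (\<bar>u i\<bar> * sqrt (W i j)) * (\<bar>v j\<bar> * sqrt (W i j))" by (simp add: mult_ac)
  qed
  also have "\<dots> = (\<Sum>(i,j)\<in>?P. (\<bar>u i\<bar> * sqrt (W i j)) * (\<bar>v j\<bar> * sqrt (W i j)))"
    by (simp add: sum.cartesian_product)
  also have "\<dots> \<le> sqrt ((\<Sum>(i,j)\<in>?P. (\<bar>u i\<bar> * sqrt (W i j))\<^sup>2) * (\<Sum>(i,j)\<in>?P. (\<bar>v j\<bar> * sqrt (W i j))\<^sup>2))"
    using Cauchy_Schwarz_ineq_sum[of "\<lambda>(i,j). \<bar>u i\<bar> * sqrt (W i j)" "\<lambda>(i,j). \<bar>v j\<bar> * sqrt (W i j)" ?P]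
    by (intro real_le_rsqrt) (simp add: case_prod_unfold)
  also have "\<dots> \<le> sqrt ((\<rho> * (\<Sum>i<n. (u i)\<^sup>2)) * (\<rho> * (\<Sum>i<n. (v i)\<^sup>2)))"
  proof (intro real_sqrt_le_mono mult_mono)
    have "(\<Sum>(i,j)\<in>?P. (\<bar>u i\<bar> * sqrt (W i j))\<^sup>2) = (\<Sum>i<n. \<Sum>j<n. (u i)\<^sup>2 * W i j)"
      unfolding sum.cartesian_product[symmetric] using W0 by (intro sum.cong refl) (simp add: power_mult_distrib)
    also have "\<dots> = (\<Sum>i<n. (u i)\<^sup>2 * (\<Sum>j<n. W i j))" by (simp add: sum_distrib_left)
    also have "\<dots> \<le> (\<Sum>i<n. (u i)\<^sup>2 * \<rho>)" using row by (intro sum_mono mult_left_mono) auto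
    finally show "(\<Sum>(i,j)\<in>?P. (\<bar>u i\<bar> * sqrt (W i j))\<^sup>2) \<le> \<rho> * (\<Sum>i<n. (u i)\<^sup>2)"
      by (simp add: sum_distrib_left mult.commute)
    have "(\<Sum>(i,j)\<in>?P. (\<bar>v j\<bar> * sqrt (W i j))\<^sup>2) = (\<Sum>i<n. \<Sum>j<n. (v j)\<^sup>2 * W i j)"
      unfolding sum.cartesian_product[symmetric] using W0 by (intro sum.cong refl) (simp add: power_mult_distrib)
    also have "\<dots> = (\<Sum>j<n. (v j)\<^sup>2 * (\<Sum>i<n. W i j))" by (subst sum.swap) (simp add: sum_distrib_left)
    also have "\<dots> \<le> (\<Sum>j<n. (v j)\<^sup>2 * \<rho>)" using col by (intro sum_mono mult_left_mono) auto
    finally show "(\<Sum>(i,j)\<in>?P. (\<bar>v j\<bar> * sqrt (W i j))\<^sup>2) \<le> \<rho> * (\<Sum>i<n. (v i)\<^sup>2)"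
      by (simp add: sum_distrib_left mult.commute)
  qed (use \<rho> in \<open>auto intro!: sum_nonneg mult_nonneg_nonneg\<close>)
  also have "\<dots> = \<rho> * (sqrt (\<Sum>i<n. (u i)\<^sup>2) * sqrt (\<Sum>i<n. (v i)\<^sup>2))"
    using \<rho> by (simp add: real_sqrt_mult)
  finally show ?thesis .
qed simp

section \<open>Spectral representation and uniform coercivity\<close>

lemma
  assumes "has_spectral_density f fhat"
  shows spectral_density_cos: "f u = (\<integral>\<omega>. fhat \<omega> * cos (\<omega> \<bullet> u) \<partial>lborel)"
    and spectral_density_cos_integrable: "integrable lborel (\<lambda>\<omega>. fhat \<omega> * cos (\<omega> \<bullet> u))"
proof -
  have i: "integrable lborel fhat" and eq: "complex_of_real (f u) = (\<integral>\<omega>. complex_of_real (fhat \<omega>) * iexp (\<omega> \<bullet> u) \<partial>lborel)"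
    using assms unfolding has_spectral_density_def by auto
  have [measurable]: "fhat \<in> borel_measurable borel" using i by simp
  show "integrable lborel (\<lambda>\<omega>. fhat \<omega> * cos (\<omega> \<bullet> u))"
    by (rule Bochner_Integration.integrable_bound[OF i]) (auto simp: abs_mult intro!: mult_left_le)
  have ic: "integrable lborel (\<lambda>\<omega>. complex_of_real (fhat \<omega>) * iexp (\<omega> \<bullet> u))"
  proof (rule Bochner_Integration.integrable_bound[OF i])
    show "AE \<omega> in lborel. norm (complex_of_real (fhat \<omega>) * iexp (\<omega> \<bullet> u)) \<le> norm (fhat \<omega>)"
      unfolding norm_mult norm_exp_i_times by simp
  qed measurable
  have "f u = Re (\<integral>\<omega>. complex_of_real (fhat \<omega>) * iexp (\<omega> \<bullet> u) \<partial>lborel)" unfolding eq[symmetric] by simp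
  also have "\<dots> = (\<integral>\<omega>. Re (complex_of_real (fhat \<omega>) * iexp (\<omega> \<bullet> u)) \<partial>lborel)" by (rule integral_Re[OF ic, symmetric])
  also have "\<dots> = (\<integral>\<omega>. fhat \<omega> * cos (\<omega> \<bullet> u) \<partial>lborel)"
    by (intro Bochner_Integration.integral_cong refl) (simp add: Re_exp)
  finally show "f u = (\<integral>\<omega>. fhat \<omega> * cos (\<omega> \<bullet> u) \<partial>lborel)" .
qed

text \<open>The sum is the squared modulus of the trigonometric polynomial with coefficients
  \<open>v\<close>, written by its real and imaginary parts.\<close>

lemma cos_quadratic_form_nonneg:
  fixes v :: "nat \<Rightarrow> real" and s :: "nat \<Rightarrow> 'a::real_inner"
  shows "0 \<le> (\<Sum>i<n. \<Sum>j<n. v i * v j * cos (\<omega> \<bullet> (s i - s j)))"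
proof -
  have "(\<Sum>i<n. \<Sum>j<n. v i * v j * cos (\<omega> \<bullet> (s i - s j)))
     = (\<Sum>i<n. v i * cos (\<omega> \<bullet> s i))\<^sup>2 + (\<Sum>i<n. v i * sin (\<omega> \<bullet> s i))\<^sup>2"
    unfolding power2_eq_square sum_product sum.distrib[symmetric]
    by (intro sum.cong refl) (simp add: inner_diff_right cos_diff algebra_simps)
  thus ?thesis by simp
qed

lemma integral_quadratic_form:
  fixes g :: "'b \<Rightarrow> 'b \<Rightarrow> real" and h :: "'a::euclidean_space \<Rightarrow> real"
  assumes i: "\<And>u. integrable lborel (\<lambda>\<omega>. h \<omega> * cos (\<omega> \<bullet> u))"
  shows "(\<integral>\<omega>. h \<omega> * (\<Sum>i<n. \<Sum>j<n. v i * v j * cos (\<omega> \<bullet> (s i - s j))) \<partial>lborel)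
      = (\<Sum>i<n. \<Sum>j<n. v i * v j * (\<integral>\<omega>. h \<omega> * cos (\<omega> \<bullet> (s i - s j)) \<partial>lborel))"
    and "integrable lborel (\<lambda>\<omega>. h \<omega> * (\<Sum>i<n. \<Sum>j<n. v i * v j * cos (\<omega> \<bullet> (s i - s j))))"
proof -
  have e: "h \<omega> * (\<Sum>i<n. \<Sum>j<n. v i * v j * cos (\<omega> \<bullet> (s i - s j))) = (\<Sum>i<n. \<Sum>j<n. v i * v j * (h \<omega> * cos (\<omega> \<bullet> (s i - s j))))" for \<omega>
    by (simp add: sum_distrib_left mult_ac)
  show "integrable lborel (\<lambda>\<omega>. h \<omega> * (\<Sum>i<n. \<Sum>j<n. v i * v j * cos (\<omega> \<bullet> (s i - s j))))"
    unfolding e by (intro Bochner_Integration.integrable_sum integrable_mult_right i)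
  have "(\<integral>\<omega>. (\<Sum>i<n. \<Sum>j<n. v i * v j * (h \<omega> * cos (\<omega> \<bullet> (s i - s j)))) \<partial>lborel)
     = (\<Sum>i<n. \<integral>\<omega>. (\<Sum>j<n. v i * v j * (h \<omega> * cos (\<omega> \<bullet> (s i - s j)))) \<partial>lborel)"
    by (intro Bochner_Integration.integral_sum Bochner_Integration.integrable_sum integrable_mult_right i)
  also have "\<dots> = (\<Sum>i<n. \<Sum>j<n. \<integral>\<omega>. v i * v j * (h \<omega> * cos (\<omega> \<bullet> (s i - s j))) \<partial>lborel)"
    by (intro sum.cong refl Bochner_Integration.integral_sum integrable_mult_right i)
  finally show "(\<integral>\<omega>. h \<omega> * (\<Sum>i<n. \<Sum>j<n. v i * v j * cos (\<omega> \<bullet> (s i - s j))) \<partial>lborel)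
      = (\<Sum>i<n. \<Sum>j<n. v i * v j * (\<integral>\<omega>. h \<omega> * cos (\<omega> \<bullet> (s i - s j)) \<partial>lborel))"
    unfolding e integral_mult_right_zero .
qed

lemma power_div_fact_le_exp:
  fixes x :: real assumes "x \<ge> 0" shows "x ^ k / fact k \<le> exp x"
proof -
  have "(\<Sum>i\<in>{k}. x ^ i /\<^sub>R fact i) \<le> (\<Sum>i. x ^ i /\<^sub>R fact i)"
    using assms by (intro sum_le_suminf summable_exp_generic) auto
  thus ?thesis unfolding exp_def by (simp add: divide_inverse mult.commute)
qed

text \<open>Exponentials beat every power. The 8 matches the half of the exponent that is reserved
  for summability when Gaussian kernel matrices are compared with the identity.\<close>

lemma gaussian_le_powr:
  fixes \<beta> :: real assumes "\<beta> \<ge> 0"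
  shows "\<exists>C>0. \<forall>x\<ge>0. exp (- x\<^sup>2 / 8) \<le> C / (1 + x powr \<beta>)"
proof -
  define k where "k = nat \<lceil>\<beta>\<rceil>"
  have k: "\<beta> \<le> 2 * real k" unfolding k_def using assms by linarith
  define C :: real where "C = 2 + 8 ^ k * fact k"
  have C: "C > 0" unfolding C_def by (simp add: add_pos_pos)
  have "exp (- x\<^sup>2 / 8) \<le> C / (1 + x powr \<beta>)" if "x \<ge> 0" for x
  proof -
    have "x powr \<beta> \<le> 1 + (x\<^sup>2) ^ k"
    proof (cases "x \<le> 1")
      case True
      hence "x powr \<beta> \<le> 1" using that assms by (metis powr_mono2 powr_one_eq_one)
      thus ?thesis by (simp add: add_increasing2)
    next
      case False
      hence "x powr \<beta> \<le> x powr (2 * real k)" using k by (intro powr_mono) auto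
      also have "\<dots> = x ^ (2 * k)" using False by (simp flip: powr_realpow)
      finally show ?thesis by (simp add: power_mult)
    qed
    also have "(x\<^sup>2) ^ k = (8 ^ k * fact k) * ((x\<^sup>2 / 8) ^ k / fact k)" by (simp add: power_divide)
    also have "\<dots> \<le> (8 ^ k * fact k) * exp (x\<^sup>2 / 8)" by (intro mult_left_mono power_div_fact_le_exp) auto
    finally have "1 + x powr \<beta> \<le> 2 + (8 ^ k * fact k) * exp (x\<^sup>2 / 8)" by simp
    also have "\<dots> \<le> C * exp (x\<^sup>2 / 8)"
    proof -
      have "2 \<le> 2 * exp (x\<^sup>2 / 8)" by simp
      thus ?thesis unfolding C_def distrib_right by linarith
    qed
    finally have le: "1 + x powr \<beta> \<le> C * exp (x\<^sup>2 / 8)" .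
    have "exp (- x\<^sup>2 / 8) * (1 + x powr \<beta>) \<le> exp (- x\<^sup>2 / 8) * (C * exp (x\<^sup>2 / 8))"
      using le by (intro mult_left_mono) auto
    also have "\<dots> = C" by (simp add: exp_minus)
    finally show ?thesis by (simp add: le_divide_eq add_pos_nonneg)
  qed
  with C show ?thesis by blast
qed

text \<open>For small a the Gaussian kernel matrix is close to the identity, uniformly in its size
  and in the separated points. Off the diagonal one half of the exponent yields the small factor exp
  (-\<Delta>^2 / (8 a)), the other half a summable decay for the Schur test.\<close>

lemma gaussian_quadratic_form_bound:
  assumes \<Delta>: "\<Delta> > 0"
  shows "\<exists>a0>0. \<forall>(s :: nat \<Rightarrow> 'a::euclidean_space) v n a. (\<forall>i j. i \<noteq> j \<longrightarrow> \<Delta> \<le> norm (s i - s j)) \<longrightarrow> 0 < a \<longrightarrow> a \<le> a0 \<longrightarrow>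
    \<bar>(\<Sum>i<n. \<Sum>j<n. v i * v j * exp (- (norm (s i - s j))\<^sup>2 / (4 * a))) - (\<Sum>i<n. (v i)\<^sup>2)\<bar> \<le> (\<Sum>i<n. (v i)\<^sup>2) / 2"
proof -
  define \<beta> where "\<beta> = real DIM('a) + 1"
  obtain C where C: "C > 0" "\<forall>x\<ge>0. exp (- x\<^sup>2 / 8) \<le> C / (1 + x powr \<beta>)"
    using gaussian_le_powr[of \<beta>] unfolding \<beta>_def by auto
  obtain S where S: "S > 0" "\<forall>(s :: nat \<Rightarrow> 'a) J x. finite J \<longrightarrow> (\<forall>i j. i \<noteq> j \<longrightarrow> \<Delta> \<le> norm (s i - s j)) \<longrightarrow>
       (\<Sum>j\<in>J. 1 / (1 + norm (s j - x) powr \<beta>)) \<le> S"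
    using separated_sum_bounded[OF \<Delta>, of \<beta>, where 'a = 'a] by (auto simp: \<beta>_def)
  have "((\<lambda>a. exp (- \<Delta>\<^sup>2 / (8 * a)) * (C * S)) \<longlongrightarrow> 0) (at_right 0)"
    using \<Delta> by real_asymp
  hence "\<forall>\<^sub>F a in at_right 0. exp (- \<Delta>\<^sup>2 / (8 * a)) * (C * S) < 1 / 2"
    by (rule order_tendstoD) auto
  then obtain a1 where a1: "a1 > 0" "\<And>a. 0 < a \<Longrightarrow> a < a1 \<Longrightarrow> exp (- \<Delta>\<^sup>2 / (8 * a)) * (C * S) < 1 / 2"
    unfolding eventually_at_right_field by auto
  \<comment> \<open>The bound 1 makes |x|^2 / (8 a) at least |x|^2 / 8; halving \<open>a1\<close>
    turns the strict condition a < a1 into a closed one.\<close>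
  define a0 where "a0 = min (a1 / 2) 1"
  have main: "\<bar>(\<Sum>i<n. \<Sum>j<n. v i * v j * exp (- (norm (s i - s j))\<^sup>2 / (4 * a))) - (\<Sum>i<n. (v i)\<^sup>2)\<bar> \<le> (\<Sum>i<n. (v i)\<^sup>2) / 2"
    if sep: "\<And>i j. i \<noteq> j \<Longrightarrow> \<Delta> \<le> norm (s i - s j)" and a: "0 < a" "a \<le> a0" for s :: "nat \<Rightarrow> 'a" and v n a
  proof -
    define q where "q = exp (- \<Delta>\<^sup>2 / (8 * a))"
    have q: "q * (C * S) \<le> 1 / 2" "q \<ge> 0" using a1(2)[of a] a a1(1) unfolding q_def a0_def by auto
    define E where "E = (\<lambda>i j. if i = j then 0 else exp (- (norm (s i - s j))\<^sup>2 / (4 * a)))"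
    define W where "W = (\<lambda>i j. q * C * (1 / (1 + norm (s j - s i) powr \<beta>)))"
    have EW: "\<bar>E i j\<bar> \<le> W i j" for i j
    proof (cases "i = j")
      case True thus ?thesis unfolding E_def W_def using q C by simp
    next
      case False
      let ?x = "norm (s i - s j)"
      have "\<Delta>\<^sup>2 \<le> ?x\<^sup>2" using sep[OF False] \<Delta> by (intro power_mono) auto
      hence "\<Delta>\<^sup>2 / (8 * a) \<le> ?x\<^sup>2 / (8 * a)" using a by (intro divide_right_mono) auto
      moreover have "?x\<^sup>2 / 8 \<le> ?x\<^sup>2 / (8 * a)" using a unfolding a0_def by (intro divide_left_mono) auto
      moreover have "?x\<^sup>2 / (4 * a) = ?x\<^sup>2 / (8 * a) + ?x\<^sup>2 / (8 * a)" by simp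
      ultimately have "- ?x\<^sup>2 / (4 * a) \<le> - \<Delta>\<^sup>2 / (8 * a) + - ?x\<^sup>2 / 8" by simp
      hence "exp (- ?x\<^sup>2 / (4 * a)) \<le> q * exp (- ?x\<^sup>2 / 8)" unfolding q_def exp_add[symmetric] by simp
      also have "\<dots> \<le> q * (C / (1 + ?x powr \<beta>))" using q using C(2) by (intro mult_left_mono) auto
      finally show ?thesis unfolding E_def W_def using False by (simp add: norm_minus_commute)
    qed
    have row: "(\<Sum>j<n. W i j) \<le> 1 / 2" for i
    proof -
      have "(\<Sum>j<n. W i j) = q * C * (\<Sum>j<n. 1 / (1 + norm (s j - s i) powr \<beta>))"
        unfolding W_def by (simp only: sum_distrib_left)
      also have "\<dots> \<le> q * C * S" using q C S(2) sep by (intro mult_left_mono) auto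
      finally show ?thesis using q by simp
    qed
    have col: "(\<Sum>i<n. W i j) \<le> 1 / 2" for j
      using row[of j] unfolding W_def by (simp add: norm_minus_commute)
    have "(\<Sum>i<n. \<Sum>j<n. v i * v j * exp (- (norm (s i - s j))\<^sup>2 / (4 * a)))
      = (\<Sum>i<n. \<Sum>j<n. v i * v j * E i j + (if i = j then v i * v j else 0))"
      by (intro sum.cong refl) (auto simp: E_def)
    also have "\<dots> = (\<Sum>i<n. \<Sum>j<n. v i * v j * E i j) + (\<Sum>i<n. (v i)\<^sup>2)"
      by (simp add: sum.distrib power2_eq_square)
    finally have "(\<Sum>i<n. \<Sum>j<n. v i * v j * exp (- (norm (s i - s j))\<^sup>2 / (4 * a))) - (\<Sum>i<n. (v i)\<^sup>2) = (\<Sum>i<n. \<Sum>j<n. v i * v j * E i j)" by simp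
    thus ?thesis using schur_test[of n E W "1 / 2" v v, OF EW row col] by (simp add: sum_nonneg)
  qed
  have "a0 > 0" using a1(1) unfolding a0_def by simp
  with main show ?thesis by blast
qed

text \<open>Compactness bounds \<open>khat\<close> away from 0 on a ball only, whereas a minorant is
  needed at every frequency. A difference of two Gaussians serves: it is at most m on the ball of
  radius r, at most 0 outside, and its quadratic form is explicit. The width a makes both kernel
  matrices comparable to the identity, and r makes the subtracted one cost at most half of the
  gain.\<close>

theorem spectral_quadratic_form_lower_bound:
  fixes k khat :: "real ^ 'p \<Rightarrow> real ^ 'd \<Rightarrow> real"
  assumes \<Theta>: "compact \<Theta>" and \<Delta>: "\<Delta> > 0"
    and sd: "\<And>\<theta>. \<theta> \<in> \<Theta> \<Longrightarrow> has_spectral_density (k \<theta>) (khat \<theta>)"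
    and cont: "continuous_on (\<Theta> \<times> UNIV) (\<lambda>(\<theta>, \<omega>). khat \<theta> \<omega>)"
    and pos: "\<And>\<theta> \<omega>. \<theta> \<in> \<Theta> \<Longrightarrow> khat \<theta> \<omega> > 0"
  shows "\<exists>c>0. \<forall>\<theta>\<in>\<Theta>. \<forall>(s :: nat \<Rightarrow> real ^ 'd) n v. (\<forall>i j. i \<noteq> j \<longrightarrow> \<Delta> \<le> norm (s i - s j)) \<longrightarrow>
    c * (\<Sum>i<n. (v i)\<^sup>2) \<le> (\<Sum>i<n. \<Sum>j<n. v i * v j * k \<theta> (s i - s j))"
proof (cases "\<Theta> = {}")
  case False
  obtain a where a: "a > 0" "\<forall>(s :: nat \<Rightarrow> real ^ 'd) v n b. (\<forall>i j. i \<noteq> j \<longrightarrow> \<Delta> \<le> norm (s i - s j)) \<longrightarrow> 0 < b \<longrightarrow> b \<le> a \<longrightarrow>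
    \<bar>(\<Sum>i<n. \<Sum>j<n. v i * v j * exp (- (norm (s i - s j))\<^sup>2 / (4 * b))) - (\<Sum>i<n. (v i)\<^sup>2)\<bar> \<le> (\<Sum>i<n. (v i)\<^sup>2) / 2"
    using gaussian_quadratic_form_bound[OF \<Delta>, where 'a = "real ^ 'd"] by blast
  define P where "P = (\<lambda>b. sqrt (pi / b) ^ CARD('d))"
  have P: "P a > 0" "P (a / 2) > 0" unfolding P_def using a by auto
  have "((\<lambda>r. exp (- (a / 2) * r\<^sup>2) * (2 * P (a / 2))) \<longlongrightarrow> 0) at_top" using a(1) by real_asymp
  hence "\<forall>\<^sub>F r in at_top. exp (- (a / 2) * r\<^sup>2) * (2 * P (a / 2)) < P a / 4"
    by (rule order_tendstoD) (use P in auto)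
  then obtain r where r: "r > 0" "exp (- (a / 2) * r\<^sup>2) * (2 * P (a / 2)) < P a / 4"
    using eventually_gt_at_top[of 0] by (metis (mono_tags, lifting) eventually_happens' eventually_conj trivial_limit_at_top_linorder)
  have "compact (\<Theta> \<times> cball (0 :: real ^ 'd) r)" using \<Theta> by (intro compact_Times) auto
  moreover have "continuous_on (\<Theta> \<times> cball 0 r) (\<lambda>(\<theta>, \<omega>). khat \<theta> \<omega>)" by (rule continuous_on_subset[OF cont]) auto
  moreover have "\<Theta> \<times> cball (0 :: real ^ 'd) r \<noteq> {}" using False r by auto
  ultimately have "\<exists>z\<in>\<Theta> \<times> cball 0 r. \<forall>z'\<in>\<Theta> \<times> cball 0 r. (\<lambda>(\<theta>, \<omega>). khat \<theta> \<omega>) z \<le> (\<lambda>(\<theta>, \<omega>). khat \<theta> \<omega>) z'"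
    by (intro continuous_attains_inf)
  then obtain z where z: "z \<in> \<Theta> \<times> cball 0 r" "\<And>z'. z' \<in> \<Theta> \<times> cball 0 r \<Longrightarrow> (\<lambda>(\<theta>, \<omega>). khat \<theta> \<omega>) z \<le> (\<lambda>(\<theta>, \<omega>). khat \<theta> \<omega>) z'"
    by (elim bexE) auto
  define m where "m = (\<lambda>(\<theta>, \<omega>). khat \<theta> \<omega>) z"
  have m: "m > 0" unfolding m_def using z(1) pos by auto
  have mle: "m \<le> khat \<theta> \<omega>" if "\<theta> \<in> \<Theta>" "norm \<omega> \<le> r" for \<theta> \<omega>
    using z(2)[of "(\<theta>, \<omega>)"] that unfolding m_def by auto
  \<comment> \<open>Outside radius r the subtracted Gaussian wins because r^2 <= |\<omega>|^2;
    inside, the bracket is at most 1.\<close>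
  let ?G = "\<lambda>\<omega> :: real ^ 'd. m * (exp (- a * (norm \<omega>)\<^sup>2) - exp (- (a / 2) * r\<^sup>2) * exp (- (a / 2) * (norm \<omega>)\<^sup>2))"
  have low: "?G \<omega> \<le> khat \<theta> \<omega>" if "\<theta> \<in> \<Theta>" for \<theta> \<omega>
  proof (cases "norm \<omega> \<le> r")
    case True
    have "?G \<omega> \<le> m * (1 - 0)" using a m by (intro mult_left_mono diff_mono) auto
    thus ?thesis using mle[OF that True] by simp
  next
    case False
    hence "r\<^sup>2 \<le> (norm \<omega>)\<^sup>2" using r by (intro power_mono) auto
    hence "(a / 2) * r\<^sup>2 \<le> (a / 2) * (norm \<omega>)\<^sup>2" using a by (intro mult_left_mono) auto
    hence "exp (- a * (norm \<omega>)\<^sup>2) \<le> exp (- (a / 2) * r\<^sup>2) * exp (- (a / 2) * (norm \<omega>)\<^sup>2)"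
      unfolding exp_add[symmetric] by simp
    hence "?G \<omega> \<le> 0" using m by (intro mult_nonneg_nonpos) auto
    thus ?thesis using pos[OF that, of \<omega>] by linarith
  qed
  have "m * (P a / 4) * (\<Sum>i<n. (v i)\<^sup>2) \<le> (\<Sum>i<n. \<Sum>j<n. v i * v j * k \<theta> (s i - s j))"
    if \<theta>: "\<theta> \<in> \<Theta>" and sep: "\<And>i j. i \<noteq> j \<Longrightarrow> \<Delta> \<le> norm (s i - s j)" for \<theta> s v and n :: nat
  proof -
    define T where "T = (\<lambda>\<omega>. \<Sum>i<n. \<Sum>j<n. v i * v j * cos (\<omega> \<bullet> (s i - s j)))"
    define V where "V = (\<Sum>i<n. (v i)\<^sup>2)"
    have V: "V \<ge> 0" unfolding V_def by (intro sum_nonneg) auto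
    define Q where "Q = (\<lambda>b. \<Sum>i<n. \<Sum>j<n. v i * v j * exp (- (norm (s i - s j))\<^sup>2 / (4 * b)))"
    have T0: "T \<omega> \<ge> 0" for \<omega> unfolding T_def by (rule cos_quadratic_form_nonneg)
    have gi: "integrable lborel (\<lambda>\<omega>. exp (- b * (norm \<omega>)\<^sup>2) * T \<omega>)"
      and gI: "(\<integral>\<omega>. exp (- b * (norm \<omega>)\<^sup>2) * T \<omega> \<partial>lborel) = P b * Q b" if b: "b > 0" for b
    proof -
      have i: "integrable lborel (\<lambda>x. exp (- b * (norm x)\<^sup>2) * cos (x \<bullet> u))" for u :: "real ^ 'd"
        using gaussian_cos_integrable[OF b, of u] by (simp only: inner_commute[of u])
      show "integrable lborel (\<lambda>\<omega>. exp (- b * (norm \<omega>)\<^sup>2) * T \<omega>)" unfolding T_def by (rule integral_quadratic_form(2)[OF i])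
      show "(\<integral>\<omega>. exp (- b * (norm \<omega>)\<^sup>2) * T \<omega> \<partial>lborel) = P b * Q b"
      proof -
        have I: "(\<integral>x. exp (- b * (norm x)\<^sup>2) * cos (x \<bullet> u) \<partial>lborel) = P b * exp (- (norm u)\<^sup>2 / (4 * b))" for u :: "real ^ 'd"
          using gaussian_cos_integral[OF b, of u] unfolding P_def by (simp only: inner_commute[of u])
        show ?thesis unfolding T_def integral_quadratic_form(1)[OF i] I Q_def
          by (simp only: sum_distrib_left mult_ac)
      qed
    qed
    have ki: "integrable lborel (\<lambda>\<omega>. khat \<theta> \<omega> * T \<omega>)"
      unfolding T_def by (rule integral_quadratic_form(2)[OF spectral_density_cos_integrable[OF sd[OF \<theta>]]])
    have Gi: "integrable lborel (\<lambda>\<omega>. m * (exp (- a * (norm \<omega>)\<^sup>2) * T \<omega> - exp (- (a / 2) * r\<^sup>2) * (exp (- (a / 2) * (norm \<omega>)\<^sup>2) * T \<omega>)))"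
      using gi[of a] gi[of "a / 2"] a(1) by (intro integrable_mult_right Bochner_Integration.integrable_diff) auto
    have QV: "\<bar>Q b - V\<bar> \<le> V / 2" if "0 < b" "b \<le> a" for b
      using a(2)[THEN spec[of _ s], THEN spec[of _ v], THEN spec[of _ n], THEN spec[of _ b]] sep that
      unfolding Q_def V_def by fast
    have Qa: "V / 2 \<le> Q a" using QV[of a] a(1) by linarith
    have Qa2: "Q (a / 2) \<le> 2 * V" using QV[of "a / 2"] a(1) V by linarith
    have "exp (- (a / 2) * r\<^sup>2) * (P (a / 2) * Q (a / 2)) \<le> exp (- (a / 2) * r\<^sup>2) * (P (a / 2) * (2 * V))"
      using Qa2 P by (intro mult_left_mono) auto
    also have "\<dots> = (exp (- (a / 2) * r\<^sup>2) * (2 * P (a / 2))) * V" by simp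
    also have "\<dots> \<le> P a / 4 * V" using r V by (intro mult_right_mono) auto
    finally have 1: "exp (- (a / 2) * r\<^sup>2) * (P (a / 2) * Q (a / 2)) \<le> P a / 4 * V" .
    have 2: "P a * (V / 2) \<le> P a * Q a" using Qa P by (intro mult_left_mono) auto
    have "m * (P a / 4) * V = m * (P a * (V / 2) - P a / 4 * V)" by (simp add: field_simps)
    also have "\<dots> \<le> m * (P a * Q a - exp (- (a / 2) * r\<^sup>2) * (P (a / 2) * Q (a / 2)))"
      by (rule mult_left_mono) (use 1 2 m in linarith)+
    also have "\<dots> = (\<integral>\<omega>. m * (exp (- a * (norm \<omega>)\<^sup>2) * T \<omega> - exp (- (a / 2) * r\<^sup>2) * (exp (- (a / 2) * (norm \<omega>)\<^sup>2) * T \<omega>)) \<partial>lborel)"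
    proof -
      have h: "a / 2 > 0" using a(1) by simp
      show ?thesis unfolding integral_mult_right_zero
          Bochner_Integration.integral_diff[OF gi[OF a(1)] integrable_mult_right[OF gi[OF h]]] gI[OF a(1)] gI[OF h] ..
    qed
    also have "\<dots> \<le> (\<integral>\<omega>. khat \<theta> \<omega> * T \<omega> \<partial>lborel)"
    proof (rule integral_mono[OF Gi ki])
      fix \<omega>
      have "?G \<omega> * T \<omega> \<le> khat \<theta> \<omega> * T \<omega>" using low[OF \<theta>] T0 by (intro mult_right_mono) auto
      thus "m * (exp (- a * (norm \<omega>)\<^sup>2) * T \<omega> - exp (- (a / 2) * r\<^sup>2) * (exp (- (a / 2) * (norm \<omega>)\<^sup>2) * T \<omega>)) \<le> khat \<theta> \<omega> * T \<omega>"
        by (simp only: mult.assoc left_diff_distrib)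
    qed
    also have "\<dots> = (\<Sum>i<n. \<Sum>j<n. v i * v j * k \<theta> (s i - s j))"
      unfolding T_def integral_quadratic_form(1)[OF spectral_density_cos_integrable[OF sd[OF \<theta>]]] spectral_density_cos[OF sd[OF \<theta>]] ..
    finally show ?thesis unfolding V_def .
  qed
  note main = this
  have p: "m * (P a / 4) > 0" using m P by simp
  show ?thesis
  proof (intro exI conjI ballI allI impI)
    show "m * (P a / 4) > 0" by (rule p)
  qed (rule main; simp)
qed (auto intro: exI[of _ 1])

text \<open>\<open>k \<theta> - k \<theta>1\<close> is bounded everywhere by the L1 distance of the
  spectral densities. Scheffe's lemma makes this distance small: the densities converge pointwise by
  joint continuity, and their masses are the values \<open>k \<theta> 0\<close>, which converge too.
  Scheffe's lemma is sequential, hence the argument by contradiction along a sequence.\<close>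

theorem spectral_family_uniformly_continuous:
  fixes k khat :: "real ^ 'p \<Rightarrow> real ^ 'd \<Rightarrow> real"
  assumes sd: "\<And>\<theta>. \<theta> \<in> \<Theta> \<Longrightarrow> has_spectral_density (k \<theta>) (khat \<theta>)"
    and cont: "continuous_on (\<Theta> \<times> UNIV) (\<lambda>(\<theta>, \<omega>). khat \<theta> \<omega>)"
    and pos: "\<And>\<theta> \<omega>. \<theta> \<in> \<Theta> \<Longrightarrow> khat \<theta> \<omega> > 0"
    and k0: "continuous_on \<Theta> (\<lambda>\<theta>. k \<theta> 0)"
    and \<theta>1: "\<theta>1 \<in> \<Theta>" and e: "e > 0"
  shows "\<exists>\<delta>>0. \<forall>\<theta>\<in>\<Theta>. norm (\<theta> - \<theta>1) < \<delta> \<longrightarrow> (\<forall>x. \<bar>k \<theta> x - k \<theta>1 x\<bar> \<le> e)"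
proof (rule ccontr)
  assume neg: "\<not> ?thesis"
  have "\<exists>\<theta>. \<theta> \<in> \<Theta> \<and> norm (\<theta> - \<theta>1) < 1 / real (Suc m) \<and> (\<exists>x. \<not> \<bar>k \<theta> x - k \<theta>1 x\<bar> \<le> e)" for m
  proof -
    have "1 / real (Suc m) > 0" by simp
    thus ?thesis using neg by blast
  qed
  hence "\<forall>m. \<exists>\<theta>. \<theta> \<in> \<Theta> \<and> norm (\<theta> - \<theta>1) < 1 / real (Suc m) \<and> (\<exists>x. \<bar>k \<theta> x - k \<theta>1 x\<bar> > e)"
    unfolding not_le by (intro allI)
  then obtain t where t: "\<And>m. t m \<in> \<Theta>" "\<And>m. norm (t m - \<theta>1) < 1 / real (Suc m)" "\<And>m. \<exists>x. \<bar>k (t m) x - k \<theta>1 x\<bar> > e"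
    by metis
  have lim: "t \<longlonglongrightarrow> \<theta>1"
    by (rule LIMSEQ_norm_0[THEN LIM_zero_cancel]) (use t(2) in auto)
  have i: "integrable lborel (khat \<theta>)" if "\<theta> \<in> \<Theta>" for \<theta> using sd[OF that] unfolding has_spectral_density_def by blast
  have I0: "(\<integral>\<omega>. khat \<theta> \<omega> \<partial>lborel) = k \<theta> 0" if "\<theta> \<in> \<Theta>" for \<theta> using spectral_density_cos[OF sd[OF that], of 0] by simp
  have nn: "(\<integral>\<^sup>+ \<omega>. ennreal (norm (khat \<theta> \<omega>)) \<partial>lborel) = ennreal (k \<theta> 0)" if "\<theta> \<in> \<Theta>" for \<theta>
    using nn_integral_eq_integral[OF integrable_norm[OF i[OF that]]] I0[OF that] pos[OF that] by (simp add: less_imp_le abs_of_pos)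
  have k0lim: "(\<lambda>m. k (t m) 0) \<longlonglongrightarrow> k \<theta>1 0"
    using k0 \<theta>1 lim t(1) by (intro continuous_on_tendsto_compose[OF k0 lim]) auto
  have "(\<lambda>m. \<integral>\<^sup>+ \<omega>. ennreal (norm (khat (t m) \<omega> - khat \<theta>1 \<omega>)) \<partial>lborel) \<longlonglongrightarrow> 0"
  proof (rule Scheffe_lemma1)
    show "integrable lborel (khat (t m))" for m by (rule i[OF t(1)])
    show "integrable lborel (khat \<theta>1)" by (rule i[OF \<theta>1])
    show "AE \<omega> in lborel. (\<lambda>m. khat (t m) \<omega>) \<longlonglongrightarrow> khat \<theta>1 \<omega>"
    proof (rule AE_I2)
      fix \<omega> :: "real ^ 'd"
      have "(\<lambda>m. (t m, \<omega>)) \<longlonglongrightarrow> (\<theta>1, \<omega>)" by (intro tendsto_Pair lim tendsto_const)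
      from continuous_on_tendsto_compose[OF cont this] show "(\<lambda>m. khat (t m) \<omega>) \<longlonglongrightarrow> khat \<theta>1 \<omega>" using \<theta>1 t(1) by auto
    qed
    have "(\<lambda>m. ennreal (k (t m) 0)) \<longlonglongrightarrow> ennreal (k \<theta>1 0)" using k0lim by (rule tendsto_ennrealI)
    hence "limsup (\<lambda>m. ennreal (k (t m) 0)) = ennreal (k \<theta>1 0)" by (intro lim_imp_Limsup) auto
    thus "limsup (\<lambda>m. \<integral>\<^sup>+ \<omega>. ennreal (norm (khat (t m) \<omega>)) \<partial>lborel) \<le> (\<integral>\<^sup>+ \<omega>. ennreal (norm (khat \<theta>1 \<omega>)) \<partial>lborel)"
      unfolding nn[OF t(1)] nn[OF \<theta>1] by simp
  qed
  hence "\<forall>\<^sub>F m in sequentially. (\<integral>\<^sup>+ \<omega>. ennreal (norm (khat (t m) \<omega> - khat \<theta>1 \<omega>)) \<partial>lborel) < ennreal e"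
    by (rule order_tendstoD) (use e in auto)
  then obtain m where m: "(\<integral>\<^sup>+ \<omega>. ennreal (norm (khat (t m) \<omega> - khat \<theta>1 \<omega>)) \<partial>lborel) < ennreal e"
    by (auto simp: eventually_sequentially)
  have id: "integrable lborel (\<lambda>\<omega>. khat (t m) \<omega> - khat \<theta>1 \<omega>)" by (intro Bochner_Integration.integrable_diff i t \<theta>1)
  have "(\<integral>\<omega>. \<bar>khat (t m) \<omega> - khat \<theta>1 \<omega>\<bar> \<partial>lborel) \<le> e"
  proof -
    have "ennreal (\<integral>\<omega>. \<bar>khat (t m) \<omega> - khat \<theta>1 \<omega>\<bar> \<partial>lborel) < ennreal e"
      using m nn_integral_eq_integral[OF integrable_norm[OF id]] by simp
    thus ?thesis by (simp add: ennreal_less_iff)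
  qed
  moreover have "\<bar>k (t m) x - k \<theta>1 x\<bar> \<le> (\<integral>\<omega>. \<bar>khat (t m) \<omega> - khat \<theta>1 \<omega>\<bar> \<partial>lborel)" for x
  proof -
    note ci = spectral_density_cos_integrable[OF sd[OF t(1)], of m x] spectral_density_cos_integrable[OF sd[OF \<theta>1], of x]
    have "k (t m) x - k \<theta>1 x = (\<integral>\<omega>. khat (t m) \<omega> * cos (\<omega> \<bullet> x) - khat \<theta>1 \<omega> * cos (\<omega> \<bullet> x) \<partial>lborel)"
      unfolding spectral_density_cos[OF sd[OF t(1)], of m x] spectral_density_cos[OF sd[OF \<theta>1], of x]
      by (rule Bochner_Integration.integral_diff[OF ci, symmetric])
    hence "\<bar>k (t m) x - k \<theta>1 x\<bar> \<le> (\<integral>\<omega>. \<bar>khat (t m) \<omega> * cos (\<omega> \<bullet> x) - khat \<theta>1 \<omega> * cos (\<omega> \<bullet> x)\<bar> \<partial>lborel)"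
      by (simp only: integral_abs_bound)
    also have "\<dots> \<le> (\<integral>\<omega>. \<bar>khat (t m) \<omega> - khat \<theta>1 \<omega>\<bar> \<partial>lborel)"
    proof (rule integral_mono)
      show "integrable lborel (\<lambda>\<omega>. \<bar>khat (t m) \<omega> * cos (\<omega> \<bullet> x) - khat \<theta>1 \<omega> * cos (\<omega> \<bullet> x)\<bar>)"
        by (intro integrable_abs Bochner_Integration.integrable_diff ci)
      show "integrable lborel (\<lambda>\<omega>. \<bar>khat (t m) \<omega> - khat \<theta>1 \<omega>\<bar>)" by (intro integrable_abs id)
      show "\<bar>khat (t m) \<omega> * cos (\<omega> \<bullet> x) - khat \<theta>1 \<omega> * cos (\<omega> \<bullet> x)\<bar> \<le> \<bar>khat (t m) \<omega> - khat \<theta>1 \<omega>\<bar>" for \<omega>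
        unfolding left_diff_distrib[symmetric] abs_mult by (intro mult_left_le) auto
    qed
    finally show ?thesis .
  qed
  ultimately show False using t(3)[of m] by (meson less_le_not_le order_trans)
qed

subsection \<open>Symmetric matrices\<close>

text \<open>First-order optimality: at t = b / d with d = |c| + 1 the linear term outweighs the
  quadratic one unless b = 0.\<close>

lemma linear_le_quadratic_imp_zero:
  fixes b c :: real
  assumes "\<And>t. 2 * t * b \<le> t\<^sup>2 * c"
  shows "b = 0"
proof -
  define d where "d = \<bar>c\<bar> + 1"
  have d: "d > 0" "c \<le> d" unfolding d_def by auto
  have "2 * (b / d) * b \<le> (b / d)\<^sup>2 * c" by (rule assms)
  also have "\<dots> \<le> (b / d)\<^sup>2 * d" by (intro mult_left_mono d) auto
  also have "\<dots> = b\<^sup>2 / d" using d by (simp add: power2_eq_square field_simps)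
  finally have "2 * b\<^sup>2 / d \<le> b\<^sup>2 / d" by (simp add: power2_eq_square field_simps)
  hence "b\<^sup>2 \<le> 0" using d by (simp add: field_simps)
  thus ?thesis by simp
qed

text \<open>Rayleigh's principle: a maximiser of the quadratic form over unit vectors orthogonal to
  the eigenvectors found so far is again an eigenvector. Vectors are functions on an arbitrary
  finite index set, so that one proof serves matrices of fixed and of growing size.\<close>

lemma symmetric_orthonormal_extension:
  fixes A :: "'i \<Rightarrow> 'i \<Rightarrow> real" and u :: "nat \<Rightarrow> 'i \<Rightarrow> real"
  assumes fin: "finite I" and sym: "\<And>i j. i \<in> I \<Longrightarrow> j \<in> I \<Longrightarrow> A i j = A j i"
    and orth: "\<And>a b. a < m \<Longrightarrow> b < m \<Longrightarrow> (\<Sum>i\<in>I. u a i * u b i) = (if a = b then 1 else 0)"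
    and eig: "\<And>a i. a < m \<Longrightarrow> i \<in> I \<Longrightarrow> (\<Sum>j\<in>I. A i j * u a j) = e a * u a i"
    and m: "m < card I"
  shows "\<exists>v \<mu>. (\<Sum>i\<in>I. v i * v i) = 1 \<and> (\<forall>a<m. (\<Sum>i\<in>I. v i * u a i) = 0) \<and>
           (\<forall>i\<in>I. (\<Sum>j\<in>I. A i j * v j) = \<mu> * v i)"
proof -
  define ip where "ip = (\<lambda>x y :: 'i \<Rightarrow> real. \<Sum>i\<in>I. x i * y i)"
  define B where "B = (\<lambda>x y. \<Sum>i\<in>I. x i * (\<Sum>j\<in>I. A i j * y j))"
  define V where "V = {v. \<forall>a<m. ip v (u a) = 0}"
  define K where "K = {v. (\<forall>i. i \<notin> I \<longrightarrow> v i = 0) \<and> ip v v = 1 \<and> v \<in> V}"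
  have ip_add: "ip (\<lambda>i. x i + t * y i) z = ip x z + t * ip y z" for x y z t
    unfolding ip_def by (simp add: algebra_simps sum.distrib sum_distrib_left)
  have ip_comm: "ip x y = ip y x" for x y
    unfolding ip_def by (simp add: mult.commute)
  have ip_scale: "ip (\<lambda>i. t * y i) z = t * ip y z" for y z t
    unfolding ip_def by (simp add: algebra_simps sum_distrib_left)
  have ip_scale2: "ip (\<lambda>i. t * y i) (\<lambda>i. t * y i) = t * (t * ip y y)" for y t
    unfolding ip_def by (simp add: algebra_simps sum_distrib_left)
  have B_scale2: "B (\<lambda>i. t * y i) (\<lambda>i. t * y i) = t * (t * B y y)" for y t
    unfolding B_def by (simp add: algebra_simps sum_distrib_left)
  have B_comm: "B x y = B y x" for x y
  proof -
    have "B x y = (\<Sum>i\<in>I. \<Sum>j\<in>I. x i * A i j * y j)"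
      unfolding B_def by (simp add: sum_distrib_left mult.assoc)
    also have "\<dots> = (\<Sum>j\<in>I. \<Sum>i\<in>I. x i * A i j * y j)" by (rule sum.swap)
    also have "\<dots> = (\<Sum>j\<in>I. \<Sum>i\<in>I. y j * A j i * x i)"
      by (intro sum.cong refl) (simp add: sym)
    also have "\<dots> = B y x" unfolding B_def by (simp add: sum_distrib_left mult.assoc)
    finally show ?thesis .
  qed
  have B_add: "B (\<lambda>i. x i + t * y i) z = B x z + t * B y z" for x y z t
    unfolding B_def by (simp add: algebra_simps sum.distrib sum_distrib_left)
  have B_scale: "B (\<lambda>i. t * y i) z = t * B y z" for y z t
    unfolding B_def by (simp add: algebra_simps sum_distrib_left)
  have ip_nonneg: "ip x x \<ge> 0" for x unfolding ip_def by (intro sum_nonneg) auto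
  \<comment> \<open>If the orthogonal projection onto the vectors found were the identity, its trace
    would give m = \<open>card I\<close>; hence some basis vector has a nonzero residual, the
    \<open>w0\<close> below.\<close>
  have "\<exists>i0\<in>I. \<exists>i\<in>I. (if i = i0 then 1 else 0) - (\<Sum>a<m. u a i0 * u a i) \<noteq> 0"
  proof (rule ccontr)
    assume "\<not> ?thesis"
    hence "\<And>i. i \<in> I \<Longrightarrow> (\<Sum>a<m. u a i * u a i) = 1" by force
    hence "(\<Sum>i\<in>I. \<Sum>a<m. u a i * u a i) = real (card I)" by simp
    moreover have "(\<Sum>i\<in>I. \<Sum>a<m. u a i * u a i) = (\<Sum>a<m. \<Sum>i\<in>I. u a i * u a i)" by (rule sum.swap)
    moreover have "\<dots> = real m" by (simp add: orth)
    ultimately show False using m by simp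
  qed
  then obtain i0 i1 where i01: "i0 \<in> I" "i1 \<in> I"
    "(if i1 = i0 then 1 else 0) - (\<Sum>a<m. u a i0 * u a i1) \<noteq> 0" by blast
  define w0 where "w0 = (\<lambda>i. if i \<in> I then (if i = i0 then 1 else 0) - (\<Sum>a<m. u a i0 * u a i) else 0)"
  have w0V: "w0 \<in> V"
  proof -
    have "ip w0 (u b) = 0" if b: "b < m" for b
    proof -
      have "ip w0 (u b) = (\<Sum>i\<in>I. (if i = i0 then u b i else 0)) - (\<Sum>i\<in>I. \<Sum>a<m. u a i0 * (u a i * u b i))"
        unfolding ip_def w0_def sum_subtractf[symmetric]
        by (intro sum.cong refl) (auto simp: algebra_simps sum_distrib_left sum_distrib_right)
      also have "(\<Sum>i\<in>I. \<Sum>a<m. u a i0 * (u a i * u b i)) = (\<Sum>a<m. u a i0 * (\<Sum>i\<in>I. u a i * u b i))"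
        unfolding sum_distrib_left by (rule sum.swap)
      also have "\<dots> = (\<Sum>a<m. if a = b then u a i0 else 0)"
        using b by (intro sum.cong refl) (simp add: orth)
      also have "\<dots> = u b i0" using b by simp
      also have "(\<Sum>i\<in>I. (if i = i0 then u b i else 0)) = u b i0" using i01 fin by simp
      finally show ?thesis by simp
    qed
    thus ?thesis unfolding V_def by blast
  qed
  have norm_in_K: "(\<lambda>i. (1 / sqrt (ip w w)) * w i) \<in> K" if "w \<in> V" "\<And>i. i \<notin> I \<Longrightarrow> w i = 0" "ip w w \<noteq> 0" for w
  proof -
    have "ip w w > 0" using that ip_nonneg[of w] by simp
    hence "(1 / sqrt (ip w w)) * ((1 / sqrt (ip w w)) * ip w w) = 1"
      by (simp add: real_div_sqrt)
    hence "ip (\<lambda>i. (1 / sqrt (ip w w)) * w i) (\<lambda>i. (1 / sqrt (ip w w)) * w i) = 1"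
      by (simp only: ip_scale2)
    thus ?thesis using that unfolding K_def V_def by (simp only: ip_scale mem_Collect_eq) auto
  qed
  have "ip w0 w0 \<noteq> 0"
  proof
    assume "ip w0 w0 = 0"
    hence "w0 i1 * w0 i1 = 0" unfolding ip_def using i01(2) fin
      by (subst (asm) sum_nonneg_eq_0_iff) auto
    thus False using i01 unfolding w0_def by auto
  qed
  hence Kne: "K \<noteq> {}" using norm_in_K[OF w0V] unfolding w0_def by fastforce
  have cont_c: "continuous_on UNIV (\<lambda>v :: 'i \<Rightarrow> real. v i)" for i by (rule continuous_on_product_coordinates)
  \<comment> \<open>Coordinates outside \<open>I\<close> are pinned to 0, so that Tychonoff's
    theorem makes the box compact in the product topology.\<close>
  define P where "P = (Pi UNIV (\<lambda>i. if i \<in> I then {-1..1} else {0}) :: ('i \<Rightarrow> real) set)"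
  have "compact P"
  proof -
    have "compactin (product_topology (\<lambda>_. euclidean) UNIV)
      (PiE UNIV (\<lambda>i. if i \<in> I then {-1..1::real} else {0}))"
      unfolding compactin_PiE by auto
    thus ?thesis unfolding P_def euclidean_product_topology by (simp add: PiE_UNIV_domain)
  qed
  have contip: "continuous_on UNIV (\<lambda>v. ip v z)" for z
    unfolding ip_def by (intro continuous_intros cont_c)
  have contip2: "continuous_on UNIV (\<lambda>v. ip v v)"
    unfolding ip_def by (intro continuous_intros cont_c)
  have contB: "continuous_on UNIV (\<lambda>v. B v v)"
    unfolding B_def by (intro continuous_intros cont_c)
  have KP: "K = P \<inter> {v. ip v v = 1} \<inter> (\<Inter>a\<in>{..<m}. {v. ip v (u a) = 0})"
  proof -
    have "v i \<in> {-1..1}" if "ip v v = 1" "i \<in> I" for v i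
    proof -
      have "v i * v i \<le> ip v v" unfolding ip_def
        using member_le_sum[of i I "\<lambda>i. v i * v i"] that fin by auto
      hence "\<bar>v i\<bar> \<le> 1" using that by (simp add: abs_le_square_iff power2_eq_square flip: abs_le_square_iff[of _ 1, simplified])
      thus ?thesis by auto
    qed
    thus ?thesis unfolding K_def P_def V_def by (fastforce simp: Pi_iff split: if_splits)
  qed
  have "closed ({v. ip v v = 1} \<inter> (\<Inter>a\<in>{..<m}. {v. ip v (u a) = 0}))"
    by (intro closed_Int closed_INT ballI closed_Collect_eq contip contip2 continuous_intros)
  hence "compact K" unfolding KP Int_assoc using \<open>compact P\<close> by (intro compact_Int_closed)
  then obtain v where v: "v \<in> K" "\<And>w. w \<in> K \<Longrightarrow> B w w \<le> B v v"
    using continuous_attains_sup[OF _ Kne, of "\<lambda>v. B v v"] contB continuous_on_subset by blast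
  define \<mu> where "\<mu> = B v v"
  have vV: "v \<in> V" "ip v v = 1" "\<And>i. i \<notin> I \<Longrightarrow> v i = 0" using v(1) unfolding K_def by auto
  have le: "B w w \<le> \<mu> * ip w w" if "w \<in> V" "\<And>i. i \<notin> I \<Longrightarrow> w i = 0" for w
  proof (cases "ip w w = 0")
    case True
    hence "w i = 0" for i using that(2) fin unfolding ip_def
      by (cases "i \<in> I") (auto simp: sum_nonneg_eq_0_iff)
    thus ?thesis unfolding B_def ip_def by simp
  next
    case False
    hence pos: "ip w w > 0" using ip_nonneg[of w] by simp
    let ?r = "1 / sqrt (ip w w)"
    have "(\<lambda>i. ?r * w i) \<in> K" by (rule norm_in_K) (use that False in auto)
    hence "?r * (?r * B w w) \<le> \<mu>"
      using v(2)[of "\<lambda>i. ?r * w i"] unfolding \<mu>_def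
      by (simp only: B_scale2)
    thus ?thesis using pos by (simp add: field_simps)
  qed
  have Bv: "B v w = \<mu> * ip v w" if w: "w \<in> V" "\<And>i. i \<notin> I \<Longrightarrow> w i = 0" for w
  proof -
    \<comment> \<open>Perturbing the maximiser in an admissible direction \<open>w\<close>; the term
      linear in t must vanish.\<close>
    have "2 * t * (B v w - \<mu> * ip v w) \<le> t\<^sup>2 * (\<mu> * ip w w - B w w)" for t
    proof -
      let ?x = "\<lambda>i. v i + t * w i"
      have "?x \<in> V" using w vV unfolding V_def by (simp add: ip_add)
      hence "B ?x ?x \<le> \<mu> * ip ?x ?x" using w vV by (intro le) auto
      moreover have "B ?x ?x = B v v + 2 * t * B v w + t\<^sup>2 * B w w"
        using B_comm[of v ?x] B_comm[of w ?x] B_comm[of v w]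
        by (simp add: B_add algebra_simps power2_eq_square)
      moreover have "ip ?x ?x = 1 + 2 * t * ip v w + t\<^sup>2 * ip w w"
        using ip_comm[of v ?x] ip_comm[of w ?x] ip_comm[of v w] vV(2)
        by (simp add: ip_add algebra_simps power2_eq_square)
      ultimately show ?thesis unfolding \<mu>_def by (simp add: algebra_simps)
    qed
    from linear_le_quadratic_imp_zero[OF this] show ?thesis by simp
  qed
  \<comment> \<open>Residual of the eigenvalue equation. It is itself an admissible direction
    because the previous vectors are eigenvectors, so it turns out orthogonal to itself.\<close>
  define w where "w = (\<lambda>i. if i \<in> I then (\<Sum>j\<in>I. A i j * v j) - \<mu> * v i else 0)"
  have Bip: "ip w x = B v x - \<mu> * ip v x" for x
  proof -
    have "ip w x = B x v - \<mu> * ip v x"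
      unfolding ip_def w_def B_def by (simp add: algebra_simps sum_subtractf sum_distrib_left)
    thus ?thesis by (simp add: B_comm)
  qed
  have "w \<in> V"
  proof -
    have "ip w (u a) = 0" if a: "a < m" for a
    proof -
      have "B v (u a) = e a * ip v (u a)"
        unfolding B_def ip_def sum_distrib_left using eig[OF a] 
        by (intro sum.cong refl) (simp flip: sum_distrib_left)
      thus ?thesis using vV(1) a unfolding Bip V_def by simp
    qed
    thus ?thesis unfolding V_def by blast
  qed
  hence "ip w w = 0" using Bv[of w] Bip[of w] unfolding w_def by auto
  hence "w i * w i = 0" if "i \<in> I" for i using that fin unfolding ip_def
    by (subst (asm) sum_nonneg_eq_0_iff) auto
  hence "\<forall>i\<in>I. (\<Sum>j\<in>I. A i j * v j) = \<mu> * v i" unfolding w_def by fastforce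
  thus ?thesis using vV unfolding V_def ip_def by blast
qed

theorem symmetric_eigenbasis:
  fixes A :: "'i \<Rightarrow> 'i \<Rightarrow> real"
  assumes fin: "finite I" and sym: "\<And>i j. i \<in> I \<Longrightarrow> j \<in> I \<Longrightarrow> A i j = A j i"
  shows "\<exists>(u :: nat \<Rightarrow> 'i \<Rightarrow> real) e. (\<forall>a<card I. \<forall>b<card I. (\<Sum>i\<in>I. u a i * u b i) = (if a = b then 1 else 0)) \<and>
     (\<forall>a<card I. \<forall>i\<in>I. (\<Sum>j\<in>I. A i j * u a j) = e a * u a i)"
proof -
  have "m \<le> card I \<Longrightarrow> \<exists>u e. (\<forall>a<m. \<forall>b<m. (\<Sum>i\<in>I. u a i * u b i) = (if a = b then 1 else 0 :: real)) \<and>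
     (\<forall>a<m. \<forall>i\<in>I. (\<Sum>j\<in>I. A i j * u a j) = e a * u a i)" for m :: nat
  proof (induction m)
    case (Suc m)
    then obtain u e where u: "\<forall>a<m. \<forall>b<m. (\<Sum>i\<in>I. u a i * u b i) = (if a = b then 1 else 0 :: real)"
     "\<forall>a<m. \<forall>i\<in>I. (\<Sum>j\<in>I. A i j * u a j) = e a * u a i" by auto
    have "m < card I" using Suc.prems by simp
    from symmetric_orthonormal_extension[OF fin, where A = A and m = m and u = u and e = e, OF sym _ _ this] u
    obtain v \<mu> where v: "(\<Sum>i\<in>I. v i * v i) = 1" "\<forall>a<m. (\<Sum>i\<in>I. v i * u a i) = 0"
      "\<forall>i\<in>I. (\<Sum>j\<in>I. A i j * v j) = \<mu> * v i" by blast
    have v': "\<forall>a<m. (\<Sum>i\<in>I. u a i * v i) = 0" using v(2) by (simp add: mult.commute)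
    show ?case
      using u v v'
      by (intro exI[of _ "u(m := v)"] exI[of _ "e(m := \<mu>)"]) (auto simp: less_Suc_eq)
  qed auto
  from this[OF order.refl] show ?thesis .
qed

section \<open>Eigenvalues and square roots of matrices of fixed size\<close>

lemma symmetric_eigenvectors:
  fixes A :: "real ^ 'p ^ 'p"
  assumes sym: "Finite_Cartesian_Product.transpose A = A"
  shows "\<exists>(U :: nat \<Rightarrow> real ^ 'p) e. (\<forall>a<CARD('p). \<forall>b<CARD('p). U a \<bullet> U b = (if a = b then 1 else 0)) \<and>
    (\<forall>a<CARD('p). A *v U a = e a *\<^sub>R U a) \<and> (\<forall>x. (\<Sum>a<CARD('p). (x \<bullet> U a) *\<^sub>R U a) = x)"
proof -
  have "vec_nth (vec_nth A i) j = vec_nth (vec_nth A j) i" for i j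
    using arg_cong[OF sym, of "\<lambda>M. vec_nth (vec_nth M i) j"] by (simp add: Finite_Cartesian_Product.transpose_def)
  from symmetric_eigenbasis[of "UNIV :: 'p set" "\<lambda>i j. vec_nth (vec_nth A i) j", OF finite this]
  obtain u :: "nat \<Rightarrow> 'p \<Rightarrow> real" and e where
    u': "\<forall>a<CARD('p). \<forall>b<CARD('p). (\<Sum>i\<in>UNIV. u a i * u b i) = (if a = b then 1 else 0 :: real)" and
    e': "\<forall>a<CARD('p). \<forall>i\<in>UNIV. (\<Sum>j\<in>UNIV. vec_nth (vec_nth A i) j * u a j) = e a * u a i"
    by (elim exE conjE)
  note u = u'[rule_format] and e = e'[rule_format, OF _ UNIV_I]
  define U where "U = (\<lambda>a. (\<chi> i. u a i) :: real ^ 'p)"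
  have orth: "U a \<bullet> U b = (if a = b then 1 else 0)" if "a < CARD('p)" "b < CARD('p)" for a b
    using u[OF that] unfolding U_def inner_vec_def by simp
  have eig: "A *v U a = e a *\<^sub>R U a" if "a < CARD('p)" for a
    using e[OF that] by (simp add: U_def matrix_vector_mult_def Finite_Cartesian_Product.vec_eq_iff)
  let ?B = "U ` {..<CARD('p)}"
  have inj: "inj_on U {..<CARD('p)}"
    by (intro inj_onI) (metis orth lessThan_iff zero_neq_one)
  have po: "pairwise real_inner_class.orthogonal ?B"
    unfolding pairwise_def Linear_Algebra.orthogonal_def using orth by (auto split: if_splits)
  have nz: "0 \<notin> ?B" using orth by force
  \<comment> \<open>A count of dimensions: as many orthonormal vectors as coordinates span the whole
    space.\<close>
  have "independent ?B" by (rule pairwise_orthogonal_independent[OF po nz])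
  moreover have "card ?B = dim (UNIV :: (real ^ 'p) set)" using card_image[OF inj] by (simp add: dim_UNIV)
  ultimately have sp: "UNIV \<subseteq> span ?B" by (intro card_ge_dim_independent) auto
  have "(\<Sum>a<CARD('p). (x \<bullet> U a) *\<^sub>R U a) = x" for x
  proof -
    have n1: "norm b = 1" if "b \<in> ?B" for b using that orth by (auto simp: norm_eq_1)
    have "(\<Sum>b\<in>?B. (x \<bullet> b) *\<^sub>R b) = x"
      by (rule orthonormal_basis_expand[OF po n1]) (use sp in auto)
    thus ?thesis by (simp add: sum.reindex[OF inj] o_def)
  qed
  with orth eig show ?thesis by (intro exI[of _ U] exI[of _ e] conjI allI impI)
qed

lemma inner_symmetric_matrix:
  fixes A :: "real ^ 'p ^ 'p"
  assumes "Finite_Cartesian_Product.transpose A = A"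
  shows "x \<bullet> (A *v y) = (A *v x) \<bullet> y"
  using assms by (metis dot_lmul_matrix transpose_matrix_vector)

text \<open>Makes \<open>Min\<close> and \<open>Max\<close> of the spectrum meaningful. An
  eigenvector has a nonzero component along some \<open>U a\<close>, which forces its eigenvalue to
  be \<open>e a\<close>.\<close>

lemma eigenvalues_symmetric:
  fixes A :: "real ^ 'p ^ 'p"
  assumes sym: "Finite_Cartesian_Product.transpose A = A"
  shows "finite (eigenvalues A)" "eigenvalues A \<noteq> {}"
proof -
  from symmetric_eigenvectors[OF sym] obtain U :: "nat \<Rightarrow> real ^ 'p" and e where
    U': "\<forall>a<CARD('p). \<forall>b<CARD('p). U a \<bullet> U b = (if a = b then 1 else 0)"
    "\<forall>a<CARD('p). A *v U a = e a *\<^sub>R U a" "\<forall>x. (\<Sum>a<CARD('p). (x \<bullet> U a) *\<^sub>R U a) = x"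
    by (elim exE conjE)
  note U = U'[rule_format]
  have "eigenvalues A \<subseteq> e ` {..<CARD('p)}"
  proof
    fix \<mu> assume "\<mu> \<in> eigenvalues A"
    then obtain v where v: "v \<noteq> 0" "A *v v = \<mu> *\<^sub>R v" unfolding eigenvalues_def by auto
    have "\<exists>a<CARD('p). v \<bullet> U a \<noteq> 0"
    proof (rule ccontr)
      assume "\<not> ?thesis"
      hence "(\<Sum>a<CARD('p). (v \<bullet> U a) *\<^sub>R U a) = 0" by (intro sum.neutral) auto
      thus False using U(3)[of v] v(1) by simp
    qed
    then obtain a where a: "a < CARD('p)" "v \<bullet> U a \<noteq> 0" by blast
    have "e a * (v \<bullet> U a) = \<mu> * (v \<bullet> U a)"
      using inner_symmetric_matrix[OF sym, of v "U a"] v(2) U(2)[OF a(1)] by simp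
    thus "\<mu> \<in> e ` {..<CARD('p)}" using a by auto
  qed
  thus "finite (eigenvalues A)" by (rule finite_subset) auto
  have "0 < CARD('p)" by simp
  hence "e 0 \<in> eigenvalues A" unfolding eigenvalues_def using U(1)[of 0 0] U(2)[of 0] by (auto intro!: exI[of _ "U 0"])
  thus "eigenvalues A \<noteq> {}" by blast
qed

text \<open>The extreme eigenvalues belong to eigenvectors, at which a bound on the quadratic form
  can be read off.\<close>

lemma
  fixes A :: "real ^ 'p ^ 'p"
  assumes sym: "Finite_Cartesian_Product.transpose A = A"
  shows lambda_inf_ge: "(\<And>x. c * (norm x)\<^sup>2 \<le> x \<bullet> (A *v x)) \<Longrightarrow> c \<le> lambda_inf A"
    and lambda_sup_le: "(\<And>x. x \<bullet> (A *v x) \<le> C * (norm x)\<^sup>2) \<Longrightarrow> lambda_sup A \<le> C"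
    and lambda_inf_le_sup: "lambda_inf A \<le> lambda_sup A"
proof -
  note E = eigenvalues_symmetric[OF sym]
  have rq: "\<exists>v. v \<noteq> 0 \<and> v \<bullet> (A *v v) = \<mu> * (norm v)\<^sup>2" if "\<mu> \<in> eigenvalues A" for \<mu>
    using that unfolding eigenvalues_def by (auto simp: power2_norm_eq_inner)
  show "c \<le> lambda_inf A" if c: "\<And>x. c * (norm x)\<^sup>2 \<le> x \<bullet> (A *v x)"
  proof -
    obtain v where "v \<noteq> 0" "v \<bullet> (A *v v) = lambda_inf A * (norm v)\<^sup>2"
      using rq[of "lambda_inf A"] Min_in[OF E] unfolding lambda_inf_def by blast
    thus ?thesis using c[of v] by simp
  qed
  show "lambda_sup A \<le> C" if c: "\<And>x. x \<bullet> (A *v x) \<le> C * (norm x)\<^sup>2"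
  proof -
    obtain v where "v \<noteq> 0" "v \<bullet> (A *v v) = lambda_sup A * (norm v)\<^sup>2"
      using rq[of "lambda_sup A"] Max_in[OF E] unfolding lambda_sup_def by blast
    thus ?thesis using c[of v] by simp
  qed
  show "lambda_inf A \<le> lambda_sup A"
    unfolding lambda_inf_def lambda_sup_def using Min_in[OF E] Max_ge[OF E(1)] by blast
qed

lemma positive_definite_invertible:
  fixes A :: "real ^ 'p ^ 'p"
  assumes "\<And>x. x \<noteq> 0 \<Longrightarrow> 0 < x \<bullet> (A *v x)"
  shows "invertible A"
proof -
  have "x = 0" if "A *v x = 0" for x using assms[of x] that by force
  hence "\<exists>B. B ** A = Finite_Cartesian_Product.mat 1" unfolding matrix_left_invertible_ker by blast
  thus ?thesis unfolding invertible_def using matrix_left_right_inverse by metis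
qed

text \<open>The square root acts on the orthonormal eigenbasis by the roots of the
  eigenvalues.\<close>

lemma positive_sqrt_exists:
  fixes A :: "real ^ 'p ^ 'p"
  assumes sym: "Finite_Cartesian_Product.transpose A = A" and pd: "\<And>x. x \<noteq> 0 \<Longrightarrow> 0 < x \<bullet> (A *v x)"
  shows "\<exists>B. Finite_Cartesian_Product.transpose B = B \<and> (\<forall>x. x \<noteq> 0 \<longrightarrow> 0 < x \<bullet> (B *v x)) \<and> B ** B = A"
proof -
  from symmetric_eigenvectors[OF sym] obtain U :: "nat \<Rightarrow> real ^ 'p" and e where
    U': "\<forall>a<CARD('p). \<forall>b<CARD('p). U a \<bullet> U b = (if a = b then 1 else 0)"
    "\<forall>a<CARD('p). A *v U a = e a *\<^sub>R U a" "\<forall>x. (\<Sum>a<CARD('p). (x \<bullet> U a) *\<^sub>R U a) = x"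
    by (elim exE conjE)
  note U = U'[rule_format]
  have e: "e a > 0" if "a < CARD('p)" for a
  proof -
    have "U a \<noteq> 0" using U(1)[OF that that] by auto
    from pd[OF this] show ?thesis using U(1)[OF that that] U(2)[OF that] by simp
  qed
  define f where "f = (\<lambda>x. \<Sum>a<CARD('p). (sqrt (e a) * (x \<bullet> U a)) *\<^sub>R U a)"
  have lin: "linear f"
    unfolding f_def by (intro linearI)
      (simp_all add: inner_add_left distrib_left scaleR_add_left sum.distrib scaleR_sum_right mult.left_commute)
  define B where "B = matrix f"
  have Bf: "B *v x = f x" for x unfolding B_def using matrix_vector_mul(2)[OF lin] by (rule fun_cong)
  have fU: "f x \<bullet> U a = sqrt (e a) * (x \<bullet> U a)" if "a < CARD('p)" for x a
  proof -
    have "f x \<bullet> U a = (\<Sum>b<CARD('p). if b = a then sqrt (e a) * (x \<bullet> U a) else 0)"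
      unfolding f_def inner_sum_left using that by (intro sum.cong refl) (auto simp: U(1))
    thus ?thesis using that by simp
  qed
  have fx: "x \<bullet> f y = (\<Sum>a<CARD('p). sqrt (e a) * (x \<bullet> U a) * (y \<bullet> U a))" for x y
    unfolding f_def inner_sum_right by (simp add: mult_ac)
  have symB: "x \<bullet> (B *v y) = (B *v x) \<bullet> y" for x y
    unfolding Bf fx inner_commute[of "f x" y] by (simp add: mult_ac)
  have "Finite_Cartesian_Product.transpose B = B"
  proof -
    have "Finite_Cartesian_Product.transpose B *v x = B *v x" for x
    proof -
      have "(Finite_Cartesian_Product.transpose B *v x) \<bullet> y = (B *v x) \<bullet> y" for y
        by (metis dot_lmul_matrix symB transpose_matrix_vector)
      thus ?thesis by (metis vector_eq_ldot inner_commute)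
    qed
    thus ?thesis unfolding matrix_eq by blast
  qed
  moreover have "0 < x \<bullet> (B *v x)" if "x \<noteq> 0" for x
  proof -
    have nn: "0 \<le> sqrt (e a) * (x \<bullet> U a) * (x \<bullet> U a)" if "a < CARD('p)" for a
      using e[OF that] by (simp add: mult.assoc)
    have "\<exists>a<CARD('p). x \<bullet> U a \<noteq> 0"
    proof (rule ccontr)
      assume "\<not> ?thesis"
      hence "(\<Sum>a<CARD('p). (x \<bullet> U a) *\<^sub>R U a) = 0" by (intro sum.neutral) auto
      thus False using U(3)[of x] that by simp
    qed
    then obtain a where a: "a < CARD('p)" "x \<bullet> U a \<noteq> 0" by blast
    have "0 < sqrt (e a) * (x \<bullet> U a) * (x \<bullet> U a)" using e[OF a(1)] a(2) by (simp add: mult.assoc zero_less_mult_iff) linarith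
    thus ?thesis unfolding Bf fx using a(1) nn by (intro sum_pos2[of _ a]) auto
  qed
  moreover have "B ** B = A"
  proof -
    have "(B ** B) *v x = A *v x" for x
    proof -
      have "(B ** B) *v x = f (f x)" by (simp add: matrix_vector_mul_assoc[symmetric] Bf)
      also have "\<dots> = (\<Sum>a<CARD('p). (e a * (x \<bullet> U a)) *\<^sub>R U a)"
      proof -
        have "sqrt (e a) * (f x \<bullet> U a) = e a * (x \<bullet> U a)" if "a < CARD('p)" for a
          using e[OF that] by (simp add: fU[OF that] mult.assoc[symmetric])
        thus ?thesis by (subst f_def) (intro sum.cong refl, simp)
      qed
      also have "\<dots> = (\<Sum>a<CARD('p). (x \<bullet> U a) *\<^sub>R (A *v U a))"
        by (intro sum.cong refl) (simp add: U(2) mult.commute)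
      also have "\<dots> = A *v (\<Sum>a<CARD('p). (x \<bullet> U a) *\<^sub>R U a)"
        by (simp add: linear_sum[OF matrix_vector_mul_linear] matrix_vector_mult_scaleR)
      finally show ?thesis unfolding U(3) .
    qed
    thus ?thesis unfolding matrix_eq by blast
  qed
  ultimately show ?thesis by blast
qed

text \<open>For an eigenvector v of the symmetric difference D with eigenvalue e, equality of the
  squares gives 0 = <Dv, (B + C) v> = e (<v, Bv> + <v, Cv>), and the bracket is positive. So all
  eigenvalues of D vanish.\<close>

lemma positive_sqrt_unique:
  fixes B C :: "real ^ 'p ^ 'p"
  assumes B: "Finite_Cartesian_Product.transpose B = B" "\<And>x. x \<noteq> 0 \<Longrightarrow> 0 < x \<bullet> (B *v x)"
    and C: "Finite_Cartesian_Product.transpose C = C" "\<And>x. x \<noteq> 0 \<Longrightarrow> 0 < x \<bullet> (C *v x)"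
    and eq: "B ** B = C ** C"
  shows "B = C"
proof -
  define D where "D = B - C"
  have tD: "Finite_Cartesian_Product.transpose D = D"
    using B(1) C(1) unfolding D_def Finite_Cartesian_Product.transpose_def Finite_Cartesian_Product.vec_eq_iff by simp
  have Dv: "D *v x = B *v x - C *v x" for x unfolding D_def by (rule matrix_vector_mult_diff_rdistrib)
  from symmetric_eigenvectors[OF tD] obtain U :: "nat \<Rightarrow> real ^ 'p" and e where
    U': "\<forall>a<CARD('p). \<forall>b<CARD('p). U a \<bullet> U b = (if a = b then 1 else 0)"
    "\<forall>a<CARD('p). D *v U a = e a *\<^sub>R U a" "\<forall>x. (\<Sum>a<CARD('p). (x \<bullet> U a) *\<^sub>R U a) = x"
    by (elim exE conjE)
  note U = U'[rule_format]
  have "e a = 0" if a: "a < CARD('p)" for a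
  proof -
    define v where "v = U a"
    have v: "v \<noteq> 0" "D *v v = e a *\<^sub>R v" using U(1)[OF a a] U(2)[OF a] unfolding v_def by auto
    have "0 = v \<bullet> (B *v (B *v v)) - v \<bullet> (C *v (C *v v))"
      using eq by (simp add: matrix_vector_mul_assoc)
    also have "\<dots> = (B *v v) \<bullet> (B *v v) - (C *v v) \<bullet> (C *v v)"
      by (simp add: inner_symmetric_matrix[OF B(1)] inner_symmetric_matrix[OF C(1)])
    also have "\<dots> = (D *v v) \<bullet> (B *v v + C *v v)"
      unfolding Dv by (simp add: inner_diff_left inner_diff_right inner_add_right inner_commute)
    also have "\<dots> = e a * (v \<bullet> (B *v v) + v \<bullet> (C *v v))" unfolding v(2) by (simp add: inner_add_right distrib_left)
    finally show ?thesis using B(2)[OF v(1)] C(2)[OF v(1)] by simp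
  qed
  have "D *v x = 0" for x
  proof -
    have "D *v x = D *v (\<Sum>a<CARD('p). (x \<bullet> U a) *\<^sub>R U a)" by (simp only: U(3))
    also have "\<dots> = (\<Sum>a<CARD('p). (x \<bullet> U a) *\<^sub>R (D *v U a))"
      by (simp add: linear_sum[OF matrix_vector_mul_linear] matrix_vector_mult_scaleR)
    also have "\<dots> = 0" using U(2) \<open>\<And>a. a < CARD('p) \<Longrightarrow> e a = 0\<close> by (intro sum.neutral) auto
    finally show ?thesis .
  qed
  thus ?thesis unfolding Dv matrix_eq by simp
qed

lemma matrix_inv_matrix_inv:
  fixes A :: "real ^ 'p ^ 'p"
  assumes "invertible A" shows "matrix_inv (matrix_inv A) = A"
proof -
  have inv: "M ** matrix_inv M = Finite_Cartesian_Product.mat 1 \<and> matrix_inv M ** M = Finite_Cartesian_Product.mat 1"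
    if "invertible M" for M :: "real ^ 'p ^ 'p"
    using that unfolding invertible_def matrix_inv_def by (rule someI_ex)
  let ?I = "matrix_inv A"
  have "invertible ?I" using inv[OF assms] unfolding invertible_def by blast
  note I = inv[OF this] inv[OF assms]
  have "A = A ** (?I ** matrix_inv ?I)" using I(1) by simp
  also have "\<dots> = matrix_inv ?I" unfolding matrix_mul_assoc using I(2) by simp
  finally show ?thesis ..
qed

text \<open>\<open>inv_sqrt_matrix\<close> is a definite description, which denotes the root only
  once existence and uniqueness are known. Applied to the inverse of A, the two inversions cancel
  and leave the positive square root of A.\<close>

theorem inv_sqrt_matrix_inv:
  fixes A :: "real ^ 'p ^ 'p"
  assumes sym: "Finite_Cartesian_Product.transpose A = A" and pd: "\<And>x. x \<noteq> 0 \<Longrightarrow> 0 < x \<bullet> (A *v x)"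
  defines "B \<equiv> inv_sqrt_matrix (matrix_inv A)"
  shows "Finite_Cartesian_Product.transpose B = B" "x \<noteq> 0 \<Longrightarrow> 0 < x \<bullet> (B *v x)" "B ** B = A"
proof -
  let ?P = "\<lambda>B. Finite_Cartesian_Product.transpose B = B \<and> (\<forall>x. x \<noteq> 0 \<longrightarrow> 0 < x \<bullet> (B *v x)) \<and> B ** B = A"
  have inv: "matrix_inv (matrix_inv A) = A" by (rule matrix_inv_matrix_inv[OF positive_definite_invertible[OF pd]])
  have Beq: "B = (THE B. ?P B)" unfolding B_def inv_sqrt_matrix_def inv by (rule refl)
  have ex1: "\<exists>!B. ?P B"
    using positive_sqrt_exists[OF sym pd] positive_sqrt_unique by blast
  have "?P B" by (rule ssubst[where P = ?P, OF Beq theI'[OF ex1]])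
  thus "Finite_Cartesian_Product.transpose B = B" "x \<noteq> 0 \<Longrightarrow> 0 < x \<bullet> (B *v x)" "B ** B = A" by auto
qed

section \<open>Diagonalisation of matrices of growing size\<close>

lemma mat_diag_index: "i < n \<Longrightarrow> j < n \<Longrightarrow> mat_diag n f $$ (i, j) = (if i = j then f j else 0)"
  unfolding mat_diag_def by simp

lemma index_mult_mat_sum:
  assumes "A \<in> carrier_mat n m" "B \<in> carrier_mat m l" "i < n" "j < l"
  shows "(A * B) $$ (i, j) = (\<Sum>k<m. A $$ (i, k) * B $$ (k, j))"
  using assms by (auto simp: times_mat_def scalar_prod_def lessThan_atLeast0)

theorem symmetric_mat_diagonalization:
  fixes A :: "real mat"
  assumes A: "A \<in> carrier_mat n n" and sym: "transpose_mat A = A"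
  shows "\<exists>U e. U \<in> carrier_mat n n \<and> transpose_mat U * U = 1\<^sub>m n \<and> U * transpose_mat U = 1\<^sub>m n \<and>
    transpose_mat U * A * U = mat_diag n e"
proof -
  have "A $$ (i, j) = A $$ (j, i)" if "i \<in> {..<n}" "j \<in> {..<n}" for i j
    using arg_cong[OF sym, of "\<lambda>M. M $$ (i, j)"] that A by auto
  hence "\<exists>(u :: nat \<Rightarrow> nat \<Rightarrow> real) e. (\<forall>a<n. \<forall>b<n. (\<Sum>i<n. u a i * u b i) = (if a = b then 1 else 0)) \<and>
     (\<forall>a<n. \<forall>i\<in>{..<n}. (\<Sum>j<n. A $$ (i, j) * u a j) = e a * u a i)"
    using symmetric_eigenbasis[of "{..<n}" "\<lambda>i j. A $$ (i, j)"] by simp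
  then obtain u :: "nat \<Rightarrow> nat \<Rightarrow> real" and e where
    u': "\<forall>a<n. \<forall>b<n. (\<Sum>i<n. u a i * u b i) = (if a = b then 1 else 0 :: real)" and
    e': "\<forall>a<n. \<forall>i\<in>{..<n}. (\<Sum>j<n. A $$ (i, j) * u a j) = e a * u a i"
    by (elim exE conjE)
  note u = u'[rule_format] and e = e'[rule_format, OF _ iffD2[OF lessThan_iff]]
  define U where "U = Matrix.mat n n (\<lambda>(i, a). u a i)"
  have U: "U \<in> carrier_mat n n" "transpose_mat U \<in> carrier_mat n n" unfolding U_def by auto
  have UU: "transpose_mat U * U = 1\<^sub>m n"
  proof (rule eq_matI)
    fix i j assume "i < dim_row (1\<^sub>m n)" "j < dim_col (1\<^sub>m n)"
    hence ij: "i < n" "j < n" by auto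
    show "(transpose_mat U * U) $$ (i, j) = 1\<^sub>m n $$ (i, j)"
      unfolding index_mult_mat_sum[OF U(2,1) ij] using ij u[OF ij] by (simp add: U_def)
  qed (use U in auto)
  have UU2: "U * transpose_mat U = 1\<^sub>m n" by (rule mat_mult_left_right_inverse[OF U(2,1) UU])
  have AU: "A * U = U * mat_diag n e"
  proof (rule eq_matI)
    fix i j assume "i < dim_row (U * mat_diag n e)" "j < dim_col (U * mat_diag n e)"
    hence ij: "i < n" "j < n" using U by (auto simp: mat_diag_def)
    have D: "mat_diag n e \<in> carrier_mat n n" by simp
    have "(A * U) $$ (i, j) = e j * u j i" unfolding index_mult_mat_sum[OF A U(1) ij] using e[OF ij(2,1)] ij by (simp add: U_def)
    moreover have "(U * mat_diag n e) $$ (i, j) = (\<Sum>k<n. if k = j then u j i * e j else 0)"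
      unfolding index_mult_mat_sum[OF U(1) D ij] using ij by (intro sum.cong refl) (auto simp: U_def mat_diag_index)
    ultimately show "(A * U) $$ (i, j) = (U * mat_diag n e) $$ (i, j)" using ij by simp
  qed (use A U in \<open>auto simp: mat_diag_def\<close>)
  have D: "mat_diag n e \<in> carrier_mat n n" by simp
  have "transpose_mat U * A * U = transpose_mat U * (A * U)" by (rule assoc_mult_mat[OF U(2) A U(1)])
  also have "\<dots> = transpose_mat U * U * mat_diag n e"
    unfolding AU by (rule assoc_mult_mat[symmetric, OF U(2,1) D])
  also have "\<dots> = mat_diag n e" unfolding UU by (rule left_mult_one_mat[OF D])
  finally show ?thesis using U(1) UU UU2 by blast
qed

lemma quadratic_form_column:
  fixes A :: "real mat"
  assumes A: "A \<in> carrier_mat n n" and P: "P \<in> carrier_mat n n" and i: "i < n"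
  shows "(transpose_mat P * A * P) $$ (i, i) = col P i \<bullet> (A *\<^sub>v col P i)"
proof -
  have tP: "transpose_mat P \<in> carrier_mat n n" using P by simp
  have "(transpose_mat P * A * P) $$ (i, i) = (transpose_mat P * (A * P)) $$ (i, i)"
    unfolding assoc_mult_mat[OF tP A P] ..
  also have "\<dots> = row (transpose_mat P) i \<bullet> col (A * P) i" using A P i by simp
  also have "\<dots> = col P i \<bullet> (A *\<^sub>v col P i)"
    using A P i by (simp add: col_mult2[OF A P i])
  finally show ?thesis .
qed

text \<open>Whitening: scaling the eigenvectors of R turns R into the identity, and an orthogonal
  diagonalisation of the transformed E keeps it so. The numbers \<open>e\<close> are the eigenvalues
  of E relative to R.\<close>

theorem simultaneous_diagonalization:
  fixes R E :: "real mat"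
  assumes R: "R \<in> carrier_mat n n" "transpose_mat R = R" and E: "E \<in> carrier_mat n n" "transpose_mat E = E"
    and pd: "\<And>v. v \<in> carrier_vec n \<Longrightarrow> v \<noteq> 0\<^sub>v n \<Longrightarrow> 0 < v \<bullet> (R *\<^sub>v v)"
  shows "\<exists>P e. P \<in> carrier_mat n n \<and> transpose_mat P * R * P = 1\<^sub>m n \<and> transpose_mat P * E * P = mat_diag n e"
proof -
  note ass = assoc_mult_mat[of _ n n _ n _ n]
  note tm = transpose_mult[of _ n n _ n]
  obtain U r where U: "U \<in> carrier_mat n n" "transpose_mat U * U = 1\<^sub>m n" "U * transpose_mat U = 1\<^sub>m n"
    "transpose_mat U * R * U = mat_diag n r"
    using symmetric_mat_diagonalization[OF R] by blast
  have r: "r i > 0" if i: "i < n" for i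
  proof -
    have "col U i \<noteq> 0\<^sub>v n"
    proof
      assume "col U i = 0\<^sub>v n"
      moreover have "(transpose_mat U * U) $$ (i, i) = col U i \<bullet> col U i" using U(1) i by simp
      ultimately show False unfolding U(2) using i by simp
    qed
    hence "0 < col U i \<bullet> (R *\<^sub>v col U i)" using U(1) i by (intro pd) auto
    thus ?thesis unfolding quadratic_form_column[OF R(1) U(1) i, symmetric] U(4) using i by (simp add: mat_diag_index)
  qed
  define D where "D = mat_diag n (\<lambda>i. 1 / sqrt (r i))"
  have D: "D \<in> carrier_mat n n" "transpose_mat D = D" unfolding D_def by (auto simp: mat_diag_def)
  define Q where "Q = U * D"
  have Q: "Q \<in> carrier_mat n n" unfolding Q_def using U D by simp
  have QRQ: "transpose_mat Q * R * Q = 1\<^sub>m n"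
  proof -
    have "transpose_mat Q * R * Q = D * (transpose_mat U * R * U) * D"
      unfolding Q_def using U(1) D R(1) by (simp add: tm ass)
    also have "\<dots> = mat_diag n (\<lambda>i. 1 / sqrt (r i) * r i * (1 / sqrt (r i)))"
      unfolding U(4) D_def mat_diag_diag ..
    also have "\<dots> = mat_diag n (\<lambda>_. 1)"
    proof -
      have "1 / sqrt (r i) * r i * (1 / sqrt (r i)) = 1" if "i < n" for i
        using r[OF that] by (simp add: real_div_sqrt)
      thus ?thesis by (intro eq_matI) (auto simp: mat_diag_def)
    qed
    finally show ?thesis by simp
  qed
  define E' where "E' = transpose_mat Q * E * Q"
  have E': "E' \<in> carrier_mat n n" "transpose_mat E' = E'" unfolding E'_def using Q E by (auto simp: tm ass)
  obtain V e where V: "V \<in> carrier_mat n n" "transpose_mat V * V = 1\<^sub>m n" "transpose_mat V * E' * V = mat_diag n e"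
    using symmetric_mat_diagonalization[OF E'] by blast
  have "transpose_mat (Q * V) * R * (Q * V) = transpose_mat V * (transpose_mat Q * R * Q) * V"
    using Q V(1) R(1) by (simp add: tm ass)
  also have "\<dots> = 1\<^sub>m n" unfolding QRQ using V by simp
  finally have 1: "transpose_mat (Q * V) * R * (Q * V) = 1\<^sub>m n" .
  have "transpose_mat (Q * V) * E * (Q * V) = transpose_mat V * E' * V"
    unfolding E'_def using Q V(1) E(1) by (simp add: tm ass)
  with 1 V(3) Q V(1) show ?thesis by (intro exI[of _ "Q * V"] exI[of _ e]) auto
qed

subsection \<open>Quadratic forms in Gaussian variables\<close>

text \<open>Removes the case distinction in \<open>gaussian_rv\<close>: a centred Gaussian variable,
  degenerate or not, has the law of sqrt v times a standard normal one.\<close>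

lemma gaussian_rv_distr:
  assumes "prob_space M" and X: "gaussian_rv M X" and mean: "(\<integral>\<omega>. X \<omega> \<partial>M) = 0"
    and var: "(\<integral>\<omega>. (X \<omega>)\<^sup>2 \<partial>M) = v"
  shows "distr M borel X = distr std_normal_distribution borel (\<lambda>z. sqrt v * z)"
proof -
  interpret prob_space M by fact
  have [measurable]: "X \<in> borel_measurable M" using X unfolding gaussian_rv_def by blast
  from X consider c where "AE \<omega> in M. X \<omega> = c"
    | \<mu> \<sigma> where "0 < \<sigma>" "distributed M lborel X (normal_density \<mu> \<sigma>)"
    unfolding gaussian_rv_def by blast
  thus ?thesis
  proof cases
    case 1
    have "(\<integral>\<omega>. X \<omega> \<partial>M) = (\<integral>\<omega>. c \<partial>M)" using 1 by (intro integral_cong_AE) auto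
    hence c: "c = 0" using mean prob_space by simp
    have "(\<integral>\<omega>. (X \<omega>)\<^sup>2 \<partial>M) = (\<integral>\<omega>. 0 \<partial>M)" using 1 c by (intro integral_cong_AE) auto
    hence v: "v = 0" using var by simp
    interpret S: prob_space std_normal_distribution
      by (rule prob_space_normal_density) simp
    have "distr M borel X = distr M borel (\<lambda>_. 0)" using 1 c by (intro distr_cong_AE) auto
    thus ?thesis using v by (simp add: distr_const S.distr_const)
  next
    case 2
    have \<mu>: "\<mu> = 0" using normal_distributed_expectation[OF 2] mean by simp
    have v: "v = \<sigma>\<^sup>2" using normal_distributed_variance[OF 2] mean var by simp
    have "distributed M lborel (\<lambda>x. (X x - \<mu>) / \<sigma>) (\<lambda>x. ennreal (std_normal_density x))"
      using 2 normal_standard_normal_convert by blast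
    hence d: "distr M lborel (\<lambda>x. X x / \<sigma>) = std_normal_distribution"
      unfolding distributed_def \<mu> by simp
    have "distr std_normal_distribution borel (\<lambda>z. sqrt v * z) = distr M borel ((\<lambda>z. sqrt v * z) \<circ> (\<lambda>x. X x / \<sigma>))"
      unfolding d[symmetric] by (subst distr_distr) auto
    also have "(\<lambda>z. sqrt v * z) \<circ> (\<lambda>x. X x / \<sigma>) = X" using v 2(1) by (auto simp: fun_eq_iff)
    finally show ?thesis by simp
  qed
qed

lemma
  fixes f :: "real \<Rightarrow> 'b::{banach, second_countable_topology}"
  assumes "prob_space M" "gaussian_rv M X" "(\<integral>\<omega>. X \<omega> \<partial>M) = 0" "(\<integral>\<omega>. (X \<omega>)\<^sup>2 \<partial>M) = v"
    and [measurable]: "f \<in> borel_measurable borel"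
  shows gaussian_rv_integral: "(\<integral>\<omega>. f (X \<omega>) \<partial>M) = (\<integral>z. f (sqrt v * z) \<partial>std_normal_distribution)"
    and gaussian_rv_integrable: "integrable M (\<lambda>\<omega>. f (X \<omega>)) \<longleftrightarrow> integrable std_normal_distribution (\<lambda>z. f (sqrt v * z))"
proof -
  have [measurable]: "X \<in> borel_measurable M" using assms(2) unfolding gaussian_rv_def by blast
  note d = gaussian_rv_distr[OF assms(1-4)]
  have "(\<integral>\<omega>. f (X \<omega>) \<partial>M) = (\<integral>x. f x \<partial>distr M borel X)" by (simp add: integral_distr)
  thus "(\<integral>\<omega>. f (X \<omega>) \<partial>M) = (\<integral>z. f (sqrt v * z) \<partial>std_normal_distribution)"
    unfolding d by (simp add: integral_distr)
  have "integrable M (\<lambda>\<omega>. f (X \<omega>)) \<longleftrightarrow> integrable (distr M borel X) f" by (simp add: integrable_distr_eq)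
  thus "integrable M (\<lambda>\<omega>. f (X \<omega>)) \<longleftrightarrow> integrable std_normal_distribution (\<lambda>z. f (sqrt v * z))"
    unfolding d by (simp add: integrable_distr_eq)
qed

lemma
  assumes "prob_space M" "gaussian_rv M X" "(\<integral>\<omega>. X \<omega> \<partial>M) = 0" "(\<integral>\<omega>. (X \<omega>)\<^sup>2 \<partial>M) = v"
  shows gaussian_rv_integrable_power: "integrable M (\<lambda>\<omega>. X \<omega> ^ m)"
    and gaussian_rv_fourth_moment: "(\<integral>\<omega>. X \<omega> ^ 4 \<partial>M) = 3 * v\<^sup>2"
    and gaussian_rv_char: "(\<integral>\<omega>. iexp (t * X \<omega>) \<partial>M) = complex_of_real (exp (- (t\<^sup>2 * v) / 2))"
proof -
  interpret prob_space M by fact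
  have v: "v \<ge> 0" using assms(4) by (auto intro!: integral_nonneg)
  show "integrable M (\<lambda>\<omega>. X \<omega> ^ m)"
    by (subst gaussian_rv_integrable[OF assms])
      (auto simp: power_mult_distrib integrable_std_normal_distribution_moment)
  have "sqrt v ^ 4 = (sqrt v ^ 2) ^ 2" unfolding power_mult[symmetric] by simp
  hence "sqrt v ^ 4 = v\<^sup>2" using v by simp
  thus "(\<integral>\<omega>. X \<omega> ^ 4 \<partial>M) = 3 * v\<^sup>2"
    using std_normal_distribution_even_moments(1)[of 2]
    by (subst gaussian_rv_integral[OF assms]) (auto simp: power_mult_distrib fact_numeral)
  have "(\<integral>\<omega>. iexp (t * X \<omega>) \<partial>M) = char std_normal_distribution (t * sqrt v)"
    unfolding char_def by (subst gaussian_rv_integral[OF assms]) (auto simp: mult.assoc)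
  also have "\<dots> = complex_of_real (exp (- (t\<^sup>2 * v) / 2))"
    using v by (simp add: char_std_normal_distribution power_mult_distrib)
  finally show "(\<integral>\<omega>. iexp (t * X \<omega>) \<partial>M) = complex_of_real (exp (- (t\<^sup>2 * v) / 2))" .
qed

subsection \<open>Factorisation through characteristic functions\<close>

context prob_space begin

text \<open>Reweighting the measure by g leaves the characteristic function of z unchanged, so by
  uniqueness the law of z is unchanged as well, and every function of z keeps its mean.\<close>

lemma char_factor_density:
  fixes g :: "'a \<Rightarrow> real" and h :: "real \<Rightarrow> complex"
  assumes [measurable]: "g \<in> borel_measurable M" "z \<in> borel_measurable M" "h \<in> borel_measurable borel"
    and bound: "\<And>\<omega>. \<omega> \<in> space M \<Longrightarrow> 0 \<le> g \<omega>" "\<And>\<omega>. \<omega> \<in> space M \<Longrightarrow> g \<omega> \<le> B" and one: "(\<integral>\<omega>. g \<omega> \<partial>M) = 1"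
    and char: "\<And>a. (\<integral>\<omega>. g \<omega> * iexp (a * z \<omega>) \<partial>M) = (\<integral>\<omega>. iexp (a * z \<omega>) \<partial>M)"
  shows "(\<integral>\<omega>. g \<omega> * h (z \<omega>) \<partial>M) = (\<integral>\<omega>. h (z \<omega>) \<partial>M)"
proof -
  have nn: "AE \<omega> in M. 0 \<le> g \<omega>" using bound by auto
  have int: "integrable M g"
    by (rule integrable_const_bound[where B = B]) (use bound in auto)
  have "emeasure (density M g) (space M) = 1"
    using one nn int by (subst emeasure_density) (auto simp: nn_integral_eq_integral cong: nn_integral_cong)
  hence "prob_space (density M g)" by (intro prob_spaceI) simp
  then interpret N: prob_space "density M g" .
  have eq: "(\<integral>\<omega>. f (z \<omega>) \<partial>density M g) = (\<integral>\<omega>. g \<omega> * f (z \<omega>) \<partial>M)"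
    if [measurable]: "f \<in> borel_measurable borel" for f :: "real \<Rightarrow> complex"
    using nn by (subst integral_density) (auto simp: scaleR_conv_of_real)
  have r1: "real_distribution (distr (density M g) borel z)"
    by (intro N.real_distribution_distr) simp
  have r2: "real_distribution (distr M borel z)"
    by (intro real_distribution_distr) simp
  have "char (distr (density M g) borel z) a = char (distr M borel z) a" for a
  proof -
    have "char (distr (density M g) borel z) a = (\<integral>\<omega>. iexp (a * z \<omega>) \<partial>density M g)"
      unfolding char_def by (subst integral_distr) auto
    also have "\<dots> = (\<integral>\<omega>. iexp (a * z \<omega>) \<partial>M)" by (subst eq) (measurable, simp only: char)
    also have "\<dots> = char (distr M borel z) a"
      unfolding char_def by (subst integral_distr) auto
    finally show ?thesis .
  qed
  hence "char (distr (density M g) borel z) = char (distr M borel z)" by blast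
  hence d: "distr (density M g) borel z = distr M borel z" by (rule Levy_uniqueness[OF r1 r2])
  have "(\<integral>\<omega>. g \<omega> * h (z \<omega>) \<partial>M) = (\<integral>x. h x \<partial>distr (density M g) borel z)"
    by (simp add: integral_distr eq)
  also have "\<dots> = (\<integral>\<omega>. h (z \<omega>) \<partial>M)" unfolding d by (simp add: integral_distr)
  finally show ?thesis .
qed

text \<open>The affine change g -> (g + B + 1) / c makes g a probability density; hypothesis and
  conclusion are both compatible with it.\<close>

lemma char_factor_real:
  fixes g :: "'a \<Rightarrow> real" and h :: "real \<Rightarrow> complex"
  assumes [measurable]: "g \<in> borel_measurable M" "z \<in> borel_measurable M" "h \<in> borel_measurable borel"
    and bound: "\<And>\<omega>. \<omega> \<in> space M \<Longrightarrow> \<bar>g \<omega>\<bar> \<le> B" and h: "\<And>x. norm (h x) \<le> C"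
    and char: "\<And>a. (\<integral>\<omega>. g \<omega> * iexp (a * z \<omega>) \<partial>M) = (\<integral>\<omega>. g \<omega> \<partial>M) * (\<integral>\<omega>. iexp (a * z \<omega>) \<partial>M)"
  shows "(\<integral>\<omega>. g \<omega> * h (z \<omega>) \<partial>M) = (\<integral>\<omega>. g \<omega> \<partial>M) * (\<integral>\<omega>. h (z \<omega>) \<partial>M)"
proof -
  have int: "integrable M g" by (rule integrable_const_bound[where B = B]) (use bound in auto)
  have intf: "integrable M (\<lambda>\<omega>. f (z \<omega>))" "integrable M (\<lambda>\<omega>. g \<omega> * f (z \<omega>))"
    if [measurable]: "f \<in> borel_measurable borel" and "\<And>x. norm (f x) \<le> D" for f :: "real \<Rightarrow> complex" and D
  proof -
    show "integrable M (\<lambda>\<omega>. f (z \<omega>))" by (rule integrable_const_bound[where B = D]) (use that in auto)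
    show "integrable M (\<lambda>\<omega>. g \<omega> * f (z \<omega>))"
      by (rule integrable_const_bound[where B = "B * D"])
        (use that bound in \<open>auto simp: norm_mult intro!: mult_mono' AE_I2\<close>)
  qed
  obtain \<omega>0 where "\<omega>0 \<in> space M" using not_empty by auto
  hence B: "B \<ge> 0" using bound[of \<omega>0] by auto
  \<comment> \<open>Mean of the shifted g. The shift B alone would make it nonnegative, the extra 1
    makes it positive.\<close>
  define c where "c = (\<integral>\<omega>. g \<omega> \<partial>M) + B + 1"
  have "\<bar>\<integral>\<omega>. g \<omega> \<partial>M\<bar> \<le> (\<integral>\<omega>. \<bar>g \<omega>\<bar> \<partial>M)" by (rule integral_abs_bound)
  also have "\<dots> \<le> (\<integral>\<omega>. B \<partial>M)" using int bound by (intro integral_mono) auto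
  finally have "\<bar>\<integral>\<omega>. g \<omega> \<partial>M\<bar> \<le> B" using prob_space by simp
  hence c: "c > 0" unfolding c_def by linarith
  define g' where "g' = (\<lambda>\<omega>. (g \<omega> + (B + 1)) / c)"
  have split: "(\<integral>\<omega>. g' \<omega> * f (z \<omega>) \<partial>M) = ((\<integral>\<omega>. g \<omega> * f (z \<omega>) \<partial>M) + (B + 1) * (\<integral>\<omega>. f (z \<omega>) \<partial>M)) / c"
    if [measurable]: "f \<in> borel_measurable borel" and D: "\<And>x. norm (f x) \<le> D" for f :: "real \<Rightarrow> complex" and D
  proof -
    have "(\<integral>\<omega>. g' \<omega> * f (z \<omega>) \<partial>M) = (\<integral>\<omega>. (g \<omega> * f (z \<omega>) + (B + 1) * f (z \<omega>)) / c \<partial>M)"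
      unfolding g'_def by (intro Bochner_Integration.integral_cong refl) (simp add: field_simps)
    also have "\<dots> = (\<integral>\<omega>. (g \<omega> * f (z \<omega>) + (B + 1) * f (z \<omega>)) \<partial>M) / c" by simp
    also have "(\<integral>\<omega>. (g \<omega> * f (z \<omega>) + (B + 1) * f (z \<omega>)) \<partial>M)
      = (\<integral>\<omega>. g \<omega> * f (z \<omega>) \<partial>M) + (\<integral>\<omega>. (B + 1) * f (z \<omega>) \<partial>M)"
      using intf[OF that] by (intro Bochner_Integration.integral_add) auto
    finally show ?thesis by simp
  qed
  have one: "(\<integral>\<omega>. g' \<omega> \<partial>M) = 1"
    using int c prob_space unfolding g'_def by (simp add: c_def)
  have [measurable]: "g' \<in> borel_measurable M" unfolding g'_def by simp
  have cc: "complex_of_real c = (\<integral>\<omega>. g \<omega> \<partial>M) + (B + 1)" unfolding c_def by simp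
  have "(\<integral>\<omega>. g' \<omega> * h (z \<omega>) \<partial>M) = (\<integral>\<omega>. h (z \<omega>) \<partial>M)"
  proof (rule char_factor_density[where B = "(2 * B + 1) / c"])
    fix \<omega> assume "\<omega> \<in> space M"
    from bound[OF this] show "0 \<le> g' \<omega>" "g' \<omega> \<le> (2 * B + 1) / c"
      unfolding g'_def using c B by (auto intro!: divide_nonneg_pos divide_right_mono)
  next
    fix a
    have "(\<integral>\<omega>. g' \<omega> * iexp (a * z \<omega>) \<partial>M)
      = ((\<integral>\<omega>. g \<omega> * iexp (a * z \<omega>) \<partial>M) + (B + 1) * (\<integral>\<omega>. iexp (a * z \<omega>) \<partial>M)) / c"
      by (rule split[of "\<lambda>x. iexp (a * x)" 1]) auto
    also have "\<dots> = (complex_of_real c * (\<integral>\<omega>. iexp (a * z \<omega>) \<partial>M)) / c"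
      unfolding char cc by (simp add: algebra_simps)
    finally show "(\<integral>\<omega>. g' \<omega> * iexp (a * z \<omega>) \<partial>M) = (\<integral>\<omega>. iexp (a * z \<omega>) \<partial>M)" using c by simp
  qed (use one in auto)
  hence "((\<integral>\<omega>. g \<omega> * h (z \<omega>) \<partial>M) + (B + 1) * (\<integral>\<omega>. h (z \<omega>) \<partial>M)) = c * (\<integral>\<omega>. h (z \<omega>) \<partial>M)"
    using split[of h C] h c by (simp add: field_simps)
  thus ?thesis unfolding cc by (simp add: algebra_simps)
qed

text \<open>Real and imaginary parts are combinations of G and its conjugate; the hypothesis for the
  conjugate is that for G at -a, conjugated.\<close>

lemma char_factor:
  fixes G :: "'a \<Rightarrow> complex" and h :: "real \<Rightarrow> complex"
  assumes [measurable]: "G \<in> borel_measurable M" "z \<in> borel_measurable M" "h \<in> borel_measurable borel"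
    and bound: "\<And>\<omega>. \<omega> \<in> space M \<Longrightarrow> norm (G \<omega>) \<le> B" and h: "\<And>x. norm (h x) \<le> C"
    and char: "\<And>a. (\<integral>\<omega>. G \<omega> * iexp (a * z \<omega>) \<partial>M) = (\<integral>\<omega>. G \<omega> \<partial>M) * (\<integral>\<omega>. iexp (a * z \<omega>) \<partial>M)"
  shows "(\<integral>\<omega>. G \<omega> * h (z \<omega>) \<partial>M) = (\<integral>\<omega>. G \<omega> \<partial>M) * (\<integral>\<omega>. h (z \<omega>) \<partial>M)"
proof -
  have intG: "integrable M G" by (rule integrable_const_bound[where B = B]) (use bound in auto)
  have int: "integrable M (\<lambda>\<omega>. H \<omega> * f (z \<omega>))"
    if [measurable]: "f \<in> borel_measurable borel" "H \<in> borel_measurable M" 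
      and "\<And>\<omega>. \<omega> \<in> space M \<Longrightarrow> norm (H \<omega>) \<le> B" "\<And>x. norm (f x) \<le> D" for f H :: "_ \<Rightarrow> complex" and D
    by (rule integrable_const_bound[where B = "B * D"])
        (use that bound in \<open>auto simp: norm_mult intro!: mult_mono' AE_I2\<close>)
  have cnj: "(\<integral>\<omega>. cnj (G \<omega>) * iexp (a * z \<omega>) \<partial>M) = cnj (\<integral>\<omega>. G \<omega> \<partial>M) * (\<integral>\<omega>. iexp (a * z \<omega>) \<partial>M)" for a
  proof -
    have "(\<integral>\<omega>. cnj (G \<omega>) * iexp (a * z \<omega>) \<partial>M) = (\<integral>\<omega>. cnj (G \<omega> * iexp (- a * z \<omega>)) \<partial>M)"
      by (simp add: exp_cnj)
    also have "\<dots> = cnj ((\<integral>\<omega>. G \<omega> \<partial>M) * (\<integral>\<omega>. iexp (- a * z \<omega>) \<partial>M))"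
      by (simp only: Bochner_Integration.integral_cnj char)
    also have "\<dots> = cnj (\<integral>\<omega>. G \<omega> \<partial>M) * (\<integral>\<omega>. cnj (iexp (- a * z \<omega>)) \<partial>M)"
      by (simp only: Bochner_Integration.integral_cnj complex_cnj_mult)
    finally show ?thesis by (simp add: exp_cnj)
  qed
  have [measurable]: "(\<lambda>\<omega>. cnj (G \<omega>)) \<in> borel_measurable M"
    by (rule borel_measurable_continuous_on[where f = cnj]) (auto intro: continuous_intros)
  have Re: "(\<integral>\<omega>. Re (G \<omega>) * f (z \<omega>) \<partial>M) = ((\<integral>\<omega>. G \<omega> * f (z \<omega>) \<partial>M) + (\<integral>\<omega>. cnj (G \<omega>) * f (z \<omega>) \<partial>M)) / 2"
    and Im: "(\<integral>\<omega>. Im (G \<omega>) * f (z \<omega>) \<partial>M) = ((\<integral>\<omega>. G \<omega> * f (z \<omega>) \<partial>M) - (\<integral>\<omega>. cnj (G \<omega>) * f (z \<omega>) \<partial>M)) / (2 * \<i>)"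
    if [measurable]: "f \<in> borel_measurable borel" and D: "\<And>x. norm (f x) \<le> D" for f :: "real \<Rightarrow> complex" and D
  proof -
    have i: "integrable M (\<lambda>\<omega>. G \<omega> * f (z \<omega>))" "integrable M (\<lambda>\<omega>. cnj (G \<omega>) * f (z \<omega>))"
      using int[of f G D] int[of f "\<lambda>\<omega>. cnj (G \<omega>)" D] bound D by auto
    show "(\<integral>\<omega>. Re (G \<omega>) * f (z \<omega>) \<partial>M) = ((\<integral>\<omega>. G \<omega> * f (z \<omega>) \<partial>M) + (\<integral>\<omega>. cnj (G \<omega>) * f (z \<omega>) \<partial>M)) / 2"
    proof -
      have "(\<integral>\<omega>. G \<omega> * f (z \<omega>) + cnj (G \<omega>) * f (z \<omega>) \<partial>M) = (\<integral>\<omega>. 2 * (Re (G \<omega>) * f (z \<omega>)) \<partial>M)"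
        by (intro Bochner_Integration.integral_cong refl) (simp add: complex_add_cnj flip: distrib_right)
      thus ?thesis unfolding Bochner_Integration.integral_add[OF i] by simp
    qed
    show "(\<integral>\<omega>. Im (G \<omega>) * f (z \<omega>) \<partial>M) = ((\<integral>\<omega>. G \<omega> * f (z \<omega>) \<partial>M) - (\<integral>\<omega>. cnj (G \<omega>) * f (z \<omega>) \<partial>M)) / (2 * \<i>)"
    proof -
      have "(\<integral>\<omega>. G \<omega> * f (z \<omega>) - cnj (G \<omega>) * f (z \<omega>) \<partial>M) = (\<integral>\<omega>. (2 * \<i>) * (Im (G \<omega>) * f (z \<omega>)) \<partial>M)"
        by (intro Bochner_Integration.integral_cong refl) (simp add: complex_diff_cnj flip: left_diff_distrib)
      also have "\<dots> = (2 * \<i>) * (\<integral>\<omega>. (Im (G \<omega>) * f (z \<omega>)) \<partial>M)" by (rule integral_mult_right_zero)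
      finally show ?thesis unfolding Bochner_Integration.integral_diff[OF i] by simp
    qed
  qed
  have R: "complex_of_real (\<integral>\<omega>. Re (G \<omega>) \<partial>M) = ((\<integral>\<omega>. G \<omega> \<partial>M) + cnj (\<integral>\<omega>. G \<omega> \<partial>M)) / 2"
    and I: "complex_of_real (\<integral>\<omega>. Im (G \<omega>) \<partial>M) = ((\<integral>\<omega>. G \<omega> \<partial>M) - cnj (\<integral>\<omega>. G \<omega> \<partial>M)) / (2 * \<i>)"
    using intG by (simp_all add: complex_eq_iff)
  have bRI: "\<bar>Re (G \<omega>)\<bar> \<le> B" "\<bar>Im (G \<omega>)\<bar> \<le> B" if "\<omega> \<in> space M" for \<omega>
    using bound[OF that] abs_Re_le_cmod[of "G \<omega>"] abs_Im_le_cmod[of "G \<omega>"] by linarith+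
  have 1: "(\<integral>\<omega>. Re (G \<omega>) * h (z \<omega>) \<partial>M) = (\<integral>\<omega>. Re (G \<omega>) \<partial>M) * (\<integral>\<omega>. h (z \<omega>) \<partial>M)"
  proof (rule char_factor_real[OF _ _ _ bRI(1) h])
    fix a show "(\<integral>\<omega>. Re (G \<omega>) * iexp (a * z \<omega>) \<partial>M) = (\<integral>\<omega>. Re (G \<omega>) \<partial>M) * (\<integral>\<omega>. iexp (a * z \<omega>) \<partial>M)"
      by (subst Re[of "\<lambda>x. iexp (a * x)" 1]) (simp_all only: char cnj R add_divide_distrib distrib_right times_divide_eq_left, measurable)
  qed auto
  have 2: "(\<integral>\<omega>. Im (G \<omega>) * h (z \<omega>) \<partial>M) = (\<integral>\<omega>. Im (G \<omega>) \<partial>M) * (\<integral>\<omega>. h (z \<omega>) \<partial>M)"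
  proof (rule char_factor_real[OF _ _ _ bRI(2) h])
    fix a show "(\<integral>\<omega>. Im (G \<omega>) * iexp (a * z \<omega>) \<partial>M) = (\<integral>\<omega>. Im (G \<omega>) \<partial>M) * (\<integral>\<omega>. iexp (a * z \<omega>) \<partial>M)"
      by (subst Im[of "\<lambda>x. iexp (a * x)" 1]) (simp_all only: char cnj I diff_divide_distrib left_diff_distrib times_divide_eq_left, measurable)
  qed auto
  have alg: "a = (a + b) / 2 + \<i> * ((a - b) / (2 * \<i>))" for a b :: complex
    by (simp add: field_simps)
  have "(\<integral>\<omega>. G \<omega> * h (z \<omega>) \<partial>M) = (\<integral>\<omega>. Re (G \<omega>) * h (z \<omega>) \<partial>M) + \<i> * (\<integral>\<omega>. Im (G \<omega>) * h (z \<omega>) \<partial>M)"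
    unfolding Re[OF \<open>h \<in> borel_measurable borel\<close> h] Im[OF \<open>h \<in> borel_measurable borel\<close> h]
    by (rule alg)
  also have "\<dots> = (\<integral>\<omega>. G \<omega> \<partial>M) * (\<integral>\<omega>. h (z \<omega>) \<partial>M)"
    unfolding 1 2 R I by (subst alg[of "\<integral>\<omega>. G \<omega> \<partial>M" "cnj (\<integral>\<omega>. G \<omega> \<partial>M)"]) (simp only: distrib_right mult.assoc)
  finally show ?thesis .
qed

end

text \<open>Characteristic function of a centred chi-square variable with one degree of
  freedom.\<close>

definition chi_char :: "real \<Rightarrow> complex" where
  "chi_char u = (\<integral>z. iexp (u * (z\<^sup>2 - 1)) \<partial>std_normal_distribution)"

lemma norm_chi_char_le: "norm (chi_char u) \<le> 1"
proof -
  interpret S: prob_space std_normal_distribution by (rule prob_space_normal_density) simp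
  have "norm (chi_char u) \<le> (\<integral>z. norm (iexp (u * (z\<^sup>2 - 1))) \<partial>std_normal_distribution)"
    unfolding chi_char_def by (rule integral_norm_bound)
  also have "\<dots> = 1" by (simp only: norm_exp_i_times) (use S.prob_space in simp)
  finally show ?thesis .
qed

lemma exp_minus_quadratic_bound:
  fixes x :: real assumes "x \<ge> 0" shows "\<bar>exp (- x) - (1 - x)\<bar> \<le> x\<^sup>2"
proof -
  have "1 + x \<le> exp x" by (rule exp_ge_add_one_self)
  hence "exp (- x) \<le> 1 / (1 + x)" using assms by (simp add: exp_minus field_simps)
  also have "\<dots> \<le> 1 - x + x\<^sup>2"
  proof -
    have "(1 - x + x\<^sup>2) * (1 + x) = 1 + x ^ 3" by (simp add: algebra_simps power2_eq_square power3_eq_cube)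
    thus ?thesis using assms by (simp add: divide_le_eq)
  qed
  finally have "exp (- x) \<le> 1 - x + x\<^sup>2" .
  moreover have "1 - x \<le> exp (- x)" using exp_ge_add_one_self[of "- x"] by simp
  ultimately show ?thesis by simp
qed

text \<open>Third-order Taylor bound for the exponential: z^2 - 1 has mean 0 and variance 2, which
  produces 1 - u^2, and its third absolute moment is finite.\<close>

lemma chi_char_approx: "\<exists>K\<ge>0. \<forall>u. norm (chi_char u - (1 - u\<^sup>2)) \<le> K * \<bar>u\<bar> ^ 3"
proof -
  let ?N = std_normal_distribution
  interpret S: prob_space ?N by (rule prob_space_normal_density) simp
  have int: "integrable ?N (\<lambda>z. z ^ k)" for k by (rule integrable_std_normal_distribution_moment)
  have m2: "(\<integral>z. z\<^sup>2 \<partial>?N) = 1" using std_normal_distribution_even_moments(1)[of 1] by simp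
  have m4: "(\<integral>z. z ^ 4 \<partial>?N) = 3" using std_normal_distribution_even_moments(1)[of 2] by (simp add: fact_numeral)
  have c1: "(\<integral>z. z\<^sup>2 - 1 \<partial>?N) = 0" using int[of 2] m2 S.prob_space by simp
  have sq: "(z\<^sup>2 - 1)\<^sup>2 = z ^ 4 - 2 * z\<^sup>2 + 1" for z :: real
    by (simp add: power2_eq_square eval_nat_numeral algebra_simps)
  have c2: "(\<integral>z. (z\<^sup>2 - 1)\<^sup>2 \<partial>?N) = 2" unfolding sq using int[of 2] int[of 4] m2 m4 S.prob_space by simp
  have i3: "integrable ?N (\<lambda>z. \<bar>z\<^sup>2 - 1\<bar> ^ 3)"
  proof -
    have "integrable ?N (\<lambda>z. (z\<^sup>2 - 1) ^ 3)"
    proof -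
      have "(z\<^sup>2 - 1) ^ 3 = z ^ 6 - 3 * z ^ 4 + 3 * z\<^sup>2 - 1" for z :: real
        by (simp add: power2_eq_square eval_nat_numeral algebra_simps)
      thus ?thesis using int[of 2] int[of 4] int[of 6] by simp
    qed
    hence "integrable ?N (\<lambda>z. \<bar>(z\<^sup>2 - 1) ^ 3\<bar>)" by (rule integrable_abs)
    thus ?thesis by (simp add: power_abs)
  qed
  define K where "K = (\<integral>z. \<bar>z\<^sup>2 - 1\<bar> ^ 3 \<partial>?N) / 6"
  have bound: "norm (chi_char u - (1 - u\<^sup>2)) \<le> K * \<bar>u\<bar> ^ 3" for u
  proof -
    let ?p = "\<lambda>z::real. 1 + \<i> * complex_of_real (u * (z\<^sup>2 - 1)) - complex_of_real (u\<^sup>2 * (z\<^sup>2 - 1)\<^sup>2 / 2)"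
    have ii: "integrable ?N (\<lambda>z. iexp (u * (z\<^sup>2 - 1)))"
      by (rule S.integrable_const_bound[where B = 1]) (auto simp del: of_real_mult)
    have i4: "integrable ?N (\<lambda>z. complex_of_real (u * (z\<^sup>2 - 1)))" "integrable ?N (\<lambda>z. complex_of_real (u\<^sup>2 * (z\<^sup>2 - 1)\<^sup>2 / 2))"
    proof -
      have r: "integrable ?N (\<lambda>z. u * (z\<^sup>2 - 1))" "integrable ?N (\<lambda>z. u\<^sup>2 * (z\<^sup>2 - 1)\<^sup>2 / 2)"
        unfolding sq using int[of 2] int[of 4] by simp_all
      show "integrable ?N (\<lambda>z. complex_of_real (u * (z\<^sup>2 - 1)))" by (rule integrable_of_real[OF r(1)])
      show "integrable ?N (\<lambda>z. complex_of_real (u\<^sup>2 * (z\<^sup>2 - 1)\<^sup>2 / 2))" by (rule integrable_of_real[OF r(2)])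
    qed
    have i5: "integrable ?N (\<lambda>z. \<i> * complex_of_real (u * (z\<^sup>2 - 1)))" by (rule integrable_mult_right[OF i4(1)])
    have i6: "integrable ?N (\<lambda>z. 1 + \<i> * complex_of_real (u * (z\<^sup>2 - 1)))"
      by (rule Bochner_Integration.integrable_add[OF _ i5]) simp
    have ip: "integrable ?N ?p" by (rule Bochner_Integration.integrable_diff[OF i6 i4(2)])
    have ep: "(\<integral>z. ?p z \<partial>?N) = 1 - u\<^sup>2"
    proof -
      have "(\<integral>z. ?p z \<partial>?N) = (\<integral>z. 1 \<partial>?N) + \<i> * (\<integral>z. complex_of_real (u * (z\<^sup>2 - 1)) \<partial>?N) - (\<integral>z. complex_of_real (u\<^sup>2 * (z\<^sup>2 - 1)\<^sup>2 / 2) \<partial>?N)"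
        unfolding Bochner_Integration.integral_diff[OF i6 i4(2)]
        by (subst Bochner_Integration.integral_add[OF _ i5]) (simp_all only: integral_mult_right_zero, simp)
      also have "(\<integral>z. complex_of_real (u * (z\<^sup>2 - 1)) \<partial>?N) = complex_of_real (u * (\<integral>z. z\<^sup>2 - 1 \<partial>?N))"
        by (simp only: integral_complex_of_real integral_mult_right_zero)
      also have "(\<integral>z. complex_of_real (u\<^sup>2 * (z\<^sup>2 - 1)\<^sup>2 / 2) \<partial>?N) = complex_of_real (u\<^sup>2 * (\<integral>z. (z\<^sup>2 - 1)\<^sup>2 \<partial>?N) / 2)"
        by (simp only: integral_complex_of_real integral_mult_right_zero integral_divide_zero)
      finally show ?thesis unfolding c1 c2 using S.prob_space by simp
    qed
    have "norm (chi_char u - (1 - u\<^sup>2)) = norm (\<integral>z. iexp (u * (z\<^sup>2 - 1)) - ?p z \<partial>?N)"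
      unfolding chi_char_def Bochner_Integration.integral_diff[OF ii ip] ep by simp
    also have "\<dots> \<le> (\<integral>z. norm (iexp (u * (z\<^sup>2 - 1)) - ?p z) \<partial>?N)" by (rule integral_norm_bound)
    also have "\<dots> \<le> (\<integral>z. \<bar>u\<bar> ^ 3 * \<bar>z\<^sup>2 - 1\<bar> ^ 3 / 6 \<partial>?N)"
    proof (rule integral_mono)
      show "integrable ?N (\<lambda>z. norm (iexp (u * (z\<^sup>2 - 1)) - ?p z))" by (rule integrable_norm[OF Bochner_Integration.integrable_diff[OF ii ip]])
      show "integrable ?N (\<lambda>z. \<bar>u\<bar> ^ 3 * \<bar>z\<^sup>2 - 1\<bar> ^ 3 / 6)" using i3 by simp
      fix z :: real
      have "norm (iexp (u * (z\<^sup>2 - 1)) - (\<Sum>k\<le>2. (\<i> * complex_of_real (u * (z\<^sup>2 - 1))) ^ k / fact k)) \<le> \<bar>u * (z\<^sup>2 - 1)\<bar> ^ Suc 2 / fact (Suc 2)"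
        by (rule iexp_approx1)
      also have "(\<Sum>k\<le>2. (\<i> * complex_of_real (u * (z\<^sup>2 - 1))) ^ k / fact k) = ?p z"
        by (simp add: numeral_2_eq_2 power_mult_distrib)
      also have "\<bar>u * (z\<^sup>2 - 1)\<bar> ^ Suc 2 / fact (Suc 2) = \<bar>u\<bar> ^ 3 * \<bar>z\<^sup>2 - 1\<bar> ^ 3 / 6"
        by (simp add: abs_mult power_mult_distrib fact_numeral)
      finally show "norm (iexp (u * (z\<^sup>2 - 1)) - ?p z) \<le> \<bar>u\<bar> ^ 3 * \<bar>z\<^sup>2 - 1\<bar> ^ 3 / 6" .
    qed
    also have "\<dots> = K * \<bar>u\<bar> ^ 3" unfolding K_def by simp
    finally show ?thesis .
  qed
  have "K \<ge> 0" unfolding K_def by simp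
  with bound show ?thesis by blast
qed

text \<open>Standard white noise in terms of what a Gaussian process provides: Gaussian linear
  combinations and identity covariance. Independence is derived from these. Only the indices below
  \<open>n\<close> are constrained.\<close>

locale gaussian_white_noise = prob_space M for M :: "'a measure" +
  fixes w :: "nat \<Rightarrow> 'a \<Rightarrow> real" and n :: nat
  assumes gaussian: "\<And>a. gaussian_rv M (\<lambda>\<omega>. \<Sum>j<n. a j * w j \<omega>)"
    and mean: "\<And>j. j < n \<Longrightarrow> (\<integral>\<omega>. w j \<omega> \<partial>M) = 0"
    and cov: "\<And>i j. i < n \<Longrightarrow> j < n \<Longrightarrow> (\<integral>\<omega>. w i \<omega> * w j \<omega> \<partial>M) = (if i = j then 1 else 0)"
begin

lemma gaussian_single: assumes "j < n" shows "gaussian_rv M (w j)"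
proof -
  have "(\<Sum>i<n. (if i = j then 1 else 0) * w i \<omega>) = w j \<omega>" for \<omega>
    using assms by (subst sum.cong[OF refl, where h = "\<lambda>i. if i = j then w i \<omega> else 0"]) auto
  thus ?thesis using gaussian[of "\<lambda>i. if i = j then 1 else 0"] by simp
qed

lemma w_measurable [measurable]: "j < n \<Longrightarrow> w j \<in> borel_measurable M"
  using gaussian_single unfolding gaussian_rv_def by blast

lemma var_single: "j < n \<Longrightarrow> (\<integral>\<omega>. (w j \<omega>)\<^sup>2 \<partial>M) = 1"
  using cov[of j j] by (simp add: power2_eq_square)

lemma integrable_power: "j < n \<Longrightarrow> integrable M (\<lambda>\<omega>. w j \<omega> ^ m)"
  using gaussian_rv_integrable_power[OF prob_space_axioms gaussian_single mean var_single] by blast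

lemma integrable_single: "j < n \<Longrightarrow> integrable M (w j)"
  using integrable_power[of j 1] by simp

lemma integrable_product:
  assumes "i < n" "j < n" shows "integrable M (\<lambda>\<omega>. w i \<omega> * w j \<omega>)"
proof (rule Bochner_Integration.integrable_bound)
  show "integrable M (\<lambda>\<omega>. (w i \<omega>)\<^sup>2 + (w j \<omega>)\<^sup>2)" using assms integrable_power by simp
  show "(\<lambda>\<omega>. w i \<omega> * w j \<omega>) \<in> borel_measurable M" using assms by measurable
  have "\<bar>x * y\<bar> \<le> x\<^sup>2 + y\<^sup>2" for x y :: real
  proof -
    have "2 * (\<bar>x\<bar> * \<bar>y\<bar>) \<le> x\<^sup>2 + y\<^sup>2" using sum_squares_bound[of "\<bar>x\<bar>" "\<bar>y\<bar>"] by (simp add: mult.assoc)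
    moreover have "0 \<le> \<bar>x\<bar> * \<bar>y\<bar>" by simp
    ultimately show ?thesis unfolding abs_mult by linarith
  qed
  thus "AE \<omega> in M. norm (w i \<omega> * w j \<omega>) \<le> norm ((w i \<omega>)\<^sup>2 + (w j \<omega>)\<^sup>2)" by simp
qed

lemma
  shows combination_mean: "(\<integral>\<omega>. (\<Sum>j<n. a j * w j \<omega>) \<partial>M) = 0"
    and combination_var: "(\<integral>\<omega>. (\<Sum>j<n. a j * w j \<omega>)\<^sup>2 \<partial>M) = (\<Sum>j<n. (a j)\<^sup>2)"
proof -
  show "(\<integral>\<omega>. (\<Sum>j<n. a j * w j \<omega>) \<partial>M) = 0"
    by (subst Bochner_Integration.integral_sum) (auto intro: integrable_single simp: mean)
  have "(\<integral>\<omega>. (\<Sum>j<n. a j * w j \<omega>)\<^sup>2 \<partial>M) = (\<integral>\<omega>. (\<Sum>i<n. \<Sum>j<n. a i * a j * (w i \<omega> * w j \<omega>)) \<partial>M)"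
    by (simp add: power2_eq_square sum_product algebra_simps)
  also have "\<dots> = (\<Sum>i<n. \<integral>\<omega>. (\<Sum>j<n. a i * a j * (w i \<omega> * w j \<omega>)) \<partial>M)"
    by (rule Bochner_Integration.integral_sum)
      (auto intro!: Bochner_Integration.integrable_sum integrable_mult_right integrable_product)
  also have "\<dots> = (\<Sum>i<n. \<Sum>j<n. \<integral>\<omega>. a i * a j * (w i \<omega> * w j \<omega>) \<partial>M)"
    by (intro sum.cong refl Bochner_Integration.integral_sum)
      (auto intro!: integrable_mult_right integrable_product)
  also have "\<dots> = (\<Sum>i<n. \<Sum>j<n. a i * a j * (\<integral>\<omega>. w i \<omega> * w j \<omega> \<partial>M))" by simp
  also have "\<dots> = (\<Sum>i<n. \<Sum>j<n. if i = j then a i * a j else 0)"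
    by (intro sum.cong refl) (simp add: cov)
  also have "\<dots> = (\<Sum>j<n. (a j)\<^sup>2)" by (simp add: power2_eq_square)
  finally show "(\<integral>\<omega>. (\<Sum>j<n. a j * w j \<omega>)\<^sup>2 \<partial>M) = (\<Sum>j<n. (a j)\<^sup>2)" .
qed

lemma char_combination:
  "(\<integral>\<omega>. iexp (\<Sum>j<n. a j * w j \<omega>) \<partial>M) = (\<Prod>j<n. complex_of_real (exp (- (a j)\<^sup>2 / 2)))"
proof -
  have "(\<integral>\<omega>. iexp (1 * (\<Sum>j<n. a j * w j \<omega>)) \<partial>M) = complex_of_real (exp (- (1\<^sup>2 * (\<Sum>j<n. (a j)\<^sup>2)) / 2))"
    by (rule gaussian_rv_char[OF prob_space_axioms gaussian combination_mean combination_var])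
  also have "\<dots> = (\<Prod>j<n. complex_of_real (exp (- (a j)\<^sup>2 / 2)))"
  proof -
    have "(\<Prod>j<n. exp (- (a j)\<^sup>2 / 2)) = exp (\<Sum>j<n. - (a j)\<^sup>2 / 2)" by (simp add: exp_sum)
    also have "(\<Sum>j<n. - (a j)\<^sup>2 / 2) = - (1\<^sup>2 * (\<Sum>j<n. (a j)\<^sup>2)) / 2" by (simp add: sum_negf sum_divide_distrib)
    finally show ?thesis unfolding of_real_prod[symmetric] by simp
  qed
  finally show ?thesis by simp
qed

lemma char_single: "j < n \<Longrightarrow> (\<integral>\<omega>. iexp (a * w j \<omega>) \<partial>M) = complex_of_real (exp (- a\<^sup>2 / 2))"
  using gaussian_rv_char[OF prob_space_axioms gaussian_single mean var_single, of j a] by simp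

text \<open>Independence of the coordinates. Exponentials of linear combinations factorise because
  the combinations are Gaussian with additive variance; one coordinate at a time,
  \<open>char_factor\<close> then replaces the exponential by an arbitrary bounded function.\<close>

theorem integral_prod_eq_prod_integral:
  fixes h :: "nat \<Rightarrow> real \<Rightarrow> complex"
  assumes [measurable]: "\<And>j. h j \<in> borel_measurable borel" and h: "\<And>j x. norm (h j x) \<le> 1"
  shows "(\<integral>\<omega>. (\<Prod>j<n. h j (w j \<omega>)) \<partial>M) = (\<Prod>j<n. \<integral>\<omega>. h j (w j \<omega>) \<partial>M)"
proof -
  \<comment> \<open>Induction invariant: arbitrary functions of the first m coordinates,
    exponentials of all others with free coefficients. The freedom of \<open>a\<close> supplies the
    hypothesis of \<open>char_factor\<close> in the next step.\<close>
  have "(\<integral>\<omega>. (\<Prod>j<m. h j (w j \<omega>)) * iexp (\<Sum>j\<in>{m..<n}. a j * w j \<omega>) \<partial>M)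
      = (\<Prod>j<m. \<integral>\<omega>. h j (w j \<omega>) \<partial>M) * (\<Prod>j\<in>{m..<n}. complex_of_real (exp (- (a j)\<^sup>2 / 2)))"
    if "m \<le> n" for m and a :: "nat \<Rightarrow> real"
    using that
  proof (induction m arbitrary: a)
    case 0
    thus ?case using char_combination[of a] by (simp add: lessThan_atLeast0)
  next
    case (Suc m)
    define G where "G = (\<lambda>\<omega>. (\<Prod>j<m. h j (w j \<omega>)) * iexp (\<Sum>j\<in>{Suc m..<n}. a j * w j \<omega>))"
    define c where "c = (\<Prod>j<m. \<integral>\<omega>. h j (w j \<omega>) \<partial>M) * (\<Prod>j\<in>{Suc m..<n}. complex_of_real (exp (- (a j)\<^sup>2 / 2)))"
    have m: "m < n" "{m..<n} = insert m {Suc m..<n}" using Suc.prems by auto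
    have E: "(\<integral>\<omega>. G \<omega> * iexp (b * w m \<omega>) \<partial>M) = c * complex_of_real (exp (- b\<^sup>2 / 2))" for b
    proof -
      have "(\<integral>\<omega>. G \<omega> * iexp (b * w m \<omega>) \<partial>M) = (\<integral>\<omega>. (\<Prod>j<m. h j (w j \<omega>)) * iexp (\<Sum>j\<in>{m..<n}. (a(m := b)) j * w j \<omega>) \<partial>M)"
      proof (intro Bochner_Integration.integral_cong refl)
        fix \<omega>
        have "(\<Sum>j\<in>{Suc m..<n}. (a(m := b)) j * w j \<omega>) = (\<Sum>j\<in>{Suc m..<n}. a j * w j \<omega>)"
          by (intro sum.cong refl) auto
        hence s: "(\<Sum>j\<in>{m..<n}. (a(m := b)) j * w j \<omega>) = (\<Sum>j\<in>{Suc m..<n}. a j * w j \<omega>) + b * w m \<omega>"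
          unfolding m(2) by simp
        show "G \<omega> * iexp (b * w m \<omega>) = (\<Prod>j<m. h j (w j \<omega>)) * iexp (\<Sum>j\<in>{m..<n}. (a(m := b)) j * w j \<omega>)"
          unfolding s G_def of_real_add distrib_left exp_add by (simp only: mult.assoc)
      qed
      also have "\<dots> = (\<Prod>j<m. \<integral>\<omega>. h j (w j \<omega>) \<partial>M) * (\<Prod>j\<in>{m..<n}. complex_of_real (exp (- ((a(m := b)) j)\<^sup>2 / 2)))"
        using Suc.prems by (intro Suc.IH) simp
      also have "\<dots> = c * complex_of_real (exp (- b\<^sup>2 / 2))"
      proof -
        have "(\<Prod>j\<in>{Suc m..<n}. complex_of_real (exp (- ((a(m := b)) j)\<^sup>2 / 2))) = (\<Prod>j\<in>{Suc m..<n}. complex_of_real (exp (- (a j)\<^sup>2 / 2)))"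
          by (intro prod.cong refl) auto
        thus ?thesis unfolding c_def m(2) by simp
      qed
      finally show ?thesis .
    qed
    have EG: "(\<integral>\<omega>. G \<omega> \<partial>M) = c" using E[of 0] by simp
    have [measurable]: "G \<in> borel_measurable M" 
    proof -
      have "(\<lambda>\<omega>. \<Prod>j<m. h j (w j \<omega>)) \<in> borel_measurable M"
        using m(1) by (intro borel_measurable_prod measurable_compose[OF w_measurable]) auto
      moreover have "(\<lambda>\<omega>. \<Sum>j\<in>{Suc m..<n}. a j * w j \<omega>) \<in> borel_measurable M"
        by (intro borel_measurable_sum borel_measurable_times measurable_const w_measurable) auto
      ultimately show ?thesis unfolding G_def by measurable
    qed
    have G1: "norm (G \<omega>) \<le> 1" for \<omega>
      unfolding G_def norm_mult norm_exp_i_times mult_1_right prod_norm[symmetric] by (rule prod_le_1) (use h in auto)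
    have F: "(\<integral>\<omega>. G \<omega> * iexp (b * w m \<omega>) \<partial>M) = (\<integral>\<omega>. G \<omega> \<partial>M) * (\<integral>\<omega>. iexp (b * w m \<omega>) \<partial>M)" for b
      by (simp only: E EG char_single[OF m(1)])
    have "(\<integral>\<omega>. G \<omega> * h m (w m \<omega>) \<partial>M) = (\<integral>\<omega>. G \<omega> \<partial>M) * (\<integral>\<omega>. h m (w m \<omega>) \<partial>M)"
      by (rule char_factor[where B = 1 and C = 1, OF _ w_measurable[OF m(1)] _ G1 h F]) measurable
    moreover have "(\<integral>\<omega>. (\<Prod>j<Suc m. h j (w j \<omega>)) * iexp (\<Sum>j\<in>{Suc m..<n}. a j * w j \<omega>) \<partial>M) = (\<integral>\<omega>. G \<omega> * h m (w m \<omega>) \<partial>M)"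
      unfolding G_def by (simp add: mult_ac)
    ultimately show ?case unfolding EG unfolding c_def by (simp add: mult_ac)
  qed
  from this[of n] show ?thesis by simp
qed

lemma char_chi_combination:
  "(\<integral>\<omega>. iexp (\<Sum>j<n. d j * ((w j \<omega>)\<^sup>2 - 1)) \<partial>M) = (\<Prod>j<n. chi_char (d j))"
proof -
  have "(\<integral>\<omega>. iexp (\<Sum>j<n. d j * ((w j \<omega>)\<^sup>2 - 1)) \<partial>M) = (\<integral>\<omega>. (\<Prod>j<n. iexp (d j * ((w j \<omega>)\<^sup>2 - 1))) \<partial>M)"
    by (simp add: exp_sum sum_distrib_left)
  also have "\<dots> = (\<Prod>j<n. \<integral>\<omega>. iexp (d j * ((w j \<omega>)\<^sup>2 - 1)) \<partial>M)"
    by (rule integral_prod_eq_prod_integral[where h = "\<lambda>j x. iexp (d j * (x\<^sup>2 - 1))"]) (simp_all only: norm_exp_i_times order.refl, measurable)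
  also have "\<dots> = (\<Prod>j<n. chi_char (d j))"
  proof (intro prod.cong refl)
    fix j assume "j \<in> {..<n}"
    hence j: "j < n" by simp
    show "(\<integral>\<omega>. iexp (d j * ((w j \<omega>)\<^sup>2 - 1)) \<partial>M) = chi_char (d j)"
      unfolding chi_char_def
      using gaussian_rv_integral[OF prob_space_axioms gaussian_single mean var_single, OF j j j, of "\<lambda>x. iexp (d j * (x\<^sup>2 - 1))"]
      by simp
  qed
  finally show ?thesis .
qed

text \<open>Polarisation: x^2 y^2 is a combination of fourth powers of linear combinations, whose
  moments are those of Gaussian variables.\<close>

lemma fourth_mixed:
  assumes ij: "i < n" "j < n"
  shows "integrable M (\<lambda>\<omega>. (w i \<omega>)\<^sup>2 * (w j \<omega>)\<^sup>2)"
    and "(\<integral>\<omega>. (w i \<omega>)\<^sup>2 * (w j \<omega>)\<^sup>2 \<partial>M) = (if i = j then 3 else 1)"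
proof -
  have g: "integrable M (\<lambda>\<omega>. (w i \<omega> + c * w j \<omega>) ^ 4)" "(\<integral>\<omega>. (w i \<omega> + c * w j \<omega>) ^ 4 \<partial>M) = 3 * (1 + c\<^sup>2)\<^sup>2"
    if "i \<noteq> j" for c
  proof -
    define a where "a = (\<lambda>l. if l = i then 1 else if l = j then c else 0)"
    have eq: "(\<Sum>l<n. a l * w l \<omega>) = w i \<omega> + c * w j \<omega>" for \<omega>
    proof -
      have "(\<Sum>l<n. a l * w l \<omega>) = (\<Sum>l\<in>{i,j}. a l * w l \<omega>)"
        by (rule sum.mono_neutral_right) (use ij in \<open>auto simp: a_def\<close>)
      thus ?thesis using that by (simp add: a_def)
    qed
    have eq2: "(\<Sum>l<n. (a l)\<^sup>2) = 1 + c\<^sup>2"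
    proof -
      have "(\<Sum>l<n. (a l)\<^sup>2) = (\<Sum>l\<in>{i,j}. (a l)\<^sup>2)"
        by (rule sum.mono_neutral_right) (use ij in \<open>auto simp: a_def\<close>)
      thus ?thesis using that by (simp add: a_def)
    qed
    note r = prob_space_axioms gaussian[of a] combination_mean[of a] combination_var[of a, unfolded eq2]
    show "integrable M (\<lambda>\<omega>. (w i \<omega> + c * w j \<omega>) ^ 4)" using gaussian_rv_integrable_power[OF r, of 4] by (simp add: eq)
    show "(\<integral>\<omega>. (w i \<omega> + c * w j \<omega>) ^ 4 \<partial>M) = 3 * (1 + c\<^sup>2)\<^sup>2" using gaussian_rv_fourth_moment[OF r] by (simp add: eq)
  qed
  note i4 = integrable_power[OF ij(1), of 4] integrable_power[OF ij(2), of 4]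
  have m4: "(\<integral>\<omega>. w l \<omega> ^ 4 \<partial>M) = 3" if "l < n" for l
    using gaussian_rv_fourth_moment[OF prob_space_axioms gaussian_single mean var_single, OF that that that] by simp
  have p: "x\<^sup>2 * y\<^sup>2 = ((x + 1 * y) ^ 4 + (x + (-1) * y) ^ 4 - 2 * x ^ 4 - 2 * y ^ 4) / 12" for x y :: real
    by (simp add: power2_eq_square eval_nat_numeral algebra_simps)
  have s: "x\<^sup>2 * x\<^sup>2 = x ^ 4" for x :: real by (simp add: eval_nat_numeral)
  show "integrable M (\<lambda>\<omega>. (w i \<omega>)\<^sup>2 * (w j \<omega>)\<^sup>2)"
  proof (cases "i = j")
    case True thus ?thesis using i4(1) by (simp only: s)
  next
    case False
    show ?thesis unfolding p using g(1)[OF False, of 1] g(1)[OF False, of "-1"] i4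
      by (intro integrable_divide Bochner_Integration.integrable_diff Bochner_Integration.integrable_add integrable_mult_right)
  qed
  show "(\<integral>\<omega>. (w i \<omega>)\<^sup>2 * (w j \<omega>)\<^sup>2 \<partial>M) = (if i = j then 3 else 1)"
  proof (cases "i = j")
    case True thus ?thesis using m4[OF ij(1)] by (simp only: s) simp
  next
    case False
    note I = g(1)[OF False, of 1] g(1)[OF False, of "-1"] i4
    have "(\<integral>\<omega>. (w i \<omega>)\<^sup>2 * (w j \<omega>)\<^sup>2 \<partial>M) = ((\<integral>\<omega>. (w i \<omega> + 1 * w j \<omega>) ^ 4 \<partial>M) + (\<integral>\<omega>. (w i \<omega> + (-1) * w j \<omega>) ^ 4 \<partial>M)
       - 2 * (\<integral>\<omega>. w i \<omega> ^ 4 \<partial>M) - 2 * (\<integral>\<omega>. w j \<omega> ^ 4 \<partial>M)) / 12"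
      unfolding p using I by simp
    also have "\<dots> = 1" unfolding g(2)[OF False] m4[OF ij(1)] m4[OF ij(2)] by simp
    finally show ?thesis using False by simp
  qed
qed

text \<open>The variables w^2 - 1 are uncorrelated with variance 2.\<close>

theorem second_moment_chi_combination:
  shows "integrable M (\<lambda>\<omega>. (\<Sum>j<n. d j * ((w j \<omega>)\<^sup>2 - 1))\<^sup>2)"
    and "(\<integral>\<omega>. (\<Sum>j<n. d j * ((w j \<omega>)\<^sup>2 - 1))\<^sup>2 \<partial>M) = 2 * (\<Sum>j<n. (d j)\<^sup>2)"
proof -
  have e: "(\<Sum>j<n. d j * ((w j \<omega>)\<^sup>2 - 1))\<^sup>2
     = (\<Sum>i<n. \<Sum>j<n. d i * d j * ((w i \<omega>)\<^sup>2 * (w j \<omega>)\<^sup>2 - (w i \<omega>)\<^sup>2 - (w j \<omega>)\<^sup>2 + 1))" for \<omega>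
    by (simp add: power2_eq_square sum_product algebra_simps)
  have int: "integrable M (\<lambda>\<omega>. (w i \<omega>)\<^sup>2 * (w j \<omega>)\<^sup>2 - (w i \<omega>)\<^sup>2 - (w j \<omega>)\<^sup>2 + 1)" if "i < n" "j < n" for i j
    using fourth_mixed(1)[OF that] integrable_power[OF that(1), of 2] integrable_power[OF that(2), of 2] by simp
  have val: "(\<integral>\<omega>. (w i \<omega>)\<^sup>2 * (w j \<omega>)\<^sup>2 - (w i \<omega>)\<^sup>2 - (w j \<omega>)\<^sup>2 + 1 \<partial>M) = (if i = j then 2 else 0)" if "i < n" "j < n" for i j
    using fourth_mixed[OF that] integrable_power[OF that(1), of 2] integrable_power[OF that(2), of 2]
      var_single[OF that(1)] var_single[OF that(2)] prob_space by simp
  show "integrable M (\<lambda>\<omega>. (\<Sum>j<n. d j * ((w j \<omega>)\<^sup>2 - 1))\<^sup>2)"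
    unfolding e using int by (intro Bochner_Integration.integrable_sum integrable_mult_right) auto
  have "(\<integral>\<omega>. (\<Sum>j<n. d j * ((w j \<omega>)\<^sup>2 - 1))\<^sup>2 \<partial>M)
     = (\<Sum>i<n. \<Sum>j<n. d i * d j * (\<integral>\<omega>. (w i \<omega>)\<^sup>2 * (w j \<omega>)\<^sup>2 - (w i \<omega>)\<^sup>2 - (w j \<omega>)\<^sup>2 + 1 \<partial>M))"
  proof -
    let ?f = "\<lambda>i j \<omega>. (w i \<omega>)\<^sup>2 * (w j \<omega>)\<^sup>2 - (w i \<omega>)\<^sup>2 - (w j \<omega>)\<^sup>2 + 1"
    have "(\<integral>\<omega>. (\<Sum>i<n. \<Sum>j<n. d i * d j * ?f i j \<omega>) \<partial>M) = (\<Sum>i<n. \<integral>\<omega>. (\<Sum>j<n. d i * d j * ?f i j \<omega>) \<partial>M)"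
      using int by (intro Bochner_Integration.integral_sum Bochner_Integration.integrable_sum integrable_mult_right) auto
    also have "\<dots> = (\<Sum>i<n. \<Sum>j<n. \<integral>\<omega>. d i * d j * ?f i j \<omega> \<partial>M)"
      using int by (intro sum.cong refl Bochner_Integration.integral_sum integrable_mult_right) auto
    finally show ?thesis unfolding e integral_mult_right_zero .
  qed
  also have "\<dots> = (\<Sum>i<n. \<Sum>j<n. if i = j then 2 * (d i * d j) else 0)"
    by (intro sum.cong refl) (simp add: val)
  also have "\<dots> = 2 * (\<Sum>j<n. (d j)\<^sup>2)" by (simp add: power2_eq_square sum_distrib_left)
  finally show "(\<integral>\<omega>. (\<Sum>j<n. d j * ((w j \<omega>)\<^sup>2 - 1))\<^sup>2 \<partial>M) = 2 * (\<Sum>j<n. (d j)\<^sup>2)" .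
qed

lemma chi_combination_tail:
  assumes "a > 0"
  shows "prob {\<omega>\<in>space M. a \<le> \<bar>\<Sum>j<n. d j * ((w j \<omega>)\<^sup>2 - 1)\<bar>} \<le> 2 * (\<Sum>j<n. (d j)\<^sup>2) / a\<^sup>2"
proof -
  have "prob {\<omega>\<in>space M. a\<^sup>2 \<le> (\<Sum>j<n. d j * ((w j \<omega>)\<^sup>2 - 1))\<^sup>2} \<le> (\<integral>\<omega>. (\<Sum>j<n. d j * ((w j \<omega>)\<^sup>2 - 1))\<^sup>2 \<partial>M) / a\<^sup>2"
    using assms second_moment_chi_combination(1) by (intro integral_Markov_inequality_measure[where A = "{}"]) auto
  moreover have "{\<omega>\<in>space M. a\<^sup>2 \<le> (\<Sum>j<n. d j * ((w j \<omega>)\<^sup>2 - 1))\<^sup>2} = {\<omega>\<in>space M. a \<le> \<bar>\<Sum>j<n. d j * ((w j \<omega>)\<^sup>2 - 1)\<bar>}"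
    using assms abs_le_square_iff[of a] by auto
  ultimately show ?thesis unfolding second_moment_chi_combination(2) by simp
qed

end

text \<open>A quantitative central limit theorem. The difference of two products of factors in the
  unit disc is at most the sum of the differences, and both factors of each pair agree with 1 - d^2
  up to third order. \<open>K\<close> precedes all other quantifiers, so the bound is uniform over
  triangular arrays.\<close>

theorem chi_combination_char_limit:
  "\<exists>K\<ge>0. \<forall>(M :: 'a measure) w n d D. gaussian_white_noise M w n \<longrightarrow> (\<forall>j<n. \<bar>d j\<bar> \<le> D) \<longrightarrow>
       norm ((\<integral>\<omega>. iexp (\<Sum>j<n. d j * ((w j \<omega>)\<^sup>2 - 1)) \<partial>M) - exp (- (\<Sum>j<n. (d j)\<^sup>2))) \<le> (K * D + D\<^sup>2) * (\<Sum>j<n. (d j)\<^sup>2)"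
proof -
  obtain K where K: "K \<ge> 0" "\<And>u. norm (chi_char u - (1 - u\<^sup>2)) \<le> K * \<bar>u\<bar> ^ 3" using chi_char_approx by auto
  have tri: "a - c = (a - b) + (b - c)" for a b c :: complex by simp
  have main: "norm ((\<integral>\<omega>. iexp (\<Sum>j<n. d j * ((w j \<omega>)\<^sup>2 - 1)) \<partial>M) - exp (- (\<Sum>j<n. (d j)\<^sup>2))) \<le> (K * D + D\<^sup>2) * (\<Sum>j<n. (d j)\<^sup>2)"
    if "gaussian_white_noise M w n" and D: "\<And>j. j < n \<Longrightarrow> \<bar>d j\<bar> \<le> D" for M :: "'a measure" and w n d D
  proof -
    interpret gaussian_white_noise M w n by (rule that(1))
    have "norm ((\<integral>\<omega>. iexp (\<Sum>j<n. d j * ((w j \<omega>)\<^sup>2 - 1)) \<partial>M) - exp (- (\<Sum>j<n. (d j)\<^sup>2)))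
        = norm ((\<Prod>j<n. chi_char (d j)) - (\<Prod>j<n. complex_of_real (exp (- (d j)\<^sup>2))))"
    proof -
      have "exp (- (\<Sum>j<n. (d j)\<^sup>2)) = (\<Prod>j<n. exp (- (d j)\<^sup>2))"
        unfolding sum_negf[symmetric] by (rule exp_sum) simp
      thus ?thesis unfolding char_chi_combination by (simp only: of_real_prod)
    qed
    also have "\<dots> \<le> (\<Sum>j<n. norm (chi_char (d j) - complex_of_real (exp (- (d j)\<^sup>2))))"
      by (rule norm_prod_diff) (auto simp: norm_chi_char_le)
    also have "\<dots> \<le> (\<Sum>j<n. (K * D + D\<^sup>2) * (d j)\<^sup>2)"
    proof (rule sum_mono)
      fix j assume "j \<in> {..<n}"
      hence dj: "\<bar>d j\<bar> \<le> D" using D by simp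
      have "norm (chi_char (d j) - complex_of_real (exp (- (d j)\<^sup>2)))
         \<le> norm (chi_char (d j) - (1 - (d j)\<^sup>2)) + norm (complex_of_real ((1 - (d j)\<^sup>2) - exp (- (d j)\<^sup>2)))"
      proof -
        have "chi_char (d j) - complex_of_real (exp (- (d j)\<^sup>2))
          = (chi_char (d j) - (1 - (d j)\<^sup>2)) + complex_of_real ((1 - (d j)\<^sup>2) - exp (- (d j)\<^sup>2))"
          by (subst of_real_diff) (rule tri)
        thus ?thesis by (simp only: norm_triangle_ineq)
      qed
      also have "\<dots> \<le> K * \<bar>d j\<bar> ^ 3 + ((d j)\<^sup>2)\<^sup>2"
        using K(2)[of "d j"] exp_minus_quadratic_bound[of "(d j)\<^sup>2"] unfolding norm_of_real by (intro add_mono) (auto simp: abs_minus_commute)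
      also have "\<dots> = (K * \<bar>d j\<bar> + (d j)\<^sup>2) * (d j)\<^sup>2"
        by (simp add: power2_eq_square power3_eq_cube algebra_simps)
      also have "\<dots> \<le> (K * D + D\<^sup>2) * (d j)\<^sup>2"
      proof -
        have "(d j)\<^sup>2 \<le> D\<^sup>2" using power_mono[OF dj, of 2] by simp
        thus ?thesis using K(1) dj by (intro mult_right_mono add_mono mult_left_mono) auto
      qed
      finally show "norm (chi_char (d j) - complex_of_real (exp (- (d j)\<^sup>2))) \<le> (K * D + D\<^sup>2) * (d j)\<^sup>2" .
    qed
    finally show ?thesis by (simp add: sum_distrib_left)
  qed
  show ?thesis by (intro exI[of _ K] conjI allI impI K(1), rule main) simp_all
qed

subsection \<open>Taylor expansion from partial derivatives\<close>

text \<open>Iterated mean value inequality on a segment that may point in the negative direction.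
  Derivatives are taken within the segment, matching \<open>has_partial_derivative\<close>, which
  only sees increments inside \<Theta>; the constants are not sharp.\<close>

lemma
  fixes g g1 g2 g3 :: "real \<Rightarrow> real" and t :: real
  defines "S \<equiv> closed_segment 0 t"
  assumes g: "\<And>\<tau>. \<tau> \<in> S \<Longrightarrow> (g has_real_derivative g1 \<tau>) (at \<tau> within S)"
  shows segment_taylor1: "(\<And>\<tau>. \<tau> \<in> S \<Longrightarrow> \<bar>g1 \<tau>\<bar> \<le> C) \<Longrightarrow> \<bar>g t - g 0\<bar> \<le> C * \<bar>t\<bar>"
    and segment_taylor2: "(\<And>\<tau>. \<tau> \<in> S \<Longrightarrow> (g1 has_real_derivative g2 \<tau>) (at \<tau> within S)) \<Longrightarrow>
      (\<And>\<tau>. \<tau> \<in> S \<Longrightarrow> \<bar>g2 \<tau>\<bar> \<le> C) \<Longrightarrow> \<bar>g t - g 0 - t * g1 0\<bar> \<le> C * t\<^sup>2"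
    and segment_taylor3: "(\<And>\<tau>. \<tau> \<in> S \<Longrightarrow> (g1 has_real_derivative g2 \<tau>) (at \<tau> within S)) \<Longrightarrow>
      (\<And>\<tau>. \<tau> \<in> S \<Longrightarrow> (g2 has_real_derivative g3 \<tau>) (at \<tau> within S)) \<Longrightarrow>
      (\<And>\<tau>. \<tau> \<in> S \<Longrightarrow> \<bar>g3 \<tau>\<bar> \<le> C) \<Longrightarrow> \<bar>g t - g 0 - t * g1 0 - t\<^sup>2 / 2 * g2 0\<bar> \<le> C * \<bar>t\<bar> ^ 3"
proof -
  have conv: "convex S" and S0: "0 \<in> S" unfolding S_def by auto
  have abs_le: "\<bar>\<tau>\<bar> \<le> \<bar>t\<bar>" if "\<tau> \<in> S" for \<tau>
    using that unfolding S_def closed_segment_eq_real_ivl by (auto split: if_splits)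
  have b: "\<bar>f \<tau> - f 0\<bar> \<le> K * \<bar>\<tau>\<bar>"
    if "\<And>\<tau>. \<tau> \<in> S \<Longrightarrow> (f has_real_derivative f1 \<tau>) (at \<tau> within S)" "\<And>\<tau>. \<tau> \<in> S \<Longrightarrow> \<bar>f1 \<tau>\<bar> \<le> K" "\<tau> \<in> S"
    for f f1 :: "real \<Rightarrow> real" and K \<tau>
    using field_differentiable_bound[OF conv, of f f1 K \<tau> 0] that S0 by auto
  have tS: "t \<in> S" unfolding S_def by simp
  show "\<bar>g t - g 0\<bar> \<le> C * \<bar>t\<bar>" if "\<And>\<tau>. \<tau> \<in> S \<Longrightarrow> \<bar>g1 \<tau>\<bar> \<le> C" using b[OF g that tS] .
  have second: "\<bar>f \<tau> - f 0 - \<tau> * f1 0\<bar> \<le> K * \<bar>t\<bar> * \<bar>\<tau>\<bar>"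
    if f: "\<And>\<tau>. \<tau> \<in> S \<Longrightarrow> (f has_real_derivative f1 \<tau>) (at \<tau> within S)"
      and f1: "\<And>\<tau>. \<tau> \<in> S \<Longrightarrow> (f1 has_real_derivative f2 \<tau>) (at \<tau> within S)"
      and K: "\<And>\<tau>. \<tau> \<in> S \<Longrightarrow> \<bar>f2 \<tau>\<bar> \<le> K" and \<tau>: "\<tau> \<in> S"
    for f f1 f2 :: "real \<Rightarrow> real" and K \<tau>
  proof -
    have K0: "K \<ge> 0" using K[OF S0] by linarith
    have "\<bar>(f \<tau> - \<tau> * f1 0) - (f 0 - 0 * f1 0)\<bar> \<le> (K * \<bar>t\<bar>) * \<bar>\<tau>\<bar>"
    proof (rule b[where f = "\<lambda>\<tau>. f \<tau> - \<tau> * f1 0" and ?f1.0 = "\<lambda>\<tau>. f1 \<tau> - f1 0", OF _ _ \<tau>])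
      fix \<sigma> assume \<sigma>: "\<sigma> \<in> S"
      show "((\<lambda>\<tau>. f \<tau> - \<tau> * f1 0) has_real_derivative f1 \<sigma> - f1 0) (at \<sigma> within S)"
        using f[OF \<sigma>] by (auto intro!: derivative_eq_intros)
      show "\<bar>f1 \<sigma> - f1 0\<bar> \<le> K * \<bar>t\<bar>"
        using b[OF f1 K \<sigma>] mult_left_mono[OF abs_le[OF \<sigma>] K0] by linarith
    qed
    thus ?thesis by simp
  qed
  show "\<bar>g t - g 0 - t * g1 0\<bar> \<le> C * t\<^sup>2"
    if "\<And>\<tau>. \<tau> \<in> S \<Longrightarrow> (g1 has_real_derivative g2 \<tau>) (at \<tau> within S)" "\<And>\<tau>. \<tau> \<in> S \<Longrightarrow> \<bar>g2 \<tau>\<bar> \<le> C"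
    using second[OF g that tS] by (simp add: power2_eq_square mult.assoc)
  show "\<bar>g t - g 0 - t * g1 0 - t\<^sup>2 / 2 * g2 0\<bar> \<le> C * \<bar>t\<bar> ^ 3"
    if g1: "\<And>\<tau>. \<tau> \<in> S \<Longrightarrow> (g1 has_real_derivative g2 \<tau>) (at \<tau> within S)"
      and g2: "\<And>\<tau>. \<tau> \<in> S \<Longrightarrow> (g2 has_real_derivative g3 \<tau>) (at \<tau> within S)"
      and C: "\<And>\<tau>. \<tau> \<in> S \<Longrightarrow> \<bar>g3 \<tau>\<bar> \<le> C"
  proof -
    have C0: "C \<ge> 0" using C[OF S0] by linarith
    have "\<bar>(g t - t * g1 0 - t\<^sup>2 / 2 * g2 0) - (g 0 - 0 * g1 0 - 0\<^sup>2 / 2 * g2 0)\<bar> \<le> (C * \<bar>t\<bar> * \<bar>t\<bar>) * \<bar>t\<bar>"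
    proof (rule b[where f = "\<lambda>\<tau>. g \<tau> - \<tau> * g1 0 - \<tau>\<^sup>2 / 2 * g2 0" and ?f1.0 = "\<lambda>\<tau>. g1 \<tau> - g1 0 - \<tau> * g2 0", OF _ _ tS])
      fix \<sigma> assume \<sigma>: "\<sigma> \<in> S"
      show "((\<lambda>\<tau>. g \<tau> - \<tau> * g1 0 - \<tau>\<^sup>2 / 2 * g2 0) has_real_derivative g1 \<sigma> - g1 0 - \<sigma> * g2 0) (at \<sigma> within S)"
        using g[OF \<sigma>] by (auto intro!: derivative_eq_intros)
      have "C * \<bar>t\<bar> * \<bar>\<sigma>\<bar> \<le> C * \<bar>t\<bar> * \<bar>t\<bar>" using C0 abs_le[OF \<sigma>] by (intro mult_left_mono) auto
      thus "\<bar>g1 \<sigma> - g1 0 - \<sigma> * g2 0\<bar> \<le> C * \<bar>t\<bar> * \<bar>t\<bar>"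
        using second[OF g1 g2 C \<sigma>] by linarith
    qed
    thus ?thesis by (simp add: power3_eq_cube mult.assoc)
  qed
qed

text \<open>A shift of the line parameter by \<tau>: a derivative at increment 0 from the displaced
  base point becomes a derivative at \<tau> along a segment inside \<Theta>.\<close>

lemma has_partial_derivative_segment:
  assumes d: "has_partial_derivative \<Theta> i f D (a + \<tau> *\<^sub>R axis i 1)"
    and sub: "\<And>\<sigma>. \<sigma> \<in> S \<Longrightarrow> a + \<sigma> *\<^sub>R axis i 1 \<in> \<Theta>"
  shows "((\<lambda>\<sigma>. f (a + \<sigma> *\<^sub>R axis i 1)) has_real_derivative D) (at \<tau> within S)"
proof -
  let ?h = "\<lambda>t. f (a + \<tau> *\<^sub>R axis i 1 + t *\<^sub>R axis i 1)"
  have e: "a + \<tau> *\<^sub>R axis i 1 + (\<sigma> - \<tau>) *\<^sub>R axis i 1 = a + \<sigma> *\<^sub>R axis i 1" for \<sigma>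
    by (simp add: algebra_simps)
  have "(?h has_real_derivative D) (at (\<tau> - \<tau>) within (\<lambda>\<sigma>. \<sigma> - \<tau>) ` S)"
    unfolding diff_self using d unfolding has_partial_derivative_def
    by (rule has_field_derivative_subset) (unfold image_subset_iff mem_Collect_eq e, use sub in blast)
  moreover have "((\<lambda>\<sigma>. \<sigma> - \<tau>) has_real_derivative 1) (at \<tau> within S)"
    by (auto intro!: derivative_eq_intros)
  ultimately have "(?h \<circ> (\<lambda>\<sigma>. \<sigma> - \<tau>) has_real_derivative D * 1) (at \<tau> within S)"
    by (rule DERIV_image_chain)
  thus ?thesis by (simp add: o_def e)
qed

text \<open>
  The weights \<open>\<kappa>\<close> are 0, 1/2 or 1: moving from \<open>\<theta>0\<close> to \<open>\<theta>0 + h\<close> one coordinate at a time only meets each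
  mixed derivative in one order of differentiation, so that symmetry of second derivatives is not used.
\<close>

lemma partial_taylor:
  fixes Dk :: "'p::finite list \<Rightarrow> real ^ 'p \<Rightarrow> real ^ 'd \<Rightarrow> real" and \<theta>0 :: "real ^ 'p" and r :: real
  defines "S \<equiv> {\<theta>. \<forall>i. \<bar>vec_nth \<theta> i - vec_nth \<theta>0 i\<bar> \<le> r}"
  assumes S: "S \<subseteq> \<Theta>"
    and D: "\<And>is i \<theta> x. length is < 3 \<Longrightarrow> \<theta> \<in> \<Theta> \<Longrightarrow> has_partial_derivative \<Theta> i (\<lambda>\<theta>'. Dk is \<theta>' x) (Dk (i # is) \<theta> x) \<theta>"
    and bd: "\<And>is \<theta> x. 1 \<le> length is \<Longrightarrow> length is \<le> 3 \<Longrightarrow> \<theta> \<in> \<Theta> \<Longrightarrow> \<bar>Dk is \<theta> x\<bar> \<le> w x"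
  shows "\<exists>\<kappa> :: 'p \<Rightarrow> 'p \<Rightarrow> real. \<forall>h x. (\<forall>i. \<bar>vec_nth h i\<bar> \<le> r) \<longrightarrow>
    \<bar>Dk [] (\<theta>0 + h) x - Dk [] \<theta>0 x - (\<Sum>i\<in>UNIV. vec_nth h i * Dk [i] \<theta>0 x) - (\<Sum>i\<in>UNIV. \<Sum>j\<in>UNIV. \<kappa> i j * vec_nth h i * vec_nth h j * Dk [j, i] \<theta>0 x)\<bar>
      \<le> w x * (\<Sum>i\<in>UNIV. \<bar>vec_nth h i\<bar>) ^ 3"
proof -
  \<comment> \<open>The increment restricted to the coordinates in A. Enlarging A by one coordinate
    moves along a single axis, and the box \<open>S\<close> contains the whole path.\<close>
  define pr where "pr = (\<lambda>(h :: real ^ 'p) A. (\<chi> i. if i \<in> A then vec_nth h i else 0))"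
  have pr0: "pr h {} = 0" for h unfolding pr_def by (simp add: Finite_Cartesian_Product.vec_eq_iff)
  have pr1: "pr h (insert i A) = pr h A + vec_nth h i *\<^sub>R axis i 1" if "i \<notin> A" for h i A
    unfolding pr_def using that by (auto simp: Finite_Cartesian_Product.vec_eq_iff axis_def)
  have prU: "pr h UNIV = h" for h unfolding pr_def by (simp add: Finite_Cartesian_Product.vec_eq_iff)
  have inS: "\<theta>0 + pr h A + \<sigma> *\<^sub>R axis i 1 \<in> S"
    if h: "\<forall>i. \<bar>vec_nth h i\<bar> \<le> r" and "i \<notin> A" and \<sigma>: "\<sigma> \<in> closed_segment 0 (vec_nth h i)" for h A i \<sigma>
  proof -
    have "\<bar>\<sigma>\<bar> \<le> \<bar>vec_nth h i\<bar>" using \<sigma> unfolding closed_segment_eq_real_ivl by (auto split: if_splits)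
    hence "\<bar>\<sigma>\<bar> \<le> r" using h by (meson order_trans)
    moreover have "0 \<le> r" using h by (meson abs_ge_zero order_trans)
    ultimately show ?thesis using h \<open>i \<notin> A\<close> unfolding S_def pr_def by (auto simp: axis_def)
  qed
  have seg: "((\<lambda>\<sigma>. Dk is (\<theta>0 + pr h A + \<sigma> *\<^sub>R axis i 1) x) has_real_derivative Dk (i # is) (\<theta>0 + pr h A + \<tau> *\<^sub>R axis i 1) x)
      (at \<tau> within closed_segment 0 (vec_nth h i))"
    if "length is < 3" "\<forall>i. \<bar>vec_nth h i\<bar> \<le> r" "i \<notin> A" "\<tau> \<in> closed_segment 0 (vec_nth h i)" for "is" h A i \<tau> x
  proof (rule has_partial_derivative_segment[where \<Theta> = \<Theta>])
    show "has_partial_derivative \<Theta> i (\<lambda>\<theta>'. Dk is \<theta>' x) (Dk (i # is) (\<theta>0 + pr h A + \<tau> *\<^sub>R axis i 1) x) (\<theta>0 + pr h A + \<tau> *\<^sub>R axis i 1)"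
      using D[OF that(1)] inS[OF that(2-4)] S by blast
    show "\<theta>0 + pr h A + \<sigma> *\<^sub>R axis i 1 \<in> \<Theta>" if "\<sigma> \<in> closed_segment 0 (vec_nth h i)" for \<sigma>
      using inS[OF \<open>\<forall>i. \<bar>vec_nth h i\<bar> \<le> r\<close> \<open>i \<notin> A\<close> that] S by blast
  qed
  have bdS: "\<bar>Dk is (\<theta>0 + pr h A + \<tau> *\<^sub>R axis i 1) x\<bar> \<le> w x"
    if "1 \<le> length is" "length is \<le> 3" "\<forall>i. \<bar>vec_nth h i\<bar> \<le> r" "i \<notin> A" "\<tau> \<in> closed_segment 0 (vec_nth h i)" for "is" h A i \<tau> x
    using bd[OF that(1,2)] inS[OF that(3-5)] S by blast
  define N where "N = (\<lambda>(h :: real ^ 'p) A. \<Sum>i\<in>A. \<bar>vec_nth h i\<bar>)"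
  have N0: "N h A \<ge> 0" for h A unfolding N_def by (intro sum_nonneg) auto
  have Nins: "N h (insert i A) = N h A + \<bar>vec_nth h i\<bar>" if "i \<notin> A" for h i A unfolding N_def using that by simp
  have w0: "w x \<ge> 0" if "\<forall>i. \<bar>vec_nth h i\<bar> \<le> r" for h :: "real ^ 'p" and x
  proof -
    have "0 \<le> r" using that by (meson abs_ge_zero order_trans)
    hence "\<theta>0 \<in> \<Theta>" using S unfolding S_def by auto
    from bd[OF _ _ this, of "[undefined]" x] show ?thesis by force
  qed
  \<comment> \<open>\<open>T1\<close> and \<open>T2\<close> are the expansions of the first and
    second order; they carry derivatives at an intermediate corner of the path back to
    \<theta>0.\<close>
  have T1: "\<bar>Dk is (\<theta>0 + pr h A) x - Dk is \<theta>0 x\<bar> \<le> w x * N h A"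
    if len: "length is < 3" and h: "\<forall>i. \<bar>vec_nth h i\<bar> \<le> r" for "is" h A x
    using finite[of A]
  proof (induction A rule: finite_induct)
    case (insert i A)
    have "\<bar>Dk is (\<theta>0 + pr h A + vec_nth h i *\<^sub>R axis i 1) x - Dk is (\<theta>0 + pr h A + 0 *\<^sub>R axis i 1) x\<bar> \<le> w x * \<bar>vec_nth h i\<bar>"
      by (rule segment_taylor1[OF seg[OF len h insert(2)] bdS[OF _ _ h insert(2)]]) (use len in auto)
    thus ?case using insert.IH unfolding pr1[OF insert(2)] Nins[OF insert(2)] by (simp add: distrib_left add.assoc)
  qed (simp add: pr0 N_def)
  have T2: "\<bar>Dk is (\<theta>0 + pr h A) x - Dk is \<theta>0 x - (\<Sum>i\<in>A. vec_nth h i * Dk (i # is) \<theta>0 x)\<bar> \<le> w x * (N h A)\<^sup>2"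
    if len: "length is < 2" and h: "\<forall>i. \<bar>vec_nth h i\<bar> \<le> r" for "is" h A x
    using finite[of A]
  proof (induction A rule: finite_induct)
    case (insert i A)
    define t where "t = vec_nth h i"
    have "\<bar>Dk is (\<theta>0 + pr h A + vec_nth h i *\<^sub>R axis i 1) x - Dk is (\<theta>0 + pr h A + 0 *\<^sub>R axis i 1) x
         - vec_nth h i * Dk (i # is) (\<theta>0 + pr h A + 0 *\<^sub>R axis i 1) x\<bar> \<le> w x * (vec_nth h i)\<^sup>2"
      by (rule segment_taylor2[OF seg[OF _ h insert(2)] seg[OF _ h insert(2)] bdS[OF _ _ h insert(2)]]) (use len in auto)
    hence 1: "\<bar>Dk is (\<theta>0 + pr h (insert i A)) x - Dk is (\<theta>0 + pr h A) x - t * Dk (i # is) (\<theta>0 + pr h A) x\<bar> \<le> w x * t\<^sup>2"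
      unfolding pr1[OF insert(2)] t_def by (simp add: add.assoc)
    have "\<bar>Dk (i # is) (\<theta>0 + pr h A) x - Dk (i # is) \<theta>0 x\<bar> \<le> w x * N h A" by (rule T1[OF _ h]) (use len in auto)
    hence 2: "\<bar>t * Dk (i # is) (\<theta>0 + pr h A) x - t * Dk (i # is) \<theta>0 x\<bar> \<le> \<bar>t\<bar> * (w x * N h A)"
      unfolding right_diff_distrib[symmetric] abs_mult by (intro mult_left_mono) auto
    have 3: "w x * (N h (insert i A))\<^sup>2 = w x * (N h A)\<^sup>2 + w x * t\<^sup>2 + 2 * (\<bar>t\<bar> * (w x * N h A))"
      unfolding Nins[OF insert(2)] t_def[symmetric] by (simp add: power2_sum algebra_simps)
    have 4: "0 \<le> \<bar>t\<bar> * (w x * N h A)" using w0[OF h] N0 by simp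
    have 5: "(\<Sum>i\<in>insert i A. vec_nth h i * Dk (i # is) \<theta>0 x) = t * Dk (i # is) \<theta>0 x + (\<Sum>i\<in>A. vec_nth h i * Dk (i # is) \<theta>0 x)"
      using insert(1,2) by (simp add: t_def)
    show ?case using 1 2 4 insert.IH unfolding 3 5 by linarith
  qed (simp add: pr0 N_def)
  have "\<exists>\<kappa> :: 'p \<Rightarrow> 'p \<Rightarrow> real. \<forall>h x. (\<forall>i. \<bar>vec_nth h i\<bar> \<le> r) \<longrightarrow>
    \<bar>Dk [] (\<theta>0 + pr h A) x - Dk [] \<theta>0 x - (\<Sum>i\<in>A. vec_nth h i * Dk [i] \<theta>0 x) - (\<Sum>i\<in>UNIV. \<Sum>j\<in>UNIV. \<kappa> i j * vec_nth h i * vec_nth h j * Dk [j, i] \<theta>0 x)\<bar>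
      \<le> w x * N h A ^ 3" for A
    using finite[of A]
  proof (induction A rule: finite_induct)
    case empty
    show ?case by (rule exI[of _ "\<lambda>_ _. 0"]) (simp add: pr0 N_def)
  next
    case (insert i A)
    then obtain \<kappa> :: "'p \<Rightarrow> 'p \<Rightarrow> real" where IH: "\<And>h x. (\<forall>i. \<bar>vec_nth h i\<bar> \<le> r) \<Longrightarrow>
       \<bar>Dk [] (\<theta>0 + pr h A) x - Dk [] \<theta>0 x - (\<Sum>i\<in>A. vec_nth h i * Dk [i] \<theta>0 x) - (\<Sum>i\<in>UNIV. \<Sum>j\<in>UNIV. \<kappa> i j * vec_nth h i * vec_nth h j * Dk [j, i] \<theta>0 x)\<bar>
      \<le> w x * N h A ^ 3" by blast
    \<comment> \<open>New second-order terms when coordinate \<open>i\<close> joins: weight 1 with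
      each coordinate visited before, 1/2 on the diagonal.\<close>
    define \<epsilon> where "\<epsilon> = (\<lambda>i' j. if i' = i then (if j \<in> A then 1 else if j = i then 1 / 2 else 0) else (0::real))"
    show ?case
    proof (intro exI[of _ "\<lambda>i' j. \<kappa> i' j + \<epsilon> i' j"] allI impI)
      fix h :: "real ^ 'p" and x assume h: "\<forall>i. \<bar>vec_nth h i\<bar> \<le> r"
      define t where "t = vec_nth h i"
      define Q where "Q = (\<lambda>\<kappa>. \<Sum>i\<in>UNIV. \<Sum>j\<in>UNIV. \<kappa> i j * vec_nth h i * vec_nth h j * Dk [j, i] \<theta>0 x)"
      have Qadd: "Q (\<lambda>i' j. \<kappa> i' j + \<epsilon> i' j) = Q \<kappa> + Q \<epsilon>"
        unfolding Q_def sum.distrib[symmetric] by (simp add: distrib_right)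
      have Q\<epsilon>: "Q \<epsilon> = t * (\<Sum>j\<in>A. vec_nth h j * Dk [j, i] \<theta>0 x) + t\<^sup>2 / 2 * Dk [i, i] \<theta>0 x"
      proof -
        have "Q \<epsilon> = (\<Sum>i'\<in>UNIV. if i' = i then (\<Sum>j\<in>UNIV. \<epsilon> i j * t * vec_nth h j * Dk [j, i] \<theta>0 x) else 0)"
          unfolding Q_def t_def by (intro sum.cong refl) (auto simp: \<epsilon>_def)
        also have "\<dots> = (\<Sum>j\<in>UNIV. \<epsilon> i j * t * vec_nth h j * Dk [j, i] \<theta>0 x)" by simp
        also have "\<dots> = (\<Sum>j\<in>insert i A. \<epsilon> i j * t * vec_nth h j * Dk [j, i] \<theta>0 x)"
          by (rule sum.mono_neutral_right) (auto simp: \<epsilon>_def)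
        also have "\<dots> = \<epsilon> i i * t * vec_nth h i * Dk [i, i] \<theta>0 x + (\<Sum>j\<in>A. \<epsilon> i j * t * vec_nth h j * Dk [j, i] \<theta>0 x)"
          using insert(1,2) by simp
        also have "(\<Sum>j\<in>A. \<epsilon> i j * t * vec_nth h j * Dk [j, i] \<theta>0 x) = t * (\<Sum>j\<in>A. vec_nth h j * Dk [j, i] \<theta>0 x)"
          unfolding sum_distrib_left by (intro sum.cong refl) (simp add: \<epsilon>_def)
        also have "\<epsilon> i i * t * vec_nth h i * Dk [i, i] \<theta>0 x = t\<^sup>2 / 2 * Dk [i, i] \<theta>0 x"
          using insert(2) by (simp add: \<epsilon>_def t_def power2_eq_square)
        finally show ?thesis by simp
      qed
      have "\<bar>Dk [] (\<theta>0 + pr h A + vec_nth h i *\<^sub>R axis i 1) x - Dk [] (\<theta>0 + pr h A + 0 *\<^sub>R axis i 1) x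
         - vec_nth h i * Dk [i] (\<theta>0 + pr h A + 0 *\<^sub>R axis i 1) x - (vec_nth h i)\<^sup>2 / 2 * Dk [i, i] (\<theta>0 + pr h A + 0 *\<^sub>R axis i 1) x\<bar> \<le> w x * \<bar>vec_nth h i\<bar> ^ 3"
        by (rule segment_taylor3[OF seg[OF _ h insert(2)] seg[OF _ h insert(2)] seg[OF _ h insert(2)] bdS[OF _ _ h insert(2)]]) auto
      hence 1: "\<bar>Dk [] (\<theta>0 + pr h (insert i A)) x - Dk [] (\<theta>0 + pr h A) x - t * Dk [i] (\<theta>0 + pr h A) x - t\<^sup>2 / 2 * Dk [i, i] (\<theta>0 + pr h A) x\<bar> \<le> w x * \<bar>t\<bar> ^ 3"
        unfolding pr1[OF insert(2)] t_def by (simp add: add.assoc)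
      have "\<bar>Dk [i] (\<theta>0 + pr h A) x - Dk [i] \<theta>0 x - (\<Sum>j\<in>A. vec_nth h j * Dk [j, i] \<theta>0 x)\<bar> \<le> w x * (N h A)\<^sup>2"
        by (rule T2[OF _ h]) auto
      hence "\<bar>t * (Dk [i] (\<theta>0 + pr h A) x - Dk [i] \<theta>0 x - (\<Sum>j\<in>A. vec_nth h j * Dk [j, i] \<theta>0 x))\<bar> \<le> \<bar>t\<bar> * (w x * (N h A)\<^sup>2)"
        unfolding abs_mult by (intro mult_left_mono) auto
      hence 2: "\<bar>t * Dk [i] (\<theta>0 + pr h A) x - t * Dk [i] \<theta>0 x - t * (\<Sum>j\<in>A. vec_nth h j * Dk [j, i] \<theta>0 x)\<bar> \<le> w x * (\<bar>t\<bar> * (N h A)\<^sup>2)"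
        by (simp add: right_diff_distrib mult_ac)
      have "\<bar>Dk [i, i] (\<theta>0 + pr h A) x - Dk [i, i] \<theta>0 x\<bar> \<le> w x * N h A" by (rule T1[OF _ h]) auto
      hence "\<bar>t\<^sup>2 / 2 * (Dk [i, i] (\<theta>0 + pr h A) x - Dk [i, i] \<theta>0 x)\<bar> \<le> t\<^sup>2 / 2 * (w x * N h A)"
        unfolding abs_mult[of "t\<^sup>2 / 2"] by (simp add: mult_left_mono)
      hence 3: "\<bar>t\<^sup>2 / 2 * Dk [i, i] (\<theta>0 + pr h A) x - t\<^sup>2 / 2 * Dk [i, i] \<theta>0 x\<bar> \<le> w x * (t\<^sup>2 * N h A) / 2"
        by (simp add: right_diff_distrib mult_ac)
      have t2: "t\<^sup>2 = \<bar>t\<bar> * \<bar>t\<bar>" by (simp add: power2_eq_square)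
      have nn: "0 \<le> w x * (\<bar>t\<bar> * (N h A)\<^sup>2)" "0 \<le> w x * (t\<^sup>2 * N h A)" using w0[OF h] N0[of h A] by auto
      \<comment> \<open>The cube of N + |t| contains three copies of each mixed term, more than the
        errors in the facts \<open>2\<close> and \<open>3\<close> require.\<close>
      have 4: "w x * N h (insert i A) ^ 3 = w x * N h A ^ 3 + w x * \<bar>t\<bar> ^ 3 + 3 * (w x * (\<bar>t\<bar> * (N h A)\<^sup>2)) + 3 * (w x * (t\<^sup>2 * N h A))"
        unfolding Nins[OF insert(2)] t_def[symmetric] t2 by (simp add: power3_eq_cube power2_eq_square algebra_simps)
      have 5: "(\<Sum>j\<in>insert i A. vec_nth h j * Dk [j] \<theta>0 x) = t * Dk [i] \<theta>0 x + (\<Sum>j\<in>A. vec_nth h j * Dk [j] \<theta>0 x)"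
        using insert(1,2) by (simp add: t_def)
      have "\<bar>Dk [] (\<theta>0 + pr h (insert i A)) x - Dk [] \<theta>0 x - (\<Sum>i\<in>insert i A. vec_nth h i * Dk [i] \<theta>0 x) - Q (\<lambda>i' j. \<kappa> i' j + \<epsilon> i' j)\<bar> \<le> w x * N h (insert i A) ^ 3"
      proof -
        have "\<bar>Dk [] (\<theta>0 + pr h A) x - Dk [] \<theta>0 x - (\<Sum>i\<in>A. vec_nth h i * Dk [i] \<theta>0 x) - Q \<kappa>\<bar> \<le> w x * N h A ^ 3"
          using IH[OF h, of x] unfolding Q_def .
        thus ?thesis using 1 2 3 nn unfolding 4 5 Qadd Q\<epsilon> by linarith
      qed
      thus "\<bar>Dk [] (\<theta>0 + pr h (insert i A)) x - Dk [] \<theta>0 x - (\<Sum>i\<in>insert i A. vec_nth h i * Dk [i] \<theta>0 x)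
          - (\<Sum>i'\<in>UNIV. \<Sum>j\<in>UNIV. (\<kappa> i' j + \<epsilon> i' j) * vec_nth h i' * vec_nth h j * Dk [j, i'] \<theta>0 x)\<bar> \<le> w x * N h (insert i A) ^ 3"
        unfolding Q_def .
    qed
  qed
  from this[of UNIV] show ?thesis unfolding prU N_def .
qed

text \<open>Evenness of the covariance is differentiated in \<theta>. At an interior point the
  difference quotient is two-sided, so the derivative is unique and both sides agree. This makes the
  Gram matrices of derivatives symmetric.\<close>

lemma partial_derivatives_symmetric:
  fixes Dk :: "'p::finite list \<Rightarrow> real ^ 'p \<Rightarrow> real ^ 'd \<Rightarrow> real"
  assumes D: "\<And>is i \<theta> x. length is < r \<Longrightarrow> \<theta> \<in> \<Theta> \<Longrightarrow> has_partial_derivative \<Theta> i (\<lambda>\<theta>'. Dk is \<theta>' x) (Dk (i # is) \<theta> x) \<theta>"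
    and sym: "\<And>\<theta> x. \<theta> \<in> \<Theta> \<Longrightarrow> Dk [] \<theta> (- x) = Dk [] \<theta> x"
  shows "length is \<le> r \<Longrightarrow> \<theta> \<in> interior \<Theta> \<Longrightarrow> Dk is \<theta> (- x) = Dk is \<theta> x"
proof (induction "is" arbitrary: \<theta>)
  case Nil
  thus ?case using sym interior_subset by blast
next
  case (Cons i "is")
  define T where "T = {t. \<theta> + t *\<^sub>R axis i 1 \<in> interior \<Theta>}"
  have "open T" unfolding T_def
    by (rule open_vimage[of "interior \<Theta>" "\<lambda>t. \<theta> + t *\<^sub>R axis i 1", unfolded vimage_def])
      (auto intro!: continuous_intros)
  have T0: "0 \<in> T" unfolding T_def using Cons.prems by simp
  have at: "at 0 within T = at 0" by (rule at_within_open[OF T0 \<open>open T\<close>])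
  have d: "((\<lambda>t. Dk is (\<theta> + t *\<^sub>R axis i 1) y) has_real_derivative Dk (i # is) \<theta> y) (at 0)" for y
  proof -
    have "has_partial_derivative \<Theta> i (\<lambda>\<theta>'. Dk is \<theta>' y) (Dk (i # is) \<theta> y) \<theta>"
      using Cons.prems interior_subset by (intro D) auto
    hence "((\<lambda>t. Dk is (\<theta> + t *\<^sub>R axis i 1) y) has_real_derivative Dk (i # is) \<theta> y) (at 0 within T)"
      unfolding has_partial_derivative_def
      by (rule has_field_derivative_subset) (use interior_subset in \<open>auto simp: T_def\<close>)
    thus ?thesis unfolding at .
  qed
  have "((\<lambda>t. Dk is (\<theta> + t *\<^sub>R axis i 1) x) has_real_derivative Dk (i # is) \<theta> (- x)) (at 0)"
    using d[of "- x"]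
    by (rule has_field_derivative_transform_within_open[OF _ \<open>open T\<close> T0]) (use Cons in \<open>auto simp: T_def\<close>)
  thus ?case using d[of x] by (rule DERIV_unique)
qed

subsection \<open>Operator bounds\<close>

abbreviation vnorm :: "real Matrix.vec \<Rightarrow> real" where
  "vnorm v \<equiv> sqrt (scalar_prod v v)"

text \<open>Operator norm at most \<rho>, stated through the bilinear form: this is what the Schur
  test delivers, and it passes directly through products, sums and transposes.\<close>

definition op_bound :: "nat \<Rightarrow> real mat \<Rightarrow> real \<Rightarrow> bool" where
  "op_bound n A \<rho> \<longleftrightarrow> A \<in> carrier_mat n n \<and> 0 \<le> \<rho> \<and>
     (\<forall>u\<in>carrier_vec n. \<forall>v\<in>carrier_vec n. \<bar>scalar_prod u (A *\<^sub>v v)\<bar> \<le> \<rho> * (vnorm u * vnorm v))"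

definition frobenius_sq :: "nat \<Rightarrow> real mat \<Rightarrow> real" where
  "frobenius_sq n A = (\<Sum>i<n. \<Sum>j<n. (A $$ (i, j))\<^sup>2)"

lemma op_bound_carrier: "op_bound n A \<rho> \<Longrightarrow> A \<in> carrier_mat n n"
  and op_bound_nonneg: "op_bound n A \<rho> \<Longrightarrow> 0 \<le> \<rho>"
  and op_bound_scalar: "op_bound n A \<rho> \<Longrightarrow> u \<in> carrier_vec n \<Longrightarrow> v \<in> carrier_vec n \<Longrightarrow>
    \<bar>scalar_prod u (A *\<^sub>v v)\<bar> \<le> \<rho> * (vnorm u * vnorm v)"
  unfolding op_bound_def by blast+

lemma scalar_prod_sum: "v \<in> carrier_vec n \<Longrightarrow> scalar_prod u v = (\<Sum>i<n. u $ i * v $ i)"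
  unfolding scalar_prod_def by (simp add: lessThan_atLeast0)

lemma scalar_prod_self_nonneg: "0 \<le> scalar_prod v (v :: real Matrix.vec)"
  unfolding scalar_prod_def by (intro sum_nonneg) auto

lemma vnorm_nonneg: "0 \<le> vnorm v" and vnorm_sq: "(vnorm v)\<^sup>2 = scalar_prod v v"
  using scalar_prod_self_nonneg[of v] by auto

lemma scalar_prod_cauchy_schwarz:
  assumes "u \<in> carrier_vec n" "v \<in> carrier_vec n"
  shows "\<bar>scalar_prod u v\<bar> \<le> vnorm u * vnorm (v :: real Matrix.vec)"
proof -
  have "(scalar_prod u v)\<^sup>2 \<le> scalar_prod u u * scalar_prod v v"
    unfolding scalar_prod_sum[OF assms(1)] scalar_prod_sum[OF assms(2)]
    using Cauchy_Schwarz_ineq_sum[of "\<lambda>i. u $ i" "\<lambda>i. v $ i" "{..<n}"] by (simp add: power2_eq_square)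
  hence "sqrt ((scalar_prod u v)\<^sup>2) \<le> sqrt (scalar_prod u u * scalar_prod v v)" by (rule real_sqrt_le_mono)
  thus ?thesis by (simp add: real_sqrt_mult)
qed

lemma mult_mat_vec_sum:
  "A \<in> carrier_mat n n \<Longrightarrow> v \<in> carrier_vec n \<Longrightarrow> i < n \<Longrightarrow> (A *\<^sub>v v) $ i = (\<Sum>j<n. A $$ (i, j) * v $ j)"
  by (auto simp: mult_mat_vec_def scalar_prod_def lessThan_atLeast0)

lemma scalar_prod_mult_mat_vec_sum:
  assumes "A \<in> carrier_mat n n" "u \<in> carrier_vec n" "v \<in> carrier_vec n"
  shows "scalar_prod u (A *\<^sub>v v) = (\<Sum>i<n. \<Sum>j<n. u $ i * v $ j * (A $$ (i, j) :: real))"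
proof -
  have "A *\<^sub>v v \<in> carrier_vec n" using assms by simp
  thus ?thesis unfolding scalar_prod_sum[OF \<open>A *\<^sub>v v \<in> carrier_vec n\<close>]
    by (intro sum.cong refl) (simp only: mult_mat_vec_sum[OF assms(1,3)] lessThan_iff sum_distrib_left mult_ac)
qed

lemma op_bound_vnorm:
  assumes A: "op_bound n A \<rho>" and v: "v \<in> carrier_vec n"
  shows "vnorm (A *\<^sub>v v) \<le> \<rho> * vnorm v"
proof (cases "vnorm (A *\<^sub>v v) = 0")
  case True
  thus ?thesis using A vnorm_nonneg[of v] unfolding op_bound_def by simp
next
  case False
  hence pos: "vnorm (A *\<^sub>v v) > 0" using vnorm_nonneg[of "A *\<^sub>v v"] by linarith
  have Av: "A *\<^sub>v v \<in> carrier_vec n" by (rule mult_mat_vec_carrier[OF op_bound_carrier[OF A] v])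
  have "\<bar>scalar_prod (A *\<^sub>v v) (A *\<^sub>v v)\<bar> \<le> \<rho> * (vnorm (A *\<^sub>v v) * vnorm v)"
    using A v Av unfolding op_bound_def by blast
  hence "vnorm (A *\<^sub>v v) * vnorm (A *\<^sub>v v) \<le> vnorm (A *\<^sub>v v) * (\<rho> * vnorm v)"
    using vnorm_sq[of "A *\<^sub>v v"] by (simp add: power2_eq_square mult_ac)
  thus ?thesis using pos by (simp only: mult_le_cancel_left_pos)
qed

lemma op_bound_mult:
  assumes A: "op_bound n A \<alpha>" and B: "op_bound n B \<beta>"
  shows "op_bound n (A * B) (\<alpha> * \<beta>)"
  unfolding op_bound_def
proof (intro conjI ballI)
  show "A * B \<in> carrier_mat n n" "0 \<le> \<alpha> * \<beta>" using A B unfolding op_bound_def by auto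
  fix u v :: "real Matrix.vec" assume uv: "u \<in> carrier_vec n" "v \<in> carrier_vec n"
  have Bv: "B *\<^sub>v v \<in> carrier_vec n" by (rule mult_mat_vec_carrier[OF op_bound_carrier[OF B] uv(2)])
  have "(A * B) *\<^sub>v v = A *\<^sub>v (B *\<^sub>v v)" using A B uv unfolding op_bound_def by (intro assoc_mult_mat_vec) auto
  hence "\<bar>scalar_prod u ((A * B) *\<^sub>v v)\<bar> \<le> \<alpha> * (vnorm u * vnorm (B *\<^sub>v v))"
    using A uv Bv unfolding op_bound_def by simp
  also have "\<dots> \<le> \<alpha> * (vnorm u * (\<beta> * vnorm v))"
    using A op_bound_vnorm[OF B uv(2)] vnorm_nonneg unfolding op_bound_def by (intro mult_left_mono) auto
  finally show "\<bar>scalar_prod u ((A * B) *\<^sub>v v)\<bar> \<le> \<alpha> * \<beta> * (vnorm u * vnorm v)" by (simp add: mult_ac)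
qed

lemma op_bound_add:
  assumes A: "op_bound n A \<alpha>" and B: "op_bound n B \<beta>"
  shows "op_bound n (A + B) (\<alpha> + \<beta>)"
  unfolding op_bound_def
proof (intro conjI ballI)
  show "A + B \<in> carrier_mat n n" "0 \<le> \<alpha> + \<beta>" using A B unfolding op_bound_def by auto
  fix u v :: "real Matrix.vec" assume uv: "u \<in> carrier_vec n" "v \<in> carrier_vec n"
  have c: "A \<in> carrier_mat n n" "B \<in> carrier_mat n n" using A B unfolding op_bound_def by auto
  have "scalar_prod u ((A + B) *\<^sub>v v) = scalar_prod u (A *\<^sub>v v) + scalar_prod u (B *\<^sub>v v)"
    using c uv by (simp add: add_mult_distrib_mat_vec[of _ n n] scalar_prod_add_distrib[of _ n])
  hence "\<bar>scalar_prod u ((A + B) *\<^sub>v v)\<bar> \<le> \<bar>scalar_prod u (A *\<^sub>v v)\<bar> + \<bar>scalar_prod u (B *\<^sub>v v)\<bar>" by simp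
  also have "\<dots> \<le> \<alpha> * (vnorm u * vnorm v) + \<beta> * (vnorm u * vnorm v)"
    using A B uv unfolding op_bound_def by (intro add_mono) auto
  finally show "\<bar>scalar_prod u ((A + B) *\<^sub>v v)\<bar> \<le> (\<alpha> + \<beta>) * (vnorm u * vnorm v)" by (simp add: distrib_right)
qed

lemma op_bound_mono: "op_bound n A \<alpha> \<Longrightarrow> \<alpha> \<le> \<beta> \<Longrightarrow> op_bound n A \<beta>"
  unfolding op_bound_def
  by (meson mult_nonneg_nonneg mult_right_mono order_trans vnorm_nonneg)

lemma op_bound_smult:
  assumes A: "op_bound n A \<alpha>" shows "op_bound n (a \<cdot>\<^sub>m A) (\<bar>a\<bar> * \<alpha>)"
  unfolding op_bound_def
proof (intro conjI ballI)
  show "a \<cdot>\<^sub>m A \<in> carrier_mat n n" "0 \<le> \<bar>a\<bar> * \<alpha>" using A unfolding op_bound_def by auto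
  fix u v :: "real Matrix.vec" assume uv: "u \<in> carrier_vec n" "v \<in> carrier_vec n"
  have c: "A \<in> carrier_mat n n" "a \<cdot>\<^sub>m A \<in> carrier_mat n n" using A unfolding op_bound_def by auto
  have "scalar_prod u ((a \<cdot>\<^sub>m A) *\<^sub>v v) = a * scalar_prod u (A *\<^sub>v v)"
    unfolding scalar_prod_mult_mat_vec_sum[OF c(1) uv] scalar_prod_mult_mat_vec_sum[OF c(2) uv]
    using c by (simp add: sum_distrib_left mult_ac)
  moreover have "\<bar>a\<bar> * \<bar>scalar_prod u (A *\<^sub>v v)\<bar> \<le> \<bar>a\<bar> * (\<alpha> * (vnorm u * vnorm v))"
    using A uv unfolding op_bound_def by (intro mult_left_mono) auto
  ultimately show "\<bar>scalar_prod u ((a \<cdot>\<^sub>m A) *\<^sub>v v)\<bar> \<le> \<bar>a\<bar> * \<alpha> * (vnorm u * vnorm v)"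
    by (simp add: abs_mult mult.assoc)
qed

lemma op_bound_transpose:
  assumes A: "op_bound n A \<alpha>" shows "op_bound n (transpose_mat A) \<alpha>"
  unfolding op_bound_def
proof (intro conjI ballI)
  have c: "A \<in> carrier_mat n n" "transpose_mat A \<in> carrier_mat n n" using A unfolding op_bound_def by auto
  thus "transpose_mat A \<in> carrier_mat n n" "0 \<le> \<alpha>" using A unfolding op_bound_def by auto
  fix u v :: "real Matrix.vec" assume uv: "u \<in> carrier_vec n" "v \<in> carrier_vec n"
  have "scalar_prod u (transpose_mat A *\<^sub>v v) = scalar_prod v (A *\<^sub>v u)"
    unfolding scalar_prod_mult_mat_vec_sum[OF c(1) uv(2,1)] scalar_prod_mult_mat_vec_sum[OF c(2) uv]
    using c(1) by (subst sum.swap) (simp add: mult_ac)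
  thus "\<bar>scalar_prod u (transpose_mat A *\<^sub>v v)\<bar> \<le> \<alpha> * (vnorm u * vnorm v)"
    using op_bound_scalar[OF A uv(2,1)] by (simp only: mult.commute[of "vnorm u"])
qed

lemma vnorm_unit_vec: "i < n \<Longrightarrow> vnorm (unit_vec n i) = 1"
  by (simp add: scalar_prod_right_unit)

lemma op_bound_entry:
  assumes A: "op_bound n A \<alpha>" and i: "i < n" shows "\<bar>A $$ (i, i)\<bar> \<le> \<alpha>"
proof -
  have c: "A \<in> carrier_mat n n" using A unfolding op_bound_def by auto
  have "\<bar>scalar_prod (unit_vec n i) (A *\<^sub>v unit_vec n i)\<bar> \<le> \<alpha> * (vnorm (unit_vec n i) * vnorm (unit_vec n i))"
    by (rule op_bound_scalar[OF A]) auto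
  moreover have "scalar_prod (unit_vec n i) (A *\<^sub>v unit_vec n i) = A $$ (i, i)"
    using c i by (simp add: scalar_prod_left_unit)
  ultimately show ?thesis using vnorm_unit_vec[OF i] by simp
qed

lemma mat_trace_sum: "A \<in> carrier_mat n n \<Longrightarrow> mat_trace A = (\<Sum>i<n. A $$ (i, i))"
  unfolding mat_trace_def by simp

lemma op_bound_trace:
  assumes A: "op_bound n A \<alpha>" shows "\<bar>mat_trace A\<bar> \<le> real n * \<alpha>"
proof -
  have "\<bar>mat_trace A\<bar> \<le> (\<Sum>i<n. \<bar>A $$ (i, i)\<bar>)"
    using A unfolding op_bound_def by (simp add: mat_trace_sum[of A n])
  also have "\<dots> \<le> (\<Sum>i<n. \<alpha>)" using op_bound_entry[OF A] by (intro sum_mono) auto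
  finally show ?thesis by simp
qed

lemma mat_trace_mult_sum:
  assumes "S \<in> carrier_mat n n" "X \<in> carrier_mat n n"
  shows "mat_trace (S * X) = (\<Sum>i<n. \<Sum>j<n. X $$ (i, j) * S $$ (j, i))"
proof -
  have c: "S * X \<in> carrier_mat n n" using assms by simp
  have "mat_trace (S * X) = (\<Sum>j<n. \<Sum>i<n. S $$ (j, i) * X $$ (i, j))"
    unfolding mat_trace_sum[OF c] by (intro sum.cong refl index_mult_mat_sum[OF assms]) auto
  thus ?thesis by (subst sum.swap) (simp add: mult.commute)
qed

lemma mat_trace_mult_comm:
  assumes "A \<in> carrier_mat n n" "B \<in> carrier_mat n n"
  shows "mat_trace (A * B) = mat_trace (B * A)"
proof -
  have c: "A * B \<in> carrier_mat n n" "B * A \<in> carrier_mat n n" using assms by auto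
  have "mat_trace (A * B) = (\<Sum>i<n. \<Sum>k<n. A $$ (i, k) * B $$ (k, i))"
    unfolding mat_trace_sum[OF c(1)] by (intro sum.cong refl index_mult_mat_sum[OF assms]) auto
  also have "\<dots> = (\<Sum>k<n. \<Sum>i<n. B $$ (k, i) * A $$ (i, k))" by (subst sum.swap) (simp add: mult.commute)
  also have "\<dots> = mat_trace (B * A)"
    unfolding mat_trace_sum[OF c(2)] by (intro sum.cong refl index_mult_mat_sum[OF assms(2,1), symmetric]) auto
  finally show ?thesis .
qed

text \<open>Works columnwise: each column of B is lengthened by at most the operator bound of
  A.\<close>

lemma frobenius_sq_mult:
  assumes A: "op_bound n A \<alpha>" and B: "B \<in> carrier_mat n n"
  shows "frobenius_sq n (A * B) \<le> \<alpha>\<^sup>2 * frobenius_sq n B"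
proof -
  have c: "A \<in> carrier_mat n n" using A unfolding op_bound_def by auto
  have col: "(\<Sum>i<n. (M $$ (i, j))\<^sup>2) = (vnorm (col M j))\<^sup>2" if "M \<in> carrier_mat n n" "j < n" for M j
    using that unfolding vnorm_sq by (subst scalar_prod_sum[of _ n]) (auto simp: power2_eq_square)
  have "frobenius_sq n (A * B) = (\<Sum>j<n. (vnorm (col (A * B) j))\<^sup>2)"
    unfolding frobenius_sq_def using c B by (subst sum.swap) (intro sum.cong refl col, auto)
  also have "\<dots> \<le> (\<Sum>j<n. \<alpha>\<^sup>2 * (vnorm (col B j))\<^sup>2)"
  proof (rule sum_mono)
    fix j assume "j \<in> {..<n}"
    hence j: "j < n" by simp
    have cB: "col B j \<in> carrier_vec n" using B j by auto
    have "vnorm (col (A * B) j) \<le> \<alpha> * vnorm (col B j)"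
      unfolding col_mult2[OF c B j] by (rule op_bound_vnorm[OF A cB])
    hence "(vnorm (col (A * B) j))\<^sup>2 \<le> (\<alpha> * vnorm (col B j))\<^sup>2" by (intro power_mono vnorm_nonneg)
    thus "(vnorm (col (A * B) j))\<^sup>2 \<le> \<alpha>\<^sup>2 * (vnorm (col B j))\<^sup>2" by (simp only: power_mult_distrib)
  qed
  also have "\<dots> = \<alpha>\<^sup>2 * frobenius_sq n B"
    unfolding frobenius_sq_def sum_distrib_left[symmetric]
    by (subst sum.swap) (use B in \<open>auto intro!: sum.cong simp: col\<close>)
  finally show ?thesis .
qed

lemma frobenius_sq_transpose: "A \<in> carrier_mat n n \<Longrightarrow> frobenius_sq n (transpose_mat A) = frobenius_sq n A"
  unfolding frobenius_sq_def by (subst sum.swap) (auto intro!: sum.cong)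

text \<open>A right inverse of a square matrix is two-sided, so A is a unit,
  \<open>mat_inverse\<close> cannot return \<open>None\<close> on it, and inverses are
  unique.\<close>

lemma mat_inv_eq:
  assumes A: "A \<in> carrier_mat n n" and B: "B \<in> carrier_mat n n" and AB: "A * B = 1\<^sub>m n"
  shows "mat_inv A = B"
proof (cases "mat_inverse A")
  case None
  have BA: "B * A = 1\<^sub>m n" by (rule mat_mult_left_right_inverse[OF A B AB])
  have "A \<in> Units (ring_mat TYPE(real) n ())" 
    unfolding Units_def ring_mat_def using A B AB BA by auto
  thus ?thesis using mat_inverse(1)[OF A None, of "()"] by blast
next
  case (Some X)
  from mat_inverse(2)[OF A Some] have X: "X * A = 1\<^sub>m n" "X \<in> carrier_mat n n" by auto
  have "X = X * (A * B)" using X AB by simp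
  also have "\<dots> = X * A * B" by (rule assoc_mult_mat[OF X(2) A B, symmetric])
  finally show ?thesis using X B Some by simp
qed

subsection \<open>Simultaneously diagonalised pairs\<close>

text \<open>Coordinates in which a covariance matrix R is the identity and a perturbation E is
  diagonal, so that the criterion difference decouples; \<open>c\<close> bounds the eigenvalues of R
  from below.\<close>

locale simultaneous_diagonal =
  fixes n :: nat and R E P :: "real mat" and e :: "nat \<Rightarrow> real" and c :: real
  assumes R: "R \<in> carrier_mat n n" and E: "E \<in> carrier_mat n n" and P: "P \<in> carrier_mat n n"
    and PRP: "transpose_mat P * R * P = 1\<^sub>m n" and PEP: "transpose_mat P * E * P = mat_diag n e"
    and c: "c > 0" and coercive: "\<And>v. v \<in> carrier_vec n \<Longrightarrow> c * scalar_prod v v \<le> scalar_prod v (R *\<^sub>v v)"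
begin

lemma tP: "transpose_mat P \<in> carrier_mat n n" using P by simp

lemmas ass = assoc_mult_mat[of _ n n _ n _ n]
lemmas mc = mult_carrier_mat[of _ n n _ n]

text \<open>The inverse of R (see \<open>inv_R\<close>), in the factorised form that P
  provides.\<close>

definition S where "S = P * transpose_mat P"

text \<open>Whitened data: if y has covariance R, these coordinates have identity
  covariance.\<close>

definition w :: "(nat \<Rightarrow> real) \<Rightarrow> nat \<Rightarrow> real" where "w y i = (\<Sum>j<n. P $$ (j, i) * y j)"

lemma S: "S \<in> carrier_mat n n" unfolding S_def using P by simp

lemma PPR: "P * (transpose_mat P * R) = 1\<^sub>m n"
  by (rule mat_mult_left_right_inverse[of _ n]) (use P R PRP in auto)

lemma RPP: "(R * P) * transpose_mat P = 1\<^sub>m n"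
  by (rule mat_mult_left_right_inverse[of _ n]) (use P R PRP in \<open>auto simp: ass\<close>)

lemma RS: "R * S = 1\<^sub>m n" using RPP R P unfolding S_def by (simp add: ass)

lemma inv_R: "mat_inv R = S" by (rule mat_inv_eq[OF R S RS])

lemma sandwich: "X \<in> carrier_mat n n \<Longrightarrow> mat_trace (S * X) = mat_trace (transpose_mat P * X * P)"
  unfolding S_def using P mat_trace_mult_comm[of P n "transpose_mat P * X"] by (simp add: ass)

lemma ESE_diag: "transpose_mat P * (E * S * E) * P = mat_diag n (\<lambda>i. (e i)\<^sup>2)"
proof -
  have "transpose_mat P * (E * S * E) * P = (transpose_mat P * E * P) * (transpose_mat P * E * P)"
    unfolding S_def using P E by (simp add: ass)
  also have "\<dots> = mat_diag n (\<lambda>i. (e i)\<^sup>2)" unfolding PEP mat_diag_diag by (simp add: power2_eq_square)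
  finally show ?thesis .
qed

lemma trace_mat_diag: "mat_trace (mat_diag n f) = (\<Sum>i<n. f i)"
  by (subst mat_trace_sum[of _ n]) (auto simp: mat_diag_index)

lemma trace_SE: "mat_trace (S * E) = (\<Sum>i<n. e i)"
  unfolding sandwich[OF E] PEP trace_mat_diag ..

lemma trace_SESE: "mat_trace (S * (E * S * E)) = (\<Sum>i<n. (e i)\<^sup>2)"
proof -
  have "E * S * E \<in> carrier_mat n n" using E S by simp
  from sandwich[OF this] show ?thesis unfolding ESE_diag trace_mat_diag .
qed

lemma w_eq: "i < n \<Longrightarrow> (transpose_mat P *\<^sub>v Matrix.vec n y) $ i = w y i"
  unfolding w_def using P by (subst mult_mat_vec_sum[OF tP]) auto

lemma quadratic_P_diag:
  assumes X: "X \<in> carrier_mat n n" and d: "X = P * mat_diag n f * transpose_mat P"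
  shows "scalar_prod (Matrix.vec n y) (X *\<^sub>v Matrix.vec n y) = (\<Sum>i<n. f i * (w y i)\<^sup>2)"
proof -
  let ?y = "Matrix.vec n y" let ?w = "transpose_mat P *\<^sub>v Matrix.vec n y"
  have w: "?w \<in> carrier_vec n" using P by simp
  have D: "mat_diag n f \<in> carrier_mat n n" by simp
  have Dw: "mat_diag n f *\<^sub>v ?w \<in> carrier_vec n" by (rule mult_mat_vec_carrier[OF D w])
  have "X *\<^sub>v ?y = P *\<^sub>v (mat_diag n f *\<^sub>v ?w)"
    unfolding d using P D by (simp add: assoc_mult_mat_vec[of _ n n _ n] )
  hence "scalar_prod ?y (X *\<^sub>v ?y) = scalar_prod ?y (P *\<^sub>v (mat_diag n f *\<^sub>v ?w))" by simp
  also have "\<dots> = scalar_prod ?w (mat_diag n f *\<^sub>v ?w)"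
    by (rule transpose_vec_mult_scalar[OF P Dw, symmetric]) simp
  also have "\<dots> = (\<Sum>i<n. \<Sum>j<n. ?w $ i * ?w $ j * mat_diag n f $$ (i, j))"
    by (rule scalar_prod_mult_mat_vec_sum[OF D w w])
  also have "\<dots> = (\<Sum>i<n. \<Sum>j<n. if i = j then f i * (w y i)\<^sup>2 else 0)"
    by (intro sum.cong refl) (auto simp: mat_diag_index w_eq power2_eq_square)
  also have "\<dots> = (\<Sum>i<n. f i * (w y i)\<^sup>2)" by simp
  finally show ?thesis .
qed

lemma quadratic_S: "scalar_prod (Matrix.vec n y) (S *\<^sub>v Matrix.vec n y) = (\<Sum>i<n. (w y i)\<^sup>2)"
  using quadratic_P_diag[OF S, of "\<lambda>_. 1"] P unfolding S_def by simp

lemma quadratic_sandwich: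
  assumes X: "X \<in> carrier_mat n n" and d: "transpose_mat P * X * P = mat_diag n f"
  shows "scalar_prod (S *\<^sub>v Matrix.vec n y) (X *\<^sub>v (S *\<^sub>v Matrix.vec n y)) = (\<Sum>i<n. f i * (w y i)\<^sup>2)"
proof -
  let ?y = "Matrix.vec n y"
  have St: "transpose_mat S = S" unfolding S_def using P by (simp add: transpose_mult[of _ n n _ n])
  have SXS: "S * (X * S) = P * mat_diag n f * transpose_mat P"
    unfolding S_def d[symmetric] using P X by (simp add: ass)
  have v: "X *\<^sub>v (S *\<^sub>v ?y) \<in> carrier_vec n" using X S by simp
  have "scalar_prod (S *\<^sub>v ?y) (X *\<^sub>v (S *\<^sub>v ?y)) = scalar_prod ?y (S *\<^sub>v (X *\<^sub>v (S *\<^sub>v ?y)))"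
    using transpose_vec_mult_scalar[OF S v, of ?y] unfolding St by simp
  also have "\<dots> = scalar_prod ?y ((S * (X * S)) *\<^sub>v ?y)" using S X by (simp add: assoc_mult_mat_vec[of _ n n _ n])
  also have "\<dots> = (\<Sum>i<n. f i * (w y i)\<^sup>2)" by (rule quadratic_P_diag[OF _ SXS]) (use S X in simp)
  finally show ?thesis .
qed

lemma PREP: "transpose_mat P * (R + E) * P = mat_diag n (\<lambda>i. 1 + e i)"
proof -
  have "transpose_mat P * (R + E) * P = transpose_mat P * R * P + transpose_mat P * E * P"
    using P R E by (simp add: mult_add_distrib_mat[of _ n n _ n] add_mult_distrib_mat[of _ n n _ _ n])
  also have "\<dots> = mat_diag n (\<lambda>i. 1 + e i)" unfolding PRP PEP by (auto simp: mat_diag_def)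
  finally show ?thesis .
qed

text \<open>Conjugation by P multiplies both determinants by (det P)^2, and (det P)^2 det R =
  1.\<close>

lemma det_ratio: "Determinant.det (R + E) = Determinant.det R * (\<Prod>i<n. 1 + e i)" and det_R_pos: "Determinant.det R > 0"
proof -
  have PX: "Determinant.det (transpose_mat P * X * P) = (Determinant.det P)\<^sup>2 * Determinant.det X" if "X \<in> carrier_mat n n" for X
    using that P by (simp add: det_mult[of _ n] det_transpose[of _ n] power2_eq_square)
  have 1: "(Determinant.det P)\<^sup>2 * Determinant.det R = 1" using PX[OF R] unfolding PRP by simp
  hence P0: "(Determinant.det P)\<^sup>2 > 0" by (cases "Determinant.det P = 0") auto
  have "0 < (Determinant.det P)\<^sup>2 * Determinant.det R" unfolding 1 by simp
  from zero_less_mult_pos[OF this P0] show "Determinant.det R > 0" .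
  have "Determinant.det (mat_diag n (\<lambda>i. 1 + e i)) = (\<Prod>i<n. 1 + e i)"
  proof -
    have "Determinant.det (mat_diag n (\<lambda>i. 1 + e i)) = prod_list (diag_mat (mat_diag n (\<lambda>i. 1 + e i)))"
      by (rule det_upper_triangular[of _ n]) (auto simp: mat_diag_def)
    also have "\<dots> = (\<Prod>i\<in>{0..<n}. mat_diag n (\<lambda>i. 1 + e i) $$ (i, i))"
      unfolding prod_list_diag_prod by (simp add: mat_diag_def)
    finally show ?thesis by (simp add: mat_diag_index lessThan_atLeast0)
  qed
  hence "(Determinant.det P)\<^sup>2 * Determinant.det (R + E) = (\<Prod>i<n. 1 + e i)" using PX[of "R + E"] R E unfolding PREP by simp
  hence "Determinant.det R * (\<Prod>i<n. 1 + e i) = ((Determinant.det P)\<^sup>2 * Determinant.det R) * Determinant.det (R + E)"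
    by (simp only: mult_ac)
  thus "Determinant.det (R + E) = Determinant.det R * (\<Prod>i<n. 1 + e i)" unfolding 1 by simp
qed

text \<open>As R P is inverse to the transpose of P, the diagonal form of R + E says that (R + E) P
  = R P diag (1 + e); with this the candidate is checked directly.\<close>

lemma inverse_sum:
  assumes "\<And>i. i < n \<Longrightarrow> 1 + e i \<noteq> 0"
  shows "mat_inv (R + E) = P * mat_diag n (\<lambda>i. 1 / (1 + e i)) * transpose_mat P"
proof (rule mat_inv_eq)
  let ?D = "mat_diag n (\<lambda>i. 1 / (1 + e i))" and ?G = "mat_diag n (\<lambda>i. 1 + e i)"
  have D: "?D \<in> carrier_mat n n" "?G \<in> carrier_mat n n" by simp_all
  show c: "R + E \<in> carrier_mat n n" "P * ?D * transpose_mat P \<in> carrier_mat n n" using R E P by auto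
  have "(R * P) * transpose_mat P * ((R + E) * P) = (R * P) * (transpose_mat P * (R + E) * P)"
    using assoc_mult_mat[of "R * P" n n "transpose_mat P" n "(R + E) * P" n] assoc_mult_mat[OF tP c(1) P] R P c(1)
    by (simp add: mc)
  hence RP: "(R + E) * P = (R * P) * ?G" unfolding RPP PREP using left_mult_one_mat[OF mc[OF c(1) P]] by simp
  have "(R + E) * (P * ?D * transpose_mat P) = ((R + E) * P) * ?D * transpose_mat P"
    using c(1) P D by (simp add: ass)
  also have "\<dots> = (R * P) * (?G * ?D) * transpose_mat P" unfolding RP using R P D by (simp add: ass)
  also have "?G * ?D = mat_diag n (\<lambda>_. 1)" unfolding mat_diag_diag using assms by (auto simp: mat_diag_def)
  also have "(R * P) * mat_diag n (\<lambda>_. 1) * transpose_mat P = 1\<^sub>m n" using R P RPP by simp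
  finally show "(R + E) * (P * ?D * transpose_mat P) = 1\<^sub>m n" .
qed

lemma quadratic_inverse_sum:
  assumes "\<And>i. i < n \<Longrightarrow> 1 + e i \<noteq> 0"
  shows "scalar_prod (Matrix.vec n y) (mat_inv (R + E) *\<^sub>v Matrix.vec n y) = (\<Sum>i<n. 1 / (1 + e i) * (w y i)\<^sup>2)"
  by (rule quadratic_P_diag[OF _ inverse_sum[OF assms]]) (use inverse_sum[OF assms] P in auto)

lemma column_bounds:
  assumes i: "i < n"
  shows "col P i \<in> carrier_vec n" "c * scalar_prod (col P i) (col P i) \<le> 1"
    "scalar_prod (col P i) (R *\<^sub>v col P i) = 1" "scalar_prod (col P i) (E *\<^sub>v col P i) = e i"
proof -
  show cc: "col P i \<in> carrier_vec n" using P i by auto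
  show 1: "scalar_prod (col P i) (R *\<^sub>v col P i) = 1"
    unfolding quadratic_form_column[OF R P i, symmetric] PRP using i by simp
  show "scalar_prod (col P i) (E *\<^sub>v col P i) = e i"
    unfolding quadratic_form_column[OF E P i, symmetric] PEP using i by (simp add: mat_diag_index)
  show "c * scalar_prod (col P i) (col P i) \<le> 1" using coercive[OF cc] 1 by simp
qed

text \<open>\<open>e i\<close> is the value of E at column i of P, and this column has squared
  length at most 1/c because R takes the value 1 there.\<close>

lemma e_bound:
  assumes "op_bound n E \<rho>" and i: "i < n" shows "\<bar>e i\<bar> \<le> \<rho> / c"
proof -
  note p = column_bounds[OF i]
  have "\<bar>e i\<bar> \<le> \<rho> * scalar_prod (col P i) (col P i)"
    using op_bound_scalar[OF assms(1) p(1,1)] p(4) vnorm_sq[of "col P i"] by (simp add: power2_eq_square)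
  also have "\<dots> \<le> \<rho> * (1 / c)"
    using p(2) c op_bound_nonneg[OF assms(1)] by (intro mult_left_mono) (auto simp: field_simps)
  finally show ?thesis by simp
qed

text \<open>Column i of P has squared length at least 1/C because R takes the value 1 there, and R +
  E, with the same coercivity constant as R, takes the value 1 + e i there.\<close>

lemma one_plus_e_bounds:
  assumes R': "op_bound n R C" and c': "\<And>v. v \<in> carrier_vec n \<Longrightarrow> c * scalar_prod v v \<le> scalar_prod v ((R + E) *\<^sub>v v)"
    and C: "C > 0" and i: "i < n"
  shows "c / C \<le> 1 + e i"
proof -
  note p = column_bounds[OF i]
  have "1 \<le> C * scalar_prod (col P i) (col P i)"
    using op_bound_scalar[OF R' p(1,1)] p(3) vnorm_sq[of "col P i"] by (simp add: power2_eq_square)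
  hence "c * (1 / C) \<le> c * scalar_prod (col P i) (col P i)"
    using c C by (intro mult_left_mono) (auto simp: field_simps)
  also have "\<dots> \<le> scalar_prod (col P i) ((R + E) *\<^sub>v col P i)" by (rule c'[OF p(1)])
  also have "\<dots> = 1 + e i"
    using p R E by (simp add: add_mult_distrib_mat_vec[of _ n n] scalar_prod_add_distrib[of _ n])
  finally show ?thesis by simp
qed

text \<open>c |Pv|^2 <= <Pv, R Pv> = |v|^2.\<close>

lemma op_bound_P: "op_bound n P (1 / sqrt c)"
  unfolding op_bound_def
proof (intro conjI ballI)
  show "P \<in> carrier_mat n n" by (rule P)
  show "0 \<le> 1 / sqrt c" using c by simp
  fix u v :: "real Matrix.vec" assume uv: "u \<in> carrier_vec n" "v \<in> carrier_vec n"
  have Pv: "P *\<^sub>v v \<in> carrier_vec n" "R *\<^sub>v (P *\<^sub>v v) \<in> carrier_vec n" using P R uv by auto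
  have "c * scalar_prod (P *\<^sub>v v) (P *\<^sub>v v) \<le> scalar_prod (P *\<^sub>v v) (R *\<^sub>v (P *\<^sub>v v))" by (rule coercive[OF Pv(1)])
  also have "\<dots> = scalar_prod (R *\<^sub>v (P *\<^sub>v v)) (P *\<^sub>v v)" by (rule comm_scalar_prod[OF Pv])
  also have "\<dots> = scalar_prod (transpose_mat P *\<^sub>v (R *\<^sub>v (P *\<^sub>v v))) v"
    by (rule transpose_vec_mult_scalar[OF P uv(2) Pv(2), symmetric])
  also have "transpose_mat P *\<^sub>v (R *\<^sub>v (P *\<^sub>v v)) = (transpose_mat P * R * P) *\<^sub>v v"
    using P R uv by (simp add: assoc_mult_mat_vec[of _ n n _ n])
  also have "\<dots> = v" unfolding PRP using uv by simp
  finally have "scalar_prod (P *\<^sub>v v) (P *\<^sub>v v) \<le> scalar_prod v v / c" using c by (simp add: field_simps)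
  hence "vnorm (P *\<^sub>v v) \<le> sqrt (scalar_prod v v / c)" by (rule real_sqrt_le_mono)
  hence Pn: "vnorm (P *\<^sub>v v) \<le> 1 / sqrt c * vnorm v" by (simp add: real_sqrt_divide)
  have "\<bar>scalar_prod u (P *\<^sub>v v)\<bar> \<le> vnorm u * vnorm (P *\<^sub>v v)" by (rule scalar_prod_cauchy_schwarz[OF uv(1) Pv(1)])
  also have "\<dots> \<le> vnorm u * (1 / sqrt c * vnorm v)" using Pn vnorm_nonneg by (intro mult_left_mono) auto
  finally show "\<bar>scalar_prod u (P *\<^sub>v v)\<bar> \<le> 1 / sqrt c * (vnorm u * vnorm v)" by (simp add: mult_ac)
qed

lemma op_bound_S: "op_bound n S (1 / c)"
  using op_bound_mult[OF op_bound_P op_bound_transpose[OF op_bound_P]] c unfolding S_def by simp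

text \<open>E is recovered as Q D Q^T with Q = R P, the inverse transpose of P; Q has operator bound
  C / sqrt c and enters twice. This converts sums of squared entries, the form of conditions (5) and
  (6), into sums of squared \<open>e i\<close>.\<close>

lemma frobenius_le:
  assumes R': "op_bound n R C"
  shows "frobenius_sq n E \<le> (C\<^sup>2 / c)\<^sup>2 * (\<Sum>i<n. (e i)\<^sup>2)"
proof -
  let ?Q = "R * P" and ?D = "mat_diag n e"
  have Q: "op_bound n ?Q (C / sqrt c)" using op_bound_mult[OF R' op_bound_P] by simp
  have Qc: "?Q \<in> carrier_mat n n" "transpose_mat ?Q \<in> carrier_mat n n" using R P by auto
  have PtR: "transpose_mat R = R \<Longrightarrow> transpose_mat ?Q = transpose_mat P * R" using R P by (simp add: transpose_mult[of _ n n _ n])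
  have PPR': "P * transpose_mat ?Q = 1\<^sub>m n"
  proof -
    have "transpose_mat (?Q * transpose_mat P) = P * transpose_mat ?Q" using Qc(1) P by (simp add: transpose_mult[of _ n n _ n])
    thus ?thesis unfolding RPP by simp
  qed
  have "?Q * ?D * transpose_mat ?Q = (?Q * transpose_mat P) * E * (P * transpose_mat ?Q)"
    unfolding PEP[symmetric] using Qc P E by (simp add: ass[of ?Q] ass[of _ "_ * _"] ass mc)
  also have "\<dots> = E" unfolding RPP PPR' using E by simp
  finally have Eeq: "E = ?Q * (?D * transpose_mat ?Q)" using Qc by (simp add: ass)
  have D: "?D \<in> carrier_mat n n" by simp
  have DQ: "?D * transpose_mat ?Q \<in> carrier_mat n n" by (rule mc[OF D Qc(2)])
  have "frobenius_sq n E \<le> (C / sqrt c)\<^sup>2 * frobenius_sq n (?D * transpose_mat ?Q)"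
    by (subst Eeq) (rule frobenius_sq_mult[OF Q DQ])
  also have "frobenius_sq n (?D * transpose_mat ?Q) = frobenius_sq n (?Q * ?D)"
  proof -
    have "transpose_mat ?D = ?D" by (auto simp: mat_diag_def)
    hence "transpose_mat (?Q * ?D) = ?D * transpose_mat ?Q" using Qc by (simp add: transpose_mult[of _ n n _ n])
    thus ?thesis using frobenius_sq_transpose[of "?Q * ?D" n] Qc by simp
  qed
  also have "(C / sqrt c)\<^sup>2 * frobenius_sq n (?Q * ?D) \<le> (C / sqrt c)\<^sup>2 * ((C / sqrt c)\<^sup>2 * frobenius_sq n ?D)"
    by (intro mult_left_mono frobenius_sq_mult[OF Q D]) auto
  also have "frobenius_sq n ?D = (\<Sum>i<n. \<Sum>j<n. if i = j then (e i)\<^sup>2 else 0)"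
    unfolding frobenius_sq_def by (intro sum.cong refl) (auto simp: mat_diag_index)
  also have "\<dots> = (\<Sum>i<n. (e i)\<^sup>2)" by simp
  also have "(C / sqrt c)\<^sup>2 * ((C / sqrt c)\<^sup>2 * (\<Sum>i<n. (e i)\<^sup>2)) = (C\<^sup>2 / c)\<^sup>2 * (\<Sum>i<n. (e i)\<^sup>2)"
    using c by (simp add: power_divide power2_eq_square)
  finally show ?thesis .
qed

end

subsection \<open>Expansions of the likelihood criterion\<close>

text \<open>The expression inside the absolute value has derivative t^2 / (1 + t), already of second
  order.\<close>

lemma ln_one_plus_taylor3:
  fixes x :: real assumes "\<bar>x\<bar> \<le> 1 / 2"
  shows "\<bar>ln (1 + x) - x + x\<^sup>2 / 2\<bar> \<le> 2 * \<bar>x\<bar> ^ 3"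
proof -
  let ?S = "closed_segment 0 x"
  have S: "\<bar>t\<bar> \<le> \<bar>x\<bar>" if "t \<in> ?S" for t using that unfolding closed_segment_eq_real_ivl by (auto split: if_splits)
  have "norm ((\<lambda>t. ln (1 + t) - t + t\<^sup>2 / 2) x - (\<lambda>t. ln (1 + t) - t + t\<^sup>2 / 2) 0) \<le> (2 * x\<^sup>2) * norm (x - 0)"
  proof (rule field_differentiable_bound[of ?S _ "\<lambda>t. t\<^sup>2 / (1 + t)"])
    fix t assume t: "t \<in> ?S"
    hence t2: "1 / 2 \<le> 1 + t" using S[OF t] assms by linarith
    show "((\<lambda>t. ln (1 + t) - t + t\<^sup>2 / 2) has_field_derivative t\<^sup>2 / (1 + t)) (at t within ?S)"
      using t2 by (auto intro!: derivative_eq_intros simp: field_simps power2_eq_square)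
    have "t\<^sup>2 / (1 + t) \<le> x\<^sup>2 / (1 / 2)"
      using t2 S[OF t] by (intro frac_le) (auto simp: abs_le_square_iff)
    thus "norm (t\<^sup>2 / (1 + t)) \<le> 2 * x\<^sup>2" using t2 by (simp add: abs_of_nonneg)
  qed auto
  thus ?thesis by (simp add: power2_eq_square power3_eq_cube abs_mult mult.assoc)
qed

lemma inverse_one_plus_taylor:
  fixes x :: real assumes "\<bar>x\<bar> \<le> 1 / 2"
  shows "\<bar>1 / (1 + x) - 1 + x - x\<^sup>2\<bar> \<le> 2 * \<bar>x\<bar> ^ 3" "\<bar>1 / (1 + x) - 1\<bar> \<le> 2 * \<bar>x\<bar>" "\<bar>ln (1 + x)\<bar> \<le> 2 * \<bar>x\<bar>"
proof -
  have p: "1 + x \<ge> 1 / 2" using assms by linarith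
  have i: "1 / (1 + x) \<le> 2" using p by (simp add: divide_le_eq)
  have "1 / (1 + x) - 1 + x - x\<^sup>2 = - (x ^ 3) * (1 / (1 + x))"
    using p by (simp add: field_simps power2_eq_square power3_eq_cube)
  hence "\<bar>1 / (1 + x) - 1 + x - x\<^sup>2\<bar> = \<bar>x\<bar> ^ 3 * (1 / (1 + x))" using p by (simp add: abs_mult power_abs)
  also have "\<dots> \<le> \<bar>x\<bar> ^ 3 * 2" by (intro mult_left_mono i) auto
  finally show "\<bar>1 / (1 + x) - 1 + x - x\<^sup>2\<bar> \<le> 2 * \<bar>x\<bar> ^ 3" by simp
  have "1 / (1 + x) - 1 = - x * (1 / (1 + x))" using p by (simp add: field_simps)
  hence "\<bar>1 / (1 + x) - 1\<bar> = \<bar>x\<bar> * (1 / (1 + x))" using p by (simp add: abs_mult)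
  also have "\<dots> \<le> \<bar>x\<bar> * 2" by (intro mult_left_mono i) auto
  finally show "\<bar>1 / (1 + x) - 1\<bar> \<le> 2 * \<bar>x\<bar>" by simp
  have "\<bar>ln (1 + x) - x\<bar> \<le> 2 * x\<^sup>2" by (rule abs_ln_one_plus_x_minus_x_bound[OF assms])
  moreover have "2 * x\<^sup>2 \<le> \<bar>x\<bar>" using assms mult_left_mono[of "\<bar>x\<bar>" "1 / 2" "\<bar>x\<bar>"] by (simp add: power2_eq_square)
  ultimately show "\<bar>ln (1 + x)\<bar> \<le> 2 * \<bar>x\<bar>" by linarith
qed

text \<open>With q = sqrt (1 + x), ln (1 + x) = 2 ln q >= 2 - 2/q, and subtracting x / (1 + x)
  leaves exactly the square (1 - 1/q)^2. The bound holds on the whole range and not only near 0,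
  because eigenvalues far from 0 occur in the consistency proof.\<close>

lemma ln_minus_ratio_lower_bound:
  fixes x b :: real assumes "0 < 1 + x" "1 + x \<le> b"
  shows "x\<^sup>2 / (b * (sqrt b + 1)\<^sup>2) \<le> ln (1 + x) - x / (1 + x)"
proof -
  define u where "u = 1 + x"
  define q where "q = sqrt u"
  have u: "u > 0" "u \<le> b" using assms unfolding u_def by auto
  have q: "q > 0" "q\<^sup>2 = u" "q \<le> sqrt b" using u unfolding q_def by auto
  have "2 * (1 - 1 / q) \<le> 2 * ln q"
    using ln_le_minus_one[of "1 / q"] q by (simp add: ln_div)
  also have "2 * ln q = ln u" using q unfolding q(2)[symmetric] by (simp add: ln_realpow)
  finally have 1: "2 - 2 / q \<le> ln u" by simp
  have "x\<^sup>2 / (b * (sqrt b + 1)\<^sup>2) \<le> x\<^sup>2 / (u * (q + 1)\<^sup>2)"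
    using u q by (intro divide_left_mono mult_mono power_mono) auto
  also have "x\<^sup>2 / (u * (q + 1)\<^sup>2) = (q - 1)\<^sup>2 / u"
  proof -
    have xq: "x = (q - 1) * (q + 1)" using q(2) unfolding u_def by (simp add: algebra_simps power2_eq_square)
    show ?thesis unfolding xq power_mult_distrib using q by simp
  qed
  also have "\<dots> = (2 - 2 / q) - (1 - 1 / u)"
    unfolding q(2)[symmetric] using q(1) by (simp add: field_simps power2_eq_square)
  also have "1 - 1 / u = x / (1 + x)" using u unfolding u_def by (simp add: field_simps)
  finally show ?thesis using 1 unfolding u_def by linarith
qed

text \<open>Quadratic form in S y minus its mean for centred data of covariance S^-1, divided by
  \<open>n\<close>: for Gaussian data an element of the second Wiener chaos, linear in X.\<close>

definition chaos :: "nat \<Rightarrow> real mat \<Rightarrow> (nat \<Rightarrow> real) \<Rightarrow> real mat \<Rightarrow> real" where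
  "chaos n S y X = 1 / real n * (scalar_prod (S *\<^sub>v Matrix.vec n y) (X *\<^sub>v (S *\<^sub>v Matrix.vec n y)) - mat_trace (S * X))"

lemma chaos_sum:
  assumes S: "S \<in> carrier_mat n n" and X: "X \<in> carrier_mat n n"
  shows "chaos n S y X = 1 / real n * (\<Sum>i<n. \<Sum>j<n. X $$ (i, j) * ((S *\<^sub>v Matrix.vec n y) $ i * (S *\<^sub>v Matrix.vec n y) $ j - S $$ (j, i)))"
proof -
  let ?z = "S *\<^sub>v Matrix.vec n y"
  have z: "?z \<in> carrier_vec n" by (rule mult_mat_vec_carrier[OF S]) simp
  show ?thesis unfolding chaos_def scalar_prod_mult_mat_vec_sum[OF X z z] mat_trace_mult_sum[OF S X] sum_subtractf[symmetric]
    by (intro arg_cong[where f = "\<lambda>x. 1 / real n * x"] sum.cong refl) (simp only: right_diff_distrib mult_ac)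
qed

lemma vnorm_vec_sq: "(vnorm (Matrix.vec n y))\<^sup>2 = (\<Sum>i<n. (y i)\<^sup>2)"
  unfolding vnorm_sq by (subst scalar_prod_sum[of _ n]) (auto simp: power2_eq_square)

text \<open>A bound for every single data vector. It ignores the cancellation by centring, but
  suffices for matrices that are already of third order in the increment.\<close>

lemma chaos_bound:
  assumes S: "op_bound n S (1 / c)" and X: "op_bound n X \<rho>" and n: "n > 0" and c: "c > 0"
  shows "\<bar>chaos n S y X\<bar> \<le> \<rho> * (1 / c\<^sup>2 + 1 / c) * (1 + (\<Sum>i<n. (y i)\<^sup>2) / real n)"
proof -
  let ?y = "Matrix.vec n y" let ?z = "S *\<^sub>v ?y"
  define Y where "Y = (\<Sum>i<n. (y i)\<^sup>2)"
  have Y: "Y \<ge> 0" unfolding Y_def by (intro sum_nonneg) auto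
  have z: "?z \<in> carrier_vec n" by (rule mult_mat_vec_carrier[OF op_bound_carrier[OF S]]) simp
  have "vnorm ?z \<le> 1 / c * vnorm ?y" by (rule op_bound_vnorm[OF S]) simp
  hence "(vnorm ?z)\<^sup>2 \<le> (1 / c * vnorm ?y)\<^sup>2" by (intro power_mono vnorm_nonneg)
  also have "\<dots> = Y / c\<^sup>2" unfolding power_mult_distrib vnorm_vec_sq Y_def by (simp add: power_divide)
  finally have z2: "(vnorm ?z)\<^sup>2 \<le> Y / c\<^sup>2" .
  have \<rho>: "\<rho> \<ge> 0" by (rule op_bound_nonneg[OF X])
  have "\<bar>scalar_prod ?z (X *\<^sub>v ?z)\<bar> \<le> \<rho> * (vnorm ?z * vnorm ?z)" by (rule op_bound_scalar[OF X z z])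
  also have "\<dots> \<le> \<rho> * (Y / c\<^sup>2)" using z2 \<rho> by (intro mult_left_mono) (simp_all only: power2_eq_square)
  finally have 1: "\<bar>scalar_prod ?z (X *\<^sub>v ?z)\<bar> \<le> \<rho> * (Y / c\<^sup>2)" .
  have 2: "\<bar>mat_trace (S * X)\<bar> \<le> real n * (1 / c * \<rho>)" by (rule op_bound_trace[OF op_bound_mult[OF S X]])
  have "\<bar>chaos n S y X\<bar> \<le> 1 / real n * (\<rho> * (Y / c\<^sup>2) + real n * (1 / c * \<rho>))"
    unfolding chaos_def abs_mult using 1 2 by (intro mult_mono) auto
  also have "\<dots> = \<rho> * (1 / c\<^sup>2 * (Y / real n) + 1 / c)" using n c by (simp add: field_simps)
  also have "\<dots> \<le> \<rho> * ((1 / c\<^sup>2 + 1 / c) * (1 + Y / real n))"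
  proof (intro mult_left_mono \<rho>)
    have "0 \<le> 1 / c\<^sup>2" "0 \<le> 1 / c * (Y / real n)" using c Y by auto
    moreover have "(p + q) * (1 + r) = p * r + q + (p + q * r)" for p q r :: real by (simp add: algebra_simps)
    ultimately show "1 / c\<^sup>2 * (Y / real n) + 1 / c \<le> (1 / c\<^sup>2 + 1 / c) * (1 + Y / real n)" by (simp only:)
  qed
  finally show ?thesis unfolding Y_def by (simp add: mult.assoc)
qed

section \<open>Criterion differences in diagonal coordinates\<close>

context simultaneous_diagonal begin

definition loglik_diff :: "(nat \<Rightarrow> real) \<Rightarrow> real" where
  "loglik_diff y = (1 / real n * ln (Determinant.det (R + E)) + 1 / real n * scalar_prod (Matrix.vec n y) (mat_inv (R + E) *\<^sub>v Matrix.vec n y))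
    - (1 / real n * ln (Determinant.det R) + 1 / real n * scalar_prod (Matrix.vec n y) (mat_inv R *\<^sub>v Matrix.vec n y))"

lemma loglik_diff_eq:
  assumes e: "\<And>i. i < n \<Longrightarrow> 0 < 1 + e i"
  shows "loglik_diff y = 1 / real n * (\<Sum>i<n. ln (1 + e i) + (w y i)\<^sup>2 * (1 / (1 + e i) - 1))"
proof -
  have e0: "1 + e i \<noteq> 0" if "i < n" for i using e[OF that] by simp
  have "(\<Prod>i<n. 1 + e i) > 0" using e by (intro prod_pos) auto
  hence "ln (Determinant.det (R + E)) = ln (Determinant.det R) + (\<Sum>i<n. ln (1 + e i))"
  proof -
    have "ln (\<Prod>i<n. 1 + e i) = (\<Sum>i<n. ln (1 + e i))" by (intro ln_prod) (use e0 in auto)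
    thus ?thesis unfolding det_ratio using det_R_pos \<open>(\<Prod>i<n. 1 + e i) > 0\<close> by (simp add: ln_mult_pos)
  qed
  moreover have "scalar_prod (Matrix.vec n y) (mat_inv (R + E) *\<^sub>v Matrix.vec n y) = (\<Sum>i<n. 1 / (1 + e i) * (w y i)\<^sup>2)"
    by (rule quadratic_inverse_sum[OF e0])
  ultimately show ?thesis unfolding loglik_diff_def inv_R quadratic_S
    by (simp add: sum.distrib sum_subtractf algebra_simps)
qed

lemma chaos_E: "chaos n S y E = 1 / real n * (\<Sum>i<n. e i * ((w y i)\<^sup>2 - 1))"
  unfolding chaos_def quadratic_sandwich[OF E PEP] trace_SE by (simp add: algebra_simps sum_subtractf)

lemma ESE_carrier: "E * S * E \<in> carrier_mat n n" using E S by simp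

lemma chaos_ESE: "chaos n S y (E * S * E) = 1 / real n * (\<Sum>i<n. (e i)\<^sup>2 * ((w y i)\<^sup>2 - 1))"
  unfolding chaos_def quadratic_sandwich[OF ESE_carrier ESE_diag] trace_SESE by (simp add: algebra_simps sum_subtractf)

lemma sum_w_sq_le: "(\<Sum>i<n. (w y i)\<^sup>2) \<le> (\<Sum>i<n. (y i)\<^sup>2) / c"
proof -
  have "(\<Sum>i<n. (w y i)\<^sup>2) \<le> 1 / c * (vnorm (Matrix.vec n y) * vnorm (Matrix.vec n y))"
    using op_bound_scalar[OF op_bound_S, of "Matrix.vec n y" "Matrix.vec n y"] unfolding quadratic_S by simp
  thus ?thesis using vnorm_vec_sq[of n y] by (simp add: power2_eq_square)
qed

text \<open>Turns a bound per coordinate into one by the mean square of the raw data, since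
  whitening enlarges the squared norm by at most the factor 1/c.\<close>

lemma weighted_sum_le:
  assumes n: "n > 0" and f: "\<And>i. i < n \<Longrightarrow> \<bar>f i\<bar> \<le> B * (1 + (w y i)\<^sup>2)" and B: "B \<ge> 0"
  shows "\<bar>1 / real n * (\<Sum>i<n. f i)\<bar> \<le> B * (1 + 1 / c) * (1 + (\<Sum>i<n. (y i)\<^sup>2) / real n)"
proof -
  define Y where "Y = (\<Sum>i<n. (y i)\<^sup>2)"
  have Y: "Y \<ge> 0" unfolding Y_def by (intro sum_nonneg) auto
  have "\<bar>\<Sum>i<n. f i\<bar> \<le> (\<Sum>i<n. B * (1 + (w y i)\<^sup>2))" by (rule order_trans[OF sum_abs sum_mono]) (use f in auto)
  also have "\<dots> = B * (real n + (\<Sum>i<n. (w y i)\<^sup>2))" by (simp add: sum_distrib_left[symmetric] sum.distrib)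
  also have "\<dots> \<le> B * (real n + Y / c)" using sum_w_sq_le[of y] B unfolding Y_def by (intro mult_left_mono add_left_mono) auto
  finally have "\<bar>1 / real n * (\<Sum>i<n. f i)\<bar> \<le> 1 / real n * (B * (real n + Y / c))"
    unfolding abs_mult by (intro mult_mono) auto
  also have "\<dots> = B * (1 + 1 / c * (Y / real n))" using n c by (simp add: field_simps)
  also have "\<dots> \<le> B * ((1 + 1 / c) * (1 + Y / real n))"
  proof (intro mult_left_mono B)
    have "0 \<le> 1 / c" "0 \<le> Y / real n" using c Y by auto
    moreover have "(1 + q) * (1 + r) = 1 + q * r + (q + r)" for q r :: real by (simp add: algebra_simps)
    ultimately show "1 + 1 / c * (Y / real n) \<le> (1 + 1 / c) * (1 + Y / real n)" by (simp only:)
  qed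
  finally show ?thesis unfolding Y_def by (simp add: mult.assoc)
qed

lemma loglik_diff_lipschitz:
  assumes n: "n > 0" and \<rho>: "op_bound n E \<rho>" "\<rho> \<le> c / 2"
  shows "\<bar>loglik_diff y\<bar> \<le> 2 * (\<rho> / c) * (1 + 1 / c) * (1 + (\<Sum>i<n. (y i)\<^sup>2) / real n)"
proof -
  have e: "\<bar>e i\<bar> \<le> \<rho> / c" "\<bar>e i\<bar> \<le> 1 / 2" if "i < n" for i
  proof -
    show 1: "\<bar>e i\<bar> \<le> \<rho> / c" by (rule e_bound[OF \<rho>(1) that])
    have "\<rho> / c \<le> 1 / 2" using \<rho>(2) c by (simp add: field_simps)
    with 1 show "\<bar>e i\<bar> \<le> 1 / 2" by linarith
  qed
  have pos: "0 < 1 + e i" if "i < n" for i using e(2)[OF that] by linarith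
  have \<rho>0: "0 \<le> \<rho>" by (rule op_bound_nonneg[OF \<rho>(1)])
  have D: "loglik_diff y = 1 / real n * (\<Sum>i<n. ln (1 + e i) + (w y i)\<^sup>2 * (1 / (1 + e i) - 1))"
    by (rule loglik_diff_eq[OF pos])
  show ?thesis unfolding D
  proof (rule weighted_sum_le[OF n])
    fix i assume i: "i < n"
    note t = inverse_one_plus_taylor[OF e(2)[OF i]]
    have "\<bar>ln (1 + e i) + (w y i)\<^sup>2 * (1 / (1 + e i) - 1)\<bar> \<le> \<bar>ln (1 + e i)\<bar> + (w y i)\<^sup>2 * \<bar>1 / (1 + e i) - 1\<bar>"
      using abs_triangle_ineq[of "ln (1 + e i)" "(w y i)\<^sup>2 * (1 / (1 + e i) - 1)"] by (simp add: abs_mult)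
    also have "\<dots> \<le> 2 * \<bar>e i\<bar> + (w y i)\<^sup>2 * (2 * \<bar>e i\<bar>)" using t by (intro add_mono mult_left_mono) auto
    also have "\<dots> = 2 * \<bar>e i\<bar> * (1 + (w y i)\<^sup>2)" by (simp add: algebra_simps)
    also have "\<dots> \<le> 2 * (\<rho> / c) * (1 + (w y i)\<^sup>2)" using e(1)[OF i] by (intro mult_right_mono) auto
    finally show "\<bar>ln (1 + e i) + (w y i)\<^sup>2 * (1 / (1 + e i) - 1)\<bar> \<le> 2 * (\<rho> / c) * (1 + (w y i)\<^sup>2)" .
  qed (use \<rho>0 c in auto)
qed

text \<open>Per coordinate, ln (1 + e) + w^2 (1/(1 + e) - 1) is e - e^2/2 + w^2 (e^2 - e) up to
  third order, that is -e (w^2 - 1) + e^2 (w^2 - 1) + e^2/2. The first two sums are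
  \<open>chaos\<close> terms, the last is a trace.\<close>

lemma loglik_diff_expansion:
  assumes n: "n > 0" and \<rho>: "op_bound n E \<rho>" "\<rho> \<le> c / 2"
  shows "\<bar>loglik_diff y - (- chaos n S y E + chaos n S y (E * S * E) + mat_trace (S * (E * S * E)) / (2 * real n))\<bar>
    \<le> 2 * (\<rho> / c) ^ 3 * (1 + 1 / c) * (1 + (\<Sum>i<n. (y i)\<^sup>2) / real n)"
proof -
  have e: "\<bar>e i\<bar> \<le> \<rho> / c" "\<bar>e i\<bar> \<le> 1 / 2" if "i < n" for i
  proof -
    show 1: "\<bar>e i\<bar> \<le> \<rho> / c" by (rule e_bound[OF \<rho>(1) that])
    have "\<rho> / c \<le> 1 / 2" using \<rho>(2) c by (simp add: field_simps)
    with 1 show "\<bar>e i\<bar> \<le> 1 / 2" by linarith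
  qed
  have pos: "0 < 1 + e i" if "i < n" for i using e(2)[OF that] by linarith
  have \<rho>0: "0 \<le> \<rho>" by (rule op_bound_nonneg[OF \<rho>(1)])
  let ?f = "\<lambda>i. (ln (1 + e i) - e i + (e i)\<^sup>2 / 2) + (w y i)\<^sup>2 * (1 / (1 + e i) - 1 + e i - (e i)\<^sup>2)"
  have tr: "mat_trace (S * (E * S * E)) / (2 * real n) = 1 / real n * (\<Sum>i<n. (e i)\<^sup>2 / 2)"
    unfolding trace_SESE by (simp add: sum_divide_distrib)
  have "loglik_diff y - (- chaos n S y E + chaos n S y (E * S * E) + mat_trace (S * (E * S * E)) / (2 * real n))
      = 1 / real n * ((\<Sum>i<n. ln (1 + e i) + (w y i)\<^sup>2 * (1 / (1 + e i) - 1)) + (\<Sum>i<n. e i * ((w y i)\<^sup>2 - 1))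
         - (\<Sum>i<n. (e i)\<^sup>2 * ((w y i)\<^sup>2 - 1)) - (\<Sum>i<n. (e i)\<^sup>2 / 2))"
  proof -
    have D: "loglik_diff y = 1 / real n * (\<Sum>i<n. ln (1 + e i) + (w y i)\<^sup>2 * (1 / (1 + e i) - 1))"
      by (rule loglik_diff_eq[OF pos])
    have "k * a - (- (k * b) + k * c' + k * d) = k * (a + b - c' - d)" for k a b c' d :: real by (simp add: algebra_simps)
    thus ?thesis unfolding D chaos_E chaos_ESE tr .
  qed
  also have "\<dots> = 1 / real n * (\<Sum>i<n. ?f i)"
    unfolding sum.distrib[symmetric] sum_subtractf[symmetric]
    by (intro arg_cong[where f = "\<lambda>x. 1 / real n * x"] sum.cong refl) (simp add: algebra_simps)
  finally have eq: "loglik_diff y - (- chaos n S y E + chaos n S y (E * S * E) + mat_trace (S * (E * S * E)) / (2 * real n)) = 1 / real n * (\<Sum>i<n. ?f i)" .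
  show ?thesis unfolding eq
  proof (rule weighted_sum_le[OF n])
    fix i assume i: "i < n"
    note t = inverse_one_plus_taylor(1)[OF e(2)[OF i]] ln_one_plus_taylor3[OF e(2)[OF i]]
    have "\<bar>?f i\<bar> \<le> \<bar>ln (1 + e i) - e i + (e i)\<^sup>2 / 2\<bar> + (w y i)\<^sup>2 * \<bar>1 / (1 + e i) - 1 + e i - (e i)\<^sup>2\<bar>"
      using abs_triangle_ineq[of "ln (1 + e i) - e i + (e i)\<^sup>2 / 2" "(w y i)\<^sup>2 * (1 / (1 + e i) - 1 + e i - (e i)\<^sup>2)"] by (simp add: abs_mult)
    also have "\<dots> \<le> 2 * \<bar>e i\<bar> ^ 3 + (w y i)\<^sup>2 * (2 * \<bar>e i\<bar> ^ 3)" using t by (intro add_mono mult_left_mono) auto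
    also have "\<dots> = 2 * \<bar>e i\<bar> ^ 3 * (1 + (w y i)\<^sup>2)" by (simp add: algebra_simps)
    also have "\<dots> \<le> 2 * (\<rho> / c) ^ 3 * (1 + (w y i)\<^sup>2)" using e(1)[OF i] by (intro mult_right_mono mult_left_mono power_mono) auto
    finally show "\<bar>?f i\<bar> \<le> 2 * (\<rho> / c) ^ 3 * (1 + (w y i)\<^sup>2)" .
  qed (use \<rho>0 c in auto)
qed

text \<open>Writing w^2 as 1 + (w^2 - 1) splits off the deterministic part ln (1 + e) - e / (1 + e).
  This is twice a Kullback-Leibler divergence, and it is at least a multiple of e^2 as long as 1 + e
  <= b.\<close>

lemma loglik_diff_lower_bound:
  assumes n: "n > 0" and \<rho>: "op_bound n E \<rho>" and a: "a > 0" "\<And>i. i < n \<Longrightarrow> a \<le> 1 + e i"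
  defines "b \<equiv> 1 + \<rho> / c"
  shows "(\<Sum>i<n. (e i)\<^sup>2) / real n / (b * (sqrt b + 1)\<^sup>2) - 1 / real n * (\<Sum>i<n. e i / (1 + e i) * ((w y i)\<^sup>2 - 1)) \<le> loglik_diff y"
proof -
  have pos: "0 < 1 + e i" if "i < n" for i using a(1) a(2)[OF that] by linarith
  have "loglik_diff y = 1 / real n * (\<Sum>i<n. (ln (1 + e i) - e i / (1 + e i)) - e i / (1 + e i) * ((w y i)\<^sup>2 - 1))"
  proof (subst loglik_diff_eq[OF pos], assumption, intro arg_cong[where f = "\<lambda>x. 1 / real n * x"] sum.cong refl)
    fix i assume "i \<in> {..<n}"
    hence p: "1 + e i > 0" using pos by simp
    have "1 / (1 + e i) - 1 = - (e i / (1 + e i))" using p by (simp add: field_simps)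
    moreover have "l + W * (- q) = (l - q) - q * (W - 1)" for l W q :: real by (simp add: algebra_simps)
    ultimately show "ln (1 + e i) + (w y i)\<^sup>2 * (1 / (1 + e i) - 1) = (ln (1 + e i) - e i / (1 + e i)) - e i / (1 + e i) * ((w y i)\<^sup>2 - 1)"
      by (simp only:)
  qed
  also have "\<dots> = 1 / real n * (\<Sum>i<n. ln (1 + e i) - e i / (1 + e i)) - 1 / real n * (\<Sum>i<n. e i / (1 + e i) * ((w y i)\<^sup>2 - 1))"
    by (simp only: sum_subtractf right_diff_distrib)
  finally have eq: "loglik_diff y = \<dots>" .
  have "(\<Sum>i<n. (e i)\<^sup>2) / (b * (sqrt b + 1)\<^sup>2) \<le> (\<Sum>i<n. ln (1 + e i) - e i / (1 + e i))"
    unfolding sum_divide_distrib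
  proof (rule sum_mono)
    fix i assume "i \<in> {..<n}"
    hence i: "i < n" by simp
    show "(e i)\<^sup>2 / (b * (sqrt b + 1)\<^sup>2) \<le> ln (1 + e i) - e i / (1 + e i)"
      by (rule ln_minus_ratio_lower_bound[OF pos[OF i]]) (use e_bound[OF \<rho> i] in \<open>auto simp: b_def\<close>)
  qed
  hence "1 / real n * ((\<Sum>i<n. (e i)\<^sup>2) / (b * (sqrt b + 1)\<^sup>2)) \<le> 1 / real n * (\<Sum>i<n. ln (1 + e i) - e i / (1 + e i))"
    by (intro mult_left_mono) auto
  thus ?thesis unfolding eq by simp
qed

end

subsection \<open>The Gaussian likelihood under expanding-domain asymptotics\<close>

unbundle no vec_syntax

lemma scalar_prod_self_pos:
  assumes v: "v \<in> carrier_vec n" "v \<noteq> 0\<^sub>v n" shows "0 < scalar_prod v (v :: real Matrix.vec)"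
proof (rule ccontr)
  assume "\<not> ?thesis"
  hence "(\<Sum>i<n. v $ i * v $ i) = 0"
    using scalar_prod_self_nonneg[of v] unfolding scalar_prod_sum[OF v(1)] by linarith
  hence "\<forall>i<n. v $ i = 0" by (subst (asm) sum_nonneg_eq_0_iff) auto
  hence "v = 0\<^sub>v n" using v(1) by (intro eq_vecI) auto
  thus False using v(2) by simp
qed

locale gaussian_mle =
  fixes \<Theta> :: "(real ^ 'p) set"
    and \<theta>0 :: "real ^ 'p"
    and k khat :: "real ^ 'p \<Rightarrow> real ^ 'd \<Rightarrow> real"
    and Dk :: "'p list \<Rightarrow> real ^ 'p \<Rightarrow> real ^ 'd \<Rightarrow> real"
    and s :: "nat \<Rightarrow> real ^ 'd"
    and M :: "'a measure"
    and \<xi> :: "real ^ 'd \<Rightarrow> 'a \<Rightarrow> real"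
    and est :: "nat \<Rightarrow> (nat \<Rightarrow> real) \<Rightarrow> real ^ 'p"
    and \<Delta> C_inf C_sup :: real
  assumes compact_params: "compact \<Theta>"
    and interior_param: "\<theta>0 \<in> interior \<Theta>"
    and covariance_functions: "\<forall>\<theta>\<in>\<Theta>. symmetric_function (k \<theta>) \<and> positive_definite_function (k \<theta>)"
    and continuous_param: "\<forall>x. continuous_on \<Theta> (\<lambda>\<theta>. k \<theta> x)"
    and derivatives: "iterated_partial_derivatives \<Theta> 3 k Dk"
    and spectral_densities: "\<forall>\<theta>\<in>\<Theta>. has_spectral_density (k \<theta>) (khat \<theta>)"
    and prob_M: "prob_space M"
    and gaussian: "gaussian_process M \<xi>"
    and centred: "\<forall>u. (\<integral>\<omega>. \<xi> u \<omega> \<partial>M) = 0"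
    and covariances: "\<forall>u v. covariance M (\<xi> u) (\<xi> v) = k \<theta>0 (u - v)"
    and inj_points: "inj s"
    and estimator: "max_likelihood_estimator M \<xi> s \<Theta> k est"
    and condition1: "\<Delta> > 0" "\<forall>i j. i \<noteq> j \<longrightarrow> norm (s i - s j) \<ge> \<Delta>"
    and constants: "C_inf > 0"
    and condition2: "\<forall>x. \<forall>\<theta>\<in>\<Theta>.
        \<bar>k \<theta> x\<bar> \<le> C_sup / (1 + norm x powr (real CARD('d) + C_inf))"
    and condition3: "\<forall>x. \<forall>r\<in>{1, 2, 3}. \<forall>is. length is = r \<longrightarrow> (\<forall>\<theta>\<in>\<Theta>.
        \<bar>Dk is \<theta> x\<bar> \<le> C_sup / (1 + norm x powr (real CARD('d) + C_inf)))"
    and condition4: "continuous_on (\<Theta> \<times> UNIV) (\<lambda>(\<theta>, \<omega>). khat \<theta> \<omega>)"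
        "\<forall>\<theta>\<in>\<Theta>. \<forall>\<omega>. khat \<theta> \<omega> > 0"
    and condition5: "\<forall>\<epsilon>>0. liminf (\<lambda>n. INF \<theta>\<in>{\<theta>\<in>\<Theta>. norm (\<theta> - \<theta>0) \<ge> \<epsilon>}.
        ereal (1 / real n * (\<Sum>i<n. \<Sum>j<n. (k \<theta> (s i - s j) - k \<theta>0 (s i - s j))\<^sup>2))) > 0"
    and condition6: "\<forall>l :: real ^ 'p. l \<noteq> 0 \<longrightarrow> liminf (\<lambda>n.
        ereal (1 / real n * (\<Sum>i<n. \<Sum>j<n.
          (\<Sum>m\<in>UNIV. vec_nth l m * Dk [m] \<theta>0 (s i - s j))\<^sup>2))) > 0"
begin

sublocale prob_space M by (rule prob_M)

lemma true_param: "\<theta>0 \<in> \<Theta>" using interior_param interior_subset by blast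

text \<open>One notation for the matrices of covariances, of their differences and of their
  derivatives, all subject to the same operator bound.\<close>

definition gram :: "nat \<Rightarrow> (real ^ 'd \<Rightarrow> real) \<Rightarrow> real mat" where
  "gram n f = Matrix.mat n n (\<lambda>(i, j). f (s i - s j))"

lemma gram_carrier [simp]: "gram n f \<in> carrier_mat n n" unfolding gram_def by simp
lemma gram_index: "i < n \<Longrightarrow> j < n \<Longrightarrow> gram n f $$ (i, j) = f (s i - s j)" unfolding gram_def by simp
lemma cov_matrix_gram: "cov_matrix \<kappa> s n \<theta> = gram n (\<kappa> \<theta>)" unfolding cov_matrix_def gram_def ..
lemma gram_add: "gram n f + gram n g = gram n (\<lambda>x. f x + g x)" unfolding gram_def by (intro eq_matI) auto
lemma gram_symmetric: "(\<And>x. f (- x) = f x) \<Longrightarrow> transpose_mat (gram n f) = gram n f"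
  unfolding gram_def by (intro eq_matI) (auto, metis minus_diff_eq)

text \<open>Summability constant of the points for two exponents: the full decay, and the decay with
  half of \<open>C_inf\<close> given up, which leaves a margin for making tails small.\<close>

definition pack :: real where
  "pack = (SOME S. S > 0 \<and> (\<forall>\<beta>\<in>{real CARD('d) + C_inf, real CARD('d) + C_inf / 2}. \<forall>n i. (\<Sum>j<n. 1 / (1 + norm (s i - s j) powr \<beta>)) \<le> S))"

lemma pack: "pack > 0" "\<beta> \<in> {real CARD('d) + C_inf, real CARD('d) + C_inf / 2} \<Longrightarrow> (\<Sum>j<n. 1 / (1 + norm (s i - s j) powr \<beta>)) \<le> pack"
proof -
  have "\<exists>S>0. \<forall>n i. (\<Sum>j<n. 1 / (1 + norm (s i - s j) powr \<beta>)) \<le> S" if "\<beta> \<in> {real CARD('d) + C_inf, real CARD('d) + C_inf / 2}" for \<beta>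
  proof -
    have "real DIM(real ^ 'd) < \<beta>" using that constants by auto
    from separated_sum_bounded[OF condition1(1) this] obtain S where S: "S > 0"
      "\<forall>(s :: nat \<Rightarrow> real ^ 'd) J x. finite J \<longrightarrow> (\<forall>i j. i \<noteq> j \<longrightarrow> \<Delta> \<le> norm (s i - s j)) \<longrightarrow> (\<Sum>j\<in>J. 1 / (1 + norm (s j - x) powr \<beta>)) \<le> S"
      by (elim exE conjE)
    have "(\<Sum>j<n. 1 / (1 + norm (s i - s j) powr \<beta>)) \<le> S" for n i
      using S(2)[rule_format, of "{..<n}" s "s i"] condition1(2) by (simp add: norm_minus_commute)
    with S(1) show ?thesis by blast
  qed
  from this[of "real CARD('d) + C_inf"] this[of "real CARD('d) + C_inf / 2"] obtain S1 S2 where S: "S1 > 0" "\<forall>n i. (\<Sum>j<n. 1 / (1 + norm (s i - s j) powr (real CARD('d) + C_inf))) \<le> S1"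
    "\<forall>n i. (\<Sum>j<n. 1 / (1 + norm (s i - s j) powr (real CARD('d) + C_inf / 2))) \<le> S2" by auto
  have "\<exists>S. S > 0 \<and> (\<forall>\<beta>\<in>{real CARD('d) + C_inf, real CARD('d) + C_inf / 2}. \<forall>n i. (\<Sum>j<n. 1 / (1 + norm (s i - s j) powr \<beta>)) \<le> S)"
    by (rule exI[of _ "max S1 S2"]) (use S in \<open>auto simp: le_max_iff_disj\<close>)
  from someI_ex[OF this] show "pack > 0" "\<beta> \<in> {real CARD('d) + C_inf, real CARD('d) + C_inf / 2} \<Longrightarrow> (\<Sum>j<n. 1 / (1 + norm (s i - s j) powr \<beta>)) \<le> pack"
    unfolding pack_def[symmetric] by auto
qed

lemma op_bound_gram:
  assumes f: "\<And>x. \<bar>f x\<bar> \<le> \<rho> / (1 + norm x powr \<beta>)" and \<beta>: "\<beta> \<in> {real CARD('d) + C_inf, real CARD('d) + C_inf / 2}" and \<rho>: "\<rho> \<ge> 0"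
  shows "op_bound n (gram n f) (\<rho> * pack)"
  unfolding op_bound_def
proof (intro conjI ballI)
  show "gram n f \<in> carrier_mat n n" by simp
  show "0 \<le> \<rho> * pack" using \<rho> pack(1) by simp
  fix u v :: "real Matrix.vec" assume uv: "u \<in> carrier_vec n" "v \<in> carrier_vec n"
  let ?W = "\<lambda>i j. \<rho> * (1 / (1 + norm (s i - s j) powr \<beta>))"
  have row: "(\<Sum>j<n. ?W i j) \<le> \<rho> * pack" for i
    unfolding sum_distrib_left[symmetric] by (intro mult_left_mono pack(2) \<beta> \<rho>)
  have col: "(\<Sum>i<n. ?W i j) \<le> \<rho> * pack" for j
    using row[of j] by (simp only: norm_minus_commute[of "s j"])
  have "\<bar>\<Sum>i<n. \<Sum>j<n. u $ i * v $ j * gram n f $$ (i, j)\<bar> \<le> \<rho> * pack * (sqrt (\<Sum>i<n. (u $ i)\<^sup>2) * sqrt (\<Sum>i<n. (v $ i)\<^sup>2))"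
    by (rule schur_test[OF _ row col]) (use f in \<open>simp add: gram_index\<close>)
  thus "\<bar>scalar_prod u (gram n f *\<^sub>v v)\<bar> \<le> \<rho> * pack * (vnorm u * vnorm v)"
    unfolding scalar_prod_mult_mat_vec_sum[OF gram_carrier uv] scalar_prod_sum[OF uv(1)] scalar_prod_sum[OF uv(2)]
    by (simp only: power2_eq_square)
qed

lemma C_sup_nonneg: "C_sup \<ge> 0"
proof -
  have "\<bar>k \<theta>0 0\<bar> \<le> C_sup / (1 + norm (0 :: real ^ 'd) powr (real CARD('d) + C_inf))" using condition2 true_param by blast
  thus ?thesis by simp
qed

text \<open>The added 1 keeps the bound positive when \<open>C_sup\<close> is 0.\<close>

definition Cop :: real where "Cop = (C_sup + 1) * pack"

lemma Cop_pos: "Cop > 0" unfolding Cop_def using C_sup_nonneg pack(1) by simp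

lemma C_sup_pack_le: "C_sup * pack \<le> Cop" unfolding Cop_def using pack(1) by (simp add: algebra_simps)

lemma op_bound_K: "\<theta> \<in> \<Theta> \<Longrightarrow> op_bound n (gram n (k \<theta>)) Cop"
  by (rule op_bound_mono[OF op_bound_gram[where \<rho> = C_sup and \<beta> = "real CARD('d) + C_inf"] C_sup_pack_le])
    (use condition2 C_sup_nonneg in auto)

text \<open>Lower eigenvalue bound shared by all parameters and all sizes; it exists by
  \<open>spectral_quadratic_form_lower_bound\<close>.\<close>

definition cR :: real where
  "cR = (SOME c. c > 0 \<and> (\<forall>\<theta>\<in>\<Theta>. \<forall>n v. c * (\<Sum>i<n. (v i)\<^sup>2) \<le> (\<Sum>i<n. \<Sum>j<n. v i * v j * k \<theta> (s i - s j))))"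

lemma cR_pos: "cR > 0"
  and coercive: "\<theta> \<in> \<Theta> \<Longrightarrow> v \<in> carrier_vec n \<Longrightarrow> cR * scalar_prod v v \<le> scalar_prod v (gram n (k \<theta>) *\<^sub>v v)"
proof -
  have "\<exists>c>0. \<forall>\<theta>\<in>\<Theta>. \<forall>(s :: nat \<Rightarrow> real ^ 'd) n v. (\<forall>i j. i \<noteq> j \<longrightarrow> \<Delta> \<le> norm (s i - s j)) \<longrightarrow>
    c * (\<Sum>i<n. (v i)\<^sup>2) \<le> (\<Sum>i<n. \<Sum>j<n. v i * v j * k \<theta> (s i - s j))"
    by (rule spectral_quadratic_form_lower_bound[OF compact_params condition1(1) _ condition4(1)])
      (use spectral_densities condition4(2) in auto)
  then obtain c where c: "c > 0" "\<forall>\<theta>\<in>\<Theta>. \<forall>(s :: nat \<Rightarrow> real ^ 'd) n v. (\<forall>i j. i \<noteq> j \<longrightarrow> \<Delta> \<le> norm (s i - s j)) \<longrightarrow>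
    c * (\<Sum>i<n. (v i)\<^sup>2) \<le> (\<Sum>i<n. \<Sum>j<n. v i * v j * k \<theta> (s i - s j))" by (elim exE conjE)
  have "\<exists>c. c > 0 \<and> (\<forall>\<theta>\<in>\<Theta>. \<forall>n v. c * (\<Sum>i<n. (v i)\<^sup>2) \<le> (\<Sum>i<n. \<Sum>j<n. v i * v j * k \<theta> (s i - s j)))"
  proof (intro exI conjI ballI allI)
    show "c > 0" by (rule c(1))
  qed (use c(2) condition1(2) in blast)
  from someI_ex[OF this] have cR: "cR > 0" "\<forall>\<theta>\<in>\<Theta>. \<forall>n v. cR * (\<Sum>i<n. (v i)\<^sup>2) \<le> (\<Sum>i<n. \<Sum>j<n. v i * v j * k \<theta> (s i - s j))"
    unfolding cR_def[symmetric] by auto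
  show "cR > 0" by (rule cR(1))
  assume \<theta>: "\<theta> \<in> \<Theta>" and v: "v \<in> carrier_vec n"
  have "cR * (\<Sum>i<n. (v $ i)\<^sup>2) \<le> (\<Sum>i<n. \<Sum>j<n. v $ i * v $ j * k \<theta> (s i - s j))"
    using cR(2)[THEN bspec, OF \<theta>, THEN spec[of _ n], THEN spec[of _ "\<lambda>i. v $ i"]] .
  also have "\<dots> = (\<Sum>i<n. \<Sum>j<n. v $ i * v $ j * gram n (k \<theta>) $$ (i, j))"
    by (intro sum.cong refl) (simp add: gram_index)
  finally show "cR * scalar_prod v v \<le> scalar_prod v (gram n (k \<theta>) *\<^sub>v v)"
    unfolding scalar_prod_mult_mat_vec_sum[OF gram_carrier v v] scalar_prod_sum[OF v] by (simp only: power2_eq_square)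
qed

lemma k_even: "\<theta> \<in> \<Theta> \<Longrightarrow> k \<theta> (- x) = k \<theta> x"
  using covariance_functions unfolding symmetric_function_def by blast

lemma diagonalize:
  assumes \<theta>: "\<theta> \<in> \<Theta>" and X: "X \<in> carrier_mat n n" "transpose_mat X = X"
  shows "\<exists>P e. simultaneous_diagonal n (gram n (k \<theta>)) X P e cR"
proof -
  have "\<exists>P e. P \<in> carrier_mat n n \<and> transpose_mat P * gram n (k \<theta>) * P = 1\<^sub>m n \<and> transpose_mat P * X * P = mat_diag n e"
  proof (rule simultaneous_diagonalization)
    fix v :: "real Matrix.vec" assume v: "v \<in> carrier_vec n" "v \<noteq> 0\<^sub>v n"
    have "0 < cR * scalar_prod v v" using cR_pos scalar_prod_self_pos[OF v] by simp
    thus "0 < scalar_prod v (gram n (k \<theta>) *\<^sub>v v)" using coercive[OF \<theta> v(1)] by linarith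
  qed (use X gram_symmetric[of "k \<theta>"] k_even[OF \<theta>] in auto)
  then obtain P e where "P \<in> carrier_mat n n" "transpose_mat P * gram n (k \<theta>) * P = 1\<^sub>m n" "transpose_mat P * X * P = mat_diag n e"
    by (elim exE conjE)
  hence "simultaneous_diagonal n (gram n (k \<theta>)) X P e cR"
    by unfold_locales (use X cR_pos coercive[OF \<theta>] in auto)
  thus ?thesis by blast
qed

section \<open>The observations as Gaussian white noise\<close>

abbreviation Y :: "'a \<Rightarrow> nat \<Rightarrow> real" where "Y \<omega> \<equiv> \<lambda>i. \<xi> (s i) \<omega>"

lemma xi_gaussian: "gaussian_rv M (\<xi> u)"
  using gaussian[unfolded gaussian_process_def, rule_format, of "{u}" "\<lambda>_. 1"] by simp

lemma xi_measurable [measurable]: "\<xi> u \<in> borel_measurable M"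
  using xi_gaussian unfolding gaussian_rv_def by blast

lemma xi_integrable_power: "integrable M (\<lambda>\<omega>. \<xi> u \<omega> ^ m)"
  by (rule gaussian_rv_integrable_power[OF prob_M xi_gaussian _ refl]) (use centred in auto)

lemma xi_integrable_product: "integrable M (\<lambda>\<omega>. \<xi> u \<omega> * \<xi> v \<omega>)"
proof (rule Bochner_Integration.integrable_bound)
  show "integrable M (\<lambda>\<omega>. (\<xi> u \<omega>)\<^sup>2 + (\<xi> v \<omega>)\<^sup>2)" using xi_integrable_power by simp
  have "\<bar>x * y\<bar> \<le> x\<^sup>2 + y\<^sup>2" for x y :: real
  proof -
    have "2 * (\<bar>x\<bar> * \<bar>y\<bar>) \<le> x\<^sup>2 + y\<^sup>2" using sum_squares_bound[of "\<bar>x\<bar>" "\<bar>y\<bar>"] by (simp add: mult.assoc)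
    moreover have "0 \<le> \<bar>x\<bar> * \<bar>y\<bar>" by simp
    ultimately show ?thesis unfolding abs_mult by linarith
  qed
  thus "AE \<omega> in M. norm (\<xi> u \<omega> * \<xi> v \<omega>) \<le> norm ((\<xi> u \<omega>)\<^sup>2 + (\<xi> v \<omega>)\<^sup>2)" by simp
qed measurable

lemma xi_cov: "(\<integral>\<omega>. \<xi> u \<omega> * \<xi> v \<omega> \<partial>M) = k \<theta>0 (u - v)"
  using covariances centred unfolding covariance_def by simp

text \<open>\<open>gaussian_process\<close> speaks of weights on sets of sites, so the weights of
  the observations are carried over to sites; distinctness of the points makes this
  possible.\<close>

lemma combination_gaussian: "gaussian_rv M (\<lambda>\<omega>. \<Sum>j<n. b j * Y \<omega> j)"
proof -
  have "(\<Sum>u\<in>s ` {..<n}. b (the_inv s u) * \<xi> u \<omega>) = (\<Sum>j<n. b j * Y \<omega> j)" for \<omega>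
    using inj_points by (subst sum.reindex) (auto simp: inj_on_def the_inv_f_f)
  thus ?thesis using gaussian[unfolded gaussian_process_def, rule_format, of "s ` {..<n}" "\<lambda>u. b (the_inv s u)"] by simp
qed

text \<open>The whitened data have covariance P^T R P = 1, with R the true covariance
  matrix.\<close>

lemma white_noise:
  assumes "simultaneous_diagonal n (gram n (k \<theta>0)) X P e cR"
  shows "gaussian_white_noise M (\<lambda>i \<omega>. simultaneous_diagonal.w n P (Y \<omega>) i) n"
proof -
  interpret D: simultaneous_diagonal n "gram n (k \<theta>0)" X P e cR by fact
  show ?thesis
  proof
    fix a
    have "(\<Sum>i<n. a i * D.w (Y \<omega>) i) = (\<Sum>j<n. (\<Sum>i<n. a i * P $$ (j, i)) * Y \<omega> j)" for \<omega>
    proof -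
      have "(\<Sum>i<n. a i * D.w (Y \<omega>) i) = (\<Sum>i<n. \<Sum>j<n. a i * P $$ (j, i) * Y \<omega> j)"
        unfolding D.w_def by (simp add: sum_distrib_left mult.assoc)
      also have "\<dots> = (\<Sum>j<n. \<Sum>i<n. a i * P $$ (j, i) * Y \<omega> j)" by (rule sum.swap)
      finally show ?thesis by (simp add: sum_distrib_right)
    qed
    thus "gaussian_rv M (\<lambda>\<omega>. \<Sum>i<n. a i * D.w (Y \<omega>) i)" using combination_gaussian by simp
  next
    fix i assume "i < n"
    have "(\<integral>\<omega>. D.w (Y \<omega>) i \<partial>M) = (\<Sum>j<n. \<integral>\<omega>. P $$ (j, i) * Y \<omega> j \<partial>M)"
      unfolding D.w_def using xi_integrable_power[of _ 1]
      by (intro Bochner_Integration.integral_sum integrable_mult_right) simp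
    thus "(\<integral>\<omega>. D.w (Y \<omega>) i \<partial>M) = 0" using centred by simp
  next
    fix a b assume ab: "a < n" "b < n"
    have "D.w (Y \<omega>) a * D.w (Y \<omega>) b = (\<Sum>i<n. \<Sum>j<n. P $$ (i, a) * P $$ (j, b) * (Y \<omega> i * Y \<omega> j))" for \<omega>
      unfolding D.w_def sum_product by (simp add: mult_ac)
    hence "(\<integral>\<omega>. D.w (Y \<omega>) a * D.w (Y \<omega>) b \<partial>M) = (\<integral>\<omega>. (\<Sum>i<n. \<Sum>j<n. P $$ (i, a) * P $$ (j, b) * (Y \<omega> i * Y \<omega> j)) \<partial>M)" by simp
    also have "\<dots> = (\<Sum>i<n. \<integral>\<omega>. (\<Sum>j<n. P $$ (i, a) * P $$ (j, b) * (Y \<omega> i * Y \<omega> j)) \<partial>M)"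
      by (intro Bochner_Integration.integral_sum Bochner_Integration.integrable_sum integrable_mult_right xi_integrable_product)
    also have "\<dots> = (\<Sum>i<n. \<Sum>j<n. \<integral>\<omega>. P $$ (i, a) * P $$ (j, b) * (Y \<omega> i * Y \<omega> j) \<partial>M)"
      by (intro sum.cong refl Bochner_Integration.integral_sum integrable_mult_right xi_integrable_product)
    also have "\<dots> = (\<Sum>i<n. \<Sum>j<n. P $$ (i, a) * P $$ (j, b) * gram n (k \<theta>0) $$ (i, j))"
      by (intro sum.cong refl) (simp add: xi_cov gram_index)
    also have "\<dots> = (transpose_mat P * gram n (k \<theta>0) * P) $$ (a, b)"
    proof -
      have RP: "gram n (k \<theta>0) * P \<in> carrier_mat n n" by (rule mult_carrier_mat[OF gram_carrier D.P])
      have "(transpose_mat P * gram n (k \<theta>0) * P) $$ (a, b) = (transpose_mat P * (gram n (k \<theta>0) * P)) $$ (a, b)"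
        unfolding assoc_mult_mat[OF D.tP gram_carrier D.P] ..
      also have "\<dots> = (\<Sum>i<n. P $$ (i, a) * (\<Sum>j<n. gram n (k \<theta>0) $$ (i, j) * P $$ (j, b)))"
        unfolding index_mult_mat_sum[OF D.tP RP ab]
        by (intro sum.cong refl) (use D.P ab in \<open>simp add: index_mult_mat_sum[OF gram_carrier D.P] del: index_mult_mat\<close>)
      finally show ?thesis by (simp add: sum_distrib_left mult_ac)
    qed
    also have "\<dots> = (if a = b then 1 else 0)" unfolding D.PRP using ab by simp
    finally show "(\<integral>\<omega>. D.w (Y \<omega>) a * D.w (Y \<omega>) b \<partial>M) = (if a = b then 1 else 0)" .
  qed
qed

text \<open>The random factor in every pathwise remainder bound. It is at least 1, so it also
  absorbs deterministic remainders, and its mean is at most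
  \<open>1 + k \<theta>0 0\<close>.\<close>

abbreviation Ysq :: "nat \<Rightarrow> 'a \<Rightarrow> real" where "Ysq n \<omega> \<equiv> 1 + (\<Sum>i<n. (Y \<omega> i)\<^sup>2) / real n"

lemma Ysq_tail:
  assumes a: "a > 0" shows "prob {\<omega>\<in>space M. a \<le> Ysq n \<omega>} \<le> (1 + k \<theta>0 0) / a"
proof -
  have i: "integrable M (\<lambda>\<omega>. Ysq n \<omega>)" using xi_integrable_power by simp
  have "prob {\<omega>\<in>space M. a \<le> Ysq n \<omega>} \<le> (\<integral>\<omega>. Ysq n \<omega> \<partial>M) / a"
    using a i by (intro integral_Markov_inequality_measure[where A = "{}"]) (auto intro!: AE_I2 add_nonneg_nonneg divide_nonneg_nonneg sum_nonneg)
  also have "(\<integral>\<omega>. Ysq n \<omega> \<partial>M) \<le> 1 + k \<theta>0 0"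
  proof -
    have sq: "(\<integral>\<omega>. (Y \<omega> i)\<^sup>2 \<partial>M) = k \<theta>0 0" for i using xi_cov[of "s i" "s i"] by (simp add: power2_eq_square)
    have "(\<integral>\<omega>. Ysq n \<omega> \<partial>M) = 1 + (\<Sum>i<n. \<integral>\<omega>. (Y \<omega> i)\<^sup>2 \<partial>M) / real n"
      using xi_integrable_power prob_space by simp
    also have "\<dots> \<le> 1 + k \<theta>0 0"
    proof -
      have "0 \<le> k \<theta>0 0" unfolding sq[symmetric, of 0] by simp
      thus ?thesis unfolding sq by (cases "n = 0") auto
    qed
    finally show ?thesis .
  qed
  finally show ?thesis using a by (simp add: divide_right_mono)
qed

definition Sinv :: "nat \<Rightarrow> real mat" where "Sinv n = mat_inv (gram n (k \<theta>0))"

definition F :: "nat \<Rightarrow> 'a \<Rightarrow> real mat \<Rightarrow> real" where "F n \<omega> X = chaos n (Sinv n) (Y \<omega>) X"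

text \<open>The perturbation 0 gives access to the facts about the true covariance matrix
  alone.\<close>

lemma zero_diag: "\<exists>P e. simultaneous_diagonal n (gram n (k \<theta>0)) (0\<^sub>m n n) P e cR"
  by (rule diagonalize[OF true_param]) auto

lemma Sinv_op_bound: "op_bound n (Sinv n) (1 / cR)" and Sinv_symmetric: "transpose_mat (Sinv n) = Sinv n"
proof -
  obtain P e where "simultaneous_diagonal n (gram n (k \<theta>0)) (0\<^sub>m n n) P e cR" using zero_diag by blast
  then interpret D: simultaneous_diagonal n "gram n (k \<theta>0)" "0\<^sub>m n n" P e cR .
  show "op_bound n (Sinv n) (1 / cR)" unfolding Sinv_def D.inv_R by (rule D.op_bound_S)
  show "transpose_mat (Sinv n) = Sinv n"
    unfolding Sinv_def D.inv_R D.S_def using D.P by (simp add: transpose_mult[of _ n n _ n])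
qed

lemma Sinv_carrier: "Sinv n \<in> carrier_mat n n" by (rule op_bound_carrier[OF Sinv_op_bound])

lemma F_bound: "op_bound n X \<rho> \<Longrightarrow> n > 0 \<Longrightarrow> \<bar>F n \<omega> X\<bar> \<le> \<rho> * (1 / cR\<^sup>2 + 1 / cR) * Ysq n \<omega>"
  unfolding F_def by (rule chaos_bound[OF Sinv_op_bound _ _ cR_pos])

lemma F_measurable:
  assumes X: "X \<in> carrier_mat n n" shows "(\<lambda>\<omega>. F n \<omega> X) \<in> borel_measurable M"
proof -
  have z: "(Sinv n *\<^sub>v Matrix.vec n (Y \<omega>)) $ i = (\<Sum>j<n. Sinv n $$ (i, j) * Y \<omega> j)" if "i < n" for i \<omega>
    by (subst mult_mat_vec_sum[OF Sinv_carrier _ that]) auto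
  have "F n \<omega> X = 1 / real n * (\<Sum>i<n. \<Sum>j<n. X $$ (i, j) * ((\<Sum>l<n. Sinv n $$ (i, l) * Y \<omega> l) * (\<Sum>l<n. Sinv n $$ (j, l) * Y \<omega> l) - Sinv n $$ (j, i)))" for \<omega>
    unfolding F_def chaos_sum[OF Sinv_carrier X]
    by (intro arg_cong[where f = "\<lambda>x. 1 / real n * x"] sum.cong refl) (simp only: z lessThan_iff)
  thus ?thesis by simp
qed

text \<open>Chebyshev's inequality: the form has variance at most 2 (\<rho> / \<open>cR\<close>)^2 /
  n.\<close>

lemma F_tail:
  assumes X: "op_bound n X \<rho>" "transpose_mat X = X" and n: "n > 0" and a: "a > 0"
  shows "prob {\<omega>\<in>space M. a \<le> \<bar>F n \<omega> X\<bar>} \<le> 2 * (\<rho> / cR)\<^sup>2 / (real n * a\<^sup>2)"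
proof -
  obtain P e where sd: "simultaneous_diagonal n (gram n (k \<theta>0)) X P e cR"
    using diagonalize[OF true_param op_bound_carrier[OF X(1)] X(2)] by blast
  interpret D: simultaneous_diagonal n "gram n (k \<theta>0)" X P e cR by (rule sd)
  interpret W: gaussian_white_noise M "\<lambda>i \<omega>. D.w (Y \<omega>) i" n by (rule white_noise[OF sd])
  have F: "F n \<omega> X = (\<Sum>i<n. (e i / real n) * ((D.w (Y \<omega>) i)\<^sup>2 - 1))" for \<omega>
    unfolding F_def Sinv_def D.inv_R D.chaos_E by (simp add: sum_divide_distrib)
  have "prob {\<omega>\<in>space M. a \<le> \<bar>F n \<omega> X\<bar>} \<le> 2 * (\<Sum>i<n. (e i / real n)\<^sup>2) / a\<^sup>2"
    unfolding F by (rule W.chi_combination_tail[OF a])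
  also have "\<dots> \<le> 2 * (\<Sum>i<n. (\<rho> / cR)\<^sup>2 / (real n)\<^sup>2) / a\<^sup>2"
  proof (intro divide_right_mono mult_left_mono sum_mono)
    fix i assume "i \<in> {..<n}"
    hence "\<bar>e i\<bar> \<le> \<rho> / cR" using D.e_bound[OF X(1)] by simp
    hence "\<bar>e i\<bar>\<^sup>2 \<le> (\<rho> / cR)\<^sup>2" by (intro power_mono) auto
    thus "(e i / real n)\<^sup>2 \<le> (\<rho> / cR)\<^sup>2 / (real n)\<^sup>2" unfolding power_divide[of "e i"] by (intro divide_right_mono) auto
  qed auto
  also have "\<dots> = 2 * (\<rho> / cR)\<^sup>2 / (real n * a\<^sup>2)" using n by (simp add: power2_eq_square)
  finally show ?thesis .
qed

text \<open>The relative eigenvalues of X are at most \<rho> / \<open>cR\<close>, so for \<tau> of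
  order sqrt n the largest coefficient is O(1 / sqrt n) while the variance stays bounded: a central
  limit theorem with explicit error.\<close>

lemma F_char:
  obtains K where "K \<ge> 0" "\<forall>n X \<rho> \<tau>. op_bound n X \<rho> \<longrightarrow> transpose_mat X = X \<longrightarrow> n > 0 \<longrightarrow>
    norm ((\<integral>\<omega>. iexp (\<tau> * F n \<omega> X) \<partial>M) - exp (- ((\<tau> / real n)\<^sup>2 * mat_trace (Sinv n * (X * Sinv n * X)))))
      \<le> (K * (\<bar>\<tau>\<bar> / real n * (\<rho> / cR)) + (\<bar>\<tau>\<bar> / real n * (\<rho> / cR))\<^sup>2) * ((\<tau> / real n)\<^sup>2 * mat_trace (Sinv n * (X * Sinv n * X)))"
proof -
  from chi_combination_char_limit obtain K where K: "K \<ge> 0" "\<forall>(M :: 'a measure) w n d D. gaussian_white_noise M w n \<longrightarrow> (\<forall>j<n. \<bar>d j\<bar> \<le> D) \<longrightarrow>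
       norm ((\<integral>\<omega>. iexp (\<Sum>j<n. d j * ((w j \<omega>)\<^sup>2 - 1)) \<partial>M) - exp (- (\<Sum>j<n. (d j)\<^sup>2))) \<le> (K * D + D\<^sup>2) * (\<Sum>j<n. (d j)\<^sup>2)"
    by (elim exE conjE)
  have "norm ((\<integral>\<omega>. iexp (\<tau> * F n \<omega> X) \<partial>M) - exp (- ((\<tau> / real n)\<^sup>2 * mat_trace (Sinv n * (X * Sinv n * X)))))
      \<le> (K * (\<bar>\<tau>\<bar> / real n * (\<rho> / cR)) + (\<bar>\<tau>\<bar> / real n * (\<rho> / cR))\<^sup>2) * ((\<tau> / real n)\<^sup>2 * mat_trace (Sinv n * (X * Sinv n * X)))"
    if X: "op_bound n X \<rho>" "transpose_mat X = X" and n: "n > 0" for n X \<rho> \<tau>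
  proof -
    obtain P e where sd: "simultaneous_diagonal n (gram n (k \<theta>0)) X P e cR"
      using diagonalize[OF true_param op_bound_carrier[OF X(1)] X(2)] by blast
    interpret D: simultaneous_diagonal n "gram n (k \<theta>0)" X P e cR by (rule sd)
    define d where "d = (\<lambda>i. \<tau> / real n * e i)"
    have S: "Sinv n = D.S" unfolding Sinv_def D.inv_R ..
    have F: "\<tau> * F n \<omega> X = (\<Sum>i<n. d i * ((D.w (Y \<omega>) i)\<^sup>2 - 1))" for \<omega>
      unfolding F_def S D.chaos_E d_def by (simp add: sum_distrib_left sum_divide_distrib mult_ac)
    have V: "(\<tau> / real n)\<^sup>2 * mat_trace (Sinv n * (X * Sinv n * X)) = (\<Sum>i<n. (d i)\<^sup>2)"
      unfolding S D.trace_SESE d_def by (simp add: sum_distrib_left power_mult_distrib power_divide)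
    have "\<forall>j<n. \<bar>d j\<bar> \<le> \<bar>\<tau>\<bar> / real n * (\<rho> / cR)"
    proof (intro allI impI)
      fix j assume "j < n"
      hence "\<bar>\<tau>\<bar> / real n * \<bar>e j\<bar> \<le> \<bar>\<tau>\<bar> / real n * (\<rho> / cR)" by (intro mult_left_mono D.e_bound[OF X(1)]) auto
      thus "\<bar>d j\<bar> \<le> \<bar>\<tau>\<bar> / real n * (\<rho> / cR)" by (simp add: d_def abs_mult)
    qed
    thus ?thesis unfolding F V
      by (intro K(2)[THEN spec[of _ M], THEN spec[of _ "\<lambda>i \<omega>. D.w (Y \<omega>) i"], THEN spec[of _ n], THEN spec[of _ d], THEN spec, THEN mp, THEN mp] white_noise[OF sd])
  qed
  with K(1) show ?thesis by (intro that[of K]) blast+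
qed

end

subsection \<open>Consistency\<close>

text \<open>T is chosen so that \<open>T powr \<gamma>\<close> is at least 2 C / \<rho>; the 2 pays
  for replacing \<open>1 + x powr \<beta>\<close> by twice the power, and the added 1 ensures T >=
  1.\<close>

lemma powr_decay_eventually:
  fixes \<beta> \<gamma> C \<rho> :: real assumes "\<beta> > 0" "\<gamma> > 0" "C \<ge> 0" "\<rho> > 0"
  shows "\<exists>T\<ge>1. \<forall>x\<ge>T. C / (1 + x powr (\<beta> + \<gamma>)) \<le> \<rho> / (1 + x powr \<beta>)"
proof (intro exI conjI allI impI)
  let ?T = "(2 * C / \<rho> + 1) powr (1 / \<gamma>)"
  show "1 \<le> ?T" using assms by (intro ge_one_powr_ge_zero) auto
  fix x assume x: "?T \<le> x"
  have x1: "1 \<le> x" using x \<open>1 \<le> ?T\<close> by linarith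
  have "?T powr \<gamma> \<le> x powr \<gamma>" using x assms by (intro powr_mono2) auto
  hence g: "2 * C / \<rho> \<le> x powr \<gamma>" using assms by (simp add: powr_powr)
  have b1: "1 \<le> x powr \<beta>" using x1 assms by (intro ge_one_powr_ge_zero) auto
  have "2 * C \<le> \<rho> * x powr \<gamma>" using g assms by (simp add: field_simps)
  hence "x powr \<beta> * (2 * C) \<le> x powr \<beta> * (\<rho> * x powr \<gamma>)" by (intro mult_left_mono) auto
  moreover have "C * (1 + x powr \<beta>) \<le> C * (2 * x powr \<beta>)" using b1 assms by (intro mult_left_mono) auto
  ultimately have "C * (1 + x powr \<beta>) \<le> \<rho> * (x powr \<beta> * x powr \<gamma>)" by (simp add: mult_ac)
  also have "\<dots> \<le> \<rho> * (1 + x powr (\<beta> + \<gamma>))" unfolding powr_add using assms by simp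
  finally show "C / (1 + x powr (\<beta> + \<gamma>)) \<le> \<rho> / (1 + x powr \<beta>)"
    by (simp add: divide_le_eq le_divide_eq add_pos_nonneg field_simps)
qed

context gaussian_mle begin

abbreviation crit :: "nat \<Rightarrow> 'a \<Rightarrow> real ^ 'p \<Rightarrow> real" where "crit n \<omega> \<theta> \<equiv> likelihood_criterion k s n (Y \<omega>) \<theta>"
abbreviation mle :: "nat \<Rightarrow> 'a \<Rightarrow> real ^ 'p" where "mle n \<omega> \<equiv> est n (observations \<xi> s n \<omega>)"

lemma criterion_observations: "likelihood_criterion k s n (observations \<xi> s n \<omega>) \<theta> = crit n \<omega> \<theta>"
proof -
  have "Matrix.vec n (observations \<xi> s n \<omega>) = Matrix.vec n (Y \<omega>)" unfolding observations_def by (intro eq_vecI) auto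
  thus ?thesis unfolding likelihood_criterion_def by simp
qed

lemma mle_param: "n > 0 \<Longrightarrow> \<omega> \<in> space M \<Longrightarrow> mle n \<omega> \<in> \<Theta>"
  and mle_minimal: "n > 0 \<Longrightarrow> \<omega> \<in> space M \<Longrightarrow> \<theta> \<in> \<Theta> \<Longrightarrow> crit n \<omega> (mle n \<omega>) \<le> crit n \<omega> \<theta>"
proof -
  assume n: "n > 0" and \<omega>: "\<omega> \<in> space M"
  have "is_arg_min (likelihood_criterion k s n (observations \<xi> s n \<omega>)) (\<lambda>\<theta>. \<theta> \<in> \<Theta>) (mle n \<omega>)"
    using estimator n \<omega> unfolding max_likelihood_estimator_def by simp
  hence a: "mle n \<omega> \<in> \<Theta>" "\<And>\<theta>. \<theta> \<in> \<Theta> \<Longrightarrow> \<not> crit n \<omega> \<theta> < crit n \<omega> (mle n \<omega>)"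
    unfolding is_arg_min_def criterion_observations by auto
  show "mle n \<omega> \<in> \<Theta>" by (rule a(1))
  assume "\<theta> \<in> \<Theta>"
  from a(2)[OF this] show "crit n \<omega> (mle n \<omega>) \<le> crit n \<omega> \<theta>" by linarith
qed

lemma mle_measurable: "n > 0 \<Longrightarrow> mle n \<in> borel_measurable M"
proof -
  assume n: "n > 0"
  have "(\<lambda>\<omega>. observations \<xi> s n \<omega>) \<in> measurable M (PiM {..<n} (\<lambda>_. borel))"
    unfolding observations_def by (intro measurable_restrict) simp
  moreover have "est n \<in> borel_measurable (PiM {..<n} (\<lambda>_. borel))"
    using estimator n unfolding max_likelihood_estimator_def by simp
  ultimately show ?thesis by (rule measurable_compose)
qed

text \<open>Identifies \<open>loglik_diff\<close> with a difference of criteria, so that the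
  estimates in diagonal coordinates apply to any two parameters.\<close>

lemma diagonalize_difference:
  assumes \<theta>: "\<theta>1 \<in> \<Theta>" "\<theta>2 \<in> \<Theta>"
  defines "E \<equiv> \<lambda>n. gram n (\<lambda>x. k \<theta>2 x - k \<theta>1 x)"
  shows "\<exists>P e. simultaneous_diagonal n (gram n (k \<theta>1)) (E n) P e cR"
    and "simultaneous_diagonal n (gram n (k \<theta>1)) (E n) P e cR \<Longrightarrow>
      simultaneous_diagonal.loglik_diff n (gram n (k \<theta>1)) (E n) (Y \<omega>) = crit n \<omega> \<theta>2 - crit n \<omega> \<theta>1"
proof -
  show "\<exists>P e. simultaneous_diagonal n (gram n (k \<theta>1)) (E n) P e cR"
    by (rule diagonalize[OF \<theta>(1)]) (auto simp: E_def k_even[OF \<theta>(1)] k_even[OF \<theta>(2)] intro!: gram_symmetric)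
  assume sd: "simultaneous_diagonal n (gram n (k \<theta>1)) (E n) P e cR"
  have RE: "gram n (k \<theta>1) + E n = gram n (k \<theta>2)" unfolding E_def gram_add by simp
  show "simultaneous_diagonal.loglik_diff n (gram n (k \<theta>1)) (E n) (Y \<omega>) = crit n \<omega> \<theta>2 - crit n \<omega> \<theta>1"
    unfolding simultaneous_diagonal.loglik_diff_def[OF sd] RE likelihood_criterion_def cov_matrix_gram ..
qed

lemma criterion_lipschitz:
  assumes \<theta>: "\<theta>1 \<in> \<Theta>" "\<theta>2 \<in> \<Theta>" and n: "n > 0" and \<rho>: "op_bound n (gram n (\<lambda>x. k \<theta>2 x - k \<theta>1 x)) \<rho>" "\<rho> \<le> cR / 2"
  shows "\<bar>crit n \<omega> \<theta>2 - crit n \<omega> \<theta>1\<bar> \<le> 2 * (\<rho> / cR) * (1 + 1 / cR) * Ysq n \<omega>"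
proof -
  obtain P e where sd: "simultaneous_diagonal n (gram n (k \<theta>1)) (gram n (\<lambda>x. k \<theta>2 x - k \<theta>1 x)) P e cR"
    using diagonalize_difference(1)[OF \<theta>] by blast
  from simultaneous_diagonal.loglik_diff_lipschitz[OF sd n \<rho>, of "Y \<omega>"]
  show ?thesis unfolding diagonalize_difference(2)[OF \<theta> sd] .
qed

lemma op_bound_difference:
  assumes "\<theta>1 \<in> \<Theta>" "\<theta>2 \<in> \<Theta>" shows "op_bound n (gram n (\<lambda>x. k \<theta>2 x - k \<theta>1 x)) (2 * Cop)"
proof (rule op_bound_mono[OF op_bound_gram[where \<rho> = "2 * C_sup" and \<beta> = "real CARD('d) + C_inf"]])
  fix x
  have "\<bar>k \<theta>1 x\<bar> \<le> C_sup / (1 + norm x powr (real CARD('d) + C_inf))" "\<bar>k \<theta>2 x\<bar> \<le> C_sup / (1 + norm x powr (real CARD('d) + C_inf))"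
    using condition2 assms by blast+
  thus "\<bar>k \<theta>2 x - k \<theta>1 x\<bar> \<le> 2 * C_sup / (1 + norm x powr (real CARD('d) + C_inf))"
    unfolding times_divide_eq_right[symmetric] by linarith
  show "2 * C_sup * pack \<le> 2 * Cop" using C_sup_pack_le by simp
qed (use C_sup_nonneg in auto)

text \<open>The deterministic gap is at least a multiple of the normalised sum of squared entries of
  the covariance difference; the random part has variance O(1/n) and is removed with an exceptional
  event. That event depends on \<theta>, which is harmless on a finite net.\<close>

lemma criterion_separation:
  "\<exists>c5>0. \<exists>K5. \<forall>\<theta>\<in>\<Theta>. \<forall>n>0. \<forall>a>0. \<exists>Z\<in>events. prob Z \<le> K5 / (real n * a\<^sup>2) \<and>
     (\<forall>\<omega>\<in>space M - Z. c5 * (1 / real n * (\<Sum>i<n. \<Sum>j<n. (k \<theta> (s i - s j) - k \<theta>0 (s i - s j))\<^sup>2)) - a < crit n \<omega> \<theta> - crit n \<omega> \<theta>0)"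
proof -
  \<comment> \<open>\<open>b\<close> bounds 1 + e from above and \<open>B\<close> is the resulting
    constant of the logarithmic inequality; \<open>D\<close> bounds |e / (1 + e)|, with
    \<open>cR / Cop\<close> below the denominator; \<open>Q\<close> compares squared entries with
    squared eigenvalues.\<close>
  define b where "b = 1 + 2 * Cop / cR"
  define B where "B = b * (sqrt b + 1)\<^sup>2"
  define D where "D = (2 * Cop / cR) / (cR / Cop)"
  have b0: "b > 0" unfolding b_def using Cop_pos cR_pos by (intro add_pos_pos divide_pos_pos) auto
  hence "sqrt b + 1 > 0" by (intro add_nonneg_pos) auto
  hence b: "b > 0" "B > 0" unfolding B_def using b0 by auto
  define Q where "Q = (Cop\<^sup>2 / cR)\<^sup>2"
  have Q: "Q > 0" unfolding Q_def using Cop_pos cR_pos by simp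
  have main: "\<exists>Z\<in>events. prob Z \<le> (2 * D\<^sup>2) / (real n * a\<^sup>2) \<and>
     (\<forall>\<omega>\<in>space M - Z. 1 / (Q * B) * (1 / real n * (\<Sum>i<n. \<Sum>j<n. (k \<theta> (s i - s j) - k \<theta>0 (s i - s j))\<^sup>2)) - a < crit n \<omega> \<theta> - crit n \<omega> \<theta>0)"
    if \<theta>: "\<theta> \<in> \<Theta>" and n: "n > 0" and a: "a > 0" for \<theta> n a
  proof -
    let ?E = "gram n (\<lambda>x. k \<theta> x - k \<theta>0 x)"
    obtain P e where sd: "simultaneous_diagonal n (gram n (k \<theta>0)) ?E P e cR"
      using diagonalize_difference(1)[OF true_param \<theta>] by blast
    interpret D: simultaneous_diagonal n "gram n (k \<theta>0)" ?E P e cR by (rule sd)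
    interpret W: gaussian_white_noise M "\<lambda>i \<omega>. D.w (Y \<omega>) i" n by (rule white_noise[OF sd])
    have RE: "gram n (k \<theta>0) + ?E = gram n (k \<theta>)" unfolding gram_add by simp
    have lo: "cR / Cop \<le> 1 + e i" if "i < n" for i
      by (rule D.one_plus_e_bounds[OF op_bound_K[OF true_param] _ Cop_pos that]) (use coercive[OF \<theta>] in \<open>simp add: RE\<close>)
    have cC: "cR / Cop > 0" using cR_pos Cop_pos by simp
    define d where "d = (\<lambda>i. 1 / real n * (e i / (1 + e i)))"
    define Z where "Z = {\<omega>\<in>space M. a \<le> \<bar>\<Sum>i<n. d i * ((D.w (Y \<omega>) i)\<^sup>2 - 1)\<bar>}"
    have dD: "\<bar>d i\<bar> \<le> D / real n" if "i < n" for i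
    proof -
      have "\<bar>e i / (1 + e i)\<bar> \<le> D"
        unfolding D_def abs_divide using D.e_bound[OF op_bound_difference[OF true_param \<theta>] that] lo[OF that] cC Cop_pos cR_pos
        by (intro frac_le) auto
      hence "1 / real n * \<bar>e i / (1 + e i)\<bar> \<le> 1 / real n * D" by (intro mult_left_mono) auto
      moreover have "\<bar>d i\<bar> = 1 / real n * \<bar>e i / (1 + e i)\<bar>" unfolding d_def abs_mult by simp
      ultimately show ?thesis by simp
    qed
    show ?thesis
    proof (intro bexI[of _ Z] conjI ballI)
      show "Z \<in> events" unfolding Z_def by measurable
      have "prob Z \<le> 2 * (\<Sum>i<n. (d i)\<^sup>2) / a\<^sup>2" unfolding Z_def by (rule W.chi_combination_tail[OF a])
      also have "\<dots> \<le> 2 * (\<Sum>i<n. (D / real n)\<^sup>2) / a\<^sup>2"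
      proof (intro divide_right_mono mult_left_mono sum_mono)
        fix i assume "i \<in> {..<n}"
        hence "\<bar>d i\<bar>\<^sup>2 \<le> (D / real n)\<^sup>2" using dD by (intro power_mono) auto
        thus "(d i)\<^sup>2 \<le> (D / real n)\<^sup>2" by simp
      qed auto
      also have "\<dots> = 2 * D\<^sup>2 / (real n * a\<^sup>2)" using n by (simp add: power_divide power2_eq_square)
      finally show "prob Z \<le> 2 * D\<^sup>2 / (real n * a\<^sup>2)" .
      fix \<omega> assume \<omega>: "\<omega> \<in> space M - Z"
      have l: "(\<Sum>i<n. (e i)\<^sup>2) / real n / B - 1 / real n * (\<Sum>i<n. e i / (1 + e i) * ((D.w (Y \<omega>) i)\<^sup>2 - 1)) \<le> crit n \<omega> \<theta> - crit n \<omega> \<theta>0"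
        using D.loglik_diff_lower_bound[OF n op_bound_difference[OF true_param \<theta>] cC lo, of "Y \<omega>"]
        unfolding diagonalize_difference(2)[OF true_param \<theta> sd] B_def b_def by simp
      have "1 / real n * (\<Sum>i<n. e i / (1 + e i) * ((D.w (Y \<omega>) i)\<^sup>2 - 1)) = (\<Sum>i<n. d i * ((D.w (Y \<omega>) i)\<^sup>2 - 1))"
        unfolding d_def sum_distrib_left by (intro sum.cong refl) (simp only: mult.assoc)
      hence g: "1 / real n * (\<Sum>i<n. e i / (1 + e i) * ((D.w (Y \<omega>) i)\<^sup>2 - 1)) < a" using \<omega> unfolding Z_def by auto
      have "(\<Sum>i<n. \<Sum>j<n. (k \<theta> (s i - s j) - k \<theta>0 (s i - s j))\<^sup>2) = frobenius_sq n ?E"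
        unfolding frobenius_sq_def by (intro sum.cong refl) (simp add: gram_index)
      also have "\<dots> \<le> Q * (\<Sum>i<n. (e i)\<^sup>2)" unfolding Q_def
        by (rule D.frobenius_le[OF op_bound_K[OF true_param]])
      finally have "1 / (Q * B) * (1 / real n * (\<Sum>i<n. \<Sum>j<n. (k \<theta> (s i - s j) - k \<theta>0 (s i - s j))\<^sup>2)) \<le> 1 / (Q * B) * (1 / real n * (Q * (\<Sum>i<n. (e i)\<^sup>2)))"
        using Q b by (intro mult_left_mono) auto
      also have "\<dots> = (\<Sum>i<n. (e i)\<^sup>2) / real n / B" using Q by simp
      finally show "1 / (Q * B) * (1 / real n * (\<Sum>i<n. \<Sum>j<n. (k \<theta> (s i - s j) - k \<theta>0 (s i - s j))\<^sup>2)) - a < crit n \<omega> \<theta> - crit n \<omega> \<theta>0"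
        using l g by linarith
    qed
  qed
  have "1 / (Q * B) > 0" using Q b by simp
  with main show ?thesis by blast
qed

text \<open>
  Uniform closeness controls \<open>k \<theta> - k \<theta>1\<close> near 0 and the common decay controls it far away; giving up half of
  \<open>C_inf\<close> makes the tail small while keeping it summable over the points.
\<close>

lemma op_bound_local:
  assumes \<theta>1: "\<theta>1 \<in> \<Theta>" and \<rho>: "\<rho> > 0"
  shows "\<exists>\<delta>>0. \<forall>\<theta>\<in>\<Theta>. norm (\<theta> - \<theta>1) < \<delta> \<longrightarrow> (\<forall>n. op_bound n (gram n (\<lambda>x. k \<theta> x - k \<theta>1 x)) \<rho>)"
proof -
  define \<rho>' where "\<rho>' = \<rho> / pack"
  have \<rho>': "\<rho>' > 0" "\<rho>' * pack = \<rho>" unfolding \<rho>'_def using \<rho> pack(1) by auto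
  define \<beta> where "\<beta> = real CARD('d) + C_inf / 2"
  have \<beta>: "\<beta> > 0" "\<beta> + C_inf / 2 = real CARD('d) + C_inf" unfolding \<beta>_def using constants by (auto intro: add_pos_pos)
  obtain T where T: "T \<ge> 1" "\<forall>x\<ge>T. (2 * C_sup) / (1 + x powr (\<beta> + C_inf / 2)) \<le> \<rho>' / (1 + x powr \<beta>)"
    using powr_decay_eventually[OF \<beta>(1), of "C_inf / 2" "2 * C_sup" \<rho>'] constants C_sup_nonneg \<rho>' by auto
  \<comment> \<open>Value of the target bound at radius T; as that bound decreases, it is at least e
    inside.\<close>
  define e where "e = \<rho>' / (1 + T powr \<beta>)"
  have e: "e > 0" unfolding e_def using \<rho>' by (simp add: add_pos_nonneg)
  have "\<exists>\<delta>>0. \<forall>\<theta>\<in>\<Theta>. norm (\<theta> - \<theta>1) < \<delta> \<longrightarrow> (\<forall>x. \<bar>k \<theta> x - k \<theta>1 x\<bar> \<le> e)"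
    by (rule spectral_family_uniformly_continuous[OF _ condition4(1) _ _ \<theta>1 e])
      (use spectral_densities condition4(2) continuous_param in auto)
  then obtain \<delta> where \<delta>: "\<delta> > 0" "\<forall>\<theta>\<in>\<Theta>. norm (\<theta> - \<theta>1) < \<delta> \<longrightarrow> (\<forall>x. \<bar>k \<theta> x - k \<theta>1 x\<bar> \<le> e)" by (elim exE conjE)
  have "op_bound n (gram n (\<lambda>x. k \<theta> x - k \<theta>1 x)) \<rho>" if \<theta>: "\<theta> \<in> \<Theta>" "norm (\<theta> - \<theta>1) < \<delta>" for \<theta> n
    unfolding \<rho>'(2)[symmetric]
  proof (rule op_bound_gram[where \<beta> = \<beta>])
    fix x
    show "\<bar>k \<theta> x - k \<theta>1 x\<bar> \<le> \<rho>' / (1 + norm x powr \<beta>)"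
    proof (cases "T \<le> norm x")
      case True
      have "\<bar>k \<theta> x\<bar> \<le> C_sup / (1 + norm x powr (real CARD('d) + C_inf))" "\<bar>k \<theta>1 x\<bar> \<le> C_sup / (1 + norm x powr (real CARD('d) + C_inf))"
        using condition2 \<theta>1 \<theta>(1) by blast+
      hence "\<bar>k \<theta> x - k \<theta>1 x\<bar> \<le> 2 * C_sup / (1 + norm x powr (real CARD('d) + C_inf))"
        unfolding times_divide_eq_right[symmetric] by linarith
      also have "\<dots> \<le> \<rho>' / (1 + norm x powr \<beta>)" using T(2) True unfolding \<beta>(2) by blast
      finally show ?thesis .
    next
      case False
      have "\<bar>k \<theta> x - k \<theta>1 x\<bar> \<le> e" using \<delta>(2) \<theta> by blast
      also have "e \<le> \<rho>' / (1 + norm x powr \<beta>)" unfolding e_def using False \<beta>(1) \<rho>'(1)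
        by (intro divide_left_mono add_left_mono powr_mono2 mult_pos_pos add_pos_nonneg) auto
      finally show ?thesis .
    qed
  qed (use \<rho>'(1) in \<open>auto simp: \<beta>_def\<close>)
  with \<delta>(1) show ?thesis by blast
qed

lemma condition5_eventually:
  assumes "\<epsilon> > 0"
  shows "\<exists>\<delta>>0. eventually (\<lambda>n. \<forall>\<theta>\<in>\<Theta>. norm (\<theta> - \<theta>0) \<ge> \<epsilon> \<longrightarrow>
    \<delta> \<le> 1 / real n * (\<Sum>i<n. \<Sum>j<n. (k \<theta> (s i - s j) - k \<theta>0 (s i - s j))\<^sup>2)) sequentially"
proof -
  let ?f = "\<lambda>n. INF \<theta>\<in>{\<theta>\<in>\<Theta>. norm (\<theta> - \<theta>0) \<ge> \<epsilon>}.
        ereal (1 / real n * (\<Sum>i<n. \<Sum>j<n. (k \<theta> (s i - s j) - k \<theta>0 (s i - s j))\<^sup>2))"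
  have "0 < liminf ?f" using condition5 assms by blast
  then obtain d where d: "0 < ereal d" "ereal d < liminf ?f" by (rule ereal_dense2[elim_format]) blast
  have "eventually (\<lambda>n. ereal d < ?f n) sequentially" by (rule less_LiminfD[OF d(2)])
  hence "eventually (\<lambda>n. \<forall>\<theta>\<in>\<Theta>. norm (\<theta> - \<theta>0) \<ge> \<epsilon> \<longrightarrow>
    d \<le> 1 / real n * (\<Sum>i<n. \<Sum>j<n. (k \<theta> (s i - s j) - k \<theta>0 (s i - s j))\<^sup>2)) sequentially"
  proof (rule eventually_mono, intro ballI impI)
    fix n \<theta> assume n: "ereal d < ?f n" and \<theta>: "\<theta> \<in> \<Theta>" "\<epsilon> \<le> norm (\<theta> - \<theta>0)"
    have "?f n \<le> ereal (1 / real n * (\<Sum>i<n. \<Sum>j<n. (k \<theta> (s i - s j) - k \<theta>0 (s i - s j))\<^sup>2))"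
      by (rule INF_lower) (use \<theta> in auto)
    with n have "ereal d < ereal (1 / real n * (\<Sum>i<n. \<Sum>j<n. (k \<theta> (s i - s j) - k \<theta>0 (s i - s j))\<^sup>2))" by (rule less_le_trans)
    thus "d \<le> 1 / real n * (\<Sum>i<n. \<Sum>j<n. (k \<theta> (s i - s j) - k \<theta>0 (s i - s j))\<^sup>2)" by simp
  qed
  with d(1) show ?thesis by auto
qed

text \<open>Outside the exceptional events, an estimator at distance at least \<epsilon> has a net
  point nearby whose criterion exceeds that of \<theta>0 by more than a, while passing to the net
  point costs at most a. This contradicts minimality.\<close>

theorem mle_consistent:
  assumes \<epsilon>: "\<epsilon> > 0"
  shows "(\<lambda>n. prob {\<omega>\<in>space M. \<epsilon> \<le> norm (mle n \<omega> - \<theta>0)}) \<longlonglongrightarrow> 0"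
proof (rule tendstoI)
  fix \<zeta> :: real assume \<zeta>: "\<zeta> > 0"
  obtain c5 K5 where c5: "c5 > 0" and sep: "\<forall>\<theta>\<in>\<Theta>. \<forall>n>0. \<forall>a>0. \<exists>Z\<in>events. prob Z \<le> K5 / (real n * a\<^sup>2) \<and>
     (\<forall>\<omega>\<in>space M - Z. c5 * (1 / real n * (\<Sum>i<n. \<Sum>j<n. (k \<theta> (s i - s j) - k \<theta>0 (s i - s j))\<^sup>2)) - a < crit n \<omega> \<theta> - crit n \<omega> \<theta>0)"
    using criterion_separation by (elim exE conjE)
  obtain \<delta> where \<delta>: "\<delta> > 0" and ev: "eventually (\<lambda>n. \<forall>\<theta>\<in>\<Theta>. norm (\<theta> - \<theta>0) \<ge> \<epsilon> \<longrightarrow>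
    \<delta> \<le> 1 / real n * (\<Sum>i<n. \<Sum>j<n. (k \<theta> (s i - s j) - k \<theta>0 (s i - s j))\<^sup>2)) sequentially"
    using condition5_eventually[OF \<epsilon>] by (elim exE conjE)
  \<comment> \<open>Half of the guaranteed gap: one half is spent on randomness, the other remains
    as margin for the net.\<close>
  define a where "a = c5 * \<delta> / 2"
  have a: "a > 0" "c5 * \<delta> - a = a" unfolding a_def using c5 \<delta> by auto
  have k0: "0 \<le> k \<theta>0 0" using xi_cov[of 0 0, symmetric] by simp
  \<comment> \<open>Threshold for \<open>Ysq\<close>, reached with probability at most \<zeta>/2 by
    Markov's inequality.\<close>
  define A where "A = 2 * (1 + k \<theta>0 0) / \<zeta>"
  have A: "A > 0" "(1 + k \<theta>0 0) / A = \<zeta> / 2" unfolding A_def using \<zeta> k0 by (auto simp: add_pos_nonneg field_simps)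
  define U where "U = 2 * (1 / cR) * (1 + 1 / cR) * A"
  have U: "U > 0" unfolding U_def using cR_pos A(1) by (intro mult_pos_pos add_pos_pos divide_pos_pos) auto
  \<comment> \<open>Mesh of the net in operator norm: at most \<open>cR / 2\<close> for the
    Lipschitz estimate to apply, and small enough for its bound not to exceed a.\<close>
  define \<rho> where "\<rho> = min (cR / 2) (a / U)"
  have \<rho>: "\<rho> > 0" "\<rho> \<le> cR / 2" "\<rho> * U \<le> a"
    unfolding \<rho>_def using cR_pos a U by (auto simp: min_def field_simps)
  define B where "B = {\<theta>\<in>\<Theta>. norm (\<theta> - \<theta>0) \<ge> \<epsilon>}"
  have "B = \<Theta> \<inter> {\<theta>. \<epsilon> \<le> norm (\<theta> - \<theta>0)}" unfolding B_def by auto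
  moreover have "closed {\<theta>. \<epsilon> \<le> norm (\<theta> - \<theta>0)}" by (intro closed_Collect_le continuous_intros)
  ultimately have "compact B" using compact_params by (simp add: compact_Int_closed)
  have "\<forall>\<theta>1\<in>B. \<exists>\<delta>>0. \<forall>\<theta>\<in>\<Theta>. norm (\<theta> - \<theta>1) < \<delta> \<longrightarrow> (\<forall>n. op_bound n (gram n (\<lambda>x. k \<theta> x - k \<theta>1 x)) \<rho>)"
    using op_bound_local[OF _ \<rho>(1)] unfolding B_def by blast
  then obtain r where r: "\<forall>\<theta>1\<in>B. r \<theta>1 > 0 \<and> (\<forall>\<theta>\<in>\<Theta>. norm (\<theta> - \<theta>1) < r \<theta>1 \<longrightarrow> (\<forall>n. op_bound n (gram n (\<lambda>x. k \<theta> x - k \<theta>1 x)) \<rho>))"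
    by (rule bchoice[elim_format]) blast
  have "B \<subseteq> (\<Union>\<theta>\<in>B. ball \<theta> (r \<theta>))" using r by force
  then obtain J where J: "J \<subseteq> B" "finite J" "B \<subseteq> (\<Union>\<theta>\<in>J. ball \<theta> (r \<theta>))"
    by (rule compactE_image[OF \<open>compact B\<close>, rotated]) auto
  have "(\<lambda>n. \<zeta> / 2 + real (card J) * (K5 / (real n * a\<^sup>2))) \<longlonglongrightarrow> \<zeta> / 2 + real (card J) * 0"
    using a by (intro tendsto_intros) real_asymp
  hence small: "eventually (\<lambda>n. \<zeta> / 2 + real (card J) * (K5 / (real n * a\<^sup>2)) < \<zeta>) sequentially"
    by (rule order_tendstoD(2)) (use \<zeta> in simp)
  show "eventually (\<lambda>n. dist (prob {\<omega>\<in>space M. \<epsilon> \<le> norm (mle n \<omega> - \<theta>0)}) 0 < \<zeta>) sequentially"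
    using ev small eventually_gt_at_top[of 0]
  proof eventually_elim
    case (elim n)
    note n = elim(3)
    have "\<forall>\<theta>\<in>J. \<exists>Z. Z \<in> events \<and> prob Z \<le> K5 / (real n * a\<^sup>2) \<and> (\<forall>\<omega>\<in>space M - Z. a < crit n \<omega> \<theta> - crit n \<omega> \<theta>0)"
    proof
      fix \<theta> assume "\<theta> \<in> J"
      hence \<theta>: "\<theta> \<in> \<Theta>" "\<epsilon> \<le> norm (\<theta> - \<theta>0)" using J(1) unfolding B_def by auto
      obtain Z where Z: "Z \<in> events" "prob Z \<le> K5 / (real n * a\<^sup>2)"
        "\<forall>\<omega>\<in>space M - Z. c5 * (1 / real n * (\<Sum>i<n. \<Sum>j<n. (k \<theta> (s i - s j) - k \<theta>0 (s i - s j))\<^sup>2)) - a < crit n \<omega> \<theta> - crit n \<omega> \<theta>0"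
        using sep \<theta>(1) n a(1) by blast
      have "c5 * \<delta> \<le> c5 * (1 / real n * (\<Sum>i<n. \<Sum>j<n. (k \<theta> (s i - s j) - k \<theta>0 (s i - s j))\<^sup>2))"
        using elim(1) \<theta> c5 by (intro mult_left_mono) auto
      hence "\<forall>\<omega>\<in>space M - Z. a < crit n \<omega> \<theta> - crit n \<omega> \<theta>0" using Z(3) a(2) by (smt (verit, best))
      with Z(1,2) show "\<exists>Z. Z \<in> events \<and> prob Z \<le> K5 / (real n * a\<^sup>2) \<and> (\<forall>\<omega>\<in>space M - Z. a < crit n \<omega> \<theta> - crit n \<omega> \<theta>0)" by blast
    qed
    then obtain Z where Z: "\<forall>\<theta>\<in>J. Z \<theta> \<in> events \<and> prob (Z \<theta>) \<le> K5 / (real n * a\<^sup>2) \<and> (\<forall>\<omega>\<in>space M - Z \<theta>. a < crit n \<omega> \<theta> - crit n \<omega> \<theta>0)"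
      by (rule bchoice[elim_format]) blast
    let ?V = "{\<omega>\<in>space M. A \<le> Ysq n \<omega>}"
    have V: "?V \<in> events" by measurable
    have UZ: "(\<Union>\<theta>\<in>J. Z \<theta>) \<in> events" using Z J(2) by (intro sets.finite_UN) auto
    have "{\<omega>\<in>space M. \<epsilon> \<le> norm (mle n \<omega> - \<theta>0)} \<subseteq> ?V \<union> (\<Union>\<theta>\<in>J. Z \<theta>)"
    proof (rule ccontr)
      assume "\<not> ?thesis"
      then obtain \<omega> where \<omega>: "\<omega> \<in> space M" "\<epsilon> \<le> norm (mle n \<omega> - \<theta>0)" "Ysq n \<omega> < A" "\<forall>\<theta>\<in>J. \<omega> \<notin> Z \<theta>" by force
      have "mle n \<omega> \<in> B" using mle_param[OF n \<omega>(1)] \<omega>(2) unfolding B_def by simp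
      then obtain \<theta> where \<theta>: "\<theta> \<in> J" "norm (mle n \<omega> - \<theta>) < r \<theta>" using J(3) by (auto simp: dist_norm norm_minus_commute)
      have \<theta>B: "\<theta> \<in> B" "\<theta> \<in> \<Theta>" using \<theta>(1) J(1) unfolding B_def by auto
      have ob: "op_bound n (gram n (\<lambda>x. k (mle n \<omega>) x - k \<theta> x)) \<rho>" using r \<theta>B(1) \<theta>(2) mle_param[OF n \<omega>(1)] by blast
      have "\<bar>crit n \<omega> (mle n \<omega>) - crit n \<omega> \<theta>\<bar> \<le> 2 * (\<rho> / cR) * (1 + 1 / cR) * Ysq n \<omega>"
        by (rule criterion_lipschitz[OF \<theta>B(2) mle_param[OF n \<omega>(1)] n ob \<rho>(2)])
      also have "\<dots> \<le> 2 * (\<rho> / cR) * (1 + 1 / cR) * A" using \<omega>(3) \<rho>(1) cR_pos by (intro mult_left_mono) auto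
      also have "\<dots> = \<rho> * U" unfolding U_def by simp
      finally have "\<bar>crit n \<omega> (mle n \<omega>) - crit n \<omega> \<theta>\<bar> \<le> a" using \<rho>(3) by linarith
      moreover have "a < crit n \<omega> \<theta> - crit n \<omega> \<theta>0" using Z \<theta>(1) \<omega>(1,4) by blast
      moreover have "crit n \<omega> (mle n \<omega>) \<le> crit n \<omega> \<theta>0" by (rule mle_minimal[OF n \<omega>(1) true_param])
      ultimately show False by linarith
    qed
    hence "prob {\<omega>\<in>space M. \<epsilon> \<le> norm (mle n \<omega> - \<theta>0)} \<le> prob (?V \<union> (\<Union>\<theta>\<in>J. Z \<theta>))"
      by (rule finite_measure_mono) (rule sets.Un[OF V UZ])
    also have "\<dots> \<le> prob ?V + prob (\<Union>\<theta>\<in>J. Z \<theta>)" by (rule measure_Un_le[OF V UZ])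
    also have "\<dots> \<le> \<zeta> / 2 + (\<Sum>\<theta>\<in>J. prob (Z \<theta>))"
      using Ysq_tail[OF A(1), of n] A(2) measure_UNION_le[OF J(2), of Z M] Z by (intro add_mono) auto
    also have "\<dots> \<le> \<zeta> / 2 + (\<Sum>\<theta>\<in>J. K5 / (real n * a\<^sup>2))" using Z by (intro add_left_mono sum_mono) auto
    also have "\<dots> = \<zeta> / 2 + real (card J) * (K5 / (real n * a\<^sup>2))" by simp
    finally show ?case using elim(2) measure_nonneg[of M "{\<omega>\<in>space M. \<epsilon> \<le> norm (mle n \<omega> - \<theta>0)}"] by simp
  qed
qed

end

subsection \<open>Local expansion of the criterion\<close>

lemma triple_product_index:
  assumes "A \<in> carrier_mat n n" "S \<in> carrier_mat n n" "C \<in> carrier_mat n n" "i < n" "j < n"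
  shows "(A * S * C) $$ (i, j) = (\<Sum>b<n. \<Sum>a<n. A $$ (i, a) * S $$ (a, b) * (C $$ (b, j) :: real))"
proof -
  have AS: "A * S \<in> carrier_mat n n" using assms by simp
  show ?thesis unfolding index_mult_mat_sum[OF AS assms(3-5)]
    by (intro sum.cong refl) (simp only: index_mult_mat_sum[OF assms(1,2,4)] lessThan_iff sum_distrib_right)
qed

lemma triple_product_bilinear:
  assumes A: "finite J" "A \<in> carrier_mat n n" "\<And>l. X l \<in> carrier_mat n n" and S: "S \<in> carrier_mat n n"
    and eq: "\<And>i j. i < n \<Longrightarrow> j < n \<Longrightarrow> A $$ (i, j) = (\<Sum>l\<in>J. c l * X l $$ (i, j))"
    and ij: "i < n" "j < n"
  shows "(A * S * A) $$ (i, j) = (\<Sum>(l, m)\<in>J \<times> J. c l * c m * (X l * S * X m) $$ (i, j) :: real)"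
proof -
  have "(A * S * A) $$ (i, j) = (\<Sum>b<n. \<Sum>a<n. (\<Sum>l\<in>J. \<Sum>m\<in>J. c l * c m * (X l $$ (i, a) * S $$ (a, b) * X m $$ (b, j))))"
    unfolding triple_product_index[OF A(2) S A(2) ij]
  proof (intro sum.cong refl)
    fix b a assume "b \<in> {..<n}" "a \<in> {..<n}"
    hence "A $$ (i, a) * S $$ (a, b) * A $$ (b, j) = (\<Sum>l\<in>J. c l * X l $$ (i, a)) * S $$ (a, b) * (\<Sum>m\<in>J. c m * X m $$ (b, j))"
      using eq ij by simp
    also have "\<dots> = (\<Sum>l\<in>J. \<Sum>m\<in>J. c l * c m * (X l $$ (i, a) * S $$ (a, b) * X m $$ (b, j)))"
      by (simp add: sum_distrib_left sum_distrib_right mult_ac)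
    finally show "A $$ (i, a) * S $$ (a, b) * A $$ (b, j) = \<dots>" .
  qed
  also have "\<dots> = (\<Sum>b<n. \<Sum>l\<in>J. \<Sum>a<n. \<Sum>m\<in>J. c l * c m * (X l $$ (i, a) * S $$ (a, b) * X m $$ (b, j)))"
    by (intro sum.cong refl sum.swap)
  also have "\<dots> = (\<Sum>l\<in>J. \<Sum>b<n. \<Sum>a<n. \<Sum>m\<in>J. c l * c m * (X l $$ (i, a) * S $$ (a, b) * X m $$ (b, j)))"
    by (rule sum.swap)
  also have "\<dots> = (\<Sum>l\<in>J. \<Sum>b<n. \<Sum>m\<in>J. \<Sum>a<n. c l * c m * (X l $$ (i, a) * S $$ (a, b) * X m $$ (b, j)))"
    by (intro sum.cong refl sum.swap)
  also have "\<dots> = (\<Sum>l\<in>J. \<Sum>m\<in>J. \<Sum>b<n. \<Sum>a<n. c l * c m * (X l $$ (i, a) * S $$ (a, b) * X m $$ (b, j)))"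
    by (intro sum.cong refl sum.swap)
  also have "\<dots> = (\<Sum>l\<in>J. \<Sum>m\<in>J. c l * c m * (X l * S * X m) $$ (i, j))"
    by (intro sum.cong refl) (simp only: triple_product_index[OF A(3) S A(3) ij] sum_distrib_left)
  finally show ?thesis by (simp add: sum.cartesian_product)
qed

text \<open>Trace and \<open>chaos\<close> are both linear functionals of the entries of a matrix,
  with different weights g; this is their common linearity.\<close>

lemma weighted_entries_linear:
  assumes "finite J" and "\<And>i j. i < n \<Longrightarrow> j < n \<Longrightarrow> A $$ (i, j) = (\<Sum>l\<in>J. c l * X l $$ (i, j))"
  shows "(\<Sum>i<n. \<Sum>j<n. A $$ (i, j) * g i j) = (\<Sum>l\<in>J. c l * (\<Sum>i<n. \<Sum>j<n. X l $$ (i, j) * (g i j :: real)))"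
proof -
  have "(\<Sum>i<n. \<Sum>j<n. A $$ (i, j) * g i j) = (\<Sum>i<n. \<Sum>j<n. \<Sum>l\<in>J. c l * (X l $$ (i, j) * g i j))"
    using assms(2) by (intro sum.cong refl) (simp add: sum_distrib_right mult.assoc)
  also have "\<dots> = (\<Sum>i<n. \<Sum>l\<in>J. \<Sum>j<n. c l * (X l $$ (i, j) * g i j))" by (intro sum.cong refl sum.swap)
  also have "\<dots> = (\<Sum>l\<in>J. \<Sum>i<n. \<Sum>j<n. c l * (X l $$ (i, j) * g i j))" by (rule sum.swap)
  finally show ?thesis by (simp add: sum_distrib_left)
qed

lemma mat_trace_linear:
  assumes "finite J" "S \<in> carrier_mat n n" "A \<in> carrier_mat n n" "\<And>l. X l \<in> carrier_mat n n"
    and "\<And>i j. i < n \<Longrightarrow> j < n \<Longrightarrow> A $$ (i, j) = (\<Sum>l\<in>J. c l * X l $$ (i, j))"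
  shows "mat_trace (S * A) = (\<Sum>l\<in>J. c l * mat_trace (S * X l))"
  unfolding mat_trace_mult_sum[OF assms(2,3)] mat_trace_mult_sum[OF assms(2,4)]
  by (rule weighted_entries_linear[OF assms(1,5)])

lemma chaos_linear:
  assumes "finite J" "S \<in> carrier_mat n n" "A \<in> carrier_mat n n" "\<And>l. X l \<in> carrier_mat n n"
    and "\<And>i j. i < n \<Longrightarrow> j < n \<Longrightarrow> A $$ (i, j) = (\<Sum>l\<in>J. c l * X l $$ (i, j))"
  shows "chaos n S y A = (\<Sum>l\<in>J. c l * chaos n S y (X l))"
proof -
  let ?g = "\<lambda>i j. (S *\<^sub>v Matrix.vec n y) $ i * (S *\<^sub>v Matrix.vec n y) $ j - S $$ (j, i)"
  have "(\<Sum>i<n. \<Sum>j<n. A $$ (i, j) * ?g i j) = (\<Sum>l\<in>J. c l * (\<Sum>i<n. \<Sum>j<n. X l $$ (i, j) * ?g i j))"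
    by (rule weighted_entries_linear[OF assms(1,5)])
  hence "chaos n S y A = 1 / real n * (\<Sum>l\<in>J. c l * (\<Sum>i<n. \<Sum>j<n. X l $$ (i, j) * ?g i j))"
    unfolding chaos_sum[OF assms(2,3)] by (simp only:)
  also have "\<dots> = (\<Sum>l\<in>J. c l * (1 / real n * (\<Sum>i<n. \<Sum>j<n. X l $$ (i, j) * ?g i j)))"
    by (subst sum_distrib_left) (intro sum.cong refl mult.left_commute)
  finally show ?thesis unfolding chaos_sum[OF assms(2,4)] .
qed

lemma mat_trace_add:
  assumes "S \<in> carrier_mat n n" "A \<in> carrier_mat n n" "B \<in> carrier_mat n n"
  shows "mat_trace (S * (A + B)) = mat_trace (S * A) + mat_trace (S * B)"
proof -
  have "mat_trace (S * (A + B)) = (\<Sum>l\<in>{False, True}. 1 * mat_trace (S * (if l then A else B)))"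
    by (rule mat_trace_linear) (use assms in auto)
  thus ?thesis by simp
qed

text \<open>With S symmetric, form and trace see only the symmetric part of X.\<close>

lemma chaos_transpose:
  assumes S: "S \<in> carrier_mat n n" "transpose_mat S = S" and X: "X \<in> carrier_mat n n"
  shows "chaos n S y (transpose_mat X) = chaos n S y X"
proof -
  have sym: "S $$ (j, i) = S $$ (i, j)" if "i < n" "j < n" for i j
    using S that by (metis carrier_matD index_transpose_mat(1))
  have tX: "transpose_mat X \<in> carrier_mat n n" using X by simp
  have "(\<Sum>i<n. \<Sum>j<n. transpose_mat X $$ (i, j) * ((S *\<^sub>v Matrix.vec n y) $ i * (S *\<^sub>v Matrix.vec n y) $ j - S $$ (j, i)))
     = (\<Sum>i<n. \<Sum>j<n. X $$ (j, i) * ((S *\<^sub>v Matrix.vec n y) $ j * (S *\<^sub>v Matrix.vec n y) $ i - S $$ (i, j)))"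
    using X by (intro sum.cong refl) (simp add: sym mult.commute)
  also have "\<dots> = (\<Sum>j<n. \<Sum>i<n. X $$ (j, i) * ((S *\<^sub>v Matrix.vec n y) $ j * (S *\<^sub>v Matrix.vec n y) $ i - S $$ (i, j)))"
    by (rule sum.swap)
  finally show ?thesis unfolding chaos_sum[OF S(1) tX] chaos_sum[OF S(1) X] by simp
qed

context gaussian_mle begin

abbreviation R1 :: "nat \<Rightarrow> 'p \<Rightarrow> real mat" where "R1 n m \<equiv> gram n (Dk [m] \<theta>0)"
text \<open>Matrices behind the random part of the second-order coefficients: one term from
  expanding the inverse, one from the second derivatives with their weights \<kappa>. They need not
  be symmetric.\<close>

abbreviation T2 :: "('p \<Rightarrow> 'p \<Rightarrow> real) \<Rightarrow> nat \<Rightarrow> 'p \<Rightarrow> 'p \<Rightarrow> real mat" where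
  "T2 \<kappa> n l m \<equiv> R1 n l * Sinv n * R1 n m + (- \<kappa> l m) \<cdot>\<^sub>m gram n (Dk [m, l] \<theta>0)"
abbreviation info :: "nat \<Rightarrow> real ^ 'p ^ 'p" where "info n \<equiv> fisher_matrix k Dk s \<theta>0 n"
text \<open>Directional derivative of the covariance matrix at \<theta>0.\<close>

definition Rdir :: "nat \<Rightarrow> real ^ 'p \<Rightarrow> real mat" where
  "Rdir n h = gram n (\<lambda>x. \<Sum>m\<in>UNIV. vec_nth h m * Dk [m] \<theta>0 x)"

lemma F_linear:
  assumes "finite J" "A \<in> carrier_mat n n" "\<And>l. X l \<in> carrier_mat n n"
    and "\<And>i j. i < n \<Longrightarrow> j < n \<Longrightarrow> A $$ (i, j) = (\<Sum>l\<in>J. c l * X l $$ (i, j))"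
  shows "F n \<omega> A = (\<Sum>l\<in>J. c l * F n \<omega> (X l))"
  unfolding F_def by (rule chaos_linear[OF assms(1) Sinv_carrier assms(2-4)])

lemma F_add:
  assumes "A \<in> carrier_mat n n" "B \<in> carrier_mat n n" shows "F n \<omega> (A + B) = F n \<omega> A + F n \<omega> B"
proof -
  have "F n \<omega> (A + B) = (\<Sum>l\<in>{False, True}. 1 * F n \<omega> (if l then A else B))"
    by (rule F_linear) (use assms in auto)
  thus ?thesis by simp
qed

lemma F_smult:
  assumes "A \<in> carrier_mat n n" shows "F n \<omega> (a \<cdot>\<^sub>m A) = a * F n \<omega> A"
proof -
  have "F n \<omega> (a \<cdot>\<^sub>m A) = (\<Sum>l\<in>{True}. a * F n \<omega> A)"
    by (rule F_linear) (use assms in auto)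
  thus ?thesis by simp
qed

text \<open>Passing to the symmetric part of X changes neither the form nor the operator
  bound.\<close>

lemma F_tail_general:
  assumes X: "op_bound n X \<rho>" and n: "n > 0" and a: "a > 0"
  shows "prob {\<omega>\<in>space M. a \<le> \<bar>F n \<omega> X\<bar>} \<le> 2 * (\<rho> / cR)\<^sup>2 / (real n * a\<^sup>2)"
proof -
  have c: "X \<in> carrier_mat n n" "transpose_mat X \<in> carrier_mat n n" using op_bound_carrier[OF X] by auto
  let ?Z = "(1 / 2) \<cdot>\<^sub>m (X + transpose_mat X)"
  have "F n \<omega> ?Z = F n \<omega> X" for \<omega>
    using c F_add[OF c] F_smult[of "X + transpose_mat X" n] chaos_transpose[OF Sinv_carrier Sinv_symmetric c(1)]
    unfolding F_def by simp
  moreover have "op_bound n ?Z \<rho>" using op_bound_smult[OF op_bound_add[OF X op_bound_transpose[OF X]], of "1 / 2"] by simp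
  moreover have "transpose_mat ?Z = ?Z" using c by (intro eq_matI) auto
  ultimately show ?thesis using F_tail[OF _ _ n a, of ?Z \<rho>] by simp
qed

lemma derivative_bound: "1 \<le> length is \<Longrightarrow> length is \<le> 3 \<Longrightarrow> \<theta> \<in> \<Theta> \<Longrightarrow>
   \<bar>Dk is \<theta> x\<bar> \<le> C_sup / (1 + norm x powr (real CARD('d) + C_inf))"
  using condition3[rule_format, of "length is" "is" \<theta> x] by (cases "length is = 1"; cases "length is = 2") auto

lemma derivative_even: "length is \<le> 3 \<Longrightarrow> Dk is \<theta>0 (- x) = Dk is \<theta>0 x"
  by (rule partial_derivatives_symmetric[where r = 3 and \<Theta> = \<Theta>])
    (use derivatives interior_param k_even in \<open>auto simp: iterated_partial_derivatives_def\<close>)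

lemma op_bound_gram_scaled:
  assumes "\<And>x. \<bar>f x\<bar> \<le> C_sup / (1 + norm x powr (real CARD('d) + C_inf)) * c" and c: "c \<ge> 0"
  shows "op_bound n (gram n f) (Cop * c)"
proof (rule op_bound_mono[OF op_bound_gram[where \<rho> = "C_sup * c" and \<beta> = "real CARD('d) + C_inf"]])
  show "C_sup * c * pack \<le> Cop * c" using mult_right_mono[OF C_sup_pack_le c] by (simp add: mult_ac)
qed (use assms C_sup_nonneg in auto)

lemma op_bound_R1: "op_bound n (R1 n m) Cop"
  using op_bound_gram_scaled[of "Dk [m] \<theta>0" 1] derivative_bound[of "[m]" \<theta>0] true_param by simp

lemma op_bound_R2: "op_bound n (gram n (Dk [m, l] \<theta>0)) Cop"
  using op_bound_gram_scaled[of "Dk [m, l] \<theta>0" 1] derivative_bound[of "[m, l]" \<theta>0] true_param by simp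

lemma op_bound_T2: "op_bound n (T2 \<kappa> n l m) (Cop * (1 / cR) * Cop + \<bar>\<kappa> l m\<bar> * Cop)"
  using op_bound_add[OF op_bound_mult[OF op_bound_mult[OF op_bound_R1 Sinv_op_bound] op_bound_R1] op_bound_smult[OF op_bound_R2, of _ "- \<kappa> l m"]]
  by simp

lemma Rdir_carrier [simp]: "Rdir n h \<in> carrier_mat n n" unfolding Rdir_def by simp

lemma Rdir_index: "i < n \<Longrightarrow> j < n \<Longrightarrow> Rdir n h $$ (i, j) = (\<Sum>m\<in>UNIV. vec_nth h m * R1 n m $$ (i, j))"
  unfolding Rdir_def by (simp add: gram_index)

lemma Rdir_symmetric: "transpose_mat (Rdir n h) = Rdir n h"
  unfolding Rdir_def by (intro gram_symmetric) (simp add: derivative_even)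

lemma op_bound_Rdir: "op_bound n (Rdir n h) (Cop * (\<Sum>m\<in>UNIV. \<bar>vec_nth h m\<bar>))"
  unfolding Rdir_def
proof (rule op_bound_gram_scaled)
  fix x
  have "\<bar>\<Sum>m\<in>UNIV. vec_nth h m * Dk [m] \<theta>0 x\<bar> \<le> (\<Sum>m\<in>UNIV. \<bar>vec_nth h m\<bar> * (C_sup / (1 + norm x powr (real CARD('d) + C_inf))))"
    unfolding abs_mult[symmetric]
  proof (intro order_trans[OF sum_abs sum_mono])
    fix m
    have "\<bar>vec_nth h m\<bar> * \<bar>Dk [m] \<theta>0 x\<bar> \<le> \<bar>vec_nth h m\<bar> * (C_sup / (1 + norm x powr (real CARD('d) + C_inf)))"
      by (intro mult_left_mono derivative_bound true_param) auto
    thus "\<bar>vec_nth h m * Dk [m] \<theta>0 x\<bar> \<le> \<bar>vec_nth h m\<bar> * (C_sup / (1 + norm x powr (real CARD('d) + C_inf)))" unfolding abs_mult .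
  qed
  thus "\<bar>\<Sum>m\<in>UNIV. vec_nth h m * Dk [m] \<theta>0 x\<bar> \<le> C_sup / (1 + norm x powr (real CARD('d) + C_inf)) * (\<Sum>m\<in>UNIV. \<bar>vec_nth h m\<bar>)"
    unfolding sum_distrib_right[symmetric] by (simp only: mult.commute)
qed (intro sum_nonneg, auto)

lemma F_Rdir: "F n \<omega> (Rdir n h) = (\<Sum>m\<in>UNIV. vec_nth h m * F n \<omega> (R1 n m))"
  by (rule F_linear) (auto simp: Rdir_index)

lemma Rdir_sandwich_index:
  "i < n \<Longrightarrow> j < n \<Longrightarrow> (Rdir n h * Sinv n * Rdir n h) $$ (i, j) =
    (\<Sum>(l, m)\<in>UNIV \<times> UNIV. vec_nth h l * vec_nth h m * (R1 n l * Sinv n * R1 n m) $$ (i, j))"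
  by (rule triple_product_bilinear[OF _ Rdir_carrier _ Sinv_carrier]) (auto simp: Rdir_index)

lemma R1_sandwich_carrier: "R1 n l * Sinv n * R1 n m \<in> carrier_mat n n"
  by (rule mult_carrier_mat[OF mult_carrier_mat[OF gram_carrier Sinv_carrier] gram_carrier])

lemma Rdir_sandwich_carrier: "Rdir n h * Sinv n * Rdir n h \<in> carrier_mat n n"
  by (rule mult_carrier_mat[OF mult_carrier_mat[OF Rdir_carrier Sinv_carrier] Rdir_carrier])

lemma F_Rdir_sandwich: "F n \<omega> (Rdir n h * Sinv n * Rdir n h) = (\<Sum>l\<in>UNIV. \<Sum>m\<in>UNIV. vec_nth h l * vec_nth h m * F n \<omega> (R1 n l * Sinv n * R1 n m))"
proof -
  have "F n \<omega> (Rdir n h * Sinv n * Rdir n h) = (\<Sum>lm\<in>UNIV \<times> UNIV. (vec_nth h (fst lm) * vec_nth h (snd lm)) * F n \<omega> (R1 n (fst lm) * Sinv n * R1 n (snd lm)))"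
    by (rule F_linear[OF _ Rdir_sandwich_carrier R1_sandwich_carrier]) (simp_all add: Rdir_sandwich_index case_prod_beta del: index_mult_mat)
  thus ?thesis by (simp add: sum.cartesian_product case_prod_beta)
qed

lemma info_index: "vec_nth (vec_nth (info n) l) m = mat_trace (Sinv n * (R1 n l * Sinv n * R1 n m)) / (2 * real n)"
proof -
  have "Sinv n * R1 n l * Sinv n * R1 n m = Sinv n * (R1 n l * Sinv n * R1 n m)"
    using Sinv_carrier[of n] by (simp add: assoc_mult_mat[of _ n n _ n _ n] mult_carrier_mat[of _ n n _ n])
  thus ?thesis unfolding fisher_matrix_def Let_def cov_matrix_gram Sinv_def[symmetric] by simp
qed

lemma info_symmetric: "Finite_Cartesian_Product.transpose (info n) = info n"
proof -
  have "mat_trace (Sinv n * (R1 n l * Sinv n * R1 n m)) = mat_trace (Sinv n * (R1 n m * Sinv n * R1 n l))" for l m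
  proof -
    have S: "Sinv n \<in> carrier_mat n n" by (rule Sinv_carrier)
    have "mat_trace ((Sinv n * R1 n l) * (Sinv n * R1 n m)) = mat_trace ((Sinv n * R1 n m) * (Sinv n * R1 n l))"
      by (rule mat_trace_mult_comm[of _ n]) (use S in \<open>auto intro!: mult_carrier_mat[of _ n n _ n]\<close>)
    thus ?thesis using S by (simp add: assoc_mult_mat[of _ n n _ n _ n] mult_carrier_mat[of _ n n _ n])
  qed
  thus ?thesis by (simp add: Finite_Cartesian_Product.vec_eq_iff Finite_Cartesian_Product.transpose_def info_index)
qed

text \<open>Bilinearity of the trace. Eigenvalue bounds for the information matrix thereby reduce to
  a single symmetric perturbation at a time.\<close>

lemma info_quadratic: "h \<bullet> (info n *v h) = mat_trace (Sinv n * (Rdir n h * Sinv n * Rdir n h)) / (2 * real n)"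
proof -
  have "mat_trace (Sinv n * (Rdir n h * Sinv n * Rdir n h)) = (\<Sum>lm\<in>UNIV \<times> UNIV. (vec_nth h (fst lm) * vec_nth h (snd lm)) * mat_trace (Sinv n * (R1 n (fst lm) * Sinv n * R1 n (snd lm))))"
    by (rule mat_trace_linear[OF _ Sinv_carrier Rdir_sandwich_carrier R1_sandwich_carrier]) (simp_all add: Rdir_sandwich_index case_prod_beta del: index_mult_mat)
  also have "\<dots> = (\<Sum>l\<in>UNIV. \<Sum>m\<in>UNIV. vec_nth h l * vec_nth h m * mat_trace (Sinv n * (R1 n l * Sinv n * R1 n m)))"
    by (simp add: sum.cartesian_product case_prod_beta)
  finally have e: "mat_trace (Sinv n * (Rdir n h * Sinv n * Rdir n h)) = \<dots>" .
  have "h \<bullet> (info n *v h) = (\<Sum>l\<in>UNIV. \<Sum>m\<in>UNIV. vec_nth h l * vec_nth h m * mat_trace (Sinv n * (R1 n l * Sinv n * R1 n m)) / (2 * real n))"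
    unfolding inner_vec_def matrix_vector_mult_def by (simp add: info_index sum_distrib_left mult_ac)
  thus ?thesis unfolding e by (simp add: sum_divide_distrib)
qed

lemma sum_abs_le_norm: "(\<Sum>m\<in>UNIV. \<bar>vec_nth (h :: real ^ 'p) m\<bar>) \<le> real CARD('p) * norm h"
  using sum_bounded_above[of UNIV "\<lambda>m. \<bar>vec_nth h m\<bar>" "norm h"] component_le_norm_cart[of h] by simp

text \<open>The covariance increment E is the directional derivative B, of first order, plus D, of
  second order. Inserted in -F(E) + F(E S E) + tr(S E S E) / (2 n), the terms linear and quadratic
  in h are kept; all others are of third order, with \<open>Ysq\<close> as their only random
  factor.\<close>

theorem criterion_expansion:
  "\<exists>K\<ge>0. \<exists>r>0. \<exists>\<kappa>. \<forall>n>0. \<forall>h \<omega>. norm h \<le> r \<longrightarrow> \<theta>0 + h \<in> \<Theta> \<and>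
    \<bar>crit n \<omega> (\<theta>0 + h) - crit n \<omega> \<theta>0 + (\<Sum>m\<in>UNIV. vec_nth h m * F n \<omega> (R1 n m)) - h \<bullet> (info n *v h)
       - (\<Sum>l\<in>UNIV. \<Sum>m\<in>UNIV. vec_nth h l * vec_nth h m * F n \<omega> (T2 \<kappa> n l m))\<bar> \<le> K * norm h ^ 3 * Ysq n \<omega>"
proof -
  define P where "P = real CARD('p)"
  have P: "P \<ge> 1" unfolding P_def using zero_less_card_finite[where 'a = 'p] by linarith
  let ?w = "\<lambda>x :: real ^ 'd. C_sup / (1 + norm x powr (real CARD('d) + C_inf))"
  obtain r1 where r1: "r1 > 0" "ball \<theta>0 r1 \<subseteq> \<Theta>" using interior_param unfolding mem_interior by blast
  \<comment> \<open>Half-width of a coordinate box inside the ball: the l1 norm of an increment in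
    it is at most P r0 = r1 / 2.\<close>
  define r0 where "r0 = r1 / (2 * P)"
  have r0: "r0 > 0" unfolding r0_def using r1 P by simp
  have box: "{\<theta>. \<forall>i. \<bar>vec_nth \<theta> i - vec_nth \<theta>0 i\<bar> \<le> r0} \<subseteq> \<Theta>"
  proof
    fix \<theta> assume "\<theta> \<in> {\<theta>. \<forall>i. \<bar>vec_nth \<theta> i - vec_nth \<theta>0 i\<bar> \<le> r0}"
    hence "norm (\<theta> - \<theta>0) \<le> (\<Sum>i\<in>(UNIV :: 'p set). r0)" by (intro order_trans[OF norm_le_l1_cart sum_mono]) simp
    also have "\<dots> < r1" using r1 P unfolding r0_def by (simp add: P_def[symmetric])
    finally show "\<theta> \<in> \<Theta>" using r1(2) by (auto simp: dist_norm norm_minus_commute)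
  qed
  from derivatives have Dd: "has_partial_derivative \<Theta> i (\<lambda>\<theta>'. Dk is \<theta>' x) (Dk (i # is) \<theta> x) \<theta>" if "length is < 3" "\<theta> \<in> \<Theta>" for "is" i \<theta> x
    using that unfolding iterated_partial_derivatives_def by blast
  have Dk0: "Dk [] \<theta> x = k \<theta> x" if "\<theta> \<in> \<Theta>" for \<theta> x using that derivatives unfolding iterated_partial_derivatives_def by blast
  obtain \<kappa> :: "'p \<Rightarrow> 'p \<Rightarrow> real" where \<kappa>: "\<forall>h x. (\<forall>i. \<bar>vec_nth h i\<bar> \<le> r0) \<longrightarrow>
    \<bar>Dk [] (\<theta>0 + h) x - Dk [] \<theta>0 x - (\<Sum>i\<in>UNIV. vec_nth h i * Dk [i] \<theta>0 x) - (\<Sum>i\<in>UNIV. \<Sum>j\<in>UNIV. \<kappa> i j * vec_nth h i * vec_nth h j * Dk [j, i] \<theta>0 x)\<bar>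
      \<le> ?w x * (\<Sum>i\<in>UNIV. \<bar>vec_nth h i\<bar>) ^ 3"
  proof -
    have "\<exists>\<kappa> :: 'p \<Rightarrow> 'p \<Rightarrow> real. \<forall>h x. (\<forall>i. \<bar>vec_nth h i\<bar> \<le> r0) \<longrightarrow>
      \<bar>Dk [] (\<theta>0 + h) x - Dk [] \<theta>0 x - (\<Sum>i\<in>UNIV. vec_nth h i * Dk [i] \<theta>0 x) - (\<Sum>i\<in>UNIV. \<Sum>j\<in>UNIV. \<kappa> i j * vec_nth h i * vec_nth h j * Dk [j, i] \<theta>0 x)\<bar>
        \<le> ?w x * (\<Sum>i\<in>UNIV. \<bar>vec_nth h i\<bar>) ^ 3"
      by (rule partial_taylor[OF box Dd derivative_bound])
    with that show ?thesis by (elim exE)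
  qed
  define \<kappa>s where "\<kappa>s = (\<Sum>i\<in>UNIV. \<Sum>j\<in>UNIV. \<bar>\<kappa> i j\<bar>)"
  have \<kappa>s: "\<kappa>s \<ge> 0" unfolding \<kappa>s_def by (intro sum_nonneg) auto
  have \<kappa>s1: "\<kappa>s + 1 > 0" using \<kappa>s by simp
  \<comment> \<open>Operator bounds up to powers of the l1 norm N: \<open>C2\<close> for the
    second-order part, \<open>C1\<close> for the whole increment, \<open>z\<close> for the cubic
    cross terms; \<open>Fk\<close> is the factor of the pathwise bound for \<open>F\<close>.
    \<open>K\<close> adds the error of the eigenvalue expansion and those of the three discarded
    terms.\<close>
  define C2 where "C2 = Cop * (\<kappa>s + 1)"
  define C1 where "C1 = Cop + C2"
  define Fk where "Fk = 1 / cR\<^sup>2 + 1 / cR"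
  define z where "z = Cop * (1 / cR) * C2 + C2 * (1 / cR) * C1"
  define K where "K = 2 * (C1 / cR) ^ 3 * (1 + 1 / cR) + Cop * Fk + z * Fk + z / (2 * cR)"
  have C: "C2 > 0" "C1 > 0" "Fk > 0" "z \<ge> 0" "K \<ge> 0"
    unfolding K_def z_def C1_def C2_def Fk_def using \<kappa>s1 Cop_pos cR_pos
    by (auto intro!: add_pos_pos add_nonneg_nonneg mult_nonneg_nonneg mult_pos_pos zero_le_power divide_nonneg_nonneg)
  \<comment> \<open>Three demands: stay in the box, N <= 1 so that higher powers of N are smaller,
    and \<open>C1 * N \<le> cR / 2\<close> so that the eigenvalue expansion applies.\<close>
  define r where "r = min r0 (min (1 / P) (cR / (2 * C1 * P)))"
  have r: "r > 0" unfolding r_def using r0 P C cR_pos by simp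
  have main: "\<theta>0 + h \<in> \<Theta> \<and>
    \<bar>crit n \<omega> (\<theta>0 + h) - crit n \<omega> \<theta>0 + (\<Sum>m\<in>UNIV. vec_nth h m * F n \<omega> (R1 n m)) - h \<bullet> (info n *v h)
       - (\<Sum>l\<in>UNIV. \<Sum>m\<in>UNIV. vec_nth h l * vec_nth h m * F n \<omega> (T2 \<kappa> n l m))\<bar> \<le> K * P ^ 3 * norm h ^ 3 * Ysq n \<omega>"
    if n: "n > 0" and h: "norm h \<le> r" for n h \<omega>
  proof -
    have "norm h \<le> r0" using h unfolding r_def by simp
    hence hi: "\<forall>i. \<bar>vec_nth h i\<bar> \<le> r0" using component_le_norm_cart[of h] by (blast intro: order_trans)
    have \<theta>: "\<theta>0 + h \<in> \<Theta>" using hi box by auto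
    define N where "N = (\<Sum>i\<in>UNIV. \<bar>vec_nth h i\<bar>)"
    have N0: "N \<ge> 0" unfolding N_def by (intro sum_nonneg) auto
    have NP: "N \<le> P * norm h" unfolding N_def P_def by (rule sum_abs_le_norm)
    also have "\<dots> \<le> P * r" using P h by (intro mult_left_mono) auto
    finally have NPr: "N \<le> P * r" .
    have "P * r \<le> P * (1 / P)" unfolding r_def using P by (intro mult_left_mono) auto
    hence N1: "N \<le> 1" using NPr P by simp
    have "P * r \<le> P * (cR / (2 * C1 * P))" unfolding r_def using P by (intro mult_left_mono) auto
    hence "N \<le> cR / (2 * C1)" using NPr P by simp
    hence C1N: "C1 * N \<le> cR / 2" using C by (simp add: field_simps)
    define b where "b = (\<lambda>x. \<Sum>m\<in>UNIV. vec_nth h m * Dk [m] \<theta>0 x)"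
    define q where "q = (\<lambda>x. \<Sum>i\<in>UNIV. \<Sum>j\<in>UNIV. \<kappa> i j * vec_nth h i * vec_nth h j * Dk [j, i] \<theta>0 x)"
    define e where "e = (\<lambda>x. k (\<theta>0 + h) x - k \<theta>0 x)"
    define u where "u = (\<lambda>x. e x - b x - q x)"
    have w0: "?w x \<ge> 0" for x :: "real ^ 'd" using C_sup_nonneg by (intro divide_nonneg_nonneg add_nonneg_nonneg) auto
    have ub: "\<bar>u x\<bar> \<le> ?w x * N ^ 3" for x
      using \<kappa>[rule_format, OF hi[rule_format], of x] unfolding Dk0[OF \<theta>] Dk0[OF true_param] u_def e_def b_def q_def N_def .
    have hN: "\<bar>vec_nth h i\<bar> \<le> N" for i unfolding N_def by (rule member_le_sum) auto
    have qb: "\<bar>q x\<bar> \<le> ?w x * (\<kappa>s * N\<^sup>2)" for x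
    proof -
      have "\<bar>q x\<bar> \<le> (\<Sum>i\<in>UNIV. \<Sum>j\<in>UNIV. \<bar>\<kappa> i j\<bar> * (N\<^sup>2 * ?w x))"
        unfolding q_def
      proof (intro order_trans[OF sum_abs sum_mono])
        fix i j
        have "\<bar>vec_nth h i\<bar> * \<bar>vec_nth h j\<bar> * \<bar>Dk [j, i] \<theta>0 x\<bar> \<le> N * N * ?w x"
          using hN N0 derivative_bound[of "[j, i]" \<theta>0 x] true_param by (intro mult_mono) auto
        hence "\<bar>\<kappa> i j\<bar> * (\<bar>vec_nth h i\<bar> * \<bar>vec_nth h j\<bar> * \<bar>Dk [j, i] \<theta>0 x\<bar>) \<le> \<bar>\<kappa> i j\<bar> * (N * N * ?w x)" by (rule mult_left_mono) simp
        thus "\<bar>\<kappa> i j * vec_nth h i * vec_nth h j * Dk [j, i] \<theta>0 x\<bar> \<le> \<bar>\<kappa> i j\<bar> * (N\<^sup>2 * ?w x)"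
          unfolding abs_mult power2_eq_square by (simp only: mult.assoc)
      qed
      also have "\<dots> = ?w x * (\<kappa>s * N\<^sup>2)" unfolding \<kappa>s_def sum_distrib_right[symmetric] by (simp only: mult_ac)
      finally show ?thesis .
    qed
    let ?B = "Rdir n h" let ?Q = "gram n q" let ?U = "gram n u" let ?E = "gram n e" let ?D = "gram n (\<lambda>x. q x + u x)" let ?S = "Sinv n"
    have N32: "N ^ 3 \<le> N\<^sup>2" using N0 N1 by (intro power_decreasing) auto
    have oB: "op_bound n ?B (Cop * N)" unfolding N_def by (rule op_bound_Rdir)
    have oU: "op_bound n ?U (Cop * N ^ 3)" by (rule op_bound_gram_scaled[OF ub]) (use N0 in simp)
    have "op_bound n ?D (Cop * ((\<kappa>s + 1) * N\<^sup>2))"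
    proof (rule op_bound_gram_scaled)
      fix x
      have "\<bar>q x + u x\<bar> \<le> ?w x * (\<kappa>s * N\<^sup>2) + ?w x * N ^ 3" using ub[of x] qb[of x] by linarith
      also have "\<dots> \<le> ?w x * (\<kappa>s * N\<^sup>2) + ?w x * N\<^sup>2" by (intro add_left_mono mult_left_mono N32 w0)
      finally show "\<bar>q x + u x\<bar> \<le> ?w x * ((\<kappa>s + 1) * N\<^sup>2)" by (simp add: algebra_simps)
    qed (use \<kappa>s in simp)
    hence oD: "op_bound n ?D (C2 * N\<^sup>2)" unfolding C2_def by (simp only: mult.assoc)
    have EBD: "?E = ?B + ?D" unfolding Rdir_def gram_add by (simp add: u_def b_def)
    have N21: "N\<^sup>2 \<le> N" using N0 N1 by (simp add: power2_eq_square mult_left_le)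
    have oE: "op_bound n ?E (C1 * N)"
      unfolding EBD
    proof (rule op_bound_mono[OF op_bound_add[OF oB oD]])
      have "C2 * N\<^sup>2 \<le> C2 * N" using N21 C by (intro mult_left_mono) auto
      thus "Cop * N + C2 * N\<^sup>2 \<le> C1 * N" unfolding C1_def by (simp add: algebra_simps)
    qed
    have S: "?S \<in> carrier_mat n n" by (rule Sinv_carrier)
    let ?Z = "?B * ?S * ?D + ?D * ?S * ?E"
    \<comment> \<open>Only B S B is quadratic in h; the terms collected in \<open>?Z\<close> all
      contain D and are cubic.\<close>
    have ESE: "?E * ?S * ?E = ?B * ?S * ?B + ?Z"
    proof -
      have c: "?B \<in> carrier_mat n n" "?D \<in> carrier_mat n n" "?E \<in> carrier_mat n n" by simp_all
      have cBS: "?B * ?S \<in> carrier_mat n n" "?D * ?S \<in> carrier_mat n n" using S c by (auto intro!: mult_carrier_mat[of _ n n _ n])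
      have "(?B + ?D) * ?S * ?E = ?B * ?S * ?E + ?D * ?S * ?E"
        unfolding add_mult_distrib_mat[OF c(1,2) S] add_mult_distrib_mat[OF cBS c(3)] ..
      moreover have "?B * ?S * (?B + ?D) = ?B * ?S * ?B + ?B * ?S * ?D"
        by (rule mult_add_distrib_mat[OF cBS(1) c(1,2)])
      ultimately have "?E * ?S * ?E = (?B * ?S * ?B + ?B * ?S * ?D) + ?D * ?S * ?E" unfolding EBD by simp
      also have "\<dots> = ?B * ?S * ?B + ?Z"
        by (rule assoc_add_mat[OF mult_carrier_mat[OF cBS(1) c(1)] mult_carrier_mat[OF cBS(1) c(2)] mult_carrier_mat[OF cBS(2) c(3)]])
      finally show ?thesis .
    qed
    have "op_bound n ?Z (Cop * N * (1 / cR) * (C2 * N\<^sup>2) + C2 * N\<^sup>2 * (1 / cR) * (C1 * N))"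
      by (rule op_bound_add[OF op_bound_mult[OF op_bound_mult[OF oB Sinv_op_bound] oD] op_bound_mult[OF op_bound_mult[OF oD Sinv_op_bound] oE]])
    hence oZ: "op_bound n ?Z (z * N ^ 3)" unfolding z_def by (simp add: algebra_simps power2_eq_square power3_eq_cube)
    have cZ: "?Z \<in> carrier_mat n n" by (rule op_bound_carrier[OF oZ])
    have FE: "F n \<omega> ?E = F n \<omega> ?B + F n \<omega> ?Q + F n \<omega> ?U"
      using F_add[of ?B n ?D \<omega>] F_add[of ?Q n ?U \<omega>] unfolding EBD gram_add by simp
    have FESE: "F n \<omega> (?E * ?S * ?E) = F n \<omega> (?B * ?S * ?B) + F n \<omega> ?Z"
      unfolding ESE by (rule F_add[OF Rdir_sandwich_carrier cZ])
    have tESE: "mat_trace (?S * (?E * ?S * ?E)) / (2 * real n) = h \<bullet> (info n *v h) + mat_trace (?S * ?Z) / (2 * real n)"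
      unfolding ESE info_quadratic mat_trace_add[OF S Rdir_sandwich_carrier cZ] by (rule add_divide_distrib)
    have Ysq1: "Ysq n \<omega> \<ge> 1" by (simp add: sum_nonneg)
    have N30: "N ^ 3 \<ge> 0" using N0 by simp
    have b1: "\<bar>F n \<omega> ?U\<bar> \<le> Cop * Fk * (N ^ 3 * Ysq n \<omega>)" using F_bound[OF oU n, of \<omega>] unfolding Fk_def by (simp only: mult_ac)
    have b2: "\<bar>F n \<omega> ?Z\<bar> \<le> z * Fk * (N ^ 3 * Ysq n \<omega>)" using F_bound[OF oZ n, of \<omega>] unfolding Fk_def by (simp only: mult_ac)
    have b3: "\<bar>mat_trace (?S * ?Z) / (2 * real n)\<bar> \<le> z / (2 * cR) * (N ^ 3 * Ysq n \<omega>)"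
    proof -
      have "\<bar>mat_trace (?S * ?Z)\<bar> \<le> real n * (1 / cR * (z * N ^ 3))" by (rule op_bound_trace[OF op_bound_mult[OF Sinv_op_bound oZ]])
      hence "\<bar>mat_trace (?S * ?Z) / (2 * real n)\<bar> \<le> real n * (1 / cR * (z * N ^ 3)) / (2 * real n)"
        unfolding abs_divide by (simp only: abs_mult abs_numeral abs_of_nat) (rule divide_right_mono, auto)
      also have "\<dots> = z / (2 * cR) * (N ^ 3 * 1)" using n by simp
      also have "\<dots> \<le> z / (2 * cR) * (N ^ 3 * Ysq n \<omega>)" using C cR_pos N30 Ysq1 by (intro mult_left_mono) auto
      finally show ?thesis .
    qed
    have b4: "\<bar>crit n \<omega> (\<theta>0 + h) - crit n \<omega> \<theta>0 - (- F n \<omega> ?E + F n \<omega> (?E * ?S * ?E) + mat_trace (?S * (?E * ?S * ?E)) / (2 * real n))\<bar>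
       \<le> 2 * (C1 / cR) ^ 3 * (1 + 1 / cR) * (N ^ 3 * Ysq n \<omega>)"
    proof -
      obtain P e' where sd: "simultaneous_diagonal n (gram n (k \<theta>0)) ?E P e' cR"
        using diagonalize_difference(1)[OF true_param \<theta>] unfolding e_def by blast
      interpret D: simultaneous_diagonal n "gram n (k \<theta>0)" ?E P e' cR by (rule sd)
      have SS: "D.S = ?S" unfolding Sinv_def D.inv_R ..
      have dl: "D.loglik_diff (Y \<omega>) = crit n \<omega> (\<theta>0 + h) - crit n \<omega> \<theta>0"
        using diagonalize_difference(2)[OF true_param \<theta>] sd unfolding e_def by blast
      have e3: "(C1 * N / cR) ^ 3 = (C1 / cR) ^ 3 * N ^ 3" by (simp add: power_mult_distrib power_divide)
      show ?thesis using D.loglik_diff_expansion[OF n oE C1N, of "Y \<omega>"] unfolding dl SS F_def e3 by (simp only: mult_ac)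
    qed
    \<comment> \<open>The \<open>T2\<close> sum recombines the quadratic noise: B S B enters with a
      plus sign, the second derivatives in q with a minus sign, since the expansion contains
      -F(E).\<close>
    have FT: "(\<Sum>l\<in>UNIV. \<Sum>m\<in>UNIV. vec_nth h l * vec_nth h m * F n \<omega> (T2 \<kappa> n l m)) = F n \<omega> (?B * ?S * ?B) - F n \<omega> ?Q"
    proof -
      have Q: "F n \<omega> ?Q = (\<Sum>lm\<in>UNIV \<times> UNIV. (\<kappa> (fst lm) (snd lm) * vec_nth h (fst lm) * vec_nth h (snd lm)) * F n \<omega> (gram n (Dk [snd lm, fst lm] \<theta>0)))"
        by (rule F_linear) (auto simp: gram_index q_def sum.cartesian_product case_prod_beta)
      have T: "F n \<omega> (T2 \<kappa> n l m) = F n \<omega> (R1 n l * ?S * R1 n m) - \<kappa> l m * F n \<omega> (gram n (Dk [m, l] \<theta>0))" for l m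
        by (subst F_add[OF R1_sandwich_carrier]) (auto simp: F_smult[OF gram_carrier])
      show ?thesis unfolding F_Rdir_sandwich Q T
        by (simp add: right_diff_distrib sum_subtractf sum.cartesian_product case_prod_beta mult_ac)
    qed
    have "\<bar>crit n \<omega> (\<theta>0 + h) - crit n \<omega> \<theta>0 + (\<Sum>m\<in>UNIV. vec_nth h m * F n \<omega> (R1 n m)) - h \<bullet> (info n *v h)
       - (\<Sum>l\<in>UNIV. \<Sum>m\<in>UNIV. vec_nth h l * vec_nth h m * F n \<omega> (T2 \<kappa> n l m))\<bar> \<le> K * (N ^ 3 * Ysq n \<omega>)"
      using b1 b2 b3 b4 unfolding FT F_Rdir[symmetric] FE FESE tESE K_def distrib_right by linarith
    also have "\<dots> \<le> K * ((P * norm h) ^ 3 * Ysq n \<omega>)"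
      using C NP N0 Ysq1 by (intro mult_left_mono mult_right_mono power_mono) auto
    also have "\<dots> = K * P ^ 3 * norm h ^ 3 * Ysq n \<omega>" by (simp add: power_mult_distrib)
    finally show ?thesis using \<theta> by blast
  qed
  have K: "K * P ^ 3 \<ge> 0" using C P by simp
  have "\<forall>n>0. \<forall>h \<omega>. norm h \<le> r \<longrightarrow> \<theta>0 + h \<in> \<Theta> \<and>
    \<bar>crit n \<omega> (\<theta>0 + h) - crit n \<omega> \<theta>0 + (\<Sum>m\<in>UNIV. vec_nth h m * F n \<omega> (R1 n m)) - h \<bullet> (info n *v h)
       - (\<Sum>l\<in>UNIV. \<Sum>m\<in>UNIV. vec_nth h l * vec_nth h m * F n \<omega> (T2 \<kappa> n l m))\<bar> \<le> K * P ^ 3 * norm h ^ 3 * Ysq n \<omega>"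
    by (intro allI impI main)
  with K r show ?thesis by (intro exI[of _ "K * P ^ 3"] exI[of _ r] exI[of _ \<kappa>] conjI)
qed

end

subsection \<open>The information matrix and linearisation of the estimator\<close>

lemma quadratic_parallelogram:
  fixes A :: "real ^ 'p ^ 'p" assumes pos: "\<And>x. 0 \<le> x \<bullet> (A *v x)"
  shows "(a + b) \<bullet> (A *v (a + b)) \<le> 2 * (a \<bullet> (A *v a)) + 2 * (b \<bullet> (A *v b))"
  using pos[of "a - b"] by (simp add: matrix_vector_right_distrib matrix_vector_mult_diff_distrib inner_add_left inner_add_right inner_diff_left inner_diff_right)

lemma quadratic_scale:
  fixes A :: "real ^ 'p ^ 'p" shows "(r *\<^sub>R u) \<bullet> (A *v (r *\<^sub>R u)) = r\<^sup>2 * (u \<bullet> (A *v u))"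
  by (simp add: matrix_vector_mult_scaleR power2_eq_square)

text \<open>The approximation error is relative to the squared increment, so the conclusion needs no
  prior rate for h: strong convexity turns the inequality of values into a distance to the minimiser
  \<open>hs\<close> that is small relative to |hs|.\<close>

lemma quadratic_comparison:
  fixes A :: "real ^ 'p ^ 'p" and g h hs :: "real ^ 'p"
  assumes sym: "Finite_Cartesian_Product.transpose A = A" and c: "c > 0" "\<And>x. c * (norm x)\<^sup>2 \<le> x \<bullet> (A *v x)"
    and hs: "A *v hs = - (1 / 2) *\<^sub>R g"
  shows "norm hs \<le> norm g / (2 * c)"
    and "\<bar>d - (g \<bullet> h + h \<bullet> (A *v h))\<bar> \<le> \<mu> * (norm h)\<^sup>2 \<Longrightarrow> \<bar>ds - (g \<bullet> hs + hs \<bullet> (A *v hs))\<bar> \<le> \<mu> * (norm hs)\<^sup>2 \<Longrightarrow>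
      d \<le> ds \<Longrightarrow> 0 \<le> \<mu> \<Longrightarrow> \<mu> \<le> c / 4 \<Longrightarrow> (norm (h - hs))\<^sup>2 \<le> 6 * \<mu> / c * (norm hs)\<^sup>2"
proof -
  have "c * (norm hs)\<^sup>2 \<le> - (1 / 2) * (hs \<bullet> g)" using c(2)[of hs] unfolding hs by simp
  also have "\<dots> \<le> 1 / 2 * (norm hs * norm g)" using Cauchy_Schwarz_ineq2[of hs g] by linarith
  finally have 1: "norm hs * (c * norm hs) \<le> norm hs * (norm g / 2)" by (simp add: power2_eq_square mult_ac)
  show "norm hs \<le> norm g / (2 * c)"
  proof (cases "norm hs = 0")
    case False
    hence "c * norm hs \<le> norm g / 2" using mult_left_le_imp_le[OF 1] by simp
    thus ?thesis using c(1) by (simp add: field_simps)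
  qed (use c in simp)
  assume d: "\<bar>d - (g \<bullet> h + h \<bullet> (A *v h))\<bar> \<le> \<mu> * (norm h)\<^sup>2" "\<bar>ds - (g \<bullet> hs + hs \<bullet> (A *v hs))\<bar> \<le> \<mu> * (norm hs)\<^sup>2"
    and le: "d \<le> ds" and \<mu>: "0 \<le> \<mu>" "\<mu> \<le> c / 4"
  define u where "u = h - hs"
  have h: "h = u + hs" unfolding u_def by simp
  have "hs \<bullet> (A *v u) = - (1 / 2) * (g \<bullet> u)" unfolding inner_symmetric_matrix[OF sym] hs by simp
  moreover have "u \<bullet> (A *v hs) = - (1 / 2) * (g \<bullet> u)" unfolding hs by (simp add: inner_commute)
  \<comment> \<open>Completing the square around the minimiser.\<close>
  ultimately have e: "(g \<bullet> h + h \<bullet> (A *v h)) - (g \<bullet> hs + hs \<bullet> (A *v hs)) = u \<bullet> (A *v u)"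
    unfolding h by (simp add: matrix_vector_right_distrib inner_add_left inner_add_right)
  have "norm h \<le> norm u + norm hs" unfolding h by (rule norm_triangle_ineq)
  hence "(norm h)\<^sup>2 \<le> (norm u + norm hs)\<^sup>2" by (intro power_mono) auto
  also have "\<dots> \<le> 2 * (norm u)\<^sup>2 + 2 * (norm hs)\<^sup>2" using sum_squares_bound[of "norm u" "norm hs"] by (simp add: power2_sum)
  finally have hb: "\<mu> * (norm h)\<^sup>2 \<le> \<mu> * (2 * (norm u)\<^sup>2 + 2 * (norm hs)\<^sup>2)" using \<mu> by (intro mult_left_mono)
  have "c * (norm u)\<^sup>2 \<le> \<mu> * (norm h)\<^sup>2 + \<mu> * (norm hs)\<^sup>2" using c(2)[of u] d le e by linarith
  also have "\<dots> \<le> 2 * (\<mu> * (norm u)\<^sup>2) + 3 * (\<mu> * (norm hs)\<^sup>2)" using hb by (simp add: algebra_simps)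
  \<comment> \<open>Absorption: twice this term takes at most half of the left-hand side.\<close>
  also have "\<mu> * (norm u)\<^sup>2 \<le> c / 4 * (norm u)\<^sup>2" using \<mu> by (intro mult_right_mono) auto
  finally have "c * (norm u)\<^sup>2 \<le> 6 * \<mu> * (norm hs)\<^sup>2" by simp
  thus "(norm (h - hs))\<^sup>2 \<le> 6 * \<mu> / c * (norm hs)\<^sup>2" using c(1) unfolding u_def[symmetric] by (simp add: field_simps)
qed

context gaussian_mle begin

section \<open>Eigenvalue bounds for the information matrix\<close>

lemma info_eigen:
  assumes n: "n > 0"
  shows "\<exists>P e. simultaneous_diagonal n (gram n (k \<theta>0)) (Rdir n h) P e cR \<and> h \<bullet> (info n *v h) = (\<Sum>i<n. (e i)\<^sup>2) / (2 * real n)"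
proof -
  obtain P e where sd: "simultaneous_diagonal n (gram n (k \<theta>0)) (Rdir n h) P e cR"
    using diagonalize[OF true_param Rdir_carrier Rdir_symmetric] by blast
  interpret D: simultaneous_diagonal n "gram n (k \<theta>0)" "Rdir n h" P e cR by (rule sd)
  have "Sinv n = D.S" unfolding Sinv_def D.inv_R ..
  with D.trace_SESE have "h \<bullet> (info n *v h) = (\<Sum>i<n. (e i)\<^sup>2) / (2 * real n)" unfolding info_quadratic by simp
  with sd show ?thesis by blast
qed

text \<open>Upper eigenvalue bound of the information matrix for all \<open>n\<close>, from the
  operator bound of \<open>Rdir\<close>; \<open>CARD('p)\<close> compares the l1 norm with the
  Euclidean one.\<close>

definition Cu :: real where "Cu = (Cop * real CARD('p) / cR)\<^sup>2"

lemma info_nonneg: "0 \<le> h \<bullet> (info n *v h)"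
  and info_upper: "h \<bullet> (info n *v h) \<le> Cu * (norm h)\<^sup>2"
proof -
  have "0 \<le> h \<bullet> (info n *v h) \<and> h \<bullet> (info n *v h) \<le> Cu * (norm h)\<^sup>2"
  proof (cases "n = 0")
    case True
    have "0 \<le> Cu" unfolding Cu_def by simp
    thus ?thesis unfolding info_quadratic using True by simp
  next
    case False
    then obtain P e where sd: "simultaneous_diagonal n (gram n (k \<theta>0)) (Rdir n h) P e cR" and q: "h \<bullet> (info n *v h) = (\<Sum>i<n. (e i)\<^sup>2) / (2 * real n)"
      using info_eigen[of n h] by auto
    let ?b = "Cop * (\<Sum>m\<in>UNIV. \<bar>vec_nth h m\<bar>) / cR"
    have "\<bar>e i\<bar> \<le> ?b" if "i < n" for i by (rule simultaneous_diagonal.e_bound[OF sd op_bound_Rdir that])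
    moreover have "?b \<le> Cop * real CARD('p) / cR * norm h"
      using mult_left_mono[OF sum_abs_le_norm[of h], of "Cop / cR"] Cop_pos cR_pos by (simp add: mult_ac)
    ultimately have "\<bar>e i\<bar> \<le> Cop * real CARD('p) / cR * norm h" if "i < n" for i using that by (blast intro: order_trans)
    hence "\<bar>e i\<bar>\<^sup>2 \<le> (Cop * real CARD('p) / cR * norm h)\<^sup>2" if "i < n" for i using that by (intro power_mono) auto
    hence "(e i)\<^sup>2 \<le> Cu * (norm h)\<^sup>2" if "i < n" for i using that unfolding Cu_def power_mult_distrib[symmetric] power2_abs by blast
    hence "(\<Sum>i<n. (e i)\<^sup>2) \<le> real n * (Cu * (norm h)\<^sup>2)" using sum_bounded_above[of "{..<n}" "\<lambda>i. (e i)\<^sup>2" "Cu * (norm h)\<^sup>2"] by simp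
    moreover have "real n * (Cu * (norm h)\<^sup>2) \<le> 2 * real n * (Cu * (norm h)\<^sup>2)" unfolding Cu_def by (intro mult_right_mono) auto
    ultimately have "(\<Sum>i<n. (e i)\<^sup>2) \<le> 2 * real n * (Cu * (norm h)\<^sup>2)" by (rule order_trans)
    hence "(\<Sum>i<n. (e i)\<^sup>2) / (2 * real n) \<le> Cu * (norm h)\<^sup>2" using False by (simp add: divide_le_eq mult.commute)
    thus ?thesis unfolding q by (simp add: sum_nonneg)
  qed
  thus "0 \<le> h \<bullet> (info n *v h)" "h \<bullet> (info n *v h) \<le> Cu * (norm h)\<^sup>2" by auto
qed

text \<open>The comparison of squared entries with squared eigenvalues carries condition (6) over to
  the information matrix.\<close>

lemma info_frobenius:
  assumes n: "n > 0"
  shows "1 / (2 * (Cop\<^sup>2 / cR)\<^sup>2) * (1 / real n * (\<Sum>i<n. \<Sum>j<n. (\<Sum>m\<in>UNIV. vec_nth h m * Dk [m] \<theta>0 (s i - s j))\<^sup>2)) \<le> h \<bullet> (info n *v h)"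
proof -
  obtain P e where sd: "simultaneous_diagonal n (gram n (k \<theta>0)) (Rdir n h) P e cR" and q: "h \<bullet> (info n *v h) = (\<Sum>i<n. (e i)\<^sup>2) / (2 * real n)"
    using info_eigen[OF n, of h] by auto
  have Q: "(Cop\<^sup>2 / cR)\<^sup>2 > 0" using Cop_pos cR_pos by simp
  have "(\<Sum>i<n. \<Sum>j<n. (\<Sum>m\<in>UNIV. vec_nth h m * Dk [m] \<theta>0 (s i - s j))\<^sup>2) = frobenius_sq n (Rdir n h)"
    unfolding frobenius_sq_def Rdir_def by (intro sum.cong refl) (simp add: gram_index)
  also have "\<dots> \<le> (Cop\<^sup>2 / cR)\<^sup>2 * (\<Sum>i<n. (e i)\<^sup>2)"
    by (rule simultaneous_diagonal.frobenius_le[OF sd op_bound_K[OF true_param]])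
  finally have "1 / (2 * (Cop\<^sup>2 / cR)\<^sup>2) * (1 / real n * (\<Sum>i<n. \<Sum>j<n. (\<Sum>m\<in>UNIV. vec_nth h m * Dk [m] \<theta>0 (s i - s j))\<^sup>2))
    \<le> 1 / (2 * (Cop\<^sup>2 / cR)\<^sup>2) * (1 / real n * ((Cop\<^sup>2 / cR)\<^sup>2 * (\<Sum>i<n. (e i)\<^sup>2)))"
    by (intro mult_left_mono) auto
  also have "\<dots> = h \<bullet> (info n *v h)" unfolding q using Q by simp
  finally show ?thesis .
qed

lemma info_direction_eventually:
  assumes l: "l \<noteq> 0"
  shows "\<exists>\<delta>>0. eventually (\<lambda>n. \<delta> \<le> l \<bullet> (info n *v l)) sequentially"
proof -
  let ?q = "\<lambda>n. 1 / real n * (\<Sum>i<n. \<Sum>j<n. (\<Sum>m\<in>UNIV. vec_nth l m * Dk [m] \<theta>0 (s i - s j))\<^sup>2)"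
  have "0 < liminf (\<lambda>n. ereal (?q n))" using condition6 l by blast
  then obtain d where d: "0 < ereal d" "ereal d < liminf (\<lambda>n. ereal (?q n))" by (rule ereal_dense2[elim_format]) blast
  have "eventually (\<lambda>n. ereal d < ereal (?q n)) sequentially" by (rule less_LiminfD[OF d(2)])
  hence "eventually (\<lambda>n. 1 / (2 * (Cop\<^sup>2 / cR)\<^sup>2) * d \<le> l \<bullet> (info n *v l)) sequentially"
    using eventually_gt_at_top[of 0]
  proof eventually_elim
    case (elim n)
    hence "1 / (2 * (Cop\<^sup>2 / cR)\<^sup>2) * d \<le> 1 / (2 * (Cop\<^sup>2 / cR)\<^sup>2) * ?q n" by (intro mult_left_mono) auto
    also have "\<dots> \<le> l \<bullet> (info n *v l)" by (rule info_frobenius[OF elim(2)])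
    finally show ?case .
  qed
  moreover have "1 / (2 * (Cop\<^sup>2 / cR)\<^sup>2) * d > 0" using d(1) Cop_pos cR_pos by simp
  ultimately show ?thesis by blast
qed

text \<open>Condition (6) is stated direction by direction. The quadratic forms are uniformly
  bounded by \<open>Cu\<close>, so lower bounds at finitely many unit vectors persist, up to a
  constant, on a cover of the sphere.\<close>

theorem info_lower:
  "\<exists>c>0. eventually (\<lambda>n. \<forall>h. c * (norm h)\<^sup>2 \<le> h \<bullet> (info n *v h)) sequentially"
proof -
  define U where "U = {l :: real ^ 'p. norm l = 1}"
  have "compact U" unfolding U_def using compact_sphere[of "0 :: real ^ 'p" 1] by (simp add: sphere_def dist_norm)
  have "\<forall>l\<in>U. \<exists>\<delta>>0. eventually (\<lambda>n. \<delta> \<le> l \<bullet> (info n *v l)) sequentially"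
  proof
    fix l assume "l \<in> U"
    hence "l \<noteq> 0" unfolding U_def by auto
    thus "\<exists>\<delta>>0. eventually (\<lambda>n. \<delta> \<le> l \<bullet> (info n *v l)) sequentially" by (rule info_direction_eventually)
  qed
  then obtain m where m: "\<forall>l\<in>U. m l > 0 \<and> eventually (\<lambda>n. m l \<le> l \<bullet> (info n *v l)) sequentially"
    by (rule bchoice[elim_format]) blast
  \<comment> \<open>With this radius a displacement costs at most \<open>m l / 4\<close>. From m l
    <= 2 q(u) + 2 (m l / 4), q being the quadratic form, there remains q(u) >= m l / 4. The added 1
    keeps the denominator positive.\<close>
  define r where "r = (\<lambda>l. sqrt (m l / (4 * (Cu + 1))))"
  have Cu: "Cu \<ge> 0" unfolding Cu_def by simp
  have r: "r l > 0" "Cu * (r l)\<^sup>2 \<le> m l / 4" if "l \<in> U" for l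
  proof -
    show "r l > 0" unfolding r_def using m that Cu by simp
    have m0: "m l > 0" using m that by blast
    hence "(r l)\<^sup>2 = m l / (4 * (Cu + 1))" unfolding r_def using Cu by simp
    hence "Cu * (r l)\<^sup>2 = m l / 4 * (Cu / (Cu + 1))" by simp
    also have "\<dots> \<le> m l / 4 * 1" using m0 Cu by (intro mult_left_mono) auto
    finally show "Cu * (r l)\<^sup>2 \<le> m l / 4" by simp
  qed
  have "U \<subseteq> (\<Union>l\<in>U. ball l (r l))" using r by force
  then obtain J where J: "J \<subseteq> U" "finite J" "U \<subseteq> (\<Union>l\<in>J. ball l (r l))"
    by (rule compactE_image[OF \<open>compact U\<close>, rotated]) auto
  define c where "c = Min (insert 1 ((\<lambda>l. m l / 4) ` J))"
  have c: "c > 0" unfolding c_def using J m by (subst Min_gr_iff) auto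
  have cm: "c \<le> m l / 4" if "l \<in> J" for l unfolding c_def using J(2) that by (intro Min_le) auto
  have "eventually (\<lambda>n. \<forall>l\<in>J. m l \<le> l \<bullet> (info n *v l)) sequentially"
    using m J(1) by (intro eventually_ball_finite[OF J(2)]) blast
  hence "eventually (\<lambda>n. \<forall>h. c * (norm h)\<^sup>2 \<le> h \<bullet> (info n *v h)) sequentially"
  proof eventually_elim
    case (elim n)
    have unit: "c \<le> u \<bullet> (info n *v u)" if u: "u \<in> U" for u
    proof -
      obtain l where l: "l \<in> J" "norm (l - u) < r l" using J(3) u by (auto simp: dist_norm)
      have lU: "l \<in> U" using l(1) J(1) by blast
      have "m l \<le> (u + (l - u)) \<bullet> (info n *v (u + (l - u)))" using elim l(1) by simp
      also have "\<dots> \<le> 2 * (u \<bullet> (info n *v u)) + 2 * ((l - u) \<bullet> (info n *v (l - u)))"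
        by (rule quadratic_parallelogram[OF info_nonneg])
      also have "(l - u) \<bullet> (info n *v (l - u)) \<le> Cu * (norm (l - u))\<^sup>2" by (rule info_upper)
      also have "\<dots> \<le> Cu * (r l)\<^sup>2" using l(2) Cu by (intro mult_left_mono power_mono) auto
      also have "\<dots> \<le> m l / 4" by (rule r(2)[OF lU])
      finally show ?thesis using cm[OF l(1)] by linarith
    qed
    show ?case
    proof
      fix h
      show "c * (norm h)\<^sup>2 \<le> h \<bullet> (info n *v h)"
      proof (cases "h = 0")
        case False
        have "(1 / norm h) *\<^sub>R h \<in> U" unfolding U_def using False by simp
        from unit[OF this] have "c \<le> (1 / norm h)\<^sup>2 * (h \<bullet> (info n *v h))" unfolding quadratic_scale .
        hence "c * (norm h)\<^sup>2 \<le> (1 / norm h)\<^sup>2 * (h \<bullet> (info n *v h)) * (norm h)\<^sup>2" by (intro mult_right_mono) auto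
        also have "\<dots> = h \<bullet> (info n *v h)" using False by (simp add: power_divide)
        finally show ?thesis .
      qed simp
    qed
  qed
  with c show ?thesis by blast
qed

theorem information_eigenvalue_bounds:
  "0 < liminf (\<lambda>n. ereal (lambda_inf (info n)))"
  "liminf (\<lambda>n. ereal (lambda_inf (info n))) \<le> limsup (\<lambda>n. ereal (lambda_sup (info n)))"
  "limsup (\<lambda>n. ereal (lambda_sup (info n))) < \<infinity>"
proof -
  obtain c where c: "c > 0" "eventually (\<lambda>n. \<forall>h. c * (norm h)\<^sup>2 \<le> h \<bullet> (info n *v h)) sequentially"
    using info_lower by (elim exE conjE)
  have "eventually (\<lambda>n. ereal c \<le> ereal (lambda_inf (info n))) sequentially"
    using c(2)
  proof eventually_elim
    case (elim n)
    have "c \<le> lambda_inf (info n)" by (rule lambda_inf_ge[OF info_symmetric]) (use elim in blast)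
    thus ?case by simp
  qed
  hence "ereal c \<le> liminf (\<lambda>n. ereal (lambda_inf (info n)))" by (rule Liminf_bounded)
  moreover have "0 < ereal c" using c(1) by simp
  ultimately show "0 < liminf (\<lambda>n. ereal (lambda_inf (info n)))" by (rule less_le_trans[rotated])
  have "liminf (\<lambda>n. ereal (lambda_inf (info n))) \<le> liminf (\<lambda>n. ereal (lambda_sup (info n)))"
    by (intro Liminf_mono always_eventually allI) (use lambda_inf_le_sup[OF info_symmetric] in simp)
  also have "\<dots> \<le> limsup (\<lambda>n. ereal (lambda_sup (info n)))" by (rule Liminf_le_Limsup) simp
  finally show "liminf (\<lambda>n. ereal (lambda_inf (info n))) \<le> limsup (\<lambda>n. ereal (lambda_sup (info n)))" .
  have "limsup (\<lambda>n. ereal (lambda_sup (info n))) \<le> ereal Cu"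
    by (intro Limsup_bounded always_eventually allI) (use lambda_sup_le[OF info_symmetric info_upper] in simp)
  thus "limsup (\<lambda>n. ereal (lambda_sup (info n))) < \<infinity>" by (rule order_le_less_trans) simp
qed

text \<open>Linear coefficient of the criterion expansion at \<theta>0.\<close>

definition score :: "nat \<Rightarrow> 'a \<Rightarrow> real ^ 'p" where "score n \<omega> = vec_lambda (\<lambda>m. - F n \<omega> (R1 n m))"
text \<open>Minimiser of the quadratic polynomial with linear coefficient \<open>score\<close> and
  quadratic part \<open>info\<close>, once the latter is positive definite.\<close>

definition hopt :: "nat \<Rightarrow> 'a \<Rightarrow> real ^ 'p" where "hopt n \<omega> = - (1 / 2) *\<^sub>R (matrix_inv (info n) *v score n \<omega>)"

lemma hopt_eq:
  assumes c: "c > 0" "\<forall>h. c * (norm h)\<^sup>2 \<le> h \<bullet> (info n *v h)"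
  shows "info n *v hopt n \<omega> = - (1 / 2) *\<^sub>R score n \<omega>"
proof -
  have "invertible (info n)"
  proof (rule positive_definite_invertible)
    fix x :: "real ^ 'p" assume "x \<noteq> 0"
    hence "0 < c * (norm x)\<^sup>2" using c(1) by simp
    also have "\<dots> \<le> x \<bullet> (info n *v x)" using c(2) by blast
    finally show "0 < x \<bullet> (info n *v x)" .
  qed
  hence "info n ** matrix_inv (info n) = Finite_Cartesian_Product.mat 1"
    unfolding invertible_def matrix_inv_def by (rule someI_ex[THEN conjunct1])
  hence "info n *v (matrix_inv (info n) *v score n \<omega>) = score n \<omega>" by (simp add: matrix_vector_mul_assoc)
  thus ?thesis unfolding hopt_def matrix_vector_mult_scaleR by (simp only:)
qed

lemma norm_score_le: "norm (score n \<omega>) \<le> (\<Sum>m\<in>UNIV. \<bar>F n \<omega> (R1 n m)\<bar>)"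
  using norm_le_l1_cart[of "score n \<omega>"] unfolding score_def by simp

text \<open>Four exceptional sets: large score, large data, estimator far from \<theta>0, large
  second-order noise. The first two have probability at most \<zeta>/4 each, the other two vanish as
  n grows. Outside them the expansion error is at most \<mu> |h|^2 both at the estimator and at the
  minimiser.\<close>

theorem mle_linearization:
  assumes \<epsilon>: "\<epsilon> > 0" and \<zeta>: "\<zeta> > 0"
  shows "eventually (\<lambda>n. \<exists>Z\<in>events. prob Z \<le> \<zeta> \<and> (\<forall>\<omega>\<in>space M - Z. sqrt (real n) * norm (mle n \<omega> - \<theta>0 - hopt n \<omega>) \<le> \<epsilon>)) sequentially"
proof -
  define P where "P = real CARD('p)"
  have P: "P \<ge> 1" unfolding P_def using zero_less_card_finite[where 'a = 'p] by linarith
  obtain c where c: "c > 0" and cev: "eventually (\<lambda>n. \<forall>h. c * (norm h)\<^sup>2 \<le> h \<bullet> (info n *v h)) sequentially"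
    using info_lower by (elim exE conjE)
  obtain K r \<kappa> where K: "K \<ge> 0" and r: "r > 0" and ex: "\<forall>n>0. \<forall>h \<omega>. norm h \<le> r \<longrightarrow> \<theta>0 + h \<in> \<Theta> \<and>
    \<bar>crit n \<omega> (\<theta>0 + h) - crit n \<omega> \<theta>0 + (\<Sum>m\<in>UNIV. vec_nth h m * F n \<omega> (R1 n m)) - h \<bullet> (info n *v h)
       - (\<Sum>l\<in>UNIV. \<Sum>m\<in>UNIV. vec_nth h l * vec_nth h m * F n \<omega> (T2 \<kappa> n l m))\<bar> \<le> K * norm h ^ 3 * Ysq n \<omega>"
    using criterion_expansion by (elim exE conjE)
  have k0: "0 \<le> k \<theta>0 0" using xi_cov[of 0 0, symmetric] by simp
  \<comment> \<open>G / sqrt n is the threshold for each score component; Chebyshev's inequality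
    over the P components gives \<zeta>/4 in total.\<close>
  define G where "G = sqrt (8 * P * (Cop / cR)\<^sup>2 / \<zeta>)"
  have G: "G > 0" "P * (2 * (Cop / cR)\<^sup>2 / G\<^sup>2) = \<zeta> / 4" unfolding G_def using P Cop_pos cR_pos \<zeta> by (auto simp: field_simps)
  define W where "W = 4 * (1 + k \<theta>0 0) / \<zeta>"
  have W: "W > 0" "(1 + k \<theta>0 0) / W = \<zeta> / 4" unfolding W_def using \<zeta> k0 by (auto simp: add_pos_nonneg field_simps)
  \<comment> \<open>Bound for sqrt n times the norm of the minimiser.\<close>
  define H where "H = P * G / (2 * c)"
  have H: "H > 0" unfolding H_def using P G c by simp
  \<comment> \<open>The first entry is the hypothesis of \<open>quadratic_comparison\<close>; the
    second makes its bound, 6 \<mu> / c times H^2, at most \<epsilon>^2.\<close>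
  define \<mu> where "\<mu> = min (c / 4) (c * \<epsilon>\<^sup>2 / (6 * H\<^sup>2))"
  have \<mu>: "\<mu> > 0" "\<mu> \<le> c / 4" unfolding \<mu>_def using c \<epsilon> H by auto
  have "\<mu> \<le> c * \<epsilon>\<^sup>2 / (6 * H\<^sup>2)" unfolding \<mu>_def by simp
  hence \<mu>H: "6 * \<mu> / c * H\<^sup>2 \<le> \<epsilon>\<^sup>2" using c H by (simp add: field_simps)
  \<comment> \<open>Radius within which the cubic remainder, with data factor at most W, stays below
    half of \<mu> |h|^2.\<close>
  define \<rho> where "\<rho> = min r (\<mu> / (2 * (K * W + 1)))"
  have KW: "K * W + 1 > 0" using K W by (simp add: add_nonneg_pos)
  have \<rho>: "\<rho> > 0" "\<rho> \<le> r" unfolding \<rho>_def using r \<mu> KW by auto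
  have "\<rho> * (K * W + 1) \<le> \<mu> / (2 * (K * W + 1)) * (K * W + 1)" unfolding \<rho>_def using KW by (intro mult_right_mono) auto
  also have "\<dots> = \<mu> / 2" using KW by (metis divide_divide_eq_left nonzero_eq_divide_eq less_irrefl)
  finally have \<rho>K: "K * W * \<rho> \<le> \<mu> / 2" using \<rho>(1) by (simp add: algebra_simps)
  \<comment> \<open>Threshold for each of the P^2 second-order noise terms, which together take the
    other half of \<mu> |h|^2.\<close>
  define \<eta> where "\<eta> = \<mu> / (2 * P * P)"
  have \<eta>: "\<eta> > 0" "P * (P * \<eta>) = \<mu> / 2" unfolding \<eta>_def using \<mu> P by auto
  define B where "B = (\<lambda>l m. Cop * (1 / cR) * Cop + \<bar>\<kappa> l m\<bar> * Cop)"
  have "(\<lambda>n. x / (real n * \<eta>\<^sup>2)) \<longlonglongrightarrow> 0" for x :: real using \<eta>(1) by real_asymp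
  hence lim4: "(\<lambda>n. \<Sum>l\<in>UNIV. \<Sum>m\<in>UNIV. 2 * (B l m / cR)\<^sup>2 / (real n * \<eta>\<^sup>2)) \<longlonglongrightarrow> (\<Sum>l\<in>(UNIV :: 'p set). \<Sum>m\<in>(UNIV :: 'p set). 0)"
    by (intro tendsto_sum)
  have lim: "(\<lambda>n. \<zeta> / 4 + \<zeta> / 4 + prob {\<omega>\<in>space M. \<rho> \<le> norm (mle n \<omega> - \<theta>0)} + (\<Sum>l\<in>UNIV. \<Sum>m\<in>UNIV. 2 * (B l m / cR)\<^sup>2 / (real n * \<eta>\<^sup>2)))
     \<longlonglongrightarrow> \<zeta> / 4 + \<zeta> / 4 + 0 + (\<Sum>l\<in>(UNIV :: 'p set). \<Sum>m\<in>(UNIV :: 'p set). 0)"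
    by (rule tendsto_add[OF tendsto_add[OF tendsto_const mle_consistent[OF \<rho>(1)]] lim4])
  have small: "eventually (\<lambda>n. \<zeta> / 4 + \<zeta> / 4 + prob {\<omega>\<in>space M. \<rho> \<le> norm (mle n \<omega> - \<theta>0)} + (\<Sum>l\<in>UNIV. \<Sum>m\<in>UNIV. 2 * (B l m / cR)\<^sup>2 / (real n * \<eta>\<^sup>2)) < \<zeta>) sequentially"
    by (rule order_tendstoD(2)[OF lim]) (use \<zeta> in simp)
  have "(\<lambda>n. H / sqrt (real n)) \<longlonglongrightarrow> 0" by real_asymp
  hence hsmall: "eventually (\<lambda>n. H / sqrt (real n) < \<rho>) sequentially" by (rule order_tendstoD(2)) (rule \<rho>(1))
  show ?thesis using cev small hsmall eventually_gt_at_top[of 0]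
  proof eventually_elim
    case (elim n)
    note n = elim(4)
    have sn: "sqrt (real n) > 0" using n by simp
    have gc: "G / sqrt (real n) > 0" using G sn by simp
    define Z1 where "Z1 = (\<lambda>m. {\<omega>\<in>space M. G / sqrt (real n) \<le> \<bar>F n \<omega> (R1 n m)\<bar>})"
    define Z2 where "Z2 = {\<omega>\<in>space M. W \<le> Ysq n \<omega>}"
    define Z3 where "Z3 = {\<omega>\<in>space M. \<rho> \<le> norm (mle n \<omega> - \<theta>0)}"
    define Z4 where "Z4 = (\<lambda>l m. {\<omega>\<in>space M. \<eta> \<le> \<bar>F n \<omega> (T2 \<kappa> n l m)\<bar>})"
    note [measurable] = F_measurable[OF gram_carrier] F_measurable[OF op_bound_carrier[OF op_bound_T2]] mle_measurable[OF n]
    have ev: "Z1 m \<in> events" "Z2 \<in> events" "Z3 \<in> events" "Z4 l m \<in> events" for l m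
      unfolding Z1_def Z2_def Z3_def Z4_def by measurable
    let ?U1 = "\<Union>m. Z1 m" let ?U4 = "\<Union>l. \<Union>m. Z4 l m"
    have evU: "?U1 \<in> events" "?U4 \<in> events" using ev by auto
    let ?Z = "?U1 \<union> Z2 \<union> Z3 \<union> ?U4"
    show ?case
    proof (intro bexI[of _ ?Z] conjI ballI)
      show "?Z \<in> events" using ev evU by auto
      have 1: "prob ?U1 \<le> \<zeta> / 4"
      proof -
        have "prob (Z1 m) \<le> 2 * (Cop / cR)\<^sup>2 / G\<^sup>2" for m
          using F_tail_general[OF op_bound_R1[of n m] n gc] n unfolding Z1_def by (simp add: power_divide)
        hence "(\<Sum>m\<in>UNIV. prob (Z1 m)) \<le> (\<Sum>m\<in>(UNIV :: 'p set). 2 * (Cop / cR)\<^sup>2 / G\<^sup>2)" by (intro sum_mono)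
        also have "\<dots> = \<zeta> / 4" using G(2) by (simp add: P_def)
        finally show ?thesis using measure_UNION_le[of "UNIV :: 'p set" Z1 M] ev by simp
      qed
      have 2: "prob Z2 \<le> \<zeta> / 4" using Ysq_tail[OF W(1), of n] unfolding Z2_def W(2) .
      have 4: "prob ?U4 \<le> (\<Sum>l\<in>UNIV. \<Sum>m\<in>UNIV. 2 * (B l m / cR)\<^sup>2 / (real n * \<eta>\<^sup>2))"
      proof -
        have "prob ?U4 \<le> (\<Sum>l\<in>UNIV. prob (\<Union>m. Z4 l m))" by (rule measure_UNION_le) (use ev in auto)
        also have "\<dots> \<le> (\<Sum>l\<in>UNIV. \<Sum>m\<in>UNIV. prob (Z4 l m))" by (intro sum_mono measure_UNION_le) (use ev in auto)
        also have "\<dots> \<le> (\<Sum>l\<in>UNIV. \<Sum>m\<in>UNIV. 2 * (B l m / cR)\<^sup>2 / (real n * \<eta>\<^sup>2))"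
          unfolding Z4_def B_def by (intro sum_mono F_tail_general[OF op_bound_T2 n \<eta>(1)])
        finally show ?thesis .
      qed
      have "prob ?Z \<le> prob (?U1 \<union> Z2 \<union> Z3) + prob ?U4" by (rule measure_Un_le) (use ev evU in auto)
      also have "prob (?U1 \<union> Z2 \<union> Z3) \<le> prob (?U1 \<union> Z2) + prob Z3" by (rule measure_Un_le) (use ev evU in auto)
      also have "prob (?U1 \<union> Z2) \<le> prob ?U1 + prob Z2" by (rule measure_Un_le) (use ev evU in auto)
      finally show "prob ?Z \<le> \<zeta>" using 1 2 4 elim(2) unfolding Z3_def by linarith
      fix \<omega> assume \<omega>: "\<omega> \<in> space M - ?Z"
      have \<omega>M: "\<omega> \<in> space M" using \<omega> by blast
      have o1: "\<bar>F n \<omega> (R1 n m)\<bar> \<le> G / sqrt (real n)" for m using \<omega> unfolding Z1_def by (auto simp: not_le intro: less_imp_le)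
      have o2: "Ysq n \<omega> \<le> W" using \<omega> unfolding Z2_def by auto
      have o3: "norm (mle n \<omega> - \<theta>0) \<le> \<rho>" using \<omega> unfolding Z3_def by auto
      have o4: "\<bar>F n \<omega> (T2 \<kappa> n l m)\<bar> \<le> \<eta>" for l m using \<omega> unfolding Z4_def by (auto simp: not_le intro: less_imp_le)
      have "norm (score n \<omega>) \<le> (\<Sum>m\<in>(UNIV :: 'p set). G / sqrt (real n))"
        by (rule order_trans[OF norm_score_le sum_mono]) (rule o1)
      hence sc: "norm (score n \<omega>) \<le> P * G / sqrt (real n)" by (simp add: P_def)
      note qc = quadratic_comparison[OF info_symmetric c _ hopt_eq[OF c elim(1)]]
      have "norm (hopt n \<omega>) \<le> norm (score n \<omega>) / (2 * c)" by (rule qc(1)) (use elim(1) in blast)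
      also have "\<dots> \<le> P * G / sqrt (real n) / (2 * c)" using sc c by (intro divide_right_mono) auto
      also have "\<dots> = H / sqrt (real n)" unfolding H_def by simp
      finally have ho: "norm (hopt n \<omega>) \<le> H / sqrt (real n)" .
      have err: "\<bar>(crit n \<omega> (\<theta>0 + h) - crit n \<omega> \<theta>0) - (score n \<omega> \<bullet> h + h \<bullet> (info n *v h))\<bar> \<le> \<mu> * (norm h)\<^sup>2" "\<theta>0 + h \<in> \<Theta>"
        if h: "norm h \<le> \<rho>" for h
      proof -
        have hr: "norm h \<le> r" using h \<rho> by linarith
        show "\<theta>0 + h \<in> \<Theta>" using ex n hr by blast
        have sg: "score n \<omega> \<bullet> h = - (\<Sum>m\<in>UNIV. vec_nth h m * F n \<omega> (R1 n m))"
          unfolding inner_vec_def score_def by (simp add: sum_negf mult.commute)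
        let ?T = "\<Sum>l\<in>UNIV. \<Sum>m\<in>UNIV. vec_nth h l * vec_nth h m * F n \<omega> (T2 \<kappa> n l m)"
        have e: "\<bar>(crit n \<omega> (\<theta>0 + h) - crit n \<omega> \<theta>0) - (score n \<omega> \<bullet> h + h \<bullet> (info n *v h)) - ?T\<bar> \<le> K * norm h ^ 3 * Ysq n \<omega>"
          using ex[rule_format, OF n hr, of \<omega>] unfolding sg by (simp add: algebra_simps)
        have "\<bar>?T\<bar> \<le> (\<Sum>l\<in>(UNIV :: 'p set). \<Sum>m\<in>(UNIV :: 'p set). norm h * norm h * \<eta>)"
        proof (intro order_trans[OF sum_abs sum_mono])
          fix l m
          show "\<bar>vec_nth h l * vec_nth h m * F n \<omega> (T2 \<kappa> n l m)\<bar> \<le> norm h * norm h * \<eta>"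
            unfolding abs_mult by (intro mult_mono component_le_norm_cart o4) auto
        qed
        also have "\<dots> = \<mu> / 2 * (norm h)\<^sup>2" using \<eta>(2) unfolding P_def by (simp add: power2_eq_square mult_ac) 
        finally have T: "\<bar>?T\<bar> \<le> \<mu> / 2 * (norm h)\<^sup>2" .
        have "K * norm h ^ 3 * Ysq n \<omega> \<le> K * (\<rho> * (norm h)\<^sup>2) * W"
        proof (rule mult_mono[OF _ o2])
          have "norm h * (norm h)\<^sup>2 \<le> \<rho> * (norm h)\<^sup>2" using h by (intro mult_right_mono) auto
          thus "K * norm h ^ 3 \<le> K * (\<rho> * (norm h)\<^sup>2)" using K by (intro mult_left_mono) (simp_all add: power3_eq_cube power2_eq_square)
        qed (use K \<rho> in \<open>auto simp: sum_nonneg\<close>)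
        also have "\<dots> = K * W * \<rho> * (norm h)\<^sup>2" by (simp only: mult_ac)
        also have "\<dots> \<le> \<mu> / 2 * (norm h)\<^sup>2" using \<rho>K by (intro mult_right_mono) auto
        finally show "\<bar>(crit n \<omega> (\<theta>0 + h) - crit n \<omega> \<theta>0) - (score n \<omega> \<bullet> h + h \<bullet> (info n *v h))\<bar> \<le> \<mu> * (norm h)\<^sup>2"
          using e T by linarith
      qed
      have hs: "norm (hopt n \<omega>) \<le> \<rho>" using ho elim(3) by linarith
      have "crit n \<omega> (mle n \<omega>) \<le> crit n \<omega> (\<theta>0 + hopt n \<omega>)" by (rule mle_minimal[OF n \<omega>M err(2)[OF hs]])
      hence le: "crit n \<omega> (\<theta>0 + (mle n \<omega> - \<theta>0)) - crit n \<omega> \<theta>0 \<le> crit n \<omega> (\<theta>0 + hopt n \<omega>) - crit n \<omega> \<theta>0" by simp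
      have "(norm (mle n \<omega> - \<theta>0 - hopt n \<omega>))\<^sup>2 \<le> 6 * \<mu> / c * (norm (hopt n \<omega>))\<^sup>2"
        by (rule qc(2)[OF _ err(1)[OF o3] err(1)[OF hs] le _ \<mu>(2)]) (use elim(1) \<mu>(1) in auto)
      also have "\<dots> \<le> 6 * \<mu> / c * (H / sqrt (real n))\<^sup>2" using ho \<mu> c by (intro mult_left_mono power_mono) auto
      also have "\<dots> = 6 * \<mu> / c * H\<^sup>2 / real n" by (simp add: power_divide)
      also have "\<dots> \<le> \<epsilon>\<^sup>2 / real n" by (intro divide_right_mono \<mu>H) auto
      finally have "(sqrt (real n) * norm (mle n \<omega> - \<theta>0 - hopt n \<omega>))\<^sup>2 \<le> \<epsilon>\<^sup>2" using n by (simp add: power_mult_distrib field_simps)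
      thus "sqrt (real n) * norm (mle n \<omega> - \<theta>0 - hopt n \<omega>) \<le> \<epsilon>" using \<epsilon> by (rule power2_le_imp_le[OF _ less_imp_le])
    qed
  qed
qed

end

subsection \<open>Asymptotic normality\<close>

lemma norm_iexp_diff_le: "norm (iexp a - iexp b) \<le> \<bar>a - b\<bar>"
proof -
  have "iexp a - iexp b = iexp b * (iexp (a - b) - 1)" by (simp add: algebra_simps exp_add[symmetric])
  hence "norm (iexp a - iexp b) = norm (iexp (a - b) - 1)" by (simp add: norm_mult)
  also have "\<dots> \<le> \<bar>a - b\<bar>" using iexp_approx1[of "a - b" 0] by simp
  finally show ?thesis .
qed

text \<open>Variables that are close outside a small event have close characteristic functions,
  because t -> exp (i t) is 1-Lipschitz and of modulus 1.\<close>

lemma (in prob_space) integral_iexp_diff_le: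
  assumes [measurable]: "U \<in> borel_measurable M" "V \<in> borel_measurable M" "Z \<in> events"
    and close: "\<And>\<omega>. \<omega> \<in> space M - Z \<Longrightarrow> \<bar>U \<omega> - V \<omega>\<bar> \<le> \<epsilon>" and \<epsilon>: "\<epsilon> \<ge> 0"
  shows "norm ((\<integral>\<omega>. iexp (U \<omega>) \<partial>M) - (\<integral>\<omega>. iexp (V \<omega>) \<partial>M)) \<le> \<epsilon> + 2 * prob Z"
proof -
  have int: "integrable M (\<lambda>\<omega>. iexp (f \<omega>))" if [measurable]: "f \<in> borel_measurable M" for f
    by (rule integrable_const_bound[of _ 1]) auto
  have ind: "integrable M (indicat_real Z)"
    by (rule integrable_const_bound[of _ 1]) (use assms(3) in \<open>auto split: split_indicator\<close>)
  hence intZ: "integrable M (\<lambda>\<omega>. \<epsilon> + 2 * indicator Z \<omega>)"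
    by (intro Bochner_Integration.integrable_add integrable_const integrable_mult_right)
  have "(\<integral>\<omega>. iexp (U \<omega>) \<partial>M) - (\<integral>\<omega>. iexp (V \<omega>) \<partial>M) = (\<integral>\<omega>. iexp (U \<omega>) - iexp (V \<omega>) \<partial>M)"
    by (rule Bochner_Integration.integral_diff[OF int int, symmetric]) measurable
  hence "norm ((\<integral>\<omega>. iexp (U \<omega>) \<partial>M) - (\<integral>\<omega>. iexp (V \<omega>) \<partial>M)) \<le> (\<integral>\<omega>. norm (iexp (U \<omega>) - iexp (V \<omega>)) \<partial>M)"
    using integral_norm_bound[of M "\<lambda>\<omega>. iexp (U \<omega>) - iexp (V \<omega>)"] by (simp only:)
  also have "\<dots> \<le> (\<integral>\<omega>. \<epsilon> + 2 * indicator Z \<omega> \<partial>M)"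
  proof (rule integral_mono)
    show "integrable M (\<lambda>\<omega>. norm (iexp (U \<omega>) - iexp (V \<omega>)))"
      by (intro integrable_norm Bochner_Integration.integrable_diff int) measurable
    fix \<omega> assume \<omega>: "\<omega> \<in> space M"
    show "norm (iexp (U \<omega>) - iexp (V \<omega>)) \<le> \<epsilon> + 2 * indicator Z \<omega>"
    proof (cases "\<omega> \<in> Z")
      case True
      have "norm (iexp (U \<omega>) - iexp (V \<omega>)) \<le> norm (iexp (U \<omega>)) + norm (iexp (V \<omega>))" by (rule norm_triangle_ineq4)
      thus ?thesis using True \<epsilon> by simp
    next
      case False
      thus ?thesis using close[of \<omega>] \<omega> norm_iexp_diff_le[of "U \<omega>" "V \<omega>"] by simp
    qed
  qed (rule intZ)
  also have "\<dots> = \<epsilon> + 2 * prob Z"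
    using ind assms(3) prob_space by (subst Bochner_Integration.integral_add) auto
  finally show ?thesis .
qed

context gaussian_mle begin

abbreviation isqrt :: "nat \<Rightarrow> real ^ 'p ^ 'p" where "isqrt n \<equiv> inv_sqrt_matrix (matrix_inv (info n))"
abbreviation normalized :: "nat \<Rightarrow> 'a \<Rightarrow> real ^ 'p" where
  "normalized n \<omega> \<equiv> sqrt (real n) *\<^sub>R (isqrt n *v (mle n \<omega> - \<theta>0))"

text \<open>\<open>max_likelihood_estimator\<close> speaks of n >= 1; for n = 0 the factor sqrt 0
  makes the variable constant.\<close>

lemma normalized_measurable: "normalized n \<in> borel_measurable M"
proof (cases "n = 0")
  case False
  have "(\<lambda>v. sqrt (real n) *\<^sub>R (isqrt n *v (v - \<theta>0))) \<in> borel_measurable borel"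
    by (intro borel_measurable_continuous_onI continuous_intros linear_continuous_on_compose[of _ _ "(*v) (isqrt n)"]) simp
  from measurable_compose[OF mle_measurable this] False show ?thesis by simp
qed simp

text \<open>\<open>isqrt n\<close> is the positive square root of the information matrix; hence it
  carries the inner product of that matrix to the Euclidean one and is onto.\<close>

lemma isqrt_facts:
  assumes c: "c > 0" "\<forall>h. c * (norm h)\<^sup>2 \<le> h \<bullet> (info n *v h)"
  shows "(isqrt n *v x) \<bullet> (isqrt n *v y) = x \<bullet> (info n *v y)"
    and "\<exists>x. isqrt n *v x = t"
proof -
  have pd: "0 < x \<bullet> (info n *v x)" if "x \<noteq> 0" for x
  proof -
    have "0 < c * (norm x)\<^sup>2" using c(1) that by simp
    also have "\<dots> \<le> x \<bullet> (info n *v x)" using c(2) by blast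
    finally show ?thesis .
  qed
  have B: "Finite_Cartesian_Product.transpose (isqrt n) = isqrt n" "\<And>x. x \<noteq> 0 \<Longrightarrow> 0 < x \<bullet> (isqrt n *v x)" "isqrt n ** isqrt n = info n"
    by (rule inv_sqrt_matrix_inv[OF info_symmetric pd]; assumption)+
  have "(isqrt n *v x) \<bullet> (isqrt n *v y) = x \<bullet> (isqrt n *v (isqrt n *v y))"
    by (rule inner_symmetric_matrix[OF B(1), symmetric])
  also have "isqrt n *v (isqrt n *v y) = info n *v y" unfolding matrix_vector_mul_assoc B(3) ..
  finally show "(isqrt n *v x) \<bullet> (isqrt n *v y) = x \<bullet> (info n *v y)" .
  have "invertible (isqrt n)" by (rule positive_definite_invertible) (rule B(2))
  then obtain C where "isqrt n ** C = Finite_Cartesian_Product.mat 1" unfolding invertible_def by blast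
  hence "isqrt n *v (C *v t) = t" by (simp add: matrix_vector_mul_assoc)
  thus "\<exists>x. isqrt n *v x = t" by blast
qed

text \<open>The estimator is replaced by the linearised minimiser, for which the inner product with
  t is a single centred quadratic form in white noise, with matrix \<open>Rdir n x\<close> for the x
  that solves \<open>isqrt n *v x = t\<close>.\<close>

lemma normalized_char_limit:
  "(\<lambda>n. \<integral>\<omega>. iexp (t \<bullet> normalized n \<omega>) \<partial>M) \<longlonglongrightarrow> complex_of_real (exp (- (norm t)\<^sup>2 / 2))"
proof (rule tendstoI)
  fix e :: real assume e: "e > 0"
  obtain c where c: "c > 0" and cev: "eventually (\<lambda>n. \<forall>h. c * (norm h)\<^sup>2 \<le> h \<bullet> (info n *v h)) sequentially"
    using info_lower by (elim exE conjE)
  obtain K where K: "K \<ge> 0" "\<forall>n X \<rho> \<tau>. op_bound n X \<rho> \<longrightarrow> transpose_mat X = X \<longrightarrow> n > 0 \<longrightarrow>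
    norm ((\<integral>\<omega>. iexp (\<tau> * F n \<omega> X) \<partial>M) - exp (- ((\<tau> / real n)\<^sup>2 * mat_trace (Sinv n * (X * Sinv n * X)))))
      \<le> (K * (\<bar>\<tau>\<bar> / real n * (\<rho> / cR)) + (\<bar>\<tau>\<bar> / real n * (\<rho> / cR))\<^sup>2) * ((\<tau> / real n)\<^sup>2 * mat_trace (Sinv n * (X * Sinv n * X)))"
    by (rule F_char)
  \<comment> \<open>Exceeds the Lipschitz constant of the inner product of t with
    \<open>isqrt n *v v\<close> as a function of v; the added 1 allows division by q at t =
    0.\<close>
  define q where "q = norm t * sqrt Cu + 1"
  have Cu: "Cu \<ge> 0" unfolding Cu_def by simp
  have q: "q > 0" unfolding q_def using Cu by (simp add: add_nonneg_pos)
  \<comment> \<open>Operator bound of \<open>Rdir n x\<close> uniform in n: x depends on n, but its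
    norm is at most |t| / sqrt c.\<close>
  define \<rho> where "\<rho> = Cop * (real CARD('p) * (norm t / sqrt c))"
  define D where "D = (\<lambda>n. \<bar>sqrt (real n) / 2\<bar> / real n * (\<rho> / cR))"
  have "(\<lambda>n. \<bar>sqrt (real n) / 2\<bar> / real n) \<longlonglongrightarrow> 0" by real_asymp
  hence "D \<longlonglongrightarrow> 0" unfolding D_def by (rule tendsto_mult_left_zero)
  hence "(\<lambda>n. (K * D n + (D n)\<^sup>2) * ((norm t)\<^sup>2 / 2)) \<longlonglongrightarrow> (K * 0 + 0\<^sup>2) * ((norm t)\<^sup>2 / 2)" by (intro tendsto_intros)
  hence dsmall: "eventually (\<lambda>n. (K * D n + (D n)\<^sup>2) * ((norm t)\<^sup>2 / 2) < e / 4) sequentially"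
    by (rule order_tendstoD(2)) (use e in simp)
  have lin: "eventually (\<lambda>n. \<exists>Z\<in>events. prob Z \<le> e / 8 \<and> (\<forall>\<omega>\<in>space M - Z. sqrt (real n) * norm (mle n \<omega> - \<theta>0 - hopt n \<omega>) \<le> e / (4 * q))) sequentially"
    by (rule mle_linearization) (use e q in auto)
  show "eventually (\<lambda>n. dist (\<integral>\<omega>. iexp (t \<bullet> normalized n \<omega>) \<partial>M) (complex_of_real (exp (- (norm t)\<^sup>2 / 2))) < e) sequentially"
    using cev dsmall lin eventually_gt_at_top[of 0]
  proof eventually_elim
    case (elim n)
    note n = elim(4) and iq = isqrt_facts[OF c elim(1)]
    obtain x where x: "isqrt n *v x = t" using iq(2) by blast
    have xx: "x \<bullet> (info n *v x) = (norm t)\<^sup>2" using iq(1)[of x x] unfolding x by (simp add: power2_norm_eq_inner)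
    have "c * (norm x)\<^sup>2 \<le> (norm t)\<^sup>2" using elim(1) unfolding xx[symmetric] by blast
    hence "(norm x)\<^sup>2 \<le> (norm t / sqrt c)\<^sup>2" using c by (simp add: power_divide field_simps)
    hence nx: "norm x \<le> norm t / sqrt c" by (rule power2_le_imp_le) (use c in simp)
    \<comment> \<open>The factor 1/2 comes from the minimiser -1/2 \<Sigma>^-1 g, the root from the
      normalisation.\<close>
    let ?\<tau> = "sqrt (real n) / 2"
    have "Cop * (\<Sum>m\<in>UNIV. \<bar>vec_nth x m\<bar>) \<le> \<rho>" unfolding \<rho>_def
      using sum_abs_le_norm[of x] nx Cop_pos by (intro mult_left_mono order_trans[OF sum_abs_le_norm]) auto
    hence ob: "op_bound n (Rdir n x) \<rho>" by (rule op_bound_mono[OF op_bound_Rdir])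
    \<comment> \<open>The trace equals 2 n |t|^2, so the exponent is exactly |t|^2 / 2 for every
      such n.\<close>
    have V: "(?\<tau> / real n)\<^sup>2 * mat_trace (Sinv n * (Rdir n x * Sinv n * Rdir n x)) = (norm t)\<^sup>2 / 2"
    proof -
      define T where "T = mat_trace (Sinv n * (Rdir n x * Sinv n * Rdir n x))"
      have "T / (2 * real n) = (norm t)\<^sup>2" using xx unfolding info_quadratic T_def .
      hence "T = (norm t)\<^sup>2 * (2 * real n)" using n by (simp add: field_simps)
      moreover have "(?\<tau> / real n)\<^sup>2 = 1 / (4 * real n)" using n by (simp add: power_divide power2_eq_square[of "real n"])
      ultimately show ?thesis unfolding T_def[symmetric] using n by simp
    qed
    have chaos: "norm ((\<integral>\<omega>. iexp (?\<tau> * F n \<omega> (Rdir n x)) \<partial>M) - complex_of_real (exp (- (norm t)\<^sup>2 / 2))) < e / 4"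
      unfolding minus_divide_left[symmetric] using K(2)[rule_format, OF ob Rdir_symmetric n, of ?\<tau>] elim(2) unfolding V D_def by linarith
    have lin_char: "?\<tau> * F n \<omega> (Rdir n x) = t \<bullet> (sqrt (real n) *\<^sub>R (isqrt n *v hopt n \<omega>))" for \<omega>
    proof -
      have "t \<bullet> (isqrt n *v hopt n \<omega>) = x \<bullet> (info n *v hopt n \<omega>)" using iq(1)[of x "hopt n \<omega>"] unfolding x .
      also have "\<dots> = - (1 / 2) * (x \<bullet> score n \<omega>)" unfolding hopt_eq[OF c elim(1)] by simp
      also have "x \<bullet> score n \<omega> = - F n \<omega> (Rdir n x)" unfolding F_Rdir inner_vec_def score_def by (simp add: sum_negf)
      finally show ?thesis by simp
    qed
    obtain Z where Z: "Z \<in> events" "prob Z \<le> e / 8" "\<forall>\<omega>\<in>space M - Z. sqrt (real n) * norm (mle n \<omega> - \<theta>0 - hopt n \<omega>) \<le> e / (4 * q)"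
      using elim(3) by blast
    have "norm ((\<integral>\<omega>. iexp (t \<bullet> normalized n \<omega>) \<partial>M) - (\<integral>\<omega>. iexp (?\<tau> * F n \<omega> (Rdir n x)) \<partial>M)) \<le> e / 4 + 2 * prob Z"
    proof (rule integral_iexp_diff_le[OF _ _ Z(1)])
      note [measurable] = normalized_measurable F_measurable[OF Rdir_carrier]
      show "(\<lambda>\<omega>. t \<bullet> normalized n \<omega>) \<in> borel_measurable M" by (intro borel_measurable_inner normalized_measurable) simp
      show "(\<lambda>\<omega>. ?\<tau> * F n \<omega> (Rdir n x)) \<in> borel_measurable M" by (intro borel_measurable_times F_measurable[OF Rdir_carrier]) simp
      fix \<omega> assume \<omega>: "\<omega> \<in> space M - Z"
      let ?u = "mle n \<omega> - \<theta>0 - hopt n \<omega>"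
      have "t \<bullet> normalized n \<omega> - ?\<tau> * F n \<omega> (Rdir n x) = t \<bullet> (sqrt (real n) *\<^sub>R (isqrt n *v ?u))"
        unfolding lin_char by (simp add: matrix_vector_mult_diff_distrib inner_diff_right algebra_simps)
      also have "\<bar>\<dots>\<bar> \<le> norm t * norm (sqrt (real n) *\<^sub>R (isqrt n *v ?u))" by (rule Cauchy_Schwarz_ineq2)
      also have "\<dots> = norm t * (sqrt (real n) * norm (isqrt n *v ?u))" by simp
      also have "\<dots> \<le> norm t * (sqrt (real n) * (sqrt Cu * norm ?u))"
      proof (intro mult_left_mono)
        have "(norm (isqrt n *v ?u))\<^sup>2 \<le> Cu * (norm ?u)\<^sup>2"
          unfolding power2_norm_eq_inner[of "isqrt n *v ?u"] iq(1) by (rule info_upper)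
        also have "\<dots> = (sqrt Cu * norm ?u)\<^sup>2" using Cu by (simp add: power_mult_distrib)
        finally show "norm (isqrt n *v ?u) \<le> sqrt Cu * norm ?u" by (rule power2_le_imp_le) (use Cu in simp)
      qed auto
      also have "\<dots> = (norm t * sqrt Cu) * (sqrt (real n) * norm ?u)" by (simp only: mult_ac)
      also have "\<dots> \<le> q * (e / (4 * q))" using Z(3) \<omega> Cu q unfolding q_def[symmetric] 
        by (intro mult_mono) (auto simp: q_def)
      also have "\<dots> = e / 4" using q by simp
      finally show "\<bar>t \<bullet> normalized n \<omega> - ?\<tau> * F n \<omega> (Rdir n x)\<bar> \<le> e / 4" .
    qed (use e in simp)
    thus ?case unfolding dist_norm using chaos Z(2) e
      norm_triangle_ineq[of "(\<integral>\<omega>. iexp (t \<bullet> normalized n \<omega>) \<partial>M) - (\<integral>\<omega>. iexp (?\<tau> * F n \<omega> (Rdir n x)) \<partial>M)" "(\<integral>\<omega>. iexp (?\<tau> * F n \<omega> (Rdir n x)) \<partial>M) - complex_of_real (exp (- (norm t)\<^sup>2 / 2))"]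
      by simp
  qed
qed

theorem mle_asymptotically_normal: "converges_in_distribution M normalized std_normal_vec"
  unfolding converges_in_distribution_def
proof (intro conjI allI impI)
  show "normalized n \<in> borel_measurable M" for n by (rule normalized_measurable)
  fix f :: "real ^ 'p \<Rightarrow> real" assume f: "continuous_on UNIV f" "bounded (range f)"
  show "(\<lambda>n. \<integral>\<omega>. f (normalized n \<omega>) \<partial>M) \<longlonglongrightarrow> (\<integral>x. f x \<partial>std_normal_vec)"
  proof (rule levy_continuity_vec[OF prob_M normalized_measurable prob_space_std_normal_vec sets_std_normal_vec _ f])
    fix t :: "real ^ 'p"
    show "(\<lambda>n. \<integral>\<omega>. iexp (t \<bullet> normalized n \<omega>) \<partial>M) \<longlonglongrightarrow> (\<integral>x. iexp (t \<bullet> x) \<partial>std_normal_vec)"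
      unfolding char_std_normal_vec by (rule normalized_char_limit)
  qed
qed

end

theorem theorem5:
  fixes \<Theta> :: "(real ^ 'p) set"
    and \<theta>0 :: "real ^ 'p"
    and k khat :: "real ^ 'p \<Rightarrow> real ^ 'd \<Rightarrow> real"
    and Dk :: "'p list \<Rightarrow> real ^ 'p \<Rightarrow> real ^ 'd \<Rightarrow> real"
    and s :: "nat \<Rightarrow> real ^ 'd"
    and M :: "'a measure"
    and \<xi> :: "real ^ 'd \<Rightarrow> 'a \<Rightarrow> real"
    and est :: "nat \<Rightarrow> (nat \<Rightarrow> real) \<Rightarrow> real ^ 'p"
    and \<Delta> C_inf C_sup :: real
  assumes "compact \<Theta>"
    and "\<theta>0 \<in> interior \<Theta>"
    and "\<forall>\<theta>\<in>\<Theta>. symmetric_function (k \<theta>) \<and> positive_definite_function (k \<theta>)"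
    and "\<forall>x. continuous_on \<Theta> (\<lambda>\<theta>. k \<theta> x)"
    and "iterated_partial_derivatives \<Theta> 3 k Dk"
    and "\<forall>\<theta>\<in>\<Theta>. has_spectral_density (k \<theta>) (khat \<theta>)"
    and "prob_space M"
    and "gaussian_process M \<xi>"
    and "\<forall>u. (\<integral>\<omega>. \<xi> u \<omega> \<partial>M) = 0"
    and "\<forall>u v. covariance M (\<xi> u) (\<xi> v) = k \<theta>0 (u - v)"
    and "inj s"
    and "\<forall>n\<ge>1. \<forall>\<theta>\<in>\<Theta>. invertible_mat (cov_matrix k s n \<theta>)"
    and "max_likelihood_estimator M \<xi> s \<Theta> k est"
    and condition1: "\<Delta> > 0" "\<forall>i j. i \<noteq> j \<longrightarrow> norm (s i - s j) \<ge> \<Delta>"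
    and constants: "C_inf > 0"
    and condition2: "\<forall>x. \<forall>\<theta>\<in>\<Theta>.
        \<bar>k \<theta> x\<bar> \<le> C_sup / (1 + norm x powr (real CARD('d) + C_inf))"
    and condition3: "\<forall>x. \<forall>r\<in>{1, 2, 3}. \<forall>is. length is = r \<longrightarrow> (\<forall>\<theta>\<in>\<Theta>.
        \<bar>Dk is \<theta> x\<bar> \<le> C_sup / (1 + norm x powr (real CARD('d) + C_inf)))"
    and condition4: "continuous_on (\<Theta> \<times> UNIV) (\<lambda>(\<theta>, \<omega>). khat \<theta> \<omega>)"
        "\<forall>\<theta>\<in>\<Theta>. \<forall>\<omega>. khat \<theta> \<omega> > 0"
    and condition5: "\<forall>\<epsilon>>0. liminf (\<lambda>n. INF \<theta>\<in>{\<theta>\<in>\<Theta>. norm (\<theta> - \<theta>0) \<ge> \<epsilon>}.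
        ereal (1 / real n * (\<Sum>i<n. \<Sum>j<n. (k \<theta> (s i - s j) - k \<theta>0 (s i - s j))\<^sup>2))) > 0"
    and condition6: "\<forall>l :: real ^ 'p. l \<noteq> 0 \<longrightarrow> liminf (\<lambda>n.
        ereal (1 / real n * (\<Sum>i<n. \<Sum>j<n.
          (\<Sum>m\<in>UNIV. vec_nth l m * Dk [m] \<theta>0 (s i - s j))\<^sup>2))) > 0"
  shows "0 < liminf (\<lambda>n. ereal (lambda_inf (fisher_matrix k Dk s \<theta>0 n))) \<and>
         liminf (\<lambda>n. ereal (lambda_inf (fisher_matrix k Dk s \<theta>0 n))) \<le> limsup (\<lambda>n. ereal (lambda_sup (fisher_matrix k Dk s \<theta>0 n))) \<and>
         limsup (\<lambda>n. ereal (lambda_sup (fisher_matrix k Dk s \<theta>0 n))) < \<infinity> \<and>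
         converges_in_distribution M
           (\<lambda>n \<omega>. sqrt (real n) *\<^sub>R
              (inv_sqrt_matrix (matrix_inv (fisher_matrix k Dk s \<theta>0 n)) *v (est n (observations \<xi> s n \<omega>) - \<theta>0)))
           std_normal_vec"
proof -
  interpret gaussian_mle \<Theta> \<theta>0 k khat Dk s M \<xi> est \<Delta> C_inf C_sup
    by (intro gaussian_mle.intro assms)
  show ?thesis using information_eigenvalue_bounds mle_asymptotically_normal by blast
qed

end
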